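(* Let $J\subset\Pi$ be a subset. The set $\{X_w\mid w\in W^J\}$ is a $\mathbb Z$-graded cellular basis of $C^J$ which makes $C^J$ into a $\mathbb Z$-graded cellular algebra. Moreover, each cell module of $C^J$ is one-dimensional.
   Context: $W$ is the Weyl group of a finite dimensional complex semisimple Lie algebra $\mathfrak g$ with Cartan subalgebra $\mathfrak h$, simple roots $\Pi$, positive roots $\Phi^+$, length function $\ell$ and longest element $w_0$. $R:=S(\mathfrak h^* )$ is graded with $\mathfrak h^*$ in degree $2$; $I_W$ is the homogeneous ideal generated by the $W$-invariants of positive degree and $C:=R/I_W$ is the coinvariant algebra. For $J\subset\Pi$, $W_J$ is the parabolic subgroup generated by the $s_\alpha$, $\alpha\in J$; $W^J$ is the set of minimal length left coset representatives of $W_J$ in $W$; $C^J:=C^{W_J}$. For $\alpha\in\Pi$ the Demazure operator is $\Delta_{s_\alpha}(f):=(f-s_\alpha f)/\alpha$ on $R$; for a reduced expression $w=s_{j_1}\cdots s_{j_k}$, $\Delta_w:=\Delta_{s_{j_1}}\cdots\Delta_{s_{j_k}}$. It induces an endomorphism of $C$, also denoted $\Delta_w$. Put $D:=\frac1{|W|}\prod_{\alpha\in\Phi^+}\alpha\in R$ with image $\overline D\in C$, and $X_w:=\Delta_{w^{-1}w_0}\overline D\in C$; it is homogeneous of degree $2\ell(w)$. It is known that $\{X_w\mid w\in W\}$ is a basis of $C$ and $\{X_w\mid w\in W^J\}$ is a basis of $C^J$. Graded cellular algebra (Hu–Mathas): a graded algebra $A$ with a finite poset $(\mathcal P,\rhd)$,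 finite sets $T(p)$ for $p\in\mathcal P$, a homogeneous basis $\{c^p_{st}\mid p\in\mathcal P,\ s,t\in T(p)\}$ and a degree function $\deg:\coprod_pT(p)\to\mathbb Z$ with $\deg c^p_{st}=\deg s+\deg t$, such that for $a\in A$ one has $a\,c^p_{st}\equiv\sum_{u}r_{u}(a,s)c^p_{ut}$ modulo the span of the $c^{q}_{uv}$ with $q\rhd p$, where $r_u(a,s)$ does not depend on $t$, and the linear map $c^p_{st}\mapsto c^p_{ts}$ is an anti-automorphism of $A$. The cell module of $p$ has basis indexed by $T(p)$ and action given by the coefficients $r_u(a,s)$. *)

theory Defs
  imports
    Complex_Main
    "HOL-Algebra.Bij"
    "HOL-Algebra.Generated_Groups"
    "HOL-Algebra.Module"
    "HOL-Algebra.QuotRing"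
    "HOL-Algebra.Algebraic_Closure_Type"
begin

section \<open>Graded cellular algebras\<close>

text \<open>
  Algebras and modules over \<open>K\<close> are HOL-Algebra records of type
  \<open>('k, 'a) module\<close>.  The library's locale for algebras insists on a commutative
  multiplication, which is too narrow for cellular algebras in general.
\<close>

locale assoc_algebra = Module.module K A + A: Ring.ring A
  for K :: "('k, 'm) ring_scheme" (structure) and A :: "('k, 'a, 'n) module_scheme" (structure) +
  assumes smult_mult_left:
      "\<lbrakk>k \<in> carrier K; a \<in> carrier A; b \<in> carrier A\<rbrakk>
        \<Longrightarrow> (k \<odot>\<^bsub>A\<^esub> a) \<otimes>\<^bsub>A\<^esub> b = k \<odot>\<^bsub>A\<^esub> (a \<otimes>\<^bsub>A\<^esub> b)"
    and smult_mult_right: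
      "\<lbrakk>k \<in> carrier K; a \<in> carrier A; b \<in> carrier A\<rbrakk>
        \<Longrightarrow> a \<otimes>\<^bsub>A\<^esub> (k \<odot>\<^bsub>A\<^esub> b) = k \<odot>\<^bsub>A\<^esub> (a \<otimes>\<^bsub>A\<^esub> b)"

definition is_finite_basis ::
    "('k, 'm) ring_scheme \<Rightarrow> ('k, 'v, 'n) module_scheme \<Rightarrow> 'i set \<Rightarrow> ('i \<Rightarrow> 'v) \<Rightarrow> bool" where
  "is_finite_basis K V I b \<longleftrightarrow>
     finite I \<and> b \<in> I \<rightarrow> carrier V \<and>
     (\<forall>v\<in>carrier V. \<exists>!f. f \<in> I \<rightarrow>\<^sub>E carrier K \<and> v = (\<Oplus>\<^bsub>V\<^esub>i\<in>I. f i \<odot>\<^bsub>V\<^esub> b i))"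

definition has_dimension ::
    "('k, 'm) ring_scheme \<Rightarrow> ('k, 'v, 'n) module_scheme \<Rightarrow> nat \<Rightarrow> bool" where
  "has_dimension K V n \<longleftrightarrow> (\<exists>b. is_finite_basis K V {..<n} b)"

definition module_span ::
    "('k, 'm) ring_scheme \<Rightarrow> ('k, 'v) module \<Rightarrow> 'v set \<Rightarrow> 'v set" where
  "module_span K V S = \<Inter>{N. submodule N K V \<and> S \<subseteq> N}"

definition linear_map_on ::
    "('k, 'm) ring_scheme \<Rightarrow> ('k, 'v, 'n) module_scheme \<Rightarrow> ('v \<Rightarrow> 'v) \<Rightarrow> bool" where
  "linear_map_on K V \<phi> \<longleftrightarrow>
     \<phi> \<in> carrier V \<rightarrow> carrier V \<and>
     (\<forall>v\<in>carrier V. \<forall>w\<in>carrier V. \<phi> (v \<oplus>\<^bsub>V\<^esub> w) = \<phi> v \<oplus>\<^bsub>V\<^esub> \<phi> w) \<and>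
     (\<forall>k\<in>carrier K. \<forall>v\<in>carrier V. \<phi> (k \<odot>\<^bsub>V\<^esub> v) = k \<odot>\<^bsub>V\<^esub> \<phi> v)"

definition anti_automorphism ::
    "('k, 'm) ring_scheme \<Rightarrow> ('k, 'a, 'n) module_scheme \<Rightarrow> ('a \<Rightarrow> 'a) \<Rightarrow> bool" where
  "anti_automorphism K A \<phi> \<longleftrightarrow>
     linear_map_on K A \<phi> \<and> bij_betw \<phi> (carrier A) (carrier A) \<and> \<phi> \<one>\<^bsub>A\<^esub> = \<one>\<^bsub>A\<^esub> \<and>
     (\<forall>a\<in>carrier A. \<forall>b\<in>carrier A. \<phi> (a \<otimes>\<^bsub>A\<^esub> b) = \<phi> b \<otimes>\<^bsub>A\<^esub> \<phi> a)"

text \<open>\<open>gr d\<close> is the homogeneous component of degree \<open>d\<close>.\<close>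

locale graded_algebra = assoc_algebra K A
  for K :: "('k, 'm) ring_scheme" (structure) and A :: "('k, 'a) module" (structure) +
  fixes gr :: "int \<Rightarrow> 'a set"
  assumes gr_submodule: "submodule (gr d) K A"
    and gr_decomposition:
      "a \<in> carrier A \<Longrightarrow>
        \<exists>!f. (\<forall>d. f d \<in> gr d) \<and> finite {d. f d \<noteq> \<zero>\<^bsub>A\<^esub>} \<and>
             a = (\<Oplus>\<^bsub>A\<^esub>d\<in>{d. f d \<noteq> \<zero>\<^bsub>A\<^esub>}. f d)"
    and gr_one: "\<one>\<^bsub>A\<^esub> \<in> gr 0"
    and gr_mult: "\<lbrakk>a \<in> gr d; b \<in> gr e\<rbrakk> \<Longrightarrow> a \<otimes>\<^bsub>A\<^esub> b \<in> gr (d + e)"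

text \<open>
  \<open>gt q p\<close> is the strict order \<open>q \<rhd> p\<close> on \<open>P\<close>; \<open>c p s t\<close> is the basis element
  \<open>c\<^sup>p\<^sub>s\<^sub>t\<close>; \<open>deg p s\<close> is the degree of \<open>s\<close> as an element of the copy of \<open>T p\<close> in the
  disjoint union; \<open>r p a s u\<close> is the structure constant \<open>r\<^sub>u(a,s)\<close>.
\<close>

locale graded_cellular_algebra = graded_algebra K A gr
  for K :: "('k, 'm) ring_scheme" (structure) and A :: "('k, 'a) module" (structure)
    and gr :: "int \<Rightarrow> 'a set" +
  fixes P :: "'p set" and gt :: "'p \<Rightarrow> 'p \<Rightarrow> bool" and T :: "'p \<Rightarrow> 't set"
    and c :: "'p \<Rightarrow> 't \<Rightarrow> 't \<Rightarrow> 'a" and deg :: "'p \<Rightarrow> 't \<Rightarrow> int"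
    and r :: "'p \<Rightarrow> 'a \<Rightarrow> 't \<Rightarrow> 't \<Rightarrow> 'k"
  assumes finite_P: "finite P"
    and gt_irrefl: "p \<in> P \<Longrightarrow> \<not> gt p p"
    and gt_trans: "\<lbrakk>p \<in> P; q \<in> P; q' \<in> P; gt q' q; gt q p\<rbrakk> \<Longrightarrow> gt q' p"
    and finite_T: "p \<in> P \<Longrightarrow> finite (T p)"
    and cellular_basis:
      "is_finite_basis K A (SIGMA p:P. T p \<times> T p) (\<lambda>(p, s, t). c p s t)"
    and cellular_degree:
      "\<lbrakk>p \<in> P; s \<in> T p; t \<in> T p\<rbrakk> \<Longrightarrow> c p s t \<in> gr (deg p s + deg p t)"
    and cellular_coeff_closed:
      "\<lbrakk>p \<in> P; a \<in> carrier A; s \<in> T p; u \<in> T p\<rbrakk> \<Longrightarrow> r p a s u \<in> carrier K"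
    and cellular_mult:
      "\<lbrakk>p \<in> P; a \<in> carrier A; s \<in> T p; t \<in> T p\<rbrakk> \<Longrightarrow>
        a \<otimes>\<^bsub>A\<^esub> c p s t \<ominus>\<^bsub>A\<^esub> (\<Oplus>\<^bsub>A\<^esub>u\<in>T p. r p a s u \<odot>\<^bsub>A\<^esub> c p u t)
          \<in> module_span K A {c q u v | q u v. q \<in> P \<and> gt q p \<and> u \<in> T q \<and> v \<in> T q}"
    and cellular_involution:
      "\<exists>\<phi>. anti_automorphism K A \<phi> \<and> (\<forall>p\<in>P. \<forall>s\<in>T p. \<forall>t\<in>T p. \<phi> (c p s t) = c p t s)"

text \<open>
  The cell module of \<open>p\<close>, as an \<open>A\<close>-module: coordinate vectors indexed by \<open>T p\<close>, where \<open>a\<close>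
  sends the \<open>s\<close>-th basis vector to the vector with \<open>u\<close>-th coordinate \<open>r\<^sub>u(a,s)\<close>.
  The fields \<open>mult\<close> and \<open>one\<close> of the record have no meaning for a module.
\<close>

definition cell_module ::
    "('k, 'm) ring_scheme \<Rightarrow> ('p \<Rightarrow> 't set) \<Rightarrow> ('p \<Rightarrow> 'a \<Rightarrow> 't \<Rightarrow> 't \<Rightarrow> 'k) \<Rightarrow> 'p
      \<Rightarrow> ('a, 't \<Rightarrow> 'k) module" where
  "cell_module K T r p =
    \<lparr>carrier = T p \<rightarrow>\<^sub>E carrier K,
     monoid.mult = undefined, one = undefined,
     ring.zero = (\<lambda>s\<in>T p. \<zero>\<^bsub>K\<^esub>),
     ring.add = (\<lambda>v w. \<lambda>s\<in>T p. v s \<oplus>\<^bsub>K\<^esub> w s),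
     module.smult = (\<lambda>a v. \<lambda>u\<in>T p. \<Oplus>\<^bsub>K\<^esub>s\<in>T p. r p a s u \<otimes>\<^bsub>K\<^esub> v s)\<rparr>"

text \<open>An \<open>A\<close>-module as a \<open>K\<close>-module along \<open>k \<mapsto> k \<odot> \<one>\<close>.\<close>

definition restrict_scalars ::
    "('k, 'a, 'n) module_scheme \<Rightarrow> ('a, 'v) module \<Rightarrow> ('k, 'v) module" where
  "restrict_scalars A V =
    \<lparr>carrier = carrier V, monoid.mult = monoid.mult V, one = one V, ring.zero = ring.zero V, ring.add = ring.add V,
     module.smult = (\<lambda>k v. (k \<odot>\<^bsub>A\<^esub> \<one>\<^bsub>A\<^esub>) \<odot>\<^bsub>V\<^esub> v)\<rparr>"

abbreviation complex_field :: "complex ring" where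
  "complex_field \<equiv> ring_of_type_algebra"

section \<open>Semisimple Lie algebras, roots and the Weyl group\<close>

locale complex_lie_algebra = vector_space scale
  for scale :: "complex \<Rightarrow> 'g::ab_group_add \<Rightarrow> 'g" (infixr \<open>*s\<close> 75) +
  fixes bracket :: "'g \<Rightarrow> 'g \<Rightarrow> 'g"
  assumes bracket_add_left: "bracket (x + y) z = bracket x z + bracket y z"
    and bracket_add_right: "bracket x (y + z) = bracket x y + bracket x z"
    and bracket_scale_left: "bracket (a *s x) y = a *s bracket x y"
    and bracket_scale_right: "bracket x (a *s y) = a *s bracket x y"
    and bracket_self: "bracket x x = 0"
    and jacobi: "bracket x (bracket y z) + bracket y (bracket z x) + bracket z (bracket x y) = 0"
    and finite_dimensional: "\<exists>B. finite B \<and> span B = UNIV"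
begin

definition lie_ideal :: "'g set \<Rightarrow> bool" where
  "lie_ideal I \<longleftrightarrow> subspace I \<and> (\<forall>x. \<forall>y\<in>I. bracket x y \<in> I)"

definition derived_algebra :: "'g set \<Rightarrow> 'g set" where
  "derived_algebra I = span {bracket x y | x y. x \<in> I \<and> y \<in> I}"

definition solvable_algebra :: "'g set \<Rightarrow> bool" where
  "solvable_algebra I \<longleftrightarrow> (\<exists>n. (derived_algebra ^^ n) I = {0})"

definition semisimple :: bool where
  "semisimple \<longleftrightarrow> (\<forall>I. lie_ideal I \<and> solvable_algebra I \<longrightarrow> I = {0})"

definition ad_diagonalizable :: "'g \<Rightarrow> bool" where
  "ad_diagonalizable h \<longleftrightarrow> span {v. \<exists>a. bracket h v = a *s v} = UNIV"

text \<open>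
  In a semisimple Lie algebra a Cartan subalgebra is a maximal abelian subalgebra consisting of
  ad-diagonalizable elements; an abelian subalgebra is maximal abelian iff it contains
  every element that commutes with all of it.
\<close>

definition cartan_subalgebra :: "'g set \<Rightarrow> bool" where
  "cartan_subalgebra H \<longleftrightarrow>
     subspace H \<and> (\<forall>x\<in>H. \<forall>y\<in>H. bracket x y = 0) \<and>
     (\<forall>x. (\<forall>y\<in>H. bracket y x = 0) \<longrightarrow> x \<in> H) \<and>
     (\<forall>x\<in>H. ad_diagonalizable x)"

end

text \<open>
  Functions on \<open>H\<close> are represented as functions on \<open>'g\<close> that are \<open>undefined\<close> outside \<open>H\<close>, so
  that equality of representatives is equality on \<open>H\<close>.
\<close>

locale semisimple_with_cartan = complex_lie_algebra scale bracket
  for scale :: "complex \<Rightarrow> 'g::ab_group_add \<Rightarrow> 'g" (infixr \<open>*s\<close> 75)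
    and bracket :: "'g \<Rightarrow> 'g \<Rightarrow> 'g" +
  fixes H :: "'g set"
  assumes semisimple: semisimple
    and cartan: "cartan_subalgebra H"
begin

definition dual :: "('g \<Rightarrow> complex) set" where
  "dual = {\<phi> \<in> extensional H.
     (\<forall>x\<in>H. \<forall>y\<in>H. \<phi> (x + y) = \<phi> x + \<phi> y) \<and> (\<forall>a. \<forall>x\<in>H. \<phi> (a *s x) = a * \<phi> x)}"

definition root_space :: "('g \<Rightarrow> complex) \<Rightarrow> 'g set" where
  "root_space \<alpha> = {v. \<forall>h\<in>H. bracket h v = \<alpha> h *s v}"

definition roots :: "('g \<Rightarrow> complex) set" where
  "roots = {\<alpha> \<in> dual. \<alpha> \<noteq> (\<lambda>x\<in>H. 0) \<and> root_space \<alpha> \<noteq> {0}}"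

text \<open>
  The coroot of \<open>\<alpha>\<close> is the element of \<open>[g\<^sub>\<alpha>, g\<^sub>-\<^sub>\<alpha>]\<close> (a line in \<open>H\<close>) on which \<open>\<alpha>\<close>
  takes the value 2.
\<close>

definition coroot :: "('g \<Rightarrow> complex) \<Rightarrow> 'g" where
  "coroot \<alpha> = (THE t. t \<in> span {bracket x y | x y.
       x \<in> root_space \<alpha> \<and> y \<in> root_space (\<lambda>h\<in>H. - \<alpha> h)} \<and> \<alpha> t = 2)"

text \<open>
  The Weyl group is realised on \<open>H\<close>.  The contragredient action on the dual, which is \<open>act\<close>
  below restricted to linear forms, satisfies
  \<open>s\<^sub>\<alpha> \<phi> = \<phi> - \<phi>(\<alpha>\<^sup>\<or>) \<alpha>\<close>.
\<close>

definition reflection :: "('g \<Rightarrow> complex) \<Rightarrow> 'g \<Rightarrow> 'g" where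
  "reflection \<alpha> = (\<lambda>x\<in>H. x - \<alpha> x *s coroot \<alpha>)"

definition weyl_group :: "('g \<Rightarrow> 'g) set" where
  "weyl_group = generate (BijGroup H) (reflection ` roots)"

definition parabolic :: "('g \<Rightarrow> complex) set \<Rightarrow> ('g \<Rightarrow> 'g) set" where
  "parabolic J = generate (BijGroup H) (reflection ` J)"

text \<open>Sets of simple roots, i.e. bases of the root system.\<close>

definition simple_system :: "('g \<Rightarrow> complex) set \<Rightarrow> bool" where
  "simple_system simples \<longleftrightarrow>
     simples \<subseteq> roots \<and>
     (\<forall>\<phi>\<in>dual. \<exists>!a. a \<in> simples \<rightarrow>\<^sub>E UNIV \<and> \<phi> = (\<lambda>x\<in>H. \<Sum>\<beta>\<in>simples. a \<beta> * \<beta> x)) \<and>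
     (\<forall>\<alpha>\<in>roots. \<exists>n :: ('g \<Rightarrow> complex) \<Rightarrow> nat.
        \<alpha> = (\<lambda>x\<in>H. \<Sum>\<beta>\<in>simples. of_nat (n \<beta>) * \<beta> x) \<or>
        \<alpha> = (\<lambda>x\<in>H. - (\<Sum>\<beta>\<in>simples. of_nat (n \<beta>) * \<beta> x)))"

section \<open>The coinvariant algebra\<close>

text \<open>
  The symmetric algebra of the dual of \<open>H\<close> is realised as the algebra of polynomial functions
  on \<open>H\<close>.  Its \<open>k\<close>-th symmetric power is spanned by the products of \<open>k\<close> linear forms; it is
  the component of degree \<open>2 * k\<close>.
\<close>

primrec sym_power :: "nat \<Rightarrow> ('g \<Rightarrow> complex) set" where
  "sym_power 0 = {\<lambda>x\<in>H. a | a. True}"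
| "sym_power (Suc k) =
     {\<lambda>x\<in>H. \<Sum>i<n. \<phi> i x * f i x | (n :: nat) \<phi> f. \<forall>i<n. \<phi> i \<in> dual \<and> f i \<in> sym_power k}"

inductive_set sym_carrier :: "('g \<Rightarrow> complex) set" where
  homogeneous: "f \<in> sym_power k \<Longrightarrow> f \<in> sym_carrier"
| add: "\<lbrakk>f \<in> sym_carrier; g \<in> sym_carrier\<rbrakk> \<Longrightarrow> (\<lambda>x\<in>H. f x + g x) \<in> sym_carrier"

definition sym_algebra :: "(complex, 'g \<Rightarrow> complex) module" where
  "sym_algebra =
    \<lparr>carrier = sym_carrier,
     monoid.mult = (\<lambda>f g. \<lambda>x\<in>H. f x * g x),
     one = (\<lambda>x\<in>H. 1),
     ring.zero = (\<lambda>x\<in>H. 0),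
     ring.add = (\<lambda>f g. \<lambda>x\<in>H. f x + g x),
     module.smult = (\<lambda>a f. \<lambda>x\<in>H. a * f x)\<rparr>"

definition act :: "('g \<Rightarrow> 'g) \<Rightarrow> ('g \<Rightarrow> complex) \<Rightarrow> 'g \<Rightarrow> complex" where
  "act w f = (\<lambda>x\<in>H. f ((inv\<^bsub>BijGroup H\<^esub> w) x))"

definition coinvariant_ideal :: "('g \<Rightarrow> complex) set" where
  "coinvariant_ideal =
     Idl\<^bsub>sym_algebra\<^esub> {f. (\<exists>k>0. f \<in> sym_power k) \<and> (\<forall>w\<in>weyl_group. act w f = f)}"

definition coinv_class :: "('g \<Rightarrow> complex) \<Rightarrow> ('g \<Rightarrow> complex) set" where
  "coinv_class f = coinvariant_ideal +>\<^bsub>sym_algebra\<^esub> f"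

text \<open>
  The map on cosets induced by a map \<open>\<theta>\<close> that is compatible with the ideal, in the style of
  \<^const>\<open>rcoset_mult\<close>.
\<close>

definition induced ::
    "(('g \<Rightarrow> complex) \<Rightarrow> ('g \<Rightarrow> complex)) \<Rightarrow> ('g \<Rightarrow> complex) set \<Rightarrow> ('g \<Rightarrow> complex) set" where
  "induced \<theta> Y = (\<Union>f\<in>Y. coinv_class (\<theta> f))"

definition coinvariant_algebra :: "(complex, ('g \<Rightarrow> complex) set) module" where
  "coinvariant_algebra =
     ring.extend (sym_algebra Quot coinvariant_ideal)
       (module.fields (\<lambda>a. induced (\<lambda>f. a \<odot>\<^bsub>sym_algebra\<^esub> f)))"

definition coinvariant_grading :: "int \<Rightarrow> ('g \<Rightarrow> complex) set set" where
  "coinvariant_grading d =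
     (if d \<ge> 0 \<and> even d then coinv_class ` sym_power (nat (d div 2))
      else {\<zero>\<^bsub>coinvariant_algebra\<^esub>})"

definition parabolic_coinvariants ::
    "('g \<Rightarrow> complex) set \<Rightarrow> (complex, ('g \<Rightarrow> complex) set) module" where
  "parabolic_coinvariants J =
     coinvariant_algebra
       \<lparr>carrier := {Y \<in> carrier coinvariant_algebra. \<forall>w\<in>parabolic J. induced (act w) Y = Y}\<rparr>"

definition parabolic_grading ::
    "('g \<Rightarrow> complex) set \<Rightarrow> int \<Rightarrow> ('g \<Rightarrow> complex) set set" where
  "parabolic_grading J d = coinvariant_grading d \<inter> carrier (parabolic_coinvariants J)"

definition demazure :: "('g \<Rightarrow> complex) \<Rightarrow> ('g \<Rightarrow> complex) \<Rightarrow> 'g \<Rightarrow> complex" where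
  "demazure \<alpha> f =
     (THE g. g \<in> carrier sym_algebra \<and>
             \<alpha> \<otimes>\<^bsub>sym_algebra\<^esub> g = f \<ominus>\<^bsub>sym_algebra\<^esub> act (reflection \<alpha>) f)"

end

section \<open>Length and the elements \<open>X\<^sub>w\<close>\<close>

locale semisimple_with_simple_roots = semisimple_with_cartan scale bracket H
  for scale :: "complex \<Rightarrow> 'g::ab_group_add \<Rightarrow> 'g" (infixr \<open>*s\<close> 75)
    and bracket :: "'g \<Rightarrow> 'g \<Rightarrow> 'g" and H :: "'g set" +
  fixes simples :: "('g \<Rightarrow> complex) set"
  assumes simple: "simple_system simples"
begin

definition positive_roots :: "('g \<Rightarrow> complex) set" where
  "positive_roots = {\<alpha> \<in> roots. \<exists>n :: ('g \<Rightarrow> complex) \<Rightarrow> nat.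
     \<alpha> = (\<lambda>x\<in>H. \<Sum>\<beta>\<in>simples. of_nat (n \<beta>) * \<beta> x)}"

definition word :: "('g \<Rightarrow> complex) list \<Rightarrow> 'g \<Rightarrow> 'g" where
  "word \<alpha>s = foldr (\<lambda>\<alpha> w. reflection \<alpha> \<otimes>\<^bsub>BijGroup H\<^esub> w) \<alpha>s \<one>\<^bsub>BijGroup H\<^esub>"

definition len :: "('g \<Rightarrow> 'g) \<Rightarrow> nat" where
  "len w = (LEAST n. \<exists>\<alpha>s. set \<alpha>s \<subseteq> simples \<and> length \<alpha>s = n \<and> word \<alpha>s = w)"

definition reduced_expression :: "('g \<Rightarrow> complex) list \<Rightarrow> ('g \<Rightarrow> 'g) \<Rightarrow> bool" where
  "reduced_expression \<alpha>s w \<longleftrightarrow> set \<alpha>s \<subseteq> simples \<and> word \<alpha>s = w \<and> length \<alpha>s = len w"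

definition longest :: "'g \<Rightarrow> 'g" where
  "longest = (THE w. w \<in> weyl_group \<and> (\<forall>v\<in>weyl_group. len v \<le> len w))"

definition min_coset_reps :: "('g \<Rightarrow> complex) set \<Rightarrow> ('g \<Rightarrow> 'g) set" where
  "min_coset_reps J =
     {w \<in> weyl_group. \<forall>v\<in>parabolic J. len w \<le> len (w \<otimes>\<^bsub>BijGroup H\<^esub> v)}"

text \<open>The operator below does not depend on the reduced expression chosen.\<close>

definition demazure_elt :: "('g \<Rightarrow> 'g) \<Rightarrow> ('g \<Rightarrow> complex) \<Rightarrow> 'g \<Rightarrow> complex" where
  "demazure_elt w = foldr (\<lambda>\<alpha> \<theta>. demazure \<alpha> \<circ> \<theta>) (SOME \<alpha>s. reduced_expression \<alpha>s w) id"

definition top_class :: "'g \<Rightarrow> complex" where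
  "top_class = (\<lambda>x\<in>H. 1 / of_nat (card weyl_group) * (\<Prod>\<alpha>\<in>positive_roots. \<alpha> x))"

definition X_elt :: "('g \<Rightarrow> 'g) \<Rightarrow> ('g \<Rightarrow> complex) set" where
  "X_elt w = induced (demazure_elt (inv\<^bsub>BijGroup H\<^esub> w \<otimes>\<^bsub>BijGroup H\<^esub> longest)) (coinv_class top_class)"

end

end

(*
  The only input about the Lie algebra is its root system. The trace of ad [x, y] on a root
  string vanishes, which makes every root a real multiple of \<alpha> on [g_\<alpha>, g_-\<alpha>]; a graded
  version of Engel's theorem then shows that the Killing form is nondegenerate, and coroots, the
  reflections of roots and reducedness follow from sl_2-strings and one more trace.

  On the coinvariant algebra the functionals f \<mapsto> (\<Delta>_w f)(0) serve as coordinates. A polynomial of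
  degree k that is killed by all Demazure words of length k lies in the ideal: its translates are
  congruent to it, so it is congruent to their average. Evaluating at a generic W-orbit, with the
  form \<Sum>_v f(vx) g(vx) / D(vx) for which Demazure operators are self-adjoint, shows that words
  which are not reduced contribute nothing, that reduced words of the same element are proportional,
  and that the longest element does not kill D; the braid relations are not needed. Hence X_w is dual
  to the coordinates up to nonzero scalars, and a class is W_J-invariant iff only coordinates of
  minimal coset representatives occur. Multiplication by a class a acts on X_w as the scalar a(0)
  modulo classes of higher degree, which is the cellular structure with one-point sets T(p).
*)
theory Submission
  imports Defs
begin

section \<open>Linear algebra: joint eigenvectors in stable subspaces, and traces on the span of an
  independent set\<close>

section \<open>Simultaneous eigenvectors and traces\<close>

text \<open>The coinvariant algebra lives on the fibre of H over its quotient by W at 0, where the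
  points have collapsed and evaluation says little. The fibre through a regular point x consists of
  |W| distinct points; there a Demazure operator is a divided difference between \<open>pt v\<close>
  and \<open>pt (v s)\<close>, and composites of such operators expand triangularly with respect to
  length. The two fibres are linked by degree: a word of length k turns a form of degree k into a
  constant, whose value at 0 is its value at x, and terms of degree below k do not change it. Hence
  everything rests on interpolation with a degree bound: the values of a polynomial at the points of
  length at most j must be attained by a polynomial of degree at most j. Then a form of degree k can
  be replaced by a function that vanishes at all points of length below k, and of such a function a
  word of length k sees at most one value. The degree bound comes from the self-adjoint pairing,
  which shows that every form of degree above the number of positive roots lies in the
  ideal.\<close>

context complex_lie_algebra
begin

text \<open>Subtracting \<open>ev b i\<close> times the sum from its image under \<open>T i\<close>
  kills the summand \<open>v b\<close> and rescales \<open>v a\<close> by a nonzero factor, so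
  induction on \<open>A\<close> applies. With \<open>U\<close> = {0} this gives linear independence,
  with a larger stable \<open>U\<close> it gives homogeneous components.\<close>

lemma eigen_components:
  fixes T :: "'i \<Rightarrow> 'g \<Rightarrow> 'g" and ev :: "'k \<Rightarrow> 'i \<Rightarrow> complex"
  assumes lin: "\<And>i. i \<in> I \<Longrightarrow> Vector_Spaces.linear scale scale (T i)"
    and U: "subspace U" and stab: "\<And>i u. i \<in> I \<Longrightarrow> u \<in> U \<Longrightarrow> T i u \<in> U"
    and A: "finite A"
    and dist: "\<And>a b. a \<in> A \<Longrightarrow> b \<in> A \<Longrightarrow> a \<noteq> b \<Longrightarrow> \<exists>i\<in>I. ev a i \<noteq> ev b i"
    and eig: "\<And>a i. a \<in> A \<Longrightarrow> i \<in> I \<Longrightarrow> T i (v a) = scale (ev a i) (v a)"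
    and sum: "(\<Sum>a\<in>A. v a) \<in> U"
  shows "\<forall>a\<in>A. v a \<in> U"
  using A dist eig sum
proof (induction A arbitrary: v rule: finite_induct)
  case (insert b A)
  have *: "v a \<in> U" if a: "a \<in> A" for a
  proof -
    obtain i where i: "i \<in> I" "ev a i \<noteq> ev b i"
      using insert.prems(1)[of a b] insert.hyps a by auto
    interpret Ti: Vector_Spaces.linear scale scale "T i" by (rule lin[OF i(1)])
    have "T i (\<Sum>c\<in>insert b A. v c) - scale (ev b i) (\<Sum>c\<in>insert b A. v c) \<in> U"
      using insert.prems(3) stab[OF i(1)] U by (intro subspace_diff subspace_scale) auto
    also have "T i (\<Sum>c\<in>insert b A. v c) - scale (ev b i) (\<Sum>c\<in>insert b A. v c)
        = (\<Sum>c\<in>insert b A. T i (v c) - scale (ev b i) (v c))"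
      by (simp add: Ti.sum scale_sum_right sum_subtractf del: sum.insert)
    also have "\<dots> = (\<Sum>c\<in>insert b A. scale (ev c i - ev b i) (v c))"
      by (rule sum.cong) (auto simp: insert.prems(2) i scale_left_diff_distrib)
    also have "\<dots> = (\<Sum>c\<in>A. scale (ev c i - ev b i) (v c))"
      using insert.hyps by simp
    finally have s: "(\<Sum>c\<in>A. scale (ev c i - ev b i) (v c)) \<in> U" .
    have "\<forall>c\<in>A. scale (ev c i - ev b i) (v c) \<in> U"
    proof (rule insert.IH[OF _ _ s])
      fix c j assume cj: "c \<in> A" "j \<in> I"
      interpret Tj: Vector_Spaces.linear scale scale "T j" by (rule lin[OF cj(2)])
      show "T j (scale (ev c i - ev b i) (v c)) = scale (ev c j) (scale (ev c i - ev b i) (v c))"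
        using insert.prems(2)[of c j] cj by (simp add: Tj.scale mult.commute)
    qed (use insert.prems(1) in auto)
    then have "scale (ev a i - ev b i) (v a) \<in> U" using a by blast
    then have "scale (inverse (ev a i - ev b i)) (scale (ev a i - ev b i) (v a)) \<in> U"
      using U subspace_scale by blast
    then show ?thesis using i by simp
  qed
  have "v b = (\<Sum>c\<in>insert b A. v c) - (\<Sum>c\<in>A. v c)" using insert.hyps by simp
  also have "\<dots> \<in> U" by (rule subspace_diff[OF U insert.prems(3) subspace_sum[OF U *]])
  finally have "v b \<in> U" .
  then show ?case using * by auto
qed auto

text \<open>The trace of \<open>f\<close> on \<open>span B\<close>. As \<open>B\<close> need not
  span the whole space, this also serves as the trace of a restriction to a stable subspace.\<close>

definition tr :: "'g set \<Rightarrow> ('g \<Rightarrow> 'g) \<Rightarrow> complex" where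
  "tr B f = (\<Sum>b\<in>B. representation B (f b) b)"

lemma tr_diff:
  assumes "independent B" "\<And>b. b \<in> B \<Longrightarrow> f b \<in> span B" "\<And>b. b \<in> B \<Longrightarrow> g b \<in> span B"
  shows "tr B (\<lambda>x. f x - g x) = tr B f - tr B g"
  using assms by (simp add: tr_def representation_diff sum_subtractf)

lemma tr_diagonal:
  assumes "independent B" "\<And>b. b \<in> B \<Longrightarrow> f b = scale (\<nu> b) b"
  shows "tr B f = (\<Sum>b\<in>B. \<nu> b)"
  unfolding tr_def
  by (rule sum.cong) (auto simp: assms representation_scale span_base representation_basis)

text \<open>Both traces are the same double sum of products of matrix entries, up to exchange of the
  summation indices.\<close>

lemma tr_commute:
  assumes B: "independent B" "finite B"
    and f: "Vector_Spaces.linear scale scale f" "\<And>b. b \<in> B \<Longrightarrow> f b \<in> span B"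
    and g: "Vector_Spaces.linear scale scale g" "\<And>b. b \<in> B \<Longrightarrow> g b \<in> span B"
  shows "tr B (\<lambda>x. f (g x)) = tr B (\<lambda>x. g (f x))"
proof -
  have exp: "tr B (\<lambda>x. f (g x)) = (\<Sum>b\<in>B. \<Sum>c\<in>B. representation B (g b) c * representation B (f c) b)"
    if f: "Vector_Spaces.linear scale scale f" "\<And>b. b \<in> B \<Longrightarrow> f b \<in> span B"
      and g: "\<And>b. b \<in> B \<Longrightarrow> g b \<in> span B" for f g
    unfolding tr_def
  proof (rule sum.cong[OF refl])
    fix b assume b: "b \<in> B"
    interpret f: Vector_Spaces.linear scale scale f by (rule f(1))
    have "f (g b) = f (\<Sum>c\<in>B. scale (representation B (g b) c) c)"
      using sum_representation_eq[OF B(1) g[OF b] B(2) order_refl] by simp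
    also have "\<dots> = (\<Sum>c\<in>B. scale (representation B (g b) c) (f c))"
      by (simp add: f.sum f.scale)
    also have "representation B \<dots> b
        = (\<Sum>c\<in>B. representation B (scale (representation B (g b) c) (f c)) b)"
      using B f(2) by (subst representation_sum) (auto intro: span_scale)
    also have "\<dots> = (\<Sum>c\<in>B. representation B (g b) c * representation B (f c) b)"
      by (rule sum.cong) (auto simp: representation_scale B f(2))
    finally show "representation B (f (g b)) b
      = (\<Sum>c\<in>B. representation B (g b) c * representation B (f c) b)" .
  qed
  have "tr B (\<lambda>x. f (g x)) = (\<Sum>b\<in>B. \<Sum>c\<in>B. representation B (g b) c * representation B (f c) b)"
    by (rule exp[OF f g(2)])
  also have "\<dots> = (\<Sum>b\<in>B. \<Sum>c\<in>B. representation B (f b) c * representation B (g c) b)"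
    by (subst sum.swap) (simp add: mult.commute)
  also have "\<dots> = tr B (\<lambda>x. g (f x))"
    by (rule exp[OF g f(2), symmetric])
  finally show ?thesis .
qed

lemma span_stable:
  assumes "Vector_Spaces.linear scale scale f" "\<And>b. b \<in> S \<Longrightarrow> f b \<in> span S" "x \<in> span S"
  shows "f x \<in> span S"
proof -
  interpret f: Vector_Spaces.linear scale scale f by (rule assms(1))
  show ?thesis
    using assms(3) by (induct rule: span_induct_alt)
      (auto simp: f.add f.scale span_zero intro: span_add span_scale assms(2))
qed

end

section \<open>Simultaneous diagonalization of ad H and finiteness of the set of weights\<close>

section \<open>Root space decomposition\<close>

context complex_lie_algebra
begin

lemma ad_linear: "Vector_Spaces.linear scale scale (bracket x)"
  by unfold_locales (simp_all add: bracket_add_right bracket_scale_right)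

lemma bracket_zero_left [simp]: "bracket 0 x = 0"
  using bracket_scale_left[of 0 0 x] by simp

lemma bracket_zero_right [simp]: "bracket x 0 = 0"
  using bracket_scale_right[of x 0 0] by simp

lemma bracket_anti: "bracket x y = - bracket y x"
proof -
  have "bracket (x + y) (x + y) = bracket x y + bracket y x"
    unfolding bracket_add_left bracket_add_right by (simp add: bracket_self)
  then show ?thesis by (simp add: bracket_self eq_neg_iff_add_eq_0)
qed

lemma bracket_minus_right: "bracket x (- y) = - bracket x y"
  using bracket_scale_right[of x "-1" y] by simp

lemma bracket_minus_left: "bracket (- x) y = - bracket x y"
  using bracket_scale_left[of "-1" x y] by simp

lemma bracket_diff_right: "bracket x (y - z) = bracket x y - bracket x z"
  using bracket_add_right[of x y "- z"] by (simp add: bracket_minus_right)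

lemma ad_bracket: "bracket (bracket x y) z = bracket x (bracket y z) - bracket y (bracket x z)"
proof -
  have "bracket z (bracket x y) = - bracket (bracket x y) z" by (rule bracket_anti)
  moreover have "bracket y (bracket z x) = - bracket y (bracket x z)"
    by (subst bracket_anti[of z x]) (rule bracket_minus_right)
  ultimately show ?thesis using jacobi[of x y z] by (simp add: algebra_simps)
qed

lemma bracket_deriv: "bracket x (bracket y z) = bracket (bracket x y) z + bracket y (bracket x z)"
  by (simp add: ad_bracket)

lemma independent_finite: "independent B \<Longrightarrow> finite B"
  using finite_dimensional independent_span_bound by (metis subset_UNIV)

end

context semisimple_with_cartan
begin

lemma H_subspace: "subspace H" and H_abelian: "x \<in> H \<Longrightarrow> y \<in> H \<Longrightarrow> bracket x y = 0"
  and H_maximal: "(\<And>y. y \<in> H \<Longrightarrow> bracket y x = 0) \<Longrightarrow> x \<in> H"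
  and H_diagonalizable: "x \<in> H \<Longrightarrow> span {v. \<exists>a. bracket x v = a *s v} = UNIV"
  using cartan unfolding cartan_subalgebra_def ad_diagonalizable_def by auto

lemma H_zero: "0 \<in> H" and H_add: "x \<in> H \<Longrightarrow> y \<in> H \<Longrightarrow> x + y \<in> H"
  and H_diff: "x \<in> H \<Longrightarrow> y \<in> H \<Longrightarrow> x - y \<in> H" and H_scale: "x \<in> H \<Longrightarrow> a *s x \<in> H"
  using H_subspace by (auto simp: subspace_0 subspace_add subspace_diff subspace_scale)

lemma dual_add: "\<phi> \<in> dual \<Longrightarrow> x \<in> H \<Longrightarrow> y \<in> H \<Longrightarrow> \<phi> (x + y) = \<phi> x + \<phi> y"
  and dual_scale: "\<phi> \<in> dual \<Longrightarrow> x \<in> H \<Longrightarrow> \<phi> (a *s x) = a * \<phi> x"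
  and dual_ext: "\<phi> \<in> dual \<Longrightarrow> \<phi> \<in> extensional H"
  by (auto simp: dual_def)

lemma dual_zero: "\<phi> \<in> dual \<Longrightarrow> \<phi> 0 = 0"
  using dual_scale[of \<phi> 0 0] H_zero by simp

lemma dual_diff: "\<phi> \<in> dual \<Longrightarrow> x \<in> H \<Longrightarrow> y \<in> H \<Longrightarrow> \<phi> (x - y) = \<phi> x - \<phi> y"
  using dual_add[of \<phi> x "(-1) *s y"] dual_scale[of \<phi> y "-1"] H_scale[of y "-1"] by simp

lemma dualI: "\<phi> \<in> extensional H \<Longrightarrow> (\<And>x y. x \<in> H \<Longrightarrow> y \<in> H \<Longrightarrow> \<phi> (x + y) = \<phi> x + \<phi> y)
    \<Longrightarrow> (\<And>a x. x \<in> H \<Longrightarrow> \<phi> (a *s x) = a * \<phi> x) \<Longrightarrow> \<phi> \<in> dual"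
  by (auto simp: dual_def)

lemma dual_comb: "\<phi> \<in> dual \<Longrightarrow> \<psi> \<in> dual \<Longrightarrow> (\<lambda>x\<in>H. a * \<phi> x + b * \<psi> x) \<in> dual"
  by (rule dualI) (auto simp: H_add H_scale dual_add dual_scale algebra_simps)

lemma dual_smult: "\<phi> \<in> dual \<Longrightarrow> (\<lambda>x\<in>H. a * \<phi> x) \<in> dual"
  by (rule dualI) (auto simp: H_add H_scale dual_add dual_scale algebra_simps)

lemma roots_dual: "\<alpha> \<in> roots \<Longrightarrow> \<alpha> \<in> dual"
  by (auto simp: roots_def)

lemma root_spaceD: "v \<in> root_space \<mu> \<Longrightarrow> h \<in> H \<Longrightarrow> bracket h v = \<mu> h *s v"
  by (simp add: root_space_def)

lemma root_space_cong: "(\<And>h. h \<in> H \<Longrightarrow> \<mu> h = \<nu> h) \<Longrightarrow> root_space \<mu> = root_space \<nu>"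
  by (auto simp: root_space_def)

lemma root_space_restrict [simp]: "root_space (restrict \<mu> H) = root_space \<mu>"
  by (rule root_space_cong) simp

lemma root_space_subspace: "subspace (root_space \<mu>)"
  by (rule subspaceI) (auto simp: root_space_def bracket_add_right bracket_scale_right
      scale_right_distrib mult.commute)

lemma root_space_zero: "root_space (\<lambda>_. 0) = H"
  using H_maximal H_abelian by (auto simp: root_space_def)

lemma root_space_bracket:
  assumes "x \<in> root_space \<mu>" "y \<in> root_space \<nu>"
  shows "bracket x y \<in> root_space (\<lambda>h. \<mu> h + \<nu> h)"
  unfolding root_space_def
proof safe
  fix h assume h: "h \<in> H"
  have "bracket h (bracket x y) = bracket (bracket h x) y + bracket x (bracket h y)"
    by (rule bracket_deriv)
  then show "bracket h (bracket x y) = (\<mu> h + \<nu> h) *s bracket x y"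
    using assms h by (simp add: root_spaceD bracket_scale_left bracket_scale_right scale_left_distrib)
qed

text \<open>Commuting diagonalizable operators: an eigenvector of the old family is split into
  eigenvectors of ad h, and the parts remain eigenvectors of the old family because the operators
  commute.\<close>

lemma joint_eigenvectors_span:
  assumes "finite F" "F \<subseteq> H"
  shows "span {v. \<forall>h\<in>F. \<exists>a. bracket h v = a *s v} = UNIV"
  using assms
proof (induction F rule: finite_induct)
  case (insert h F)
  let ?E = "\<lambda>F. {v. \<forall>h\<in>F. \<exists>a. bracket h v = a *s v}"
  have h: "h \<in> H" using insert by auto
  have "?E F \<subseteq> span (?E (insert h F))"
  proof
    fix v assume v: "v \<in> ?E F"
    have "\<forall>k\<in>F. \<exists>a. bracket k v = a *s v" using v by auto
    from bchoice[OF this] obtain a where a: "\<And>k. k \<in> F \<Longrightarrow> bracket k v = a k *s v" by auto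
    have "v \<in> span {v. \<exists>a. bracket h v = a *s v}" using H_diagonalizable[OF h] by simp
    then have "\<exists>A w. finite A \<and> v = (\<Sum>c\<in>A. w c) \<and> (\<forall>c\<in>A. bracket h (w c) = c *s w c)"
    proof (induct rule: span_induct_alt)
      case base
      show ?case by (rule exI[of _ "{}"]) auto
    next
      case (step k x y)
      then obtain A w b where A: "finite A" "y = (\<Sum>c\<in>A. w c)" "\<forall>c\<in>A. bracket h (w c) = c *s w c"
        and b: "bracket h x = b *s x" by auto
      \<comment> \<open>The new term joins the component with its own eigenvalue \<open>b\<close>,
        which may or may not occur in \<open>A\<close> already; the components stay indexed by
        distinct eigenvalues.\<close>
      define w' where "w' c = (if c \<in> A then w c else 0) + (if c = b then k *s x else 0)" for c
      have "k *s x + y = (\<Sum>c\<in>insert b A. w' c)"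
        using A(1,2) unfolding w'_def sum.distrib
        by (simp add: sum.delta' sum.If_cases Int_absorb1 Int_insert_left add.commute)
          (simp add: insert_absorb)
      moreover have "\<forall>c\<in>insert b A. bracket h (w' c) = c *s w' c"
        using A(3) b by (auto simp: w'_def bracket_add_right bracket_scale_right scale_right_distrib mult.commute)
      ultimately show ?case using A(1) by (metis finite_insert)
    qed
    then obtain A w where A: "finite A" and vw: "v = (\<Sum>c\<in>A. w c)"
      and w: "\<And>c. c \<in> A \<Longrightarrow> bracket h (w c) = c *s w c" by blast
    have "w c \<in> ?E (insert h F)" if c: "c \<in> A" for c
    proof -
      have "bracket k (w c) = a k *s w c" if k: "k \<in> F" for k
      proof -
        \<comment> \<open>This eigenspace of ad k is stable under ad h since [k, h] = 0, so
          \<open>eigen_components\<close> puts every component of \<open>v\<close> into it.\<close>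
        let ?U = "{u. bracket k u = a k *s u}"
        have kh: "bracket k h = 0" using H_abelian k h insert.prems by auto
        have "\<forall>c\<in>A. w c \<in> ?U"
        proof (rule eigen_components[where T = "\<lambda>_::unit. bracket h" and I = UNIV and ev = "\<lambda>c _. c"])
          show "subspace ?U"
            by (rule subspaceI) (auto simp: bracket_add_right bracket_scale_right scale_right_distrib mult.commute)
          show "bracket h u \<in> ?U" if "u \<in> ?U" for u
            using that bracket_deriv[of k h u] kh by (simp add: bracket_scale_right)
        qed (use A w a[OF k] vw ad_linear in auto)
        then show ?thesis using c by blast
      qed
      then show ?thesis using w[OF c] by blast
    qed
    then show "v \<in> span (?E (insert h F))" unfolding vw by (intro span_sum span_base) auto
  qed
  then have "span (?E F) \<subseteq> span (?E (insert h F))" by (rule span_minimal) simp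
  then show ?case using insert by auto
qed simp

text \<open>The roots, together with the zero functional when H is nonzero. Keeping zero makes the
  root spaces span the whole algebra and lets strings pass through H.\<close>

definition weights :: "('g \<Rightarrow> complex) set" where
  "weights = {\<mu> \<in> dual. root_space \<mu> \<noteq> {0}}"

lemma weightsI: "\<mu> \<in> dual \<Longrightarrow> v \<in> root_space \<mu> \<Longrightarrow> v \<noteq> 0 \<Longrightarrow> \<mu> \<in> weights"
  by (auto simp: weights_def)

text \<open>A joint eigenvector for a finite basis of H is one for all of H, and its eigenvalue
  depends linearly on h because the vector is nonzero.\<close>

lemma weight_vectors_span: "span (\<Union>\<mu>\<in>weights. root_space \<mu>) = UNIV"
proof -
  obtain F where F: "F \<subseteq> H" "independent F" "H \<subseteq> span F"
    using maximal_independent_subset[of H] by blast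
  have fF: "finite F" using F independent_finite by blast
  have "{v. \<forall>h\<in>F. \<exists>a. bracket h v = a *s v} \<subseteq> span (\<Union>\<mu>\<in>weights. root_space \<mu>)"
  proof
    fix v assume "v \<in> {v. \<forall>h\<in>F. \<exists>a. bracket h v = a *s v}"
    then have v: "\<exists>a. bracket h v = a *s v" if "h \<in> F" for h using that by auto
    show "v \<in> span (\<Union>\<mu>\<in>weights. root_space \<mu>)"
    proof (cases "v = 0")
      case False
      have "\<exists>a. bracket h v = a *s v" if "h \<in> span F" for h
        using that
      proof (induct rule: span_induct_alt)
        case (step c x y)
        then obtain a b where "bracket x v = a *s v" "bracket y v = b *s v" using v by blast
        then have "bracket (c *s x + y) v = (c * a + b) *s v"
          by (simp add: bracket_add_left bracket_scale_left scale_left_distrib)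
        then show ?case by blast
      qed (auto intro: exI[of _ 0])
      then obtain \<nu> where \<nu>: "\<And>h. h \<in> H \<Longrightarrow> bracket h v = \<nu> h *s v" using F(3) by (metis subsetD)
      let ?\<mu> = "restrict \<nu> H"
      have "?\<mu> \<in> dual"
      proof (rule dualI)
        fix x y assume xy: "x \<in> H" "y \<in> H"
        have "\<nu> (x + y) *s v = (\<nu> x + \<nu> y) *s v"
          using \<nu>[OF xy(1)] \<nu>[OF xy(2)] \<nu>[OF H_add[OF xy]]
          by (simp add: bracket_add_left scale_left_distrib)
        then show "?\<mu> (x + y) = ?\<mu> x + ?\<mu> y" using False xy H_add by simp
      next
        fix a x assume x: "x \<in> H"
        have "\<nu> (a *s x) *s v = (a * \<nu> x) *s v"
          by (metis \<nu> x H_scale bracket_scale_left scale_scale)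
        then have "\<nu> (a *s x) = a * \<nu> x" using False scale_cancel_right by blast
        then show "?\<mu> (a *s x) = a * ?\<mu> x" using x H_scale by simp
      qed simp
      moreover have "v \<in> root_space ?\<mu>" using \<nu> by (auto simp: root_space_def)
      ultimately have "?\<mu> \<in> weights" "v \<in> root_space ?\<mu>" using False weightsI by auto
      then show ?thesis by (intro span_base) blast
    qed (simp add: span_zero)
  qed
  then have "span {v. \<forall>h\<in>F. \<exists>a. bracket h v = a *s v} \<subseteq> span (\<Union>\<mu>\<in>weights. root_space \<mu>)"
    by (rule span_minimal) simp
  then show ?thesis using joint_eigenvectors_span[OF fF F(1)] by auto
qed

lemma dual_neq: "\<mu> \<in> dual \<Longrightarrow> \<nu> \<in> dual \<Longrightarrow> \<mu> \<noteq> \<nu> \<Longrightarrow> \<exists>h\<in>H. \<mu> h \<noteq> \<nu> h"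
  by (metis dual_ext extensionalityI)

lemma weight_components:
  assumes "subspace U" "\<And>h u. h \<in> H \<Longrightarrow> u \<in> U \<Longrightarrow> bracket h u \<in> U"
    and "finite A" "A \<subseteq> dual" "\<And>\<mu>. \<mu> \<in> A \<Longrightarrow> v \<mu> \<in> root_space \<mu>" "(\<Sum>\<mu>\<in>A. v \<mu>) \<in> U" "\<mu> \<in> A"
  shows "v \<mu> \<in> U"
proof -
  have "\<forall>\<mu>\<in>A. v \<mu> \<in> U"
    by (rule eigen_components[where T = bracket and I = H and ev = "\<lambda>\<mu>. \<mu>"])
      (use assms ad_linear dual_neq root_spaceD in \<open>auto simp: subset_iff\<close>)
  then show ?thesis using assms by blast
qed

text \<open>One nonzero vector per weight forms an independent family; with finite dimension this
  bounds the number of weights.\<close>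

lemma weights_independent:
  assumes "S \<subseteq> weights" "\<And>\<mu>. \<mu> \<in> S \<Longrightarrow> v \<mu> \<in> root_space \<mu>" "\<And>\<mu>. \<mu> \<in> S \<Longrightarrow> v \<mu> \<noteq> 0"
  shows "inj_on v S" "independent (v ` S)"
proof -
  have dual: "S \<subseteq> dual" using assms by (auto simp: weights_def)
  show inj: "inj_on v S"
  proof (rule inj_onI)
    fix \<mu> \<nu> assume *: "\<mu> \<in> S" "\<nu> \<in> S" "v \<mu> = v \<nu>"
    have "\<mu> h = \<nu> h" if "h \<in> H" for h
      using root_spaceD[OF assms(2)[OF *(1)] that] root_spaceD[OF assms(2)[OF *(2)] that] * assms(3)[OF *(1)]
      by simp
    then show "\<mu> = \<nu>" using dual_neq[of \<mu> \<nu>] * dual by blast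
  qed
  show "independent (v ` S)"
    unfolding independent_explicit_finite_subsets
  proof (intro allI impI ballI)
    fix F u x assume F: "F \<subseteq> v ` S" "finite F" "(\<Sum>x\<in>F. u x *s x) = 0" and x: "x \<in> F"
    obtain A where A: "A \<subseteq> S" "finite A" "F = v ` A" using F(1,2) by (meson finite_subset_image)
    have iA: "inj_on v A" using inj A inj_on_subset by blast
    have s: "(\<Sum>\<mu>\<in>A. u (v \<mu>) *s v \<mu>) \<in> {0}"
      using F(3) iA by (simp add: A(3) sum.reindex)
    obtain \<mu> where l: "\<mu> \<in> A" "x = v \<mu>" using x A by auto
    have "u (v \<mu>) *s v \<mu> \<in> {0}"
      by (rule weight_components[OF _ _ A(2) _ _ s l(1)])
        (use A(1) assms(2) dual root_space_subspace in \<open>auto intro: subspace_scale[OF root_space_subspace]\<close>)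
    then show "u x = 0" using l assms(3) A(1) by auto
  qed
qed

lemma finite_weights: "finite weights"
proof -
  have "\<forall>\<mu>\<in>weights. \<exists>v. v \<in> root_space \<mu> \<and> v \<noteq> 0"
    using root_space_subspace subspace_0 by (fastforce simp: weights_def)
  then obtain v where v: "\<And>\<mu>. \<mu> \<in> weights \<Longrightarrow> v \<mu> \<in> root_space \<mu>" "\<And>\<mu>. \<mu> \<in> weights \<Longrightarrow> v \<mu> \<noteq> 0"
    by metis
  have "finite (v ` weights)"
    by (rule independent_finite, rule weights_independent(2)[of weights]) (use v in auto)
  then show ?thesis
    by (rule finite_imageD, intro weights_independent(1)[of weights]) (use v in auto)
qed

lemma roots_weights: "roots \<subseteq> weights"
  by (auto simp: roots_def weights_def)

lemma finite_roots: "finite roots"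
  using finite_weights roots_weights finite_subset by blast

end


context complex_lie_algebra
begin

lemma abelian_ideal_zero:
  assumes "semisimple" "lie_ideal I" "\<And>x y. x \<in> I \<Longrightarrow> y \<in> I \<Longrightarrow> bracket x y = 0"
  shows "I = {0}"
proof -
  have "0 \<in> I" using assms(2) unfolding lie_ideal_def by (blast intro: subspace_0)
  then have "{bracket x y |x y. x \<in> I \<and> y \<in> I} = {0}" using assms(3) by fastforce
  then have "(derived_algebra ^^ 1) I = {0}" by (simp add: derived_algebra_def)
  then have "solvable_algebra I" unfolding solvable_algebra_def by blast
  then show ?thesis using assms unfolding semisimple_def by blast
qed

text \<open>The line through a central element is an abelian ideal.\<close>

lemma central_zero:
  assumes "semisimple" "\<And>v. bracket t v = 0"
  shows "t = 0"
proof -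
  have c: "bracket v t = 0" for v using assms(2)[of v] bracket_anti[of v t] by simp
  have z: "bracket x y = 0" if "y \<in> span {t}" for x y
    using that by (auto simp: span_singleton bracket_scale_right c)
  have "span {t} = {0}"
    by (rule abelian_ideal_zero[OF assms(1)]) (auto simp: lie_ideal_def z span_zero)
  then show ?thesis using span_base[of t "{t}"] by auto
qed

lemma derived_ideal:
  assumes "lie_ideal I"
  shows "lie_ideal (derived_algebra I)"
  unfolding lie_ideal_def derived_algebra_def
proof (intro conjI subspace_span allI ballI)
  fix z x assume "x \<in> span {bracket x y |x y. x \<in> I \<and> y \<in> I}"
  then show "bracket z x \<in> span {bracket x y |x y. x \<in> I \<and> y \<in> I}"
  proof (rule span_stable[OF ad_linear, rotated])
    fix b assume "b \<in> {bracket x y |x y. x \<in> I \<and> y \<in> I}"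
    then obtain x y where b: "b = bracket x y" "x \<in> I" "y \<in> I" by blast
    have "bracket z x \<in> I" "bracket z y \<in> I" using assms b unfolding lie_ideal_def by blast+
    then show "bracket z b \<in> span {bracket x y |x y. x \<in> I \<and> y \<in> I}"
      unfolding b(1) bracket_deriv[of z x y] using b(2,3) by (intro span_add span_base) blast+
  qed
qed

lemma dim_strict_mono:
  assumes "subspace A" "subspace B" "A \<subset> B"
  shows "dim A < dim B"
proof -
  obtain C where C: "independent C" "span C = UNIV"
    using maximal_independent_subset[of UNIV] by (metis top.extremum_uniqueI subset_UNIV)
  interpret finite_dimensional_vector_space scale C
    using C independent_finite by unfold_locales auto
  show ?thesis by (rule dim_psubset) (use assms in \<open>simp add: span_eq_iff[THEN iffD2]\<close>)
qed

end

context semisimple_with_cartan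
begin

section \<open>The Killing form and the values of weights on [g_\<alpha>, g_-\<alpha>]\<close>

section \<open>The Killing form\<close>

text \<open>Elements of H act diagonally on this basis, so that the Killing form on H becomes a sum
  over weights.\<close>

definition weight_basis :: "'g set" where
  "weight_basis = (SOME B. B \<subseteq> (\<Union>\<mu>\<in>weights. root_space \<mu>) \<and> independent B \<and> span B = UNIV)"

lemma weight_basis: "weight_basis \<subseteq> (\<Union>\<mu>\<in>weights. root_space \<mu>)" "independent weight_basis"
    "span weight_basis = UNIV" "finite weight_basis"
proof -
  obtain B where B: "B \<subseteq> (\<Union>\<mu>\<in>weights. root_space \<mu>)" "independent B"
      "(\<Union>\<mu>\<in>weights. root_space \<mu>) \<subseteq> span B"
    using maximal_independent_subset by blast
  have "span B = UNIV" using span_minimal[OF B(3) subspace_span] weight_vectors_span by auto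
  then have "\<exists>B. B \<subseteq> (\<Union>\<mu>\<in>weights. root_space \<mu>) \<and> independent B \<and> span B = UNIV" using B by blast
  from someI_ex[OF this] show "weight_basis \<subseteq> (\<Union>\<mu>\<in>weights. root_space \<mu>)" "independent weight_basis"
    "span weight_basis = UNIV" unfolding weight_basis_def by blast+
  then show "finite weight_basis" using independent_finite by blast
qed

definition killing :: "'g \<Rightarrow> 'g \<Rightarrow> complex" where
  "killing x y = tr weight_basis (\<lambda>z. bracket x (bracket y z))"

lemma killing_add_left: "killing (x + x') y = killing x y + killing x' y"
  and killing_scale_left: "killing (a *s x) y = a * killing x y"
  and killing_add_right: "killing x (y + y') = killing x y + killing x y'"
  and killing_scale_right: "killing x (a *s y) = a * killing x y"
  by (simp_all add: killing_def tr_def bracket_add_left bracket_add_right bracket_scale_left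
      bracket_scale_right representation_add representation_scale weight_basis sum.distrib sum_distrib_left)

text \<open>Expanding both sides with \<open>ad_bracket\<close> leaves terms that cancel by
  cyclicity of the trace, applied to ad z and ad x ad y.\<close>

lemma killing_invariant: "killing (bracket z x) y = - killing x (bracket z y)"
proof -
  note w = weight_basis
  have l: "Vector_Spaces.linear scale scale (\<lambda>v. bracket x (bracket y v))"
    using Vector_Spaces.linear_compose[OF ad_linear[of y] ad_linear[of x]] by (simp add: o_def)
  have "killing (bracket z x) y = tr weight_basis (\<lambda>v. bracket z (bracket x (bracket y v)))
     - tr weight_basis (\<lambda>v. bracket x (bracket z (bracket y v)))"
    unfolding killing_def ad_bracket[of z x] by (rule tr_diff) (auto simp: w)
  moreover have "killing x (bracket z y) = tr weight_basis (\<lambda>v. bracket x (bracket z (bracket y v)))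
     - tr weight_basis (\<lambda>v. bracket x (bracket y (bracket z v)))"
    unfolding killing_def ad_bracket[of z y] bracket_diff_right by (rule tr_diff) (auto simp: w)
  moreover have "tr weight_basis (\<lambda>v. bracket z (bracket x (bracket y v)))
     = tr weight_basis (\<lambda>v. bracket x (bracket y (bracket z v)))"
    using tr_commute[OF w(2,4) ad_linear[of z] _ l] by (simp add: w)
  ultimately show ?thesis by simp
qed

definition killing_radical :: "'g set" where
  "killing_radical = {x. \<forall>y. killing x y = 0}"

lemma killing_radical_ideal: "lie_ideal killing_radical"
  unfolding lie_ideal_def killing_radical_def
proof (intro conjI subspaceI allI ballI)
  show "0 \<in> {x. \<forall>y. killing x y = 0}" using killing_scale_left[of 0 0] by simp
qed (auto simp: killing_add_left killing_scale_left killing_invariant)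

abbreviation neg_root :: "('g \<Rightarrow> complex) \<Rightarrow> 'g \<Rightarrow> complex" where
  "neg_root \<alpha> \<equiv> \<lambda>h\<in>H. - \<alpha> h"

lemma neg_root_dual: "\<alpha> \<in> dual \<Longrightarrow> neg_root \<alpha> \<in> dual"
  using dual_smult[of \<alpha> "-1"] by (simp cong: restrict_cong)

lemma opposite_bracket_H: "x \<in> root_space \<alpha> \<Longrightarrow> y \<in> root_space (neg_root \<alpha>) \<Longrightarrow> bracket x y \<in> H"
  using root_space_bracket[of x \<alpha> y "\<lambda>h. - \<alpha> h"] root_space_zero by simp

text \<open>Invariance under h multiplies the form at (x, y) by (\<alpha> + \<nu>)(h), which settles
  every weight \<nu> except -\<alpha>. For weight -\<alpha>, x is a multiple of some [x, h], and
  invariance moves the bracket onto [x, y] = 0.\<close>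

lemma mem_killing_radical:
  assumes \<alpha>: "\<alpha> \<in> roots" and x: "x \<in> root_space \<alpha>"
    and z: "\<And>y. y \<in> root_space (neg_root \<alpha>) \<Longrightarrow> bracket x y = 0"
  shows "x \<in> killing_radical"
proof -
  have *: "killing x y = 0" if y: "y \<in> root_space \<nu>" "\<nu> \<in> weights" for y \<nu>
  proof (cases "\<forall>h\<in>H. \<alpha> h + \<nu> h = 0")
    case True
    then have "\<And>h. h \<in> H \<Longrightarrow> \<nu> h = - \<alpha> h" by (simp add: eq_neg_iff_add_eq_0 add.commute)
    then have "y \<in> root_space (neg_root \<alpha>)" using y(1) root_space_cong[of \<nu> "neg_root \<alpha>"] by simp
    then have xy: "bracket x y = 0" by (rule z)
    obtain h where h: "h \<in> H" "\<alpha> h \<noteq> 0" using \<alpha> dual_ext by (fastforce simp: roots_def extensional_def)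
    have "killing (bracket x h) y = 0" using killing_invariant[of x h y] xy killing_scale_right[of h 0 0] by simp
    moreover have "bracket x h = (- \<alpha> h) *s x"
      using bracket_anti[of x h] root_spaceD[OF x h(1)] by simp
    ultimately show ?thesis using h(2) killing_scale_left[of "- \<alpha> h" x y] by simp
  next
    case False
    then obtain h where h: "h \<in> H" "\<alpha> h + \<nu> h \<noteq> 0" by blast
    have "\<alpha> h * killing x y = - (\<nu> h * killing x y)"
      using killing_invariant[of h x y] root_spaceD[OF x h(1)] root_spaceD[OF y(1) h(1)]
      by (simp add: killing_scale_left killing_scale_right)
    then have "(\<alpha> h + \<nu> h) * killing x y = 0" by (simp add: algebra_simps)
    then show ?thesis using h(2) by simp
  qed
  have "killing x y = 0" for y
  proof -
    have "y \<in> span (\<Union>\<mu>\<in>weights. root_space \<mu>)" by (simp add: weight_vectors_span)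
    then show ?thesis
      by (induct rule: span_induct_alt)
        (use * killing_scale_right[of x 0 0] in \<open>auto simp: killing_add_right killing_scale_right\<close>)
  qed
  then show ?thesis by (simp add: killing_radical_def)
qed

text \<open>The space [g_\<alpha>, g_-\<alpha>]. For a root it is the line that contains the coroot;
  that it is at most a line is the content of \<open>coline_zero\<close>.\<close>

definition coline :: "('g \<Rightarrow> complex) \<Rightarrow> 'g set" where
  "coline \<alpha> = span {bracket x y | x y. x \<in> root_space \<alpha> \<and> y \<in> root_space (neg_root \<alpha>)}"

lemma coline_H: "coline \<alpha> \<subseteq> H"
  unfolding coline_def using opposite_bracket_H by (intro span_minimal H_subspace) blast

text \<open>The operator \<open>ad [x, y]\<close> has trace zero on the root string through \<open>\<nu>\<close>.\<close>

lemma string_ratio: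
  assumes \<alpha>: "\<alpha> \<in> dual" and \<nu>: "\<nu> \<in> weights"
  shows "\<exists>r::real. \<forall>t\<in>coline \<alpha>. \<nu> t = of_real r * \<alpha> t"
proof -
  have \<nu>d: "\<nu> \<in> dual" using \<nu> by (simp add: weights_def)
  define S where "S = (\<Union>k::int. root_space (\<lambda>h. \<nu> h + of_int k * \<alpha> h))"
  obtain B where B: "B \<subseteq> S" "independent B" "S \<subseteq> span B" using maximal_independent_subset by blast
  have fB: "finite B" using B independent_finite by blast
  have "\<forall>b\<in>B. \<exists>k::int. b \<in> root_space (\<lambda>h. \<nu> h + of_int k * \<alpha> h)"
    using B(1) unfolding S_def by blast
  from bchoice[OF this] obtain k :: "'g \<Rightarrow> int"
    where k: "\<And>b. b \<in> B \<Longrightarrow> b \<in> root_space (\<lambda>h. \<nu> h + of_int (k b) * \<alpha> h)" by blast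
  have SB: "v \<in> span B" if "v \<in> root_space \<mu>" "\<And>h. h \<in> H \<Longrightarrow> \<mu> h = \<nu> h + of_int m * \<alpha> h" for v m \<mu>
  proof -
    have "v \<in> root_space (\<lambda>h. \<nu> h + of_int m * \<alpha> h)"
      using that(1) root_space_cong[of \<mu>, OF that(2)] by simp
    then show ?thesis using B(3) unfolding S_def by blast
  qed
  obtain v where v: "v \<in> root_space \<nu>" "v \<noteq> 0"
    using \<nu> subspace_0[OF root_space_subspace[of \<nu>]] unfolding weights_def by blast
  have "v \<in> span B" by (rule SB[OF v(1), of 0]) simp
  then have "B \<noteq> {}" using v(2) by auto
  then have c: "card B \<noteq> 0" using fB by simp
  \<comment> \<open>Minus the mean position in the string: the solution of the equation trace = 0
    below. It does not depend on x and y, because the basis and the positions are fixed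
    beforehand.\<close>
  define r :: real where "r = - of_int (\<Sum>b\<in>B. k b) / of_nat (card B)"
  have up: "bracket x b \<in> span B" if "x \<in> root_space \<alpha>" "b \<in> B" for x b
    by (rule SB[OF root_space_bracket[OF that(1) k[OF that(2)]], of "k b + 1"]) (simp add: algebra_simps)
  have dn: "bracket y b \<in> span B" if "y \<in> root_space (neg_root \<alpha>)" "b \<in> B" for y b
    by (rule SB[OF root_space_bracket[OF that(1) k[OF that(2)]], of "k b - 1"]) (simp add: algebra_simps)
  have gen: "\<nu> (bracket x y) = of_real r * \<alpha> (bracket x y)"
    if x: "x \<in> root_space \<alpha>" and y: "y \<in> root_space (neg_root \<alpha>)" for x y
  proof -
    let ?t = "bracket x y"
    have t: "?t \<in> H" using x y by (rule opposite_bracket_H)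
    have "tr B (bracket ?t) = tr B (\<lambda>v. bracket x (bracket y v)) - tr B (\<lambda>v. bracket y (bracket x v))"
      unfolding ad_bracket
      by (rule tr_diff[OF B(2)]) (auto intro: span_stable[OF ad_linear] up[OF x] dn[OF y])
    also have "\<dots> = 0" using tr_commute[OF B(2) fB ad_linear up[OF x] ad_linear dn[OF y]] by simp
    finally have "0 = tr B (bracket ?t)" by simp
    also have "\<dots> = (\<Sum>b\<in>B. \<nu> ?t + of_int (k b) * \<alpha> ?t)"
      by (rule tr_diagonal[OF B(2)]) (use k t root_spaceD in blast)
    also have "\<dots> = of_nat (card B) * \<nu> ?t + of_int (\<Sum>b\<in>B. k b) * \<alpha> ?t"
      by (simp add: sum.distrib sum_distrib_right)
    finally show ?thesis using c by (simp add: r_def field_simps eq_neg_iff_add_eq_0)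
  qed
  have "\<nu> t = of_real r * \<alpha> t" if "t \<in> coline \<alpha>" for t
  proof -
    have "t \<in> H \<and> \<nu> t = of_real r * \<alpha> t"
      using that unfolding coline_def
    proof (induct rule: span_induct_alt)
      case base then show ?case using \<alpha> \<nu>d by (simp add: dual_zero H_zero)
    next
      case (step c x y)
      then obtain u v where uv: "x = bracket u v" "u \<in> root_space \<alpha>" "v \<in> root_space (neg_root \<alpha>)" by blast
      then have "x \<in> H" "\<nu> x = of_real r * \<alpha> x" using opposite_bracket_H gen by auto
      then show ?case using step \<alpha> \<nu>d by (simp add: dual_add dual_scale H_add H_scale algebra_simps)
    qed
    then show ?thesis by simp
  qed
  then show ?thesis by blast
qed

lemma H_acts_zero:
  assumes t: "t \<in> H" and z: "\<And>\<nu>. \<nu> \<in> weights \<Longrightarrow> \<nu> t = 0"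
  shows "t = 0"
proof (rule central_zero[OF semisimple])
  fix v
  have "v \<in> span (\<Union>\<mu>\<in>weights. root_space \<mu>)" by (simp add: weight_vectors_span)
  then show "bracket t v = 0"
    by (induct rule: span_induct_alt)
      (use z root_spaceD[OF _ t] in \<open>auto simp: bracket_add_right bracket_scale_right\<close>)
qed

text \<open>By \<open>string_ratio\<close> every weight vanishes at a point of the coline where
  \<alpha> does, so such a point is central.\<close>

lemma coline_zero: "\<alpha> \<in> dual \<Longrightarrow> t \<in> coline \<alpha> \<Longrightarrow> \<alpha> t = 0 \<Longrightarrow> t = 0"
proof -
  assume a: "\<alpha> \<in> dual" "t \<in> coline \<alpha>" "\<alpha> t = 0"
  have "\<nu> t = 0" if "\<nu> \<in> weights" for \<nu>
    using string_ratio[OF a(1) that] a(2,3) by auto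
  then show "t = 0" using H_acts_zero a(2) coline_H by blast
qed

text \<open>In the weight basis the form at (t, t) is \<alpha>(t)^2 times a sum of squares of the
  ratios from \<open>string_ratio\<close>. As the ratios are real, no cancellation occurs: either
  \<alpha>(t) = 0 or all ratios vanish, and in both cases t acts as zero.\<close>

lemma killing_anisotropic:
  assumes \<alpha>: "\<alpha> \<in> dual" and t: "t \<in> coline \<alpha>" "killing t t = 0"
  shows "t = 0"
proof -
  have tH: "t \<in> H" using t coline_H by blast
  obtain wt where wt: "\<And>b. b \<in> weight_basis \<Longrightarrow> b \<in> root_space (wt b) \<and> wt b \<in> weights"
    using weight_basis(1) by (metis (no_types, lifting) UN_iff subsetD)
  have "\<forall>b\<in>weight_basis. \<exists>r::real. wt b t = of_real r * \<alpha> t"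
    using string_ratio[OF \<alpha>] wt t(1) by blast
  then obtain r :: "'g \<Rightarrow> real" where r: "\<And>b. b \<in> weight_basis \<Longrightarrow> wt b t = of_real (r b) * \<alpha> t" by metis
  have "killing t t = (\<Sum>b\<in>weight_basis. wt b t * wt b t)"
    unfolding killing_def
  proof (rule tr_diagonal[OF weight_basis(2)])
    fix b assume "b \<in> weight_basis"
    then have "bracket t b = wt b t *s b" using wt root_spaceD tH by blast
    then show "bracket t (bracket t b) = (wt b t * wt b t) *s b" by (simp add: bracket_scale_right)
  qed
  also have "\<dots> = (\<Sum>b\<in>weight_basis. of_real ((r b)\<^sup>2) * (\<alpha> t)\<^sup>2)"
    by (rule sum.cong) (auto simp: r power2_eq_square)
  also have "\<dots> = of_real (\<Sum>b\<in>weight_basis. (r b)\<^sup>2) * (\<alpha> t)\<^sup>2"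
    by (simp add: sum_distrib_right)
  finally have "\<alpha> t = 0 \<or> (\<Sum>b\<in>weight_basis. (r b)\<^sup>2) = 0"
    using t(2) by (metis (no_types) mult_eq_0_iff of_real_eq_0_iff power_eq_0_iff)
  then show ?thesis
  proof
    assume "(\<Sum>b\<in>weight_basis. (r b)\<^sup>2) = 0"
    then have "wt b t = 0" if "b \<in> weight_basis" for b
      using that r weight_basis(4) by (simp add: sum_nonneg_eq_0_iff)
    then have z: "bracket t b = 0" if "b \<in> weight_basis" for b
      using that wt root_spaceD[OF _ tH, of b "wt b"] by simp
    show ?thesis
    proof (rule central_zero[OF semisimple])
      fix v
      have "v \<in> span weight_basis" by (simp add: weight_basis)
      then show "bracket t v = 0"
        by (induct rule: span_induct_alt) (auto simp: z bracket_add_right bracket_scale_right)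
    qed
  qed (use coline_zero \<alpha> t in blast)
qed

end


context semisimple_with_cartan
begin

section \<open>A graded Engel theorem and the vanishing of the Killing radical\<close>

section \<open>Nondegeneracy of the Killing form\<close>

text \<open>A member of the span is regrouped with one vector per index, the form in which
  components can be compared.\<close>

lemma span_weight_sum:
  assumes "x \<in> span (\<Union>\<nu>\<in>A. V \<nu>)" and V: "\<And>\<nu>. \<nu> \<in> A \<Longrightarrow> subspace (V \<nu>)"
  shows "\<exists>F v. finite F \<and> F \<subseteq> A \<and> x = (\<Sum>\<nu>\<in>F. v \<nu>) \<and> (\<forall>\<nu>\<in>F. v \<nu> \<in> V \<nu>)"
  using assms(1)
proof (induct rule: span_induct_alt)
  case base
  show ?case by (rule exI[of _ "{}"]) auto
next
  case (step c x y)
  then obtain F v \<mu> where F: "finite F" "F \<subseteq> A" "y = (\<Sum>\<nu>\<in>F. v \<nu>)" "\<forall>\<nu>\<in>F. v \<nu> \<in> V \<nu>"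
    and \<mu>: "\<mu> \<in> A" "x \<in> V \<mu>" by auto
  define w where "w \<nu> = (if \<nu> \<in> F then v \<nu> else 0) + (if \<nu> = \<mu> then c *s x else 0)" for \<nu>
  have "c *s x + y = (\<Sum>\<nu>\<in>insert \<mu> F. w \<nu>)"
    using F(1,3) unfolding w_def sum.distrib
    by (simp add: sum.delta' sum.If_cases Int_absorb1 Int_insert_left add.commute)
      (simp add: insert_absorb)
  moreover have "\<forall>\<nu>\<in>insert \<mu> F. w \<nu> \<in> V \<nu>"
    using F(2,4) \<mu> V by (auto simp: w_def subset_iff intro!: subspace_add subspace_scale subspace_0)
  ultimately show ?case using F(1,2) \<mu>(1) by (metis finite_insert insert_subset)
qed

definition homogeneous :: "'g \<Rightarrow> bool" where
  "homogeneous v \<longleftrightarrow> (\<exists>\<nu>\<in>dual. v \<in> root_space \<nu>)"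

text \<open>Stability under H. By \<open>graded_components\<close> such a subspace is spanned by
  weight vectors, so that inclusions can be tested on homogeneous vectors.\<close>

definition graded :: "'g set \<Rightarrow> bool" where
  "graded U \<longleftrightarrow> subspace U \<and> (\<forall>h\<in>H. \<forall>u\<in>U. bracket h u \<in> U)"

lemma graded_ideal: "lie_ideal I \<Longrightarrow> graded I"
  by (auto simp: graded_def lie_ideal_def)

lemma graded_components:
  assumes U: "graded U" and x: "x \<in> U"
  shows "x \<in> span (\<Union>\<nu>\<in>weights. U \<inter> root_space \<nu>)"
proof -
  have "x \<in> span (\<Union>\<nu>\<in>weights. root_space \<nu>)" by (simp add: weight_vectors_span)
  from span_weight_sum[OF this root_space_subspace]
  obtain F v where F: "finite F" "F \<subseteq> weights" "x = (\<Sum>\<nu>\<in>F. v \<nu>)" "\<forall>\<nu>\<in>F. v \<nu> \<in> root_space \<nu>" by blast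
  have "v \<nu> \<in> U" if "\<nu> \<in> F" for \<nu>
    by (rule weight_components[of U F v]) (use U x F that in \<open>auto simp: graded_def weights_def\<close>)
  then show ?thesis unfolding F(3) using F(2,4) by (intro span_sum span_base) auto
qed

lemma homogeneous_notin:
  assumes "graded U" "graded V" "\<not> V \<subseteq> U"
  shows "\<exists>v\<in>V. homogeneous v \<and> v \<notin> U"
proof (rule ccontr)
  assume *: "\<not> ?thesis"
  have "(\<Union>\<nu>\<in>weights. V \<inter> root_space \<nu>) \<subseteq> U" using * by (auto simp: homogeneous_def weights_def)
  then have "span (\<Union>\<nu>\<in>weights. V \<inter> root_space \<nu>) \<subseteq> U"
    using assms(1) unfolding graded_def by (intro span_minimal) auto
  then show False using graded_components[OF assms(2)] assms(3) by blast
qed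

lemma nonzero_weight_span:
  assumes z: "z \<in> span (\<Union>\<nu>\<in>weights - {\<lambda>x\<in>H. 0}. root_space \<nu>)" "z \<in> H"
  shows "z = 0"
proof -
  let ?o = "\<lambda>x\<in>H. 0::complex"
  from span_weight_sum[OF z(1) root_space_subspace]
  obtain F v where F: "finite F" "F \<subseteq> weights - {?o}" "z = (\<Sum>\<nu>\<in>F. v \<nu>)" "\<forall>\<nu>\<in>F. v \<nu> \<in> root_space \<nu>" by blast
  \<comment> \<open>With -z placed in weight zero the components sum to 0, so each of them
    vanishes.\<close>
  define w where "w = v(?o := - z)"
  have o: "?o \<notin> F" using F(2) by blast
  have "w ?o \<in> {0}"
  proof (rule weight_components[of "{0}" "insert ?o F" w])
    have "?o \<in> dual" by (rule dualI) (auto simp: H_add H_scale)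
    then show "insert ?o F \<subseteq> dual" using F(2) by (auto simp: weights_def)
    have "sum w F = sum v F" by (rule sum.cong) (use o in \<open>auto simp: w_def\<close>)
    then show "sum w (insert ?o F) \<in> {0}" using F(1,3) o by (simp add: w_def)
    fix \<mu> assume m: "\<mu> \<in> insert ?o F"
    show "w \<mu> \<in> root_space \<mu>"
    proof (cases "\<mu> = ?o")
      case True
      then show ?thesis using z(2) H_subspace root_space_zero by (simp add: w_def subspace_neg)
    qed (use m F(4) in \<open>auto simp: w_def\<close>)
  qed (use F(1) in auto)
  then show ?thesis by (simp add: w_def)
qed

text \<open>Each application of ad x shifts the weight by \<beta>. The shifted weights are told
  apart by their values at h, while there are only finitely many weights.\<close>

lemma ad_locally_nilpotent:
  assumes x: "x \<in> root_space \<beta>" "\<beta> \<in> dual" "h \<in> H" "\<beta> h \<noteq> 0" and v: "v \<in> root_space \<nu>" "\<nu> \<in> dual"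
  shows "(bracket x ^^ k) v \<in> root_space (\<lambda>h. \<nu> h + of_nat k * \<beta> h)"
    and "\<exists>k. (bracket x ^^ k) v = 0"
proof -
  show w: "(bracket x ^^ k) v \<in> root_space (\<lambda>h. \<nu> h + of_nat k * \<beta> h)" for k
  proof (induction k)
    case (Suc k)
    have "bracket x ((bracket x ^^ k) v) \<in> root_space (\<lambda>h. \<beta> h + (\<nu> h + of_nat k * \<beta> h))"
      by (rule root_space_bracket[OF x(1) Suc])
    then show ?case by (simp add: algebra_simps)
  qed (use v in simp)
  show "\<exists>k. (bracket x ^^ k) v = 0"
  proof (rule ccontr)
    assume *: "\<not> ?thesis"
    let ?f = "\<lambda>k::nat. \<lambda>h\<in>H. 1 * \<nu> h + of_nat k * \<beta> h"
    have "?f k \<in> weights" for k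
      by (rule weightsI[OF dual_comb[OF v(2) x(2)], of "(bracket x ^^ k) v"]) (use w * in auto)
    moreover have "inj ?f"
    proof (rule injI)
      fix k l assume "?f k = ?f l"
      then have "?f k h = ?f l h" by metis
      then show "k = l" using x(3,4) by simp
    qed
    ultimately have "finite (UNIV :: nat set)"
      using finite_imageD[OF finite_subset[OF _ finite_weights], of ?f UNIV] by blast
    then show False by simp
  qed
qed

text \<open>Engel's theorem for a graded subalgebra without a part of degree zero, relative to a
  pair of invariant subspaces so that no quotients are needed.\<close>

lemma engel:
  assumes "graded B" "\<And>x y. x \<in> B \<Longrightarrow> y \<in> B \<Longrightarrow> bracket x y \<in> B" "B \<inter> H = {0}"
    and "graded U" "graded V" "U \<subset> V"
    and "\<And>b v. b \<in> B \<Longrightarrow> v \<in> V \<Longrightarrow> bracket b v \<in> V" "\<And>b u. b \<in> B \<Longrightarrow> u \<in> U \<Longrightarrow> bracket b u \<in> U"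
  shows "\<exists>v\<in>V. homogeneous v \<and> v \<notin> U \<and> (\<forall>b\<in>B. bracket b v \<in> U)"
  using assms
proof (induction "dim B" arbitrary: B U V rule: less_induct)
  case less
  note gB = less.prems(1) and cB = less.prems(2) and hB = less.prems(3) and gU = less.prems(4)
    and gV = less.prems(5) and UV = less.prems(6) and sV = less.prems(7) and sU = less.prems(8)
  have sub: "subspace B" "subspace U" "subspace V" using gB gU gV by (auto simp: graded_def)
  show ?case
  proof (cases "B = {0}")
    case True
    have "\<exists>v\<in>V. homogeneous v \<and> v \<notin> U" by (rule homogeneous_notin[OF gU gV]) (use UV in blast)
    then show ?thesis using True subspace_0[OF sub(2)] by auto
  next
    case False
    define P where "P C \<longleftrightarrow> graded C \<and> (\<forall>x\<in>C. \<forall>y\<in>C. bracket x y \<in> C) \<and> C \<subset> B" for C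
    have bound: "dim C < dim B" if "P C" for C
      using that sub unfolding P_def graded_def by (intro dim_strict_mono) auto
    have "P {0}" using False subspace_0[OF sub(1)] by (auto simp: P_def graded_def)
    \<comment> \<open>A proper graded subalgebra of maximal dimension; it will turn out to be an
      ideal of codimension one in B.\<close>
    then obtain C where C: "P C" and max: "\<And>C'. P C' \<Longrightarrow> dim C' \<le> dim C"
      using ex_has_greatest_nat[of P "{0}" dim "dim B"] bound by (metis less_imp_le_nat)
    have gC: "graded C" and cC: "\<And>x y. x \<in> C \<Longrightarrow> y \<in> C \<Longrightarrow> bracket x y \<in> C" and CB: "C \<subset> B"
      using C by (auto simp: P_def)
    have subC: "subspace C" using gC by (simp add: graded_def)
    have hC: "C \<inter> H = {0}" using CB hB subspace_0[OF subC] H_zero by blast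
    \<comment> \<open>The induction hypothesis for C, acting on B relative to C, yields a
      homogeneous x outside C that normalizes C.\<close>
    have "\<exists>x\<in>B. homogeneous x \<and> x \<notin> C \<and> (\<forall>c\<in>C. bracket c x \<in> C)"
      by (rule less.hyps[OF bound[OF C] gC cC hC gC gB CB]) (use CB cB cC in blast)+
    then obtain x \<beta> where x: "x \<in> B" "x \<notin> C" "\<beta> \<in> dual" "x \<in> root_space \<beta>" "\<And>c. c \<in> C \<Longrightarrow> bracket c x \<in> C"
      unfolding homogeneous_def by blast
    have "x \<noteq> 0" using x(2) subspace_0[OF subC] by blast
    \<comment> \<open>Since B meets H only in 0, the weight of x is nonzero; this makes ad x
      nilpotent on every weight vector.\<close>
    then have "x \<notin> H" using hB x(1) by blast
    then obtain h where h: "h \<in> H" "\<beta> h \<noteq> 0"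
      using x(4) root_space_cong[of \<beta> "\<lambda>_. 0"] root_space_zero by blast
    have exC: "\<exists>c k. c \<in> C \<and> z = k *s x + c" if "z \<in> span (insert x C)" for z
      using that span_breakdown_eq[of z x C] span_eq_iff[THEN iffD2, OF subC]
      by (metis add.commute diff_add_cancel)
    have inC: "k *s x + c \<in> span (insert x C)" if "c \<in> C" for k c
      using that by (intro span_add span_scale span_base) auto
    \<comment> \<open>Adjoining x to C gives a strictly larger graded subalgebra inside B, so
      maximality leaves only B itself.\<close>
    have Bx: "span (insert x C) = B"
    proof (rule ccontr)
      assume ne: "span (insert x C) \<noteq> B"
      have "P (span (insert x C))"
        unfolding P_def graded_def
      proof (intro conjI ballI subspace_span psubsetI ne)
        show "span (insert x C) \<subseteq> B" using x(1) CB sub(1) by (intro span_minimal) auto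
        fix h z assume hz: "h \<in> H" "z \<in> span (insert x C)"
        obtain c k where z: "c \<in> C" "z = k *s x + c" using exC[OF hz(2)] by blast
        have "bracket h z = (k * \<beta> h) *s x + bracket h c"
          using root_spaceD[OF x(4) hz(1)] by (simp add: z bracket_add_right bracket_scale_right)
        then show "bracket h z \<in> span (insert x C)" using inC gC hz(1) z(1) by (simp add: graded_def)
      next
        fix z w assume "z \<in> span (insert x C)" "w \<in> span (insert x C)"
        then obtain c k d l where z: "c \<in> C" "z = k *s x + c" "d \<in> C" "w = l *s x + d" using exC by meson
        have "bracket x d \<in> C" using x(5)[OF z(3)] bracket_anti[of x d] subspace_neg[OF subC] by simp
        then have "k *s bracket x d + (l *s bracket c x + bracket c d) \<in> C"
          using x(5)[OF z(1)] cC z subC by (intro subspace_add subspace_scale)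
        then show "bracket z w \<in> span (insert x C)"
          using inC[of _ 0] by (simp add: z bracket_add_right bracket_add_left bracket_scale_right
              bracket_scale_left bracket_self add.assoc add.left_commute scale_right_distrib)
      qed
      then have "dim (span (insert x C)) \<le> dim C" by (rule max)
      moreover have "C \<subset> span (insert x C)" using span_superset[of "insert x C"] x(2) by auto
      then have "dim C < dim (span (insert x C))" using subC by (intro dim_strict_mono) auto
      ultimately show False by simp
    qed
    have "\<exists>v\<in>V. homogeneous v \<and> v \<notin> U \<and> (\<forall>c\<in>C. bracket c v \<in> U)"
      by (rule less.hyps[OF bound[OF C] gC cC hC gU gV UV]) (use CB sV sU in blast)+
    then obtain v \<nu> where v: "v \<in> V" "\<nu> \<in> dual" "v \<in> root_space \<nu>" "v \<notin> U" "\<And>c. c \<in> C \<Longrightarrow> bracket c v \<in> U"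
      unfolding homogeneous_def by blast
    let ?v = "\<lambda>k. (bracket x ^^ k) v"
    have vk: "?v k \<in> V \<and> (\<forall>c\<in>C. bracket c (?v k) \<in> U)" for k
    proof (induction k)
      case (Suc k)
      have "bracket c (bracket x (?v k)) \<in> U" if c: "c \<in> C" for c
        unfolding bracket_deriv[of c x]
        using Suc x(1) x(5)[OF c] c sU sub(2) by (intro subspace_add) auto
      then show ?case using Suc sV x(1) by simp
    qed (use v in simp)
    obtain k0 where "?v k0 = 0" using ad_locally_nilpotent(2)[OF x(4,3) h v(3,2)] by blast
    then have "?v k0 \<in> U" using subspace_0[OF sub(2)] by simp
    \<comment> \<open>The last iterate outside U is sent into U by x, and by C as every iterate is;
      hence by all of B.\<close>
    then obtain k where k: "?v k \<in> U" "\<And>j. j < k \<Longrightarrow> ?v j \<notin> U"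
      using LeastI[of "\<lambda>k. ?v k \<in> U"] not_less_Least[of _ "\<lambda>k. ?v k \<in> U"] by blast
    then obtain j where j: "k = Suc j" using v(4) by (cases k) auto
    have "bracket b (?v j) \<in> U" if b: "b \<in> B" for b
    proof -
      obtain c a where ca: "c \<in> C" "b = a *s x + c" using exC b Bx by blast
      have "bracket x (?v j) \<in> U" using k(1) by (simp add: j)
      then show ?thesis using vk[of j] ca sub(2)
        by (auto simp: bracket_add_left bracket_scale_left intro!: subspace_add subspace_scale)
    qed
    moreover have "homogeneous (?v j)"
    proof -
      have "?v j \<in> root_space (\<lambda>h\<in>H. 1 * \<nu> h + of_nat j * \<beta> h)"
        using ad_locally_nilpotent(1)[OF x(4,3) h v(3,2), of j] by simp
      then show ?thesis using dual_comb[OF v(2) x(3)] unfolding homogeneous_def by blast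
    qed
    ultimately show ?thesis using vk[of j] k(2)[of j] j by blast
  qed
qed

text \<open>The derived ideal of the radical has no part of weight zero, so \<open>engel\<close>
  applies to it. If it were nonzero, it would have a nonzero centre, which is an abelian ideal of
  the whole algebra. Hence the radical is abelian, and semisimplicity removes it.\<close>

lemma killing_radical_zero: "killing_radical = {0}"
proof -
  let ?S = killing_radical and ?o = "\<lambda>x\<in>H. 0::complex"
  let ?D = "derived_algebra ?S"
  define N where "N = span (\<Union>\<nu>\<in>weights - {?o}. root_space \<nu>)"
  have N: "subspace N" by (simp add: N_def)
  note S = killing_radical_ideal
  have gS: "graded ?S" by (rule graded_ideal[OF S])
  have D: "lie_ideal ?D" by (rule derived_ideal[OF S])
  have gD: "graded ?D" by (rule graded_ideal[OF D])
  have hom: "bracket x y \<in> N"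
    if x: "x \<in> ?S \<inter> root_space \<mu>" "\<mu> \<in> weights" and y: "y \<in> ?S \<inter> root_space \<nu>" "\<nu> \<in> weights" for x y \<mu> \<nu>
  proof -
    let ?\<sigma> = "\<lambda>h\<in>H. 1 * \<mu> h + 1 * \<nu> h"
    have xy: "bracket x y \<in> root_space ?\<sigma>" using root_space_bracket[of x \<mu> y \<nu>] x y by simp
    have "?\<sigma> \<in> dual" using x y by (intro dual_comb) (auto simp: weights_def)
    show ?thesis
    proof (cases "bracket x y = 0")
      case False
      then have w: "?\<sigma> \<in> weights" using weightsI \<open>?\<sigma> \<in> dual\<close> xy by blast
      \<comment> \<open>A bracket of weight zero would lie both in a coline and in the radical; it
        would be isotropic there, hence 0 by \<open>killing_anisotropic\<close>.\<close>
      have "?\<sigma> \<noteq> ?o"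
      proof
        assume "?\<sigma> = ?o"
        then have s: "\<mu> h + \<nu> h = 0" if "h \<in> H" for h using that by (auto dest: fun_cong[of _ _ h])
        then have "\<And>h. h \<in> H \<Longrightarrow> \<nu> h = - \<mu> h" by (simp add: eq_neg_iff_add_eq_0 add.commute)
        then have y': "y \<in> root_space (neg_root \<mu>)" using y(1) root_space_cong[of \<nu> "neg_root \<mu>"] by simp
        then have "bracket x y \<in> coline \<mu>" unfolding coline_def using x(1) by (intro span_base) blast
        moreover have "bracket x y \<in> ?S" using S y(1) unfolding lie_ideal_def by blast
        then have "killing (bracket x y) (bracket x y) = 0" by (simp add: killing_radical_def)
        ultimately have "bracket x y = 0" using killing_anisotropic[of \<mu>] x(2) by (auto simp: weights_def)
        then show False using False by simp
      qed
      then show ?thesis using w xy unfolding N_def by (intro span_base) blast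
    qed (simp add: subspace_0[OF N])
  qed
  have "bracket x y \<in> N" if "x \<in> ?S" "y \<in> ?S" for x y
    using graded_components[OF gS that(1)]
  proof (induct rule: span_induct_alt)
    case (step c u w)
    have "bracket u y \<in> N"
      using graded_components[OF gS that(2)]
    proof (induct rule: span_induct_alt)
      case (step d u' w')
      then show ?case using \<open>u \<in> _\<close> hom
        by (auto simp: bracket_add_right bracket_scale_right intro!: subspace_add[OF N] subspace_scale[OF N])
    qed (simp add: subspace_0[OF N])
    then show ?case using step by (auto simp: bracket_add_left bracket_scale_left intro!: subspace_add[OF N] subspace_scale[OF N])
  qed (simp add: subspace_0[OF N])
  then have "?D \<subseteq> N"
    unfolding derived_algebra_def by (intro span_minimal N) blast
  then have DH: "?D \<inter> H = {0}"
    using nonzero_weight_span[folded N_def] H_zero subspace_0[of ?D] D by (auto simp: lie_ideal_def)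
  have cD: "bracket x y \<in> ?D" if "y \<in> ?D" for x y using D that by (auto simp: lie_ideal_def)
  have sD: "subspace ?D" using D by (simp add: lie_ideal_def)
  have "?D = {0}"
  proof (rule ccontr)
    assume ne: "?D \<noteq> {0}"
    have "\<exists>v\<in>?D. homogeneous v \<and> v \<notin> {0} \<and> (\<forall>b\<in>?D. bracket b v \<in> {0})"
      by (rule engel[OF gD cD DH _ gD]) (use ne subspace_0[OF sD] cD in \<open>auto simp: graded_def\<close>)
    then obtain v where v: "v \<in> ?D" "v \<noteq> 0" "\<forall>b\<in>?D. bracket b v = 0" by blast
    let ?Z = "{v \<in> ?D. \<forall>b\<in>?D. bracket b v = 0}"
    have "?Z = {0}"
    proof (rule abelian_ideal_zero[OF semisimple])
      show "lie_ideal ?Z"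
        unfolding lie_ideal_def
      proof (intro conjI allI ballI)
        show "subspace ?Z" using sD
          by (intro subspaceI) (auto simp: subspace_0 subspace_add subspace_scale bracket_add_right bracket_scale_right)
        fix x z assume z: "z \<in> ?Z"
        have "bracket b (bracket x z) = 0" if b: "b \<in> ?D" for b
        proof -
          have "bracket x b \<in> ?D" using cD b by blast
          then have "bracket (bracket b x) z = 0"
            using z bracket_anti[of b x] by (simp add: bracket_minus_left)
          then show ?thesis using bracket_deriv[of b x z] z b by simp
        qed
        then show "bracket x z \<in> ?Z" using z cD by blast
      qed
    qed blast
    then show False using v by blast
  qed
  then have "bracket x y = 0" if "x \<in> ?S" "y \<in> ?S" for x y
    using that unfolding derived_algebra_def by (metis (mono_tags, lifting) mem_Collect_eq singletonD span_base)
  then show ?thesis by (rule abelian_ideal_zero[OF semisimple S])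
qed

section \<open>sl_2-triples, root strings and reducedness of the root system\<close>

section \<open>Coroots and root strings\<close>

lemma root_nonzero: "\<alpha> \<in> roots \<Longrightarrow> \<exists>h\<in>H. \<alpha> h \<noteq> 0"
  using dual_ext by (fastforce simp: roots_def extensional_def)

text \<open>Nondegeneracy provides y with [x, y] nonzero. By \<open>coline_zero\<close>, \<alpha>
  does not vanish on this bracket, so y can be rescaled to give the value 2.\<close>

lemma sl2_triple:
  assumes \<alpha>: "\<alpha> \<in> roots"
  obtains x y where "x \<in> root_space \<alpha>" "y \<in> root_space (neg_root \<alpha>)" "\<alpha> (bracket x y) = 2" "x \<noteq> 0"
proof -
  obtain x where x: "x \<in> root_space \<alpha>" "x \<noteq> 0"
    using \<alpha> subspace_0[OF root_space_subspace[of \<alpha>]] unfolding roots_def by blast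
  then have "x \<notin> killing_radical" by (simp add: killing_radical_zero)
  then obtain y where y: "y \<in> root_space (neg_root \<alpha>)" "bracket x y \<noteq> 0"
    using mem_killing_radical[OF \<alpha> x(1)] by blast
  have t: "bracket x y \<in> coline \<alpha>" unfolding coline_def using x(1) y(1) by (intro span_base) blast
  have a: "\<alpha> (bracket x y) \<noteq> 0" using coline_zero[OF roots_dual[OF \<alpha>] t] y(2) by blast
  show ?thesis
  proof (rule that[OF x(1) _ _ x(2)])
    show "(2 / \<alpha> (bracket x y)) *s y \<in> root_space (neg_root \<alpha>)"
      using y(1) root_space_subspace subspace_scale by blast
    show "\<alpha> (bracket x ((2 / \<alpha> (bracket x y)) *s y)) = 2"
      using a subsetD[OF coline_H t] by (simp add: bracket_scale_right dual_scale[OF roots_dual[OF \<alpha>]])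
  qed
qed

text \<open>\<alpha> is injective on its coline, so the definite description of
  \<open>coroot\<close> has at most one solution.\<close>

lemma coroot_unique:
  assumes \<alpha>: "\<alpha> \<in> roots" and t: "t \<in> coline \<alpha>" "\<alpha> t = 2"
  shows "coroot \<alpha> = t"
  unfolding coroot_def
proof (rule the_equality)
  show "t \<in> span {bracket x y |x y. x \<in> root_space \<alpha> \<and> y \<in> root_space (neg_root \<alpha>)} \<and> \<alpha> t = 2"
    using t by (simp add: coline_def)
  fix u assume "u \<in> span {bracket x y |x y. x \<in> root_space \<alpha> \<and> y \<in> root_space (neg_root \<alpha>)} \<and> \<alpha> u = 2"
  then have u: "u \<in> coline \<alpha>" "\<alpha> u = 2" by (simp_all add: coline_def)
  have "u - t \<in> coline \<alpha>" using u t unfolding coline_def by (intro span_diff)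
  moreover have "\<alpha> (u - t) = 0" using u t coline_H dual_diff[OF roots_dual[OF \<alpha>]] by (simp add: subset_iff)
  ultimately show "u = t" using coline_zero[OF roots_dual[OF \<alpha>]] by fastforce
qed

lemma coroot:
  assumes \<alpha>: "\<alpha> \<in> roots"
  obtains x y where "x \<in> root_space \<alpha>" "y \<in> root_space (neg_root \<alpha>)" "bracket x y = coroot \<alpha>"
    "\<alpha> (coroot \<alpha>) = 2" "x \<noteq> 0" "coroot \<alpha> \<in> H" "coroot \<alpha> \<in> coline \<alpha>"
proof -
  obtain x y where xy: "x \<in> root_space \<alpha>" "y \<in> root_space (neg_root \<alpha>)" "\<alpha> (bracket x y) = 2" "x \<noteq> 0"
    by (rule sl2_triple[OF \<alpha>])
  have t: "bracket x y \<in> coline \<alpha>" unfolding coline_def using xy by (intro span_base) blast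
  have "coroot \<alpha> = bracket x y" by (rule coroot_unique[OF \<alpha> t xy(3)])
  then show ?thesis using that xy t coline_H by (metis subsetD)
qed

lemma coroot_H: "\<alpha> \<in> roots \<Longrightarrow> coroot \<alpha> \<in> H" and root_coroot: "\<alpha> \<in> roots \<Longrightarrow> \<alpha> (coroot \<alpha>) = 2"
  using coroot by metis+

text \<open>With t = [x, y], induction gives x y^(i+1) v = (i+1)(\<nu>(t) - i) y^i v. The first
  vanishing power y^(n+1) v therefore forces \<nu>(t) = n.\<close>

lemma primitive_vector:
  assumes \<alpha>: "\<alpha> \<in> dual" and x: "x \<in> root_space \<alpha>" and y: "y \<in> root_space (neg_root \<alpha>)"
    and t: "\<alpha> (bracket x y) = 2"
    and v: "v \<in> root_space \<nu>" "\<nu> \<in> dual" "v \<noteq> 0" "bracket x v = 0"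
  shows "\<exists>n::nat. \<nu> (bracket x y) = of_nat n \<and> (\<forall>i\<le>n. (bracket y ^^ i) v \<noteq> 0)"
proof -
  let ?t = "bracket x y" and ?v = "\<lambda>i. (bracket y ^^ i) v"
  have tH: "?t \<in> H" by (rule opposite_bracket_H[OF x y])
  note nil = ad_locally_nilpotent[OF y neg_root_dual[OF \<alpha>] tH _ v(1,2)]
  have n0: "neg_root \<alpha> ?t \<noteq> 0" using t tH by simp
  have tv: "bracket ?t (?v i) = (\<nu> ?t - 2 * of_nat i) *s ?v i" for i
    using root_spaceD[OF nil(1)[OF n0] tH] t tH by (simp add: algebra_simps)
  have xv: "bracket x (?v (Suc i)) = (of_nat (Suc i) * (\<nu> ?t - of_nat i)) *s ?v i" for i
  proof (induction i)
    case 0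
    show ?case using bracket_deriv[of x y v] tv[of 0] v(4) by simp
  next
    case (Suc i)
    have "bracket x (?v (Suc (Suc i))) = bracket ?t (?v (Suc i)) + bracket y (bracket x (?v (Suc i)))"
      using bracket_deriv[of x y "?v (Suc i)"] by simp
    also have "\<dots> = (\<nu> ?t - 2 * of_nat (Suc i)) *s ?v (Suc i)
        + (of_nat (Suc i) * (\<nu> ?t - of_nat i)) *s ?v (Suc i)"
      unfolding tv Suc.IH by (simp add: bracket_scale_right)
    also have "\<dots> = (of_nat (Suc (Suc i)) * (\<nu> ?t - of_nat (Suc i))) *s ?v (Suc i)"
      unfolding scale_left_distrib[symmetric] by (rule arg_cong[of _ _ "\<lambda>c. c *s _"]) (simp add: algebra_simps)
    finally show ?case .
  qed
  obtain m where "?v m = 0" using nil(2)[OF n0] by blast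
  then obtain m where m: "?v m = 0" "\<And>j. j < m \<Longrightarrow> ?v j \<noteq> 0"
    using LeastI[of "\<lambda>k. ?v k = 0"] not_less_Least[of _ "\<lambda>k. ?v k = 0"] by blast
  then obtain n where n: "m = Suc n" using v(3) by (cases m) auto
  have "(of_nat (Suc n) * (\<nu> ?t - of_nat n)) *s ?v n = 0" using xv[of n] m(1) n by simp
  then have "\<nu> ?t - of_nat n = 0" using m(2)[of n] n by (simp del: of_nat_Suc)
  then show ?thesis using m(2) n by (intro exI[of _ n]) auto
qed

text \<open>With t = [x, y], the top vector w = x^q v of the string has weight value n at t, so
  \<nu>(t) = m = n - 2q. If m is nonnegative, then q is at most n, and the nonzero vector y^(n-q) w
  has weight \<nu> - m \<alpha>.\<close>

lemma weight_string:
  assumes \<alpha>: "\<alpha> \<in> dual" and x: "x \<in> root_space \<alpha>" and y: "y \<in> root_space (neg_root \<alpha>)"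
    and t: "\<alpha> (bracket x y) = 2" and \<nu>: "\<nu> \<in> weights"
  shows "\<exists>m::int. \<nu> (bracket x y) = of_int m \<and> (m \<ge> 0 \<longrightarrow> (\<lambda>h\<in>H. \<nu> h - of_int m * \<alpha> h) \<in> weights)"
proof -
  let ?t = "bracket x y"
  have tH: "?t \<in> H" by (rule opposite_bracket_H[OF x y])
  have \<nu>d: "\<nu> \<in> dual" using \<nu> by (simp add: weights_def)
  obtain v where v: "v \<in> root_space \<nu>" "v \<noteq> 0"
    using \<nu> subspace_0[OF root_space_subspace[of \<nu>]] unfolding weights_def by blast
  have a0: "\<alpha> ?t \<noteq> 0" and b0: "neg_root \<alpha> ?t \<noteq> 0" using t tH by simp_all
  obtain k where "(bracket x ^^ k) v = 0" using ad_locally_nilpotent(2)[OF x \<alpha> tH a0 v(1) \<nu>d] by blast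
  then obtain k where k: "(bracket x ^^ k) v = 0" "\<And>j. j < k \<Longrightarrow> (bracket x ^^ j) v \<noteq> 0"
    using LeastI[of "\<lambda>k. (bracket x ^^ k) v = 0"] not_less_Least[of _ "\<lambda>k. (bracket x ^^ k) v = 0"] by blast
  then obtain q where q: "k = Suc q" using v(2) by (cases k) auto
  let ?w = "(bracket x ^^ q) v" and ?\<mu> = "\<lambda>h\<in>H. 1 * \<nu> h + of_nat q * \<alpha> h"
  have w: "?w \<in> root_space ?\<mu>" using ad_locally_nilpotent(1)[OF x \<alpha> tH a0 v(1) \<nu>d, of q] by simp
  have \<mu>d: "?\<mu> \<in> dual" by (rule dual_comb[OF \<nu>d \<alpha>])
  obtain n where n: "?\<mu> ?t = of_nat n" "\<And>i. i \<le> n \<Longrightarrow> (bracket y ^^ i) ?w \<noteq> 0"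
    using primitive_vector[OF \<alpha> x y t w \<mu>d] k(2)[of q] k(1) q by auto
  define m where "m = int n - 2 * int q"
  have "\<nu> ?t + 2 * of_nat q = of_nat n" using n(1) tH t by (simp add: mult.commute)
  then have m: "\<nu> ?t = of_int m" unfolding m_def by (simp add: algebra_simps)
  have "(\<lambda>h\<in>H. \<nu> h - of_int m * \<alpha> h) \<in> weights" if "m \<ge> 0"
  proof -
    have qn: "q \<le> n" using that by (simp add: m_def)
    have "(bracket y ^^ (n - q)) ?w \<in> root_space (\<lambda>h. ?\<mu> h + of_nat (n - q) * neg_root \<alpha> h)"
      by (rule ad_locally_nilpotent(1)[OF y neg_root_dual[OF \<alpha>] tH b0 w \<mu>d])
    also have "root_space (\<lambda>h. ?\<mu> h + of_nat (n - q) * neg_root \<alpha> h) = root_space (\<lambda>h. \<nu> h - of_int m * \<alpha> h)"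
      by (rule root_space_cong) (use qn in \<open>simp add: m_def of_nat_diff algebra_simps\<close>)
    finally have "(bracket y ^^ (n - q)) ?w \<in> root_space (\<lambda>h\<in>H. 1 * \<nu> h + (- of_int m) * \<alpha> h)" by simp
    then have "(\<lambda>h\<in>H. 1 * \<nu> h + (- of_int m) * \<alpha> h) \<in> weights"
      using n(2)[of "n - q"] by (intro weightsI[OF dual_comb[OF \<nu>d \<alpha>]]) auto
    then show ?thesis by (simp cong: restrict_cong)
  qed
  then show ?thesis using m by blast
qed

text \<open>\<open>weight_string\<close> covers nonnegative values only. For a negative value it is
  applied to the opposite triple (y, x) of the root -\<alpha>, where the value changes sign.\<close>

lemma reflected_weight:
  assumes \<alpha>: "\<alpha> \<in> roots" and \<nu>: "\<nu> \<in> weights"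
  shows "(\<lambda>h\<in>H. \<nu> h - \<nu> (coroot \<alpha>) * \<alpha> h) \<in> weights"
proof -
  obtain x y where xy: "x \<in> root_space \<alpha>" "y \<in> root_space (neg_root \<alpha>)" "bracket x y = coroot \<alpha>"
    using coroot[OF \<alpha>] by metis
  have \<alpha>d: "\<alpha> \<in> dual" and t: "\<alpha> (bracket x y) = 2" and tH: "coroot \<alpha> \<in> H"
    using \<alpha> xy(3) root_coroot coroot_H roots_dual by auto
  have \<nu>d: "\<nu> \<in> dual" using \<nu> by (simp add: weights_def)
  obtain m where m: "\<nu> (coroot \<alpha>) = of_int m" "m \<ge> 0 \<longrightarrow> (\<lambda>h\<in>H. \<nu> h - of_int m * \<alpha> h) \<in> weights"
    using weight_string[OF \<alpha>d xy(1,2) t \<nu>] xy(3) by auto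
  have yx: "bracket y x = - coroot \<alpha>" using xy(3) bracket_anti[of y x] by simp
  have x': "x \<in> root_space (neg_root (neg_root \<alpha>))"
    using xy(1) root_space_cong[of \<alpha> "neg_root (neg_root \<alpha>)"] by simp
  have "- coroot \<alpha> \<in> H" using tH H_subspace subspace_neg by blast
  moreover have neg: "\<phi> (- coroot \<alpha>) = - \<phi> (coroot \<alpha>)" if "\<phi> \<in> dual" for \<phi>
    using dual_scale[OF that tH, of "-1"] by simp
  ultimately have t': "neg_root \<alpha> (bracket y x) = 2" using neg[OF \<alpha>d] root_coroot[OF \<alpha>] yx by simp
  obtain m' where m': "\<nu> (- coroot \<alpha>) = of_int m'" "m' \<ge> 0 \<longrightarrow> (\<lambda>h\<in>H. \<nu> h - of_int m' * neg_root \<alpha> h) \<in> weights"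
    using weight_string[OF neg_root_dual[OF \<alpha>d] xy(2) x' t' \<nu>] yx by auto
  have "of_int m' = (of_int (- m) :: complex)" using m(1) m'(1) neg[OF \<nu>d] by simp
  then have mm: "m' = - m" by (simp only: of_int_eq_iff)
  show ?thesis
  proof (cases "m \<ge> 0")
    case False
    then have "(\<lambda>h\<in>H. \<nu> h - of_int m' * neg_root \<alpha> h) \<in> weights" using m'(2) mm by simp
    then show ?thesis using m(1) mm by (simp cong: restrict_cong)
  qed (use m in simp)
qed

lemma roots_eq: "roots = weights - {\<lambda>x\<in>H. 0}"
  by (auto simp: roots_def weights_def)

lemma reflected_root:
  assumes \<alpha>: "\<alpha> \<in> roots" and \<beta>: "\<beta> \<in> roots"
  shows "(\<lambda>h\<in>H. \<beta> h - \<beta> (coroot \<alpha>) * \<alpha> h) \<in> roots"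
proof -
  let ?\<gamma> = "\<lambda>h\<in>H. \<beta> h - \<beta> (coroot \<alpha>) * \<alpha> h"
  have "?\<gamma> \<noteq> (\<lambda>x\<in>H. 0)"
  proof
    assume "?\<gamma> = (\<lambda>x\<in>H. 0)"
    then have *: "\<beta> h = \<beta> (coroot \<alpha>) * \<alpha> h" if "h \<in> H" for h using that by (auto dest: fun_cong[of _ _ h])
    have "\<beta> (coroot \<alpha>) = 0" using *[OF coroot_H[OF \<alpha>]] root_coroot[OF \<alpha>] by simp
    then show False using * root_nonzero[OF \<beta>] by auto
  qed
  then show ?thesis using reflected_weight[OF \<alpha>, of \<beta>] \<beta> unfolding roots_eq by blast
qed

text \<open>The operator \<open>ad [x, y]\<close> has trace zero on the sum of the lines through \<open>y\<close> and \<open>[x, y]\<close> and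
  the root spaces of the positive multiples of \<open>\<alpha>\<close>.\<close>

lemma multiple_not_root:
  assumes \<alpha>: "\<alpha> \<in> roots" and k: "k \<ge> 2"
  shows "(\<lambda>h\<in>H. of_nat k * \<alpha> h) \<notin> roots"
proof
  assume k\<alpha>: "(\<lambda>h\<in>H. of_nat k * \<alpha> h) \<in> roots"
  obtain x y where xy: "x \<in> root_space \<alpha>" "y \<in> root_space (neg_root \<alpha>)" "bracket x y = coroot \<alpha>" "x \<noteq> 0"
    using coroot[OF \<alpha>] by metis
  let ?t = "coroot \<alpha>"
  have \<alpha>d: "\<alpha> \<in> dual" and t: "\<alpha> ?t = 2" and tH: "?t \<in> H"
    using \<alpha> root_coroot coroot_H roots_dual by auto
  obtain z where z: "z \<in> root_space (\<lambda>h. of_nat k * \<alpha> h)" "z \<noteq> 0"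
    using k\<alpha> subspace_0[OF root_space_subspace] unfolding roots_def by auto
  let ?w = "\<lambda>j::int. root_space (\<lambda>h. of_int j * \<alpha> h)"
  have weq: "v \<in> ?w j" if "v \<in> root_space \<mu>" "\<And>h. h \<in> H \<Longrightarrow> \<mu> h = of_int j * \<alpha> h" for v j \<mu>
    using that(1) root_space_cong[of \<mu>, OF that(2)] by simp
  have xw: "x \<in> ?w 1" and yw: "y \<in> ?w (-1)" and zw: "z \<in> ?w (int k)" and tw: "?t \<in> ?w 0"
    using xy(1,2) z(1) tH root_space_zero by simp_all
  define S where "S = {y, ?t} \<union> (\<Union>j\<in>{1..}. ?w j)"
  \<comment> \<open>Both x and z are forced into the basis, where they contribute 1 + k to the sum
    of the positions; y contributes at least -1 and no other basis vector is negative.\<close>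
  have xz: "independent {x, z}"
  proof (rule independent_insertI)
    show "independent {z}" using z(2) by simp
    show "x \<notin> span {z}"
    proof
      assume "x \<in> span {z}"
      then obtain c where c: "x = c *s z" by (auto simp: span_singleton)
      have "2 *s x = bracket ?t x" using root_spaceD[OF xy(1) tH] t by simp
      also have "\<dots> = (of_nat k * 2) *s x"
        using root_spaceD[OF z(1) tH] t by (simp add: c bracket_scale_right mult.commute)
      finally have "(2::complex) = of_nat k * 2" using xy(4) by simp
      then have "of_nat k = (1::complex)" by simp
      then show False using k by simp
    qed
  qed
  have "{x, z} \<subseteq> S" using xw zw k unfolding S_def by (auto intro: bexI[of _ 1] bexI[of _ "int k"])
  then obtain B where B: "{x, z} \<subseteq> B" "B \<subseteq> S" "independent B" "S \<subseteq> span B"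
    using maximal_independent_subset_extend[OF _ xz, of S] by metis
  have fB: "finite B" using B(3) independent_finite by blast
  have 0: "0 \<notin> B" using B(3) dependent_zero by blast
  have up: "bracket x b \<in> span B" if b: "b \<in> B" for b
  proof -
    consider "b = y" | "b = ?t" | j where "j \<ge> 1" "b \<in> ?w j" using b B(2) unfolding S_def by auto
    then show ?thesis
    proof cases
      case 1
      then show ?thesis using B(4) xy(3) unfolding S_def by auto
    next
      case 2
      have "bracket x b = (-2) *s x" using 2 bracket_anti[of x ?t] root_spaceD[OF xy(1) tH] t by simp
      then show ?thesis using B(1) by (auto intro: span_scale span_base span_neg)
    next
      case 3
      have "bracket x b \<in> ?w (j + 1)"
        by (rule weq[OF root_space_bracket[OF xw 3(2)]]) (simp add: algebra_simps)
      then have "bracket x b \<in> S" using 3(1) unfolding S_def by (intro UnI2 UN_I[of "j + 1"]) auto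
      then show ?thesis using B(4) by blast
    qed
  qed
  have dn: "bracket y b \<in> span B" if b: "b \<in> B" for b
  proof -
    consider "b = y" | "b = ?t" | "b \<in> ?w 1" | j where "j \<ge> 2" "b \<in> ?w j"
    proof -
      consider "b = y" | "b = ?t" | j where "j \<ge> 1" "b \<in> ?w j" using b B(2) unfolding S_def by auto
      then show thesis
      proof cases
        case (3 j)
        then have "j = 1 \<or> j \<ge> 2" by auto
        with 3 show thesis using that by blast
      qed (use that in blast)+
    qed
    then show ?thesis
    proof cases
      case 1
      then show ?thesis by (simp add: bracket_self span_zero)
    next
      case 2
      have "bracket y b = 2 *s y" using 2 bracket_anti[of y ?t] root_spaceD[OF xy(2) tH] t tH by simp
      then show ?thesis using B(4) unfolding S_def by (auto intro: span_scale)
    next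
      case 3
      \<comment> \<open>Lowering a vector of weight \<alpha> lands on the coline, which the coroot
        spans; so the span stays stable although H enters \<open>S\<close> only through the
        coroot.\<close>
      then have "bracket b y \<in> coline \<alpha>" unfolding coline_def using xy(2) by (intro span_base) auto
      then have u: "bracket y b \<in> coline \<alpha>"
        using bracket_anti[of y b] span_neg unfolding coline_def by auto
      let ?c = "\<alpha> (bracket y b) / 2"
      have tc: "?t \<in> coline \<alpha>" using coroot[OF \<alpha>] by metis
      have "bracket y b - ?c *s ?t = 0"
      proof (rule coline_zero[OF \<alpha>d])
        show "bracket y b - ?c *s ?t \<in> coline \<alpha>" using u tc unfolding coline_def by (intro span_diff span_scale)
        show "\<alpha> (bracket y b - ?c *s ?t) = 0"
          using subsetD[OF coline_H u] tH t by (simp add: dual_diff[OF \<alpha>d] dual_scale[OF \<alpha>d] H_scale)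
      qed
      then have "bracket y b = ?c *s ?t" by simp
      moreover have "?t \<in> span B" using B(4) unfolding S_def by auto
      ultimately show ?thesis using span_scale by metis
    next
      case (4 j)
      have "bracket y b \<in> ?w (j - 1)"
        by (rule weq[OF root_space_bracket[OF yw 4(2)]]) (simp add: algebra_simps)
      then have "bracket y b \<in> S" using 4(1) unfolding S_def by (intro UnI2 UN_I[of "j - 1"]) auto
      then show ?thesis using B(4) by blast
    qed
  qed
  have "\<forall>b\<in>B. \<exists>j::int. b \<in> ?w j \<and> (b \<noteq> y \<longrightarrow> j \<ge> 0) \<and> j \<ge> -1 \<and> (b = x \<longrightarrow> j = 1) \<and> (b = z \<longrightarrow> j = int k)"
  proof
    fix b assume b: "b \<in> B"
    have uniq: "i = j" if "b \<in> ?w i" "b \<in> ?w j" for i j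
    proof -
      have "(of_int i * 2) *s b = (of_int j * 2) *s b"
        using root_spaceD[OF that(1) tH] root_spaceD[OF that(2) tH] unfolding t by (rule trans[OF sym])
      then have "(of_int i :: complex) = of_int j" using b 0 by auto
      then show ?thesis by simp
    qed
    have "\<exists>j. b \<in> ?w j \<and> (b \<noteq> y \<longrightarrow> j \<ge> 0) \<and> j \<ge> -1"
    proof -
      consider "b = y" | "b = ?t" | i where "i \<ge> 1" "b \<in> ?w i" using b B(2) unfolding S_def by auto
      then show ?thesis
      proof cases
        case 1
        then show ?thesis using yw by (intro exI[of _ "-1"]) simp
      next
        case 2
        then show ?thesis using tw by (intro exI[of _ 0]) simp
      next
        case (3 i)
        then show ?thesis by (intro exI[of _ i]) simp
      qed
    qed
    then show "\<exists>j::int. b \<in> ?w j \<and> (b \<noteq> y \<longrightarrow> j \<ge> 0) \<and> j \<ge> -1 \<and> (b = x \<longrightarrow> j = 1) \<and> (b = z \<longrightarrow> j = int k)"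
      using uniq xw zw by blast
  qed
  from bchoice[OF this] obtain j :: "'g \<Rightarrow> int" where j: "\<And>b. b \<in> B \<Longrightarrow> b \<in> ?w (j b)"
    "\<And>b. b \<in> B \<Longrightarrow> b \<noteq> y \<Longrightarrow> j b \<ge> 0" "\<And>b. b \<in> B \<Longrightarrow> j b \<ge> -1" "j x = 1" "j z = int k" using B(1) by auto
  have "tr B (bracket ?t) = tr B (\<lambda>v. bracket x (bracket y v)) - tr B (\<lambda>v. bracket y (bracket x v))"
    unfolding xy(3)[symmetric] ad_bracket
    by (rule tr_diff[OF B(3)]) (auto intro: span_stable[OF ad_linear] up dn)
  also have "\<dots> = 0" using tr_commute[OF B(3) fB ad_linear up ad_linear dn] by simp
  finally have "0 = tr B (bracket ?t)" by simp
  also have "\<dots> = (\<Sum>b\<in>B. of_int (j b) * 2)"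
    by (rule tr_diagonal[OF B(3)]) (use root_spaceD[OF j(1) tH] t in simp)
  also have "\<dots> = of_int ((\<Sum>b\<in>B. j b) * 2)" by (simp add: sum_distrib_right)
  finally have "(\<Sum>b\<in>B. j b) = 0" by (metis of_int_eq_0_iff mult_eq_0_iff zero_neq_numeral)
  moreover have "x \<noteq> z" using j(4,5) k by auto
  then have "(\<Sum>b\<in>B. j b) = j x + (j z + (\<Sum>b\<in>B - {x} - {z}. j b))"
    using B(1) fB by (simp add: sum.remove[of B x] sum.remove[of "B - {x}" z])
  moreover have "(\<Sum>b\<in>B - {x} - {z}. j b) \<ge> (\<Sum>b\<in>B - {x} - {z}. if b = y then -1 else 0)"
    by (rule sum_mono) (use j in auto)
  moreover have "(\<Sum>b\<in>B - {x} - {z}. if b = y then -1 else 0) \<ge> (-1::int)"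
    using fB by (simp add: sum.delta)
  ultimately show False using j(4,5) k by linarith
qed

end


context semisimple_with_cartan
begin

section \<open>The Weyl group as a finite group of linear bijections of H that permutes the
  roots\<close>

section \<open>Reflections and the Weyl group\<close>

abbreviation GH ("\<G>") where "\<G> \<equiv> BijGroup H"

lemma group_GH: "group \<G>" by (rule group_BijGroup)

lemma carrier_GH: "carrier \<G> = Bij H" by (simp add: BijGroup_def)

lemma Bij_closed: "v \<in> Bij H \<Longrightarrow> w \<in> Bij H \<Longrightarrow> v \<otimes>\<^bsub>\<G>\<^esub> w \<in> Bij H"
  and Bij_one: "\<one>\<^bsub>\<G>\<^esub> \<in> Bij H" and Bij_inv: "w \<in> Bij H \<Longrightarrow> inv\<^bsub>\<G>\<^esub> w \<in> Bij H"
  using group.is_monoid[OF group_GH] group.inv_closed[OF group_GH, of w]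
  by (auto simp: carrier_GH[symmetric] intro: monoid.m_closed monoid.one_closed)

lemma Bij_assoc: "u \<in> Bij H \<Longrightarrow> v \<in> Bij H \<Longrightarrow> w \<in> Bij H
    \<Longrightarrow> (u \<otimes>\<^bsub>\<G>\<^esub> v) \<otimes>\<^bsub>\<G>\<^esub> w = u \<otimes>\<^bsub>\<G>\<^esub> (v \<otimes>\<^bsub>\<G>\<^esub> w)"
  using monoid.m_assoc[OF group.is_monoid[OF group_GH]] by (simp add: carrier_GH)

lemma Bij_l_one: "w \<in> Bij H \<Longrightarrow> \<one>\<^bsub>\<G>\<^esub> \<otimes>\<^bsub>\<G>\<^esub> w = w" and Bij_r_one: "w \<in> Bij H \<Longrightarrow> w \<otimes>\<^bsub>\<G>\<^esub> \<one>\<^bsub>\<G>\<^esub> = w"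
  and Bij_l_inv: "w \<in> Bij H \<Longrightarrow> inv\<^bsub>\<G>\<^esub> w \<otimes>\<^bsub>\<G>\<^esub> w = \<one>\<^bsub>\<G>\<^esub>" and Bij_r_inv: "w \<in> Bij H \<Longrightarrow> w \<otimes>\<^bsub>\<G>\<^esub> inv\<^bsub>\<G>\<^esub> w = \<one>\<^bsub>\<G>\<^esub>"
  and Bij_inv_inv: "w \<in> Bij H \<Longrightarrow> inv\<^bsub>\<G>\<^esub> (inv\<^bsub>\<G>\<^esub> w) = w"
  and Bij_inv_mult: "v \<in> Bij H \<Longrightarrow> w \<in> Bij H \<Longrightarrow> inv\<^bsub>\<G>\<^esub> (v \<otimes>\<^bsub>\<G>\<^esub> w) = inv\<^bsub>\<G>\<^esub> w \<otimes>\<^bsub>\<G>\<^esub> inv\<^bsub>\<G>\<^esub> v"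
  using group.l_inv[OF group_GH] group.r_inv[OF group_GH] group.inv_inv[OF group_GH]
    group.inv_mult_group[OF group_GH] monoid.l_one[OF group.is_monoid[OF group_GH]]
    monoid.r_one[OF group.is_monoid[OF group_GH]]
  by (auto simp: carrier_GH)

lemma Bij_app: "w \<in> Bij H \<Longrightarrow> x \<in> H \<Longrightarrow> w x \<in> H"
  using Bij_imp_funcset by blast

lemma mult_app: "v \<in> Bij H \<Longrightarrow> w \<in> Bij H \<Longrightarrow> x \<in> H \<Longrightarrow> (v \<otimes>\<^bsub>\<G>\<^esub> w) x = v (w x)"
  by (simp add: BijGroup_def compose_def)

lemma one_app: "x \<in> H \<Longrightarrow> \<one>\<^bsub>\<G>\<^esub> x = x"
  by (simp add: BijGroup_def)

lemma inv_app: "w \<in> Bij H \<Longrightarrow> x \<in> H \<Longrightarrow> (inv\<^bsub>\<G>\<^esub> w) (w x) = x"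
  and app_inv: "w \<in> Bij H \<Longrightarrow> x \<in> H \<Longrightarrow> w ((inv\<^bsub>\<G>\<^esub> w) x) = x"
  using mult_app[of "inv\<^bsub>\<G>\<^esub> w" w x] mult_app[of w "inv\<^bsub>\<G>\<^esub> w" x] Bij_inv[of w]
  by (simp_all add: Bij_l_inv Bij_r_inv one_app)

lemma Bij_eqI: "v \<in> Bij H \<Longrightarrow> w \<in> Bij H \<Longrightarrow> (\<And>x. x \<in> H \<Longrightarrow> v x = w x) \<Longrightarrow> v = w"
  using Bij_imp_extensional by (metis extensionalityI)

lemma act_app: "x \<in> H \<Longrightarrow> act w f x = f ((inv\<^bsub>\<G>\<^esub> w) x)"
  by (simp add: act_def)

lemma act_ext: "act w f \<in> extensional H" by (simp add: act_def)

lemma act_mult: "v \<in> Bij H \<Longrightarrow> w \<in> Bij H \<Longrightarrow> act (v \<otimes>\<^bsub>\<G>\<^esub> w) f = act v (act w f)"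
  by (rule extensionalityI[OF act_ext act_ext]) (simp add: act_app Bij_inv_mult mult_app Bij_inv Bij_app)

lemma act_one: "f \<in> extensional H \<Longrightarrow> act \<one>\<^bsub>\<G>\<^esub> f = f"
  using group_GH by (intro extensionalityI[OF act_ext]) (auto simp: act_app one_app group.is_monoid monoid.inv_one)

lemma act_inv_act: "w \<in> Bij H \<Longrightarrow> f \<in> extensional H \<Longrightarrow> act (inv\<^bsub>\<G>\<^esub> w) (act w f) = f"
  by (simp add: act_mult[symmetric] Bij_inv Bij_l_inv act_one)

lemma reflection_app: "x \<in> H \<Longrightarrow> reflection \<alpha> x = x - \<alpha> x *s coroot \<alpha>"
  by (simp add: reflection_def)

lemma reflection_involution:
  assumes "\<alpha> \<in> roots" "x \<in> H"
  shows "reflection \<alpha> x \<in> H" "reflection \<alpha> (reflection \<alpha> x) = x"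
proof -
  show 1: "reflection \<alpha> x \<in> H"
    using assms by (simp add: reflection_app H_diff H_scale coroot_H)
  have "\<alpha> (reflection \<alpha> x) = - \<alpha> x"
    using assms by (simp add: reflection_app dual_diff dual_scale roots_dual H_scale coroot_H root_coroot)
  then show "reflection \<alpha> (reflection \<alpha> x) = x"
    using 1 assms(2) by (simp add: reflection_app)
qed

lemma reflection_Bij: "\<alpha> \<in> roots \<Longrightarrow> reflection \<alpha> \<in> Bij H"
  using reflection_involution
  by (auto simp: Bij_def reflection_def intro!: bij_betw_byWitness[where f' = "reflection \<alpha>"])

lemma reflection_square: "\<alpha> \<in> roots \<Longrightarrow> reflection \<alpha> \<otimes>\<^bsub>\<G>\<^esub> reflection \<alpha> = \<one>\<^bsub>\<G>\<^esub>"
  by (rule Bij_eqI) (auto simp: Bij_closed Bij_one reflection_Bij mult_app one_app reflection_involution)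

lemma inv_reflection: "\<alpha> \<in> roots \<Longrightarrow> inv\<^bsub>\<G>\<^esub> (reflection \<alpha>) = reflection \<alpha>"
  by (rule group.inv_equality[OF group_GH]) (auto simp: carrier_GH reflection_Bij reflection_square)

lemma act_reflection_app: "\<alpha> \<in> roots \<Longrightarrow> x \<in> H \<Longrightarrow> act (reflection \<alpha>) f x = f (reflection \<alpha> x)"
  by (simp add: act_app inv_reflection)

lemma act_reflection_dual: "\<alpha> \<in> roots \<Longrightarrow> \<phi> \<in> dual
    \<Longrightarrow> act (reflection \<alpha>) \<phi> = (\<lambda>x\<in>H. \<phi> x - \<phi> (coroot \<alpha>) * \<alpha> x)"
  by (rule extensionalityI[OF act_ext])
    (auto simp: act_reflection_app reflection_app dual_diff dual_scale H_scale coroot_H)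

lemma act_reflection_self: "\<alpha> \<in> roots \<Longrightarrow> act (reflection \<alpha>) \<alpha> = neg_root \<alpha>"
  by (simp add: act_reflection_dual roots_dual root_coroot cong: restrict_cong)

lemma act_reflection_root: "\<alpha> \<in> roots \<Longrightarrow> \<beta> \<in> roots \<Longrightarrow> act (reflection \<alpha>) \<beta> \<in> roots"
  by (simp add: act_reflection_dual roots_dual reflected_root)

lemma neg_root_root: "\<alpha> \<in> roots \<Longrightarrow> neg_root \<alpha> \<in> roots"
  using act_reflection_root[of \<alpha> \<alpha>] by (simp add: act_reflection_self)

lemma act_neg: "w \<in> Bij H \<Longrightarrow> act w (neg_root f) = neg_root (act w f)"
  by (rule extensionalityI[OF act_ext]) (auto simp: act_app Bij_app Bij_inv)

lemma neg_neg: "f \<in> extensional H \<Longrightarrow> neg_root (neg_root f) = f"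
  by (rule extensionalityI) auto

definition lin :: "('g \<Rightarrow> 'g) \<Rightarrow> bool" where
  "lin w \<longleftrightarrow> (\<forall>x\<in>H. \<forall>y\<in>H. w (x + y) = w x + w y) \<and> (\<forall>a. \<forall>x\<in>H. w (a *s x) = a *s w x)"

lemma lin_mult: "v \<in> Bij H \<Longrightarrow> w \<in> Bij H \<Longrightarrow> lin v \<Longrightarrow> lin w \<Longrightarrow> lin (v \<otimes>\<^bsub>\<G>\<^esub> w)"
  by (simp add: lin_def mult_app H_add H_scale Bij_app)

lemma lin_reflection: "\<alpha> \<in> roots \<Longrightarrow> lin (reflection \<alpha>)"
  by (simp add: lin_def reflection_app H_add H_scale dual_add dual_scale roots_dual scale_left_distrib
      scale_right_diff_distrib)

text \<open>Reflections are involutions, so the inverse generators in \<open>generate\<close> add no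
  case.\<close>

lemma weyl_induct [consumes 1, case_names one step]:
  assumes "w \<in> weyl_group" "P \<one>\<^bsub>\<G>\<^esub>"
    "\<And>u v. u \<in> weyl_group \<Longrightarrow> v \<in> weyl_group \<Longrightarrow> P u \<Longrightarrow> P v \<Longrightarrow> P (u \<otimes>\<^bsub>\<G>\<^esub> v)"
    "\<And>\<alpha>. \<alpha> \<in> roots \<Longrightarrow> P (reflection \<alpha>)"
  shows "P w"
  using assms(1) unfolding weyl_group_def
proof (induct rule: generate.induct)
  case (inv h)
  then show ?case using assms(4) inv_reflection by auto
next
  case (eng u v)
  then show ?case using assms(3) unfolding weyl_group_def by blast
qed (use assms in auto)

lemma weyl_Bij: "w \<in> weyl_group \<Longrightarrow> w \<in> Bij H"
  by (induct rule: weyl_induct) (auto simp: Bij_one Bij_closed reflection_Bij)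

lemma weyl_one: "\<one>\<^bsub>\<G>\<^esub> \<in> weyl_group" and weyl_reflection: "\<alpha> \<in> roots \<Longrightarrow> reflection \<alpha> \<in> weyl_group"
  and weyl_mult: "v \<in> weyl_group \<Longrightarrow> w \<in> weyl_group \<Longrightarrow> v \<otimes>\<^bsub>\<G>\<^esub> w \<in> weyl_group"
  unfolding weyl_group_def by (auto intro: generate.intros)

lemma weyl_inv: "w \<in> weyl_group \<Longrightarrow> inv\<^bsub>\<G>\<^esub> w \<in> weyl_group"
  unfolding weyl_group_def using reflection_Bij
  by (intro group.generate_m_inv_closed[OF group_GH]) (auto simp: carrier_GH)

lemma weyl_lin: "w \<in> weyl_group \<Longrightarrow> lin w"
proof (induct rule: weyl_induct)
  case one
  show ?case by (simp add: lin_def one_app H_add H_scale)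
qed (auto simp: lin_mult weyl_Bij lin_reflection)

lemma weyl_add: "w \<in> weyl_group \<Longrightarrow> x \<in> H \<Longrightarrow> y \<in> H \<Longrightarrow> w (x + y) = w x + w y"
  and weyl_scale: "w \<in> weyl_group \<Longrightarrow> x \<in> H \<Longrightarrow> w (a *s x) = a *s w x"
  using weyl_lin by (auto simp: lin_def)

lemma act_root: "w \<in> weyl_group \<Longrightarrow> \<beta> \<in> roots \<Longrightarrow> act w \<beta> \<in> roots"
proof (induct arbitrary: \<beta> rule: weyl_induct)
  case one
  then show ?case using act_one dual_ext roots_dual by simp
qed (auto simp: act_mult weyl_Bij act_reflection_root)

lemma act_dual: "w \<in> weyl_group \<Longrightarrow> \<phi> \<in> dual \<Longrightarrow> act w \<phi> \<in> dual"
  using weyl_inv[of w] weyl_Bij[of "inv\<^bsub>\<G>\<^esub> w"] Bij_app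
  by (intro dualI act_ext) (auto simp: act_app H_add H_scale weyl_add weyl_scale dual_add dual_scale)

lemma roots_separate: "x \<in> H \<Longrightarrow> (\<And>\<beta>. \<beta> \<in> roots \<Longrightarrow> \<beta> x = 0) \<Longrightarrow> x = 0"
proof (rule H_acts_zero)
  fix \<nu> assume x: "x \<in> H" and z: "\<And>\<beta>. \<beta> \<in> roots \<Longrightarrow> \<beta> x = 0" and "\<nu> \<in> weights"
  then show "\<nu> x = 0" using z[of \<nu>] by (cases "\<nu> = (\<lambda>x\<in>H. 0)") (auto simp: roots_eq)
qed

lemma act_trivial:
  assumes w: "w \<in> weyl_group" and f: "\<And>\<beta>. \<beta> \<in> roots \<Longrightarrow> act w \<beta> = \<beta>"
  shows "w = \<one>\<^bsub>\<G>\<^esub>"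
proof -
  note wB = weyl_Bij[OF w]
  have "w x = x" if x: "x \<in> H" for x
  proof -
    have wx: "w x \<in> H" using wB x by (rule Bij_app)
    have "\<beta> (w x - x) = 0" if b: "\<beta> \<in> roots" for \<beta>
    proof -
      have "\<beta> (w x) = act w \<beta> (w x)" using f[OF b] by simp
      also have "\<dots> = \<beta> x" using x wx wB by (simp add: act_app inv_app)
      finally show ?thesis using dual_diff[OF roots_dual[OF b] wx x] by simp
    qed
    then have "w x - x = 0" using wx x by (intro roots_separate H_diff)
    then show ?thesis by simp
  qed
  then show ?thesis using wB by (intro Bij_eqI) (auto simp: Bij_one one_app)
qed

text \<open>The action on the finite set of roots is faithful, by
  \<open>act_trivial\<close>.\<close>

lemma finite_weyl: "finite weyl_group"
proof (rule inj_on_finite)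
  show "inj_on (\<lambda>w. restrict (act w) roots) weyl_group"
  proof (rule inj_onI)
    fix v w assume vw: "v \<in> weyl_group" "w \<in> weyl_group" "restrict (act v) roots = restrict (act w) roots"
    note B = weyl_Bij[OF vw(1)] weyl_Bij[OF vw(2)]
    have "inv\<^bsub>\<G>\<^esub> w \<otimes>\<^bsub>\<G>\<^esub> v = \<one>\<^bsub>\<G>\<^esub>"
    proof (rule act_trivial)
      fix \<beta> assume b: "\<beta> \<in> roots"
      have "act v \<beta> = act w \<beta>" using vw(3) b by (metis restrict_apply')
      then show "act (inv\<^bsub>\<G>\<^esub> w \<otimes>\<^bsub>\<G>\<^esub> v) \<beta> = \<beta>"
        using B b by (simp add: act_mult Bij_inv act_inv_act dual_ext roots_dual)
    qed (use vw in \<open>auto intro: weyl_mult weyl_inv\<close>)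
    then have "w \<otimes>\<^bsub>\<G>\<^esub> (inv\<^bsub>\<G>\<^esub> w \<otimes>\<^bsub>\<G>\<^esub> v) = w" using B by (simp add: Bij_r_one)
    then show "v = w" using B by (simp add: Bij_assoc[symmetric] Bij_inv Bij_r_inv Bij_l_one)
  qed
  show "(\<lambda>w. restrict (act w) roots) ` weyl_group \<subseteq> (\<Pi>\<^sub>E \<beta>\<in>roots. roots)"
    using act_root by auto
  show "finite (\<Pi>\<^sub>E \<beta>\<in>roots. roots)" using finite_roots by (intro finite_PiE) auto
qed

text \<open>Two reflections with the same root that permute the roots agree, since their product is
  unipotent of finite order.\<close>

lemma coroot_characterization:
  assumes \<beta>: "\<beta> \<in> roots" and t: "t \<in> H" "\<beta> t = 2"
    and st: "\<And>\<phi>. \<phi> \<in> roots \<Longrightarrow> (\<lambda>x\<in>H. \<phi> x - \<phi> t * \<beta> x) \<in> roots"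
  shows "t = coroot \<beta>"
proof -
  let ?c = "coroot \<beta>"
  have \<beta>c: "\<beta> ?c = 2" "?c \<in> H" using \<beta> by (simp_all add: root_coroot coroot_H)
  have "\<phi> (t - ?c) = 0" if \<phi>: "\<phi> \<in> roots" for \<phi>
  proof (rule ccontr)
    assume ne: "\<phi> (t - ?c) \<noteq> 0"
    let ?d = "\<phi> t - \<phi> ?c"
    have d: "?d \<noteq> 0" using ne t \<beta>c dual_diff[OF roots_dual[OF \<phi>]] by simp
    \<comment> \<open>The composite of the two reflections adds \<open>?d\<close> times \<beta> at
      each application, so a nonzero \<open>?d\<close> would produce infinitely many roots.\<close>
    have k: "(\<lambda>x\<in>H. \<phi> x + of_nat k * ?d * \<beta> x) \<in> roots" (is "?f k \<in> roots") for k
    proof (induction k)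
      case 0
      have "?f 0 = restrict \<phi> H" by (rule restrict_ext) simp
      also have "\<dots> = \<phi>" by (rule extensional_restrict[OF dual_ext[OF roots_dual[OF \<phi>]]])
      finally have "?f 0 = \<phi>" .
      then show ?case using \<phi> by simp
    next
      case (Suc k)
      have 1: "(\<lambda>x\<in>H. ?f k x - ?f k t * \<beta> x) \<in> roots" (is "?g \<in> _") by (rule st[OF Suc])
      have "(\<lambda>x\<in>H. ?g x - ?g ?c * \<beta> x) \<in> roots" by (rule reflected_root[OF \<beta> 1])
      also have "(\<lambda>x\<in>H. ?g x - ?g ?c * \<beta> x) = ?f (Suc k)"
        by (rule restrict_ext) (use t \<beta>c in \<open>simp add: algebra_simps\<close>)
      finally show ?case .
    qed
    have "inj ?f"
    proof (rule injI)
      fix k l assume "?f k = ?f l"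
      then have "?f k t = ?f l t" by metis
      then show "k = l" using d t by simp
    qed
    then have "finite (UNIV :: nat set)"
      using finite_imageD[OF finite_subset[OF _ finite_roots], of ?f UNIV] k by blast
    then show False by simp
  qed
  then have "t - ?c = 0" using t \<beta>c by (intro roots_separate H_diff)
  then show ?thesis by simp
qed

text \<open>The image of the coroot under w takes the value 2 on w\<alpha>, and its reflection
  permutes the roots because w does; \<open>coroot_characterization\<close> identifies it as the
  coroot of w\<alpha>.\<close>

lemma reflection_conjugate:
  assumes w: "w \<in> weyl_group" and \<alpha>: "\<alpha> \<in> roots"
  shows "w \<otimes>\<^bsub>\<G>\<^esub> reflection \<alpha> = reflection (act w \<alpha>) \<otimes>\<^bsub>\<G>\<^esub> w"
proof -
  note wB = weyl_Bij[OF w]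
  have \<beta>: "act w \<alpha> \<in> roots" using w \<alpha> by (rule act_root)
  have tH: "w (coroot \<alpha>) \<in> H" using wB coroot_H[OF \<alpha>] by (rule Bij_app)
  have "w (coroot \<alpha>) = coroot (act w \<alpha>)"
  proof (rule coroot_characterization[OF \<beta> tH])
    show "act w \<alpha> (w (coroot \<alpha>)) = 2"
      using tH wB coroot_H[OF \<alpha>] root_coroot[OF \<alpha>] by (simp add: act_app inv_app)
    fix \<phi> assume \<phi>: "\<phi> \<in> roots"
    let ?\<psi> = "act (inv\<^bsub>\<G>\<^esub> w) \<phi>"
    have \<psi>: "?\<psi> \<in> roots" using weyl_inv[OF w] \<phi> by (rule act_root)
    have \<psi>a: "?\<psi> x = \<phi> (w x)" if "x \<in> H" for x using that wB by (simp add: act_app Bij_inv_inv)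
    have "act w (act (reflection \<alpha>) ?\<psi>) \<in> roots"
      by (rule act_root[OF w act_root[OF weyl_reflection[OF \<alpha>] \<psi>]])
    also have "act w (act (reflection \<alpha>) ?\<psi>) = (\<lambda>x\<in>H. \<phi> x - \<phi> (w (coroot \<alpha>)) * act w \<alpha> x)"
      unfolding act_reflection_dual[OF \<alpha> roots_dual[OF \<psi>]]
      by (rule extensionalityI[OF act_ext])
        (auto simp: act_app[of _ w] Bij_app Bij_inv wB \<psi>a coroot_H \<alpha> app_inv)
    finally show "(\<lambda>x\<in>H. \<phi> x - \<phi> (w (coroot \<alpha>)) * act w \<alpha> x) \<in> roots" .
  qed
  then have c: "coroot (act w \<alpha>) = w (coroot \<alpha>)" by simp
  show ?thesis
  proof (rule Bij_eqI)
    fix x assume x: "x \<in> H"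
    have wx: "w x \<in> H" using wB x by (rule Bij_app)
    have "w (x - \<alpha> x *s coroot \<alpha>) = w (x + (- \<alpha> x) *s coroot \<alpha>)" by simp
    also have "\<dots> = w x + (- \<alpha> x) *s w (coroot \<alpha>)"
      using w x coroot_H[OF \<alpha>] by (simp only: weyl_add weyl_scale H_scale)
    finally show "(w \<otimes>\<^bsub>\<G>\<^esub> reflection \<alpha>) x = (reflection (act w \<alpha>) \<otimes>\<^bsub>\<G>\<^esub> w) x"
      using x wx wB \<alpha> \<beta> by (simp add: mult_app reflection_Bij reflection_app c act_app inv_app)
  qed (use wB \<alpha> \<beta> in \<open>auto intro: Bij_closed reflection_Bij\<close>)
qed

end

context semisimple_with_simple_roots
begin

section \<open>Coxeter combinatorics of the simple reflections: inversions, exchange, longest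
  element\<close>

section \<open>Length and inversions\<close>

lemma neg_flip: "- a = b \<Longrightarrow> a = - (b::complex)"
  by auto

lemma simples_roots: "simples \<subseteq> roots"
  using simple by (simp add: simple_system_def)

lemma simple_root: "\<alpha> \<in> simples \<Longrightarrow> \<alpha> \<in> roots"
  using simples_roots by blast

lemma finite_simples: "finite simples"
  using simples_roots finite_roots finite_subset by blast

lemma simple_coefficients_unique:
  assumes "\<And>x. x \<in> H \<Longrightarrow> (\<Sum>\<beta>\<in>simples. a \<beta> * \<beta> x) = (\<Sum>\<beta>\<in>simples. b \<beta> * \<beta> x)" "\<beta> \<in> simples"
  shows "a \<beta> = b \<beta>"
proof -
  let ?\<phi> = "\<lambda>x\<in>H. \<Sum>\<beta>\<in>simples. a \<beta> * \<beta> x"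
  have \<phi>: "?\<phi> \<in> dual"
    by (rule dualI) (auto simp: H_add H_scale dual_add dual_scale roots_dual simple_root
        sum.distrib[symmetric] sum_distrib_left algebra_simps intro!: sum.cong)
  have "\<exists>!c. c \<in> simples \<rightarrow>\<^sub>E UNIV \<and> ?\<phi> = (\<lambda>x\<in>H. \<Sum>\<beta>\<in>simples. c \<beta> * \<beta> x)"
    using simple \<phi> unfolding simple_system_def by blast
  moreover have "restrict a simples \<in> simples \<rightarrow>\<^sub>E UNIV \<and> ?\<phi> = (\<lambda>x\<in>H. \<Sum>\<beta>\<in>simples. restrict a simples \<beta> * \<beta> x)"
    by (auto cong: sum.cong)
  moreover have "restrict b simples \<in> simples \<rightarrow>\<^sub>E UNIV \<and> ?\<phi> = (\<lambda>x\<in>H. \<Sum>\<beta>\<in>simples. restrict b simples \<beta> * \<beta> x)"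
    by (auto simp: assms(1) cong: restrict_cong sum.cong)
  ultimately have "restrict a simples = restrict b simples" by blast
  then show ?thesis using assms(2) by (metis restrict_apply')
qed

lemma positive_root: "\<beta> \<in> positive_roots \<Longrightarrow> \<beta> \<in> roots"
  by (simp add: positive_roots_def)

lemma finite_positive: "finite positive_roots"
  using finite_roots finite_subset[of positive_roots roots] positive_root by blast

lemma positive_coefficients:
  assumes "\<beta> \<in> positive_roots"
  obtains n :: "('g \<Rightarrow> complex) \<Rightarrow> nat" where "\<And>x. x \<in> H \<Longrightarrow> \<beta> x = (\<Sum>\<delta>\<in>simples. of_nat (n \<delta>) * \<delta> x)"
  using assms unfolding positive_roots_def by force

lemma positive_coefficients_ex: "\<beta> \<in> positive_roots
    \<Longrightarrow> \<exists>n::('g \<Rightarrow> complex) \<Rightarrow> nat. \<forall>x\<in>H. \<beta> x = (\<Sum>\<delta>\<in>simples. of_nat (n \<delta>) * \<delta> x)"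
  by (erule positive_coefficients) blast

lemma positive_or_negative: "\<beta> \<in> roots \<Longrightarrow> \<beta> \<in> positive_roots \<or> neg_root \<beta> \<in> positive_roots"
proof -
  assume \<beta>: "\<beta> \<in> roots"
  then obtain n :: "('g \<Rightarrow> complex) \<Rightarrow> nat" where
    "\<beta> = (\<lambda>x\<in>H. \<Sum>\<delta>\<in>simples. of_nat (n \<delta>) * \<delta> x) \<or> \<beta> = (\<lambda>x\<in>H. - (\<Sum>\<delta>\<in>simples. of_nat (n \<delta>) * \<delta> x))"
    using simple unfolding simple_system_def by blast
  then show ?thesis
  proof
    assume b: "\<beta> = (\<lambda>x\<in>H. - (\<Sum>\<delta>\<in>simples. of_nat (n \<delta>) * \<delta> x))"
    have "neg_root \<beta> = (\<lambda>x\<in>H. \<Sum>\<delta>\<in>simples. of_nat (n \<delta>) * \<delta> x)"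
      by (rule restrict_ext) (simp add: b)
    then show ?thesis using neg_root_root[OF \<beta>] unfolding positive_roots_def by blast
  qed (use \<beta> positive_roots_def in blast)
qed

lemma positive_not_negative:
  assumes "\<beta> \<in> positive_roots" shows "neg_root \<beta> \<notin> positive_roots"
proof
  assume n: "neg_root \<beta> \<in> positive_roots"
  obtain a :: "('g \<Rightarrow> complex) \<Rightarrow> nat" where a: "\<And>x. x \<in> H \<Longrightarrow> \<beta> x = (\<Sum>\<delta>\<in>simples. of_nat (a \<delta>) * \<delta> x)"
    using positive_coefficients[OF assms] by metis
  obtain b :: "('g \<Rightarrow> complex) \<Rightarrow> nat" where b: "\<And>x. x \<in> H \<Longrightarrow> neg_root \<beta> x = (\<Sum>\<delta>\<in>simples. of_nat (b \<delta>) * \<delta> x)"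
    using positive_coefficients[OF n] by metis
  have "(of_nat (a \<delta>) :: complex) = - of_nat (b \<delta>)" if "\<delta> \<in> simples" for \<delta>
  proof (rule simple_coefficients_unique[OF _ that])
    fix x assume x: "x \<in> H"
    show "(\<Sum>\<beta>\<in>simples. of_nat (a \<beta>) * \<beta> x) = (\<Sum>\<beta>\<in>simples. - of_nat (b \<beta>) * \<beta> x)"
    proof -
      have "\<beta> x = - (\<Sum>\<beta>\<in>simples. of_nat (b \<beta>) * \<beta> x)" by (rule neg_flip) (use b[OF x] x in simp)
      then show ?thesis using a[OF x] by (simp add: sum_negf)
    qed
  qed
  then have "of_nat (a \<delta> + b \<delta>) = (0::complex)" if "\<delta> \<in> simples" for \<delta> using that by simp
  then have "a \<delta> = 0" if "\<delta> \<in> simples" for \<delta> using that by (metis add_is_0 of_nat_eq_0_iff)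
  then have "\<beta> x = 0" if "x \<in> H" for x using a[OF that] by simp
  then show False using root_nonzero[OF positive_root[OF assms]] by blast
qed

lemma negative_iff: "\<beta> \<in> roots \<Longrightarrow> neg_root \<beta> \<in> positive_roots \<longleftrightarrow> \<beta> \<notin> positive_roots"
  using positive_or_negative positive_not_negative by blast

lemma simple_positive: "\<alpha> \<in> simples \<Longrightarrow> \<alpha> \<in> positive_roots"
proof -
  assume \<alpha>: "\<alpha> \<in> simples"
  have "\<alpha> = (\<lambda>x\<in>H. \<Sum>\<delta>\<in>simples. of_nat (if \<delta> = \<alpha> then 1 else 0) * \<delta> x)"
  proof (rule extensionalityI)
    show "\<alpha> x = (\<lambda>x\<in>H. \<Sum>\<delta>\<in>simples. of_nat (if \<delta> = \<alpha> then 1 else 0) * \<delta> x) x" if "x \<in> H" for x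
      using \<alpha> finite_simples that by (simp add: if_distrib[of of_nat] if_distrib[of "\<lambda>c. c * _"] sum.delta cong: if_cong)
  qed (use \<alpha> dual_ext roots_dual simple_root in auto)
  then show ?thesis unfolding positive_roots_def using simple_root[OF \<alpha>] by (auto intro!: exI)
qed

text \<open>The reflection changes only the coefficient of \<alpha>. If the image were negative, all
  other coefficients of \<beta> would vanish and \<beta> would be a multiple of \<alpha>, which
  \<open>multiple_not_root\<close> excludes.\<close>

lemma simple_permutes:
  assumes \<alpha>: "\<alpha> \<in> simples" and \<beta>: "\<beta> \<in> positive_roots" "\<beta> \<noteq> \<alpha>"
  shows "act (reflection \<alpha>) \<beta> \<in> positive_roots"
proof (rule ccontr)
  let ?\<gamma> = "act (reflection \<alpha>) \<beta>"
  note r = simple_root[OF \<alpha>] positive_root[OF \<beta>(1)]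
  assume "?\<gamma> \<notin> positive_roots"
  then have n: "neg_root ?\<gamma> \<in> positive_roots" using negative_iff act_reflection_root r by blast
  obtain a :: "('g \<Rightarrow> complex) \<Rightarrow> nat" where a: "\<And>x. x \<in> H \<Longrightarrow> \<beta> x = (\<Sum>\<delta>\<in>simples. of_nat (a \<delta>) * \<delta> x)"
    using positive_coefficients[OF \<beta>(1)] by metis
  obtain b :: "('g \<Rightarrow> complex) \<Rightarrow> nat" where b: "\<And>x. x \<in> H \<Longrightarrow> neg_root ?\<gamma> x = (\<Sum>\<delta>\<in>simples. of_nat (b \<delta>) * \<delta> x)"
    using positive_coefficients[OF n] by metis
  let ?c = "\<beta> (coroot \<alpha>)"
  have "of_nat (a \<delta>) - (if \<delta> = \<alpha> then ?c else 0) = - of_nat (b \<delta>)" if "\<delta> \<in> simples" for \<delta>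
  proof (rule simple_coefficients_unique[OF _ that])
    fix x assume x: "x \<in> H"
    have "(\<Sum>\<delta>\<in>simples. (of_nat (a \<delta>) - (if \<delta> = \<alpha> then ?c else 0)) * \<delta> x)
       = \<beta> x - (\<Sum>\<delta>\<in>simples. if \<delta> = \<alpha> then ?c * \<delta> x else 0)"
      unfolding a[OF x] sum_subtractf[symmetric] by (rule sum.cong) (auto simp: algebra_simps)
    also have "\<dots> = ?\<gamma> x"
      using \<alpha> finite_simples x r by (simp add: sum.delta act_reflection_dual roots_dual)
    also have "?\<gamma> x = - (\<Sum>\<delta>\<in>simples. of_nat (b \<delta>) * \<delta> x)"
      by (rule neg_flip) (use b[OF x] x in simp)
    finally show "(\<Sum>\<delta>\<in>simples. (of_nat (a \<delta>) - (if \<delta> = \<alpha> then ?c else 0)) * \<delta> x) = (\<Sum>\<delta>\<in>simples. - of_nat (b \<delta>) * \<delta> x)"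
      by (simp add: sum_negf)
  qed
  note co = this
  have "of_nat (a \<delta> + b \<delta>) = (0::complex)" if "\<delta> \<in> simples - {\<alpha>}" for \<delta>
    using co[of \<delta>] that by (auto simp: eq_neg_iff_add_eq_0)
  then have "a \<delta> = 0" if "\<delta> \<in> simples - {\<alpha>}" for \<delta> using that by (metis add_is_0 of_nat_eq_0_iff)
  then have b\<alpha>: "\<beta> x = of_nat (a \<alpha>) * \<alpha> x" if "x \<in> H" for x
    using a[OF that] \<alpha> finite_simples by (simp add: sum.remove[of simples \<alpha>])
  have e: "\<beta> = (\<lambda>h\<in>H. of_nat (a \<alpha>) * \<alpha> h)"
    by (rule extensionalityI) (use b\<alpha> dual_ext[OF roots_dual[OF r(2)]] in auto)
  have "a \<alpha> \<noteq> 0" using root_nonzero[OF r(2)] b\<alpha> by auto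
  moreover have "a \<alpha> \<noteq> 1"
  proof
    assume "a \<alpha> = 1"
    then have "\<beta> = \<alpha>" using e by (intro extensionalityI[of \<beta> H]) (use b\<alpha> dual_ext roots_dual r in auto)
    then show False using \<beta>(2) by simp
  qed
  ultimately have "a \<alpha> \<ge> 2" by simp
  then show False using multiple_not_root[OF r(1), of "a \<alpha>"] e r(2) by metis
qed

lemma word_Nil: "word [] = \<one>\<^bsub>\<G>\<^esub>" and word_Cons: "word (\<alpha> # as) = reflection \<alpha> \<otimes>\<^bsub>\<G>\<^esub> word as"
  by (simp_all add: word_def)

lemma word_weyl: "set as \<subseteq> simples \<Longrightarrow> word as \<in> weyl_group"
  by (induction as) (auto simp: word_Nil word_Cons weyl_one intro!: weyl_mult weyl_reflection simple_root)

lemmas word_Bij = weyl_Bij[OF word_weyl]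
lemmas simple_reflection_Bij = reflection_Bij[OF simple_root]
lemmas simple_reflection_weyl = weyl_reflection[OF simple_root]

lemma word_append: "set as \<subseteq> simples \<Longrightarrow> set bs \<subseteq> simples \<Longrightarrow> word (as @ bs) = word as \<otimes>\<^bsub>\<G>\<^esub> word bs"
  by (induction as) (auto simp: word_Nil word_Cons Bij_l_one word_Bij Bij_assoc simple_reflection_Bij)

lemma word_snoc: "set as \<subseteq> simples \<Longrightarrow> \<alpha> \<in> simples \<Longrightarrow> word (as @ [\<alpha>]) = word as \<otimes>\<^bsub>\<G>\<^esub> reflection \<alpha>"
  by (simp add: word_append word_Nil word_Cons Bij_r_one simple_reflection_Bij)

lemma word_rev: "set as \<subseteq> simples \<Longrightarrow> word (rev as) = inv\<^bsub>\<G>\<^esub> (word as)"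
proof (induction as)
  case Nil
  show ?case by (simp add: word_Nil group.is_monoid[OF group_GH] monoid.inv_one)
next
  case (Cons \<alpha> as)
  then show ?case
    by (simp add: word_Cons word_snoc Bij_inv_mult simple_reflection_Bij word_Bij inv_reflection simple_root)
qed

definition inversions :: "('g \<Rightarrow> 'g) \<Rightarrow> ('g \<Rightarrow> complex) set" where
  "inversions w = {\<beta> \<in> positive_roots. act w \<beta> \<notin> positive_roots}"

lemma finite_inversions: "finite (inversions w)"
  using finite_positive by (simp add: inversions_def)

lemma right_cancel: "w \<in> Bij H \<Longrightarrow> \<alpha> \<in> simples \<Longrightarrow> (w \<otimes>\<^bsub>\<G>\<^esub> reflection \<alpha>) \<otimes>\<^bsub>\<G>\<^esub> reflection \<alpha> = w"
  by (simp add: Bij_assoc simple_reflection_Bij reflection_square simple_root Bij_r_one)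

lemma act_right_simple:
  "w \<in> weyl_group \<Longrightarrow> \<alpha> \<in> simples \<Longrightarrow> act (w \<otimes>\<^bsub>\<G>\<^esub> reflection \<alpha>) \<alpha> = neg_root (act w \<alpha>)"
  by (simp add: act_mult weyl_Bij simple_reflection_Bij act_reflection_self simple_root act_neg)

text \<open>With s the reflection of \<alpha>, the inversions of w s are \<alpha> itself and the
  images under s of the inversions of w.\<close>

lemma inversions_up:
  assumes w: "w \<in> weyl_group" and \<alpha>: "\<alpha> \<in> simples" and p: "act w \<alpha> \<in> positive_roots"
  shows "card (inversions (w \<otimes>\<^bsub>\<G>\<^esub> reflection \<alpha>)) = Suc (card (inversions w))"
proof -
  let ?s = "reflection \<alpha>"
  note B = weyl_Bij[OF w] simple_reflection_Bij[OF \<alpha>]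
  have ss: "act ?s (act ?s \<beta>) = \<beta>" if "\<beta> \<in> roots" for \<beta>
    using act_inv_act[OF B(2), of \<beta>] that by (simp add: inv_reflection simple_root \<alpha> dual_ext roots_dual)
  have ne: "act ?s \<beta> \<noteq> \<alpha>" if "\<beta> \<in> positive_roots" for \<beta>
    using that ss[OF positive_root[OF that]] act_reflection_self[OF simple_root[OF \<alpha>]]
      positive_not_negative[OF simple_positive[OF \<alpha>]] by metis
  have "inversions (w \<otimes>\<^bsub>\<G>\<^esub> ?s) = insert \<alpha> (act ?s ` inversions w)"
  proof (intro equalityI subsetI)
    fix \<beta> assume b: "\<beta> \<in> inversions (w \<otimes>\<^bsub>\<G>\<^esub> ?s)"
    then have bp: "\<beta> \<in> positive_roots" and bn: "act w (act ?s \<beta>) \<notin> positive_roots"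
      using B by (auto simp: inversions_def act_mult)
    show "\<beta> \<in> insert \<alpha> (act ?s ` inversions w)"
    proof (cases "\<beta> = \<alpha>")
      case False
      then have "act ?s \<beta> \<in> inversions w" using simple_permutes[OF \<alpha> bp] bn by (simp add: inversions_def)
      then show ?thesis using ss[OF positive_root[OF bp]] by (metis image_eqI insertCI)
    qed simp
  next
    fix \<beta> assume "\<beta> \<in> insert \<alpha> (act ?s ` inversions w)"
    then consider "\<beta> = \<alpha>" | \<gamma> where "\<gamma> \<in> inversions w" "\<beta> = act ?s \<gamma>" by blast
    then show "\<beta> \<in> inversions (w \<otimes>\<^bsub>\<G>\<^esub> ?s)"
    proof cases
      case 1
      then show ?thesis using act_right_simple[OF w \<alpha>] positive_not_negative[OF p] simple_positive[OF \<alpha>]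
        by (simp add: inversions_def)
    next
      case 2
      then have g: "\<gamma> \<in> positive_roots" "act w \<gamma> \<notin> positive_roots" by (auto simp: inversions_def)
      then have "\<gamma> \<noteq> \<alpha>" using p by blast
      then show ?thesis using 2(2) g simple_permutes[OF \<alpha> g(1)] B ss[OF positive_root[OF g(1)]]
        by (simp add: inversions_def act_mult)
    qed
  qed
  moreover have "\<alpha> \<notin> act ?s ` inversions w"
  proof
    assume "\<alpha> \<in> act ?s ` inversions w"
    then obtain \<gamma> where "\<gamma> \<in> positive_roots" "act ?s \<gamma> = \<alpha>" by (auto simp: inversions_def)
    then show False using ne by blast
  qed
  moreover have "inj_on (act ?s) (inversions w)"
    by (rule inj_on_inverseI[where g = "act ?s"]) (auto simp: inversions_def ss positive_root)
  ultimately show ?thesis using finite_inversions by (simp add: card_image)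
qed

lemma inversions_down:
  assumes w: "w \<in> weyl_group" and \<alpha>: "\<alpha> \<in> simples" and p: "act w \<alpha> \<notin> positive_roots"
  shows "card (inversions w) = Suc (card (inversions (w \<otimes>\<^bsub>\<G>\<^esub> reflection \<alpha>)))"
proof -
  have "act (w \<otimes>\<^bsub>\<G>\<^esub> reflection \<alpha>) \<alpha> \<in> positive_roots"
    using act_right_simple[OF w \<alpha>] negative_iff p act_root[OF w simple_root[OF \<alpha>]] by simp
  from inversions_up[OF weyl_mult[OF w simple_reflection_weyl[OF \<alpha>]] \<alpha> this]
  show ?thesis using right_cancel[OF weyl_Bij[OF w] \<alpha>] by simp
qed

lemma inversions_one: "inversions \<one>\<^bsub>\<G>\<^esub> = {}"
  by (auto simp: inversions_def act_one dual_ext roots_dual positive_root)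

lemma all_negative:
  assumes w: "w \<in> weyl_group" and n: "\<And>\<alpha>. \<alpha> \<in> simples \<Longrightarrow> act w \<alpha> \<notin> positive_roots"
    and \<beta>: "\<beta> \<in> positive_roots"
  shows "act w \<beta> \<notin> positive_roots"
proof
  assume p: "act w \<beta> \<in> positive_roots"
  obtain a :: "('g \<Rightarrow> complex) \<Rightarrow> nat" where a: "\<And>x. x \<in> H \<Longrightarrow> \<beta> x = (\<Sum>\<delta>\<in>simples. of_nat (a \<delta>) * \<delta> x)"
    using positive_coefficients[OF \<beta>] by metis
  obtain b :: "('g \<Rightarrow> complex) \<Rightarrow> nat" where b: "\<And>x. x \<in> H \<Longrightarrow> act w \<beta> x = (\<Sum>\<delta>\<in>simples. of_nat (b \<delta>) * \<delta> x)"
    using positive_coefficients[OF p] by metis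
  have "\<forall>\<delta>\<in>simples. \<exists>m::('g \<Rightarrow> complex) \<Rightarrow> nat. \<forall>x\<in>H. neg_root (act w \<delta>) x = (\<Sum>\<epsilon>\<in>simples. of_nat (m \<epsilon>) * \<epsilon> x)"
    using n negative_iff[OF act_root[OF w simple_root]] positive_coefficients_ex by blast
  from bchoice[OF this] obtain m :: "('g \<Rightarrow> complex) \<Rightarrow> ('g \<Rightarrow> complex) \<Rightarrow> nat"
    where m: "\<And>\<delta> x. \<delta> \<in> simples \<Longrightarrow> x \<in> H \<Longrightarrow> neg_root (act w \<delta>) x = (\<Sum>\<epsilon>\<in>simples. of_nat (m \<delta> \<epsilon>) * \<epsilon> x)" by blast
  have "(of_nat (b \<epsilon>) :: complex) = - of_nat (\<Sum>\<delta>\<in>simples. a \<delta> * m \<delta> \<epsilon>)" if "\<epsilon> \<in> simples" for \<epsilon>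
  proof (rule simple_coefficients_unique[OF _ that])
    fix x assume x: "x \<in> H"
    then have ix: "(inv\<^bsub>\<G>\<^esub> w) x \<in> H" using weyl_Bij[OF w] by (simp add: Bij_app Bij_inv)
    have d: "act w \<delta> x = - (\<Sum>\<epsilon>\<in>simples. of_nat (m \<delta> \<epsilon>) * \<epsilon> x)" if "\<delta> \<in> simples" for \<delta>
      by (rule neg_flip) (use m[OF that x] x in simp)
    have "(\<Sum>\<epsilon>\<in>simples. of_nat (b \<epsilon>) * \<epsilon> x) = act w \<beta> x" using b[OF x] by simp
    also have "\<dots> = (\<Sum>\<delta>\<in>simples. of_nat (a \<delta>) * act w \<delta> x)" using a[OF ix] x by (simp add: act_app)
    also have "\<dots> = (\<Sum>\<delta>\<in>simples. \<Sum>\<epsilon>\<in>simples. - (of_nat (a \<delta>) * (of_nat (m \<delta> \<epsilon>) * \<epsilon> x)))"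
      by (rule sum.cong) (auto simp: d sum_distrib_left sum_negf)
    also have "\<dots> = (\<Sum>\<epsilon>\<in>simples. \<Sum>\<delta>\<in>simples. - (of_nat (a \<delta>) * (of_nat (m \<delta> \<epsilon>) * \<epsilon> x)))"
      by (rule sum.swap)
    also have "\<dots> = (\<Sum>\<epsilon>\<in>simples. - of_nat (\<Sum>\<delta>\<in>simples. a \<delta> * m \<delta> \<epsilon>) * \<epsilon> x)"
      by (rule sum.cong) (auto simp: sum_distrib_right sum_negf mult.assoc)
    finally show "(\<Sum>\<epsilon>\<in>simples. of_nat (b \<epsilon>) * \<epsilon> x) = (\<Sum>\<epsilon>\<in>simples. - of_nat (\<Sum>\<delta>\<in>simples. a \<delta> * m \<delta> \<epsilon>) * \<epsilon> x)" .
  qed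
  then have "of_nat (b \<epsilon> + (\<Sum>\<delta>\<in>simples. a \<delta> * m \<delta> \<epsilon>)) = (0::complex)" if "\<epsilon> \<in> simples" for \<epsilon> using that by simp
  then have "b \<epsilon> = 0" if "\<epsilon> \<in> simples" for \<epsilon> using that by (metis add_is_0 of_nat_eq_0_iff)
  then have "act w \<beta> x = 0" if "x \<in> H" for x using b[OF that] by simp
  then show False using root_nonzero[OF positive_root[OF p]] by blast
qed

text \<open>As the letters act on \<alpha> from the right, the root turns negative at some letter
  \<beta>. Just before, it equals \<beta>, and \<open>reflection_conjugate\<close> cancels this
  letter against the appended reflection.\<close>

lemma exchange:
  assumes "set as \<subseteq> simples" "\<alpha> \<in> simples" "act (word as) \<alpha> \<notin> positive_roots"
  shows "\<exists>bs. Suc (length bs) = length as \<and> set bs \<subseteq> set as \<and> word bs = word as \<otimes>\<^bsub>\<G>\<^esub> reflection \<alpha>"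
  using assms
proof (induction as)
  case Nil
  then show ?case using simple_positive[of \<alpha>]
    by (simp add: word_Nil act_one dual_ext roots_dual simple_root)
next
  case (Cons \<beta> as)
  have b: "\<beta> \<in> simples" and as: "set as \<subseteq> simples" using Cons.prems by auto
  note B = simple_reflection_Bij[OF b] word_Bij[OF as] simple_reflection_Bij[OF Cons.prems(2)]
  show ?case
  proof (cases "act (word as) \<alpha> \<in> positive_roots")
    case False
    then obtain bs where bs: "Suc (length bs) = length as" "set bs \<subseteq> set as"
        "word bs = word as \<otimes>\<^bsub>\<G>\<^esub> reflection \<alpha>"
      using Cons.IH as Cons.prems by blast
    then show ?thesis using B by (intro exI[of _ "\<beta> # bs"]) (auto simp: word_Cons Bij_assoc)
  next
    case True
    have "act (reflection \<beta>) (act (word as) \<alpha>) \<notin> positive_roots"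
      using Cons.prems(3) B by (simp add: word_Cons act_mult)
    then have e: "act (word as) \<alpha> = \<beta>" using simple_permutes[OF b True] by blast
    have "word (\<beta> # as) \<otimes>\<^bsub>\<G>\<^esub> reflection \<alpha> = reflection \<beta> \<otimes>\<^bsub>\<G>\<^esub> (word as \<otimes>\<^bsub>\<G>\<^esub> reflection \<alpha>)"
      using B by (simp add: word_Cons Bij_assoc)
    also have "\<dots> = reflection \<beta> \<otimes>\<^bsub>\<G>\<^esub> (reflection \<beta> \<otimes>\<^bsub>\<G>\<^esub> word as)"
      using reflection_conjugate[OF word_weyl[OF as] simple_root[OF Cons.prems(2)]] e by simp
    also have "\<dots> = word as"
      using B b by (simp add: Bij_assoc[symmetric] reflection_square simple_root Bij_l_one)
    finally show ?thesis by (intro exI[of _ as]) auto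
  qed
qed

lemma inversions_le: "card (inversions w) \<le> card positive_roots"
  using finite_positive by (intro card_mono) (auto simp: inversions_def)

text \<open>A word with the largest number of inversions cannot gain one from any simple reflection.
  Words are used instead of group elements because generation by the simple reflections is itself
  deduced from this lemma.\<close>

lemma longest_word_exists:
  "\<exists>as. set as \<subseteq> simples \<and> (\<forall>\<beta>\<in>positive_roots. act (word as) \<beta> \<notin> positive_roots)"
proof -
  obtain as where as: "set as \<subseteq> simples"
      and max: "\<And>bs. set bs \<subseteq> simples \<Longrightarrow> card (inversions (word bs)) \<le> card (inversions (word as))"
    using ex_has_greatest_nat[of "\<lambda>as. set as \<subseteq> simples" "[]" "\<lambda>as. card (inversions (word as))" "Suc (card positive_roots)"]
      inversions_le by (auto simp: less_Suc_eq_le)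
  have "act (word as) \<alpha> \<notin> positive_roots" if \<alpha>: "\<alpha> \<in> simples" for \<alpha>
  proof
    assume "act (word as) \<alpha> \<in> positive_roots"
    from inversions_up[OF word_weyl[OF as] \<alpha> this] have "card (inversions (word (as @ [\<alpha>]))) = Suc (card (inversions (word as)))"
      by (simp add: word_snoc as \<alpha>)
    then show False using max[of "as @ [\<alpha>]"] as \<alpha> by simp
  qed
  then show ?thesis using as all_negative[OF word_weyl[OF as]] by blast
qed

text \<open>The root is still positive just before the letter that changes its sign, and only the
  simple root of that letter can change sign there.\<close>

lemma conjugate_to_simple:
  assumes "set as \<subseteq> simples" "\<beta> \<in> positive_roots" "act (word as) \<beta> \<notin> positive_roots"
  shows "\<exists>bs \<alpha>. set bs \<subseteq> simples \<and> \<alpha> \<in> simples \<and> act (word bs) \<beta> = \<alpha>"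
  using assms
proof (induction as)
  case Nil
  then show ?case by (simp add: word_Nil act_one dual_ext roots_dual positive_root)
next
  case (Cons \<alpha> as)
  have a: "\<alpha> \<in> simples" "set as \<subseteq> simples" using Cons.prems by auto
  show ?case
  proof (cases "act (word as) \<beta> \<in> positive_roots")
    case True
    have "act (reflection \<alpha>) (act (word as) \<beta>) \<notin> positive_roots"
      using Cons.prems(3) a by (simp add: word_Cons act_mult simple_reflection_Bij word_Bij)
    then have "act (word as) \<beta> = \<alpha>" using simple_permutes[OF a(1) True] by blast
    then show ?thesis using a by blast
  qed (use Cons a in blast)
qed

lemma reflection_word:
  assumes "\<beta> \<in> positive_roots"
  shows "\<exists>as. set as \<subseteq> simples \<and> word as = reflection \<beta>"
proof -
  obtain bs \<alpha> where bs: "set bs \<subseteq> simples" "\<alpha> \<in> simples" "act (word bs) \<beta> = \<alpha>"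
  proof -
    obtain as where as: "set as \<subseteq> simples" "\<forall>\<beta>\<in>positive_roots. act (word as) \<beta> \<notin> positive_roots"
      using longest_word_exists by blast
    then show ?thesis using conjugate_to_simple[OF as(1) assms] assms that by blast
  qed
  note B = word_Bij[OF bs(1)] simple_reflection_Bij[OF bs(2)] reflection_Bij[OF positive_root[OF assms]]
  have "word (rev bs @ [\<alpha>] @ bs) = inv\<^bsub>\<G>\<^esub> (word bs) \<otimes>\<^bsub>\<G>\<^esub> (reflection \<alpha> \<otimes>\<^bsub>\<G>\<^esub> word bs)"
    using bs by (simp add: word_append[of "rev bs"] word_rev word_Cons)
  also have "\<dots> = inv\<^bsub>\<G>\<^esub> (word bs) \<otimes>\<^bsub>\<G>\<^esub> (word bs \<otimes>\<^bsub>\<G>\<^esub> reflection \<beta>)"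
    using reflection_conjugate[OF word_weyl[OF bs(1)] positive_root[OF assms]] bs(3) by simp
  also have "\<dots> = reflection \<beta>" using B by (simp add: Bij_assoc[symmetric] Bij_inv Bij_l_inv Bij_l_one)
  finally show ?thesis using bs by (intro exI[of _ "rev bs @ [\<alpha>] @ bs"]) auto
qed

text \<open>\<open>weyl_group\<close> is generated by the reflections of all roots, whereas
  \<open>reflection_word\<close> treats the positive ones; this closes the gap. The coroot of
  -\<beta> is found with \<open>coroot_characterization\<close>.\<close>

lemma reflection_neg_root: "\<beta> \<in> roots \<Longrightarrow> reflection (neg_root \<beta>) = reflection \<beta>"
proof -
  assume \<beta>: "\<beta> \<in> roots"
  have neg: "\<phi> (- coroot \<beta>) = - \<phi> (coroot \<beta>)" if "\<phi> \<in> roots" for \<phi>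
    using dual_scale[OF roots_dual[OF that] coroot_H[OF \<beta>], of "-1"] by simp
  have c: "neg_root \<beta> (- coroot \<beta>) = 2" "- coroot \<beta> \<in> H"
    using root_coroot[OF \<beta>] subspace_neg[OF H_subspace coroot_H[OF \<beta>]] neg[OF \<beta>] by auto
  have "- coroot \<beta> = coroot (neg_root \<beta>)"
  proof (rule coroot_characterization[OF neg_root_root[OF \<beta>] c(2,1)])
    fix \<phi> assume \<phi>: "\<phi> \<in> roots"
    show "(\<lambda>x\<in>H. \<phi> x - \<phi> (- coroot \<beta>) * neg_root \<beta> x) \<in> roots"
      using reflected_root[OF \<beta> \<phi>] by (simp add: neg[OF \<phi>] cong: restrict_cong)
  qed
  then have "coroot (neg_root \<beta>) = - coroot \<beta>" by simp
  then show ?thesis by (auto simp: reflection_def intro!: restrict_ext)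
qed

lemma weyl_word: "w \<in> weyl_group \<Longrightarrow> \<exists>as. set as \<subseteq> simples \<and> word as = w"
proof (induct rule: weyl_induct)
  case one
  show ?case by (rule exI[of _ "[]"]) (simp add: word_Nil)
next
  case (step u v)
  then obtain as bs where "set as \<subseteq> simples" "word as = u" "set bs \<subseteq> simples" "word bs = v" by blast
  then show ?case by (intro exI[of _ "as @ bs"]) (auto simp: word_append)
next
  fix \<beta> assume \<beta>: "\<beta> \<in> roots"
  then show "\<exists>as. set as \<subseteq> simples \<and> word as = reflection \<beta>"
    using positive_or_negative reflection_word reflection_neg_root[OF \<beta>] by metis
qed

lemma reduced_exists: "w \<in> weyl_group \<Longrightarrow> \<exists>as. reduced_expression as w"
  unfolding reduced_expression_def len_def
  using weyl_word[of w] LeastI_ex[of "\<lambda>n. \<exists>\<alpha>s. set \<alpha>s \<subseteq> simples \<and> length \<alpha>s = n \<and> word \<alpha>s = w"] by blast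

lemma len_word_le: "set as \<subseteq> simples \<Longrightarrow> len (word as) \<le> length as"
  unfolding len_def by (rule Least_le) blast

text \<open>Every letter appended to a reduced word that stays reduced creates an inversion;
  otherwise \<open>exchange\<close> would give a shorter word for the same element.\<close>

lemma len_inversions:
  assumes "w \<in> weyl_group"
  shows "len w = card (inversions w)"
proof -
  have *: "card (inversions (word as)) = length as" if "set as \<subseteq> simples" "len (word as) = length as" for as
    using that
  proof (induction as rule: rev_induct)
    case (snoc \<alpha> as)
    then have as: "set as \<subseteq> simples" "\<alpha> \<in> simples" by auto
    have p: "act (word as) \<alpha> \<in> positive_roots"
    proof (rule ccontr)
      assume "\<not> ?thesis"
      then obtain bs where bs: "Suc (length bs) = length as" "set bs \<subseteq> set as" "word bs = word (as @ [\<alpha>])"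
        using exchange[OF as] by (auto simp: word_snoc as)
      then show False using len_word_le[of bs] snoc.prems as by auto
    qed
    have "length as \<le> len (word as)"
    proof -
      obtain bs where bs: "reduced_expression bs (word as)" using reduced_exists[OF word_weyl[OF as(1)]] by blast
      then have b: "set bs \<subseteq> simples" "word bs = word as" "length bs = len (word as)" by (auto simp: reduced_expression_def)
      then have "word (bs @ [\<alpha>]) = word (as @ [\<alpha>])" using as by (simp add: word_snoc)
      then show ?thesis using len_word_le[of "bs @ [\<alpha>]"] b as snoc.prems(2) by simp
    qed
    then have "len (word as) = length as" using len_word_le[OF as(1)] by simp
    then show ?case using snoc.IH as inversions_up[OF word_weyl[OF as(1)] as(2) p] by (simp add: word_snoc)
  qed (simp add: word_Nil inversions_one)
  obtain as where "reduced_expression as w" using reduced_exists[OF assms] by blast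
  then show ?thesis using *[of as] by (auto simp: reduced_expression_def)
qed

lemma len_up: "w \<in> weyl_group \<Longrightarrow> \<alpha> \<in> simples \<Longrightarrow> act w \<alpha> \<in> positive_roots
    \<Longrightarrow> len (w \<otimes>\<^bsub>\<G>\<^esub> reflection \<alpha>) = Suc (len w)"
  and len_down: "w \<in> weyl_group \<Longrightarrow> \<alpha> \<in> simples \<Longrightarrow> act w \<alpha> \<notin> positive_roots
    \<Longrightarrow> len w = Suc (len (w \<otimes>\<^bsub>\<G>\<^esub> reflection \<alpha>))"
  using inversions_up[of w \<alpha>] inversions_down[of w \<alpha>]
  by (auto simp: len_inversions weyl_mult simple_reflection_weyl)

lemma len_up_or_down: "w \<in> weyl_group \<Longrightarrow> \<alpha> \<in> simples \<Longrightarrow>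
    len (w \<otimes>\<^bsub>\<G>\<^esub> reflection \<alpha>) = Suc (len w) \<or> len w = Suc (len (w \<otimes>\<^bsub>\<G>\<^esub> reflection \<alpha>))"
  using len_up len_down by blast

lemma len_le: "w \<in> weyl_group \<Longrightarrow> len w \<le> card positive_roots"
  by (simp add: len_inversions inversions_le)

lemma len_one: "len \<one>\<^bsub>\<G>\<^esub> = 0"
  by (simp add: len_inversions weyl_one inversions_one)

lemma len_zero: "w \<in> weyl_group \<Longrightarrow> len w = 0 \<Longrightarrow> w = \<one>\<^bsub>\<G>\<^esub>"
  using reduced_exists[of w] by (auto simp: reduced_expression_def word_Nil)

lemma len_max_iff: "w \<in> weyl_group \<Longrightarrow> len w = card positive_roots \<longleftrightarrow> (\<forall>\<beta>\<in>positive_roots. act w \<beta> \<notin> positive_roots)"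
proof -
  assume w: "w \<in> weyl_group"
  have "inversions w \<subseteq> positive_roots" by (auto simp: inversions_def)
  then have "len w = card positive_roots \<longleftrightarrow> inversions w = positive_roots"
    using w finite_positive card_subset_eq by (auto simp: len_inversions)
  then show ?thesis by (auto simp: inversions_def)
qed

lemma len_inv: "w \<in> weyl_group \<Longrightarrow> len (inv\<^bsub>\<G>\<^esub> w) = len w"
proof -
  have le: "len (inv\<^bsub>\<G>\<^esub> w) \<le> len w" if "w \<in> weyl_group" for w
  proof -
    from reduced_exists[OF that] obtain as where "reduced_expression as w" ..
    then show ?thesis using len_word_le[of "rev as"] by (auto simp: reduced_expression_def word_rev)
  qed
  assume "w \<in> weyl_group"
  then show ?thesis using le[of w] le[OF weyl_inv[of w]] by (simp add: Bij_inv_inv weyl_Bij)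
qed

text \<open>If v and w both make every positive root negative, then w^-1 v keeps all of them
  positive and has length 0.\<close>

lemma len_max_unique:
  assumes v: "v \<in> weyl_group" "len v = card positive_roots" and w: "w \<in> weyl_group" "len w = card positive_roots"
  shows "v = w"
proof -
  note B = weyl_Bij[OF v(1)] weyl_Bij[OF w(1)]
  let ?u = "inv\<^bsub>\<G>\<^esub> w \<otimes>\<^bsub>\<G>\<^esub> v"
  have u: "?u \<in> weyl_group" using v w by (intro weyl_mult weyl_inv)
  have iw: "act (inv\<^bsub>\<G>\<^esub> w) \<beta> \<notin> positive_roots" if "\<beta> \<in> positive_roots" for \<beta>
    using len_max_iff[OF weyl_inv[OF w(1)]] len_inv[OF w(1)] w(2) that by simp
  have "act ?u \<beta> \<in> positive_roots" if b: "\<beta> \<in> positive_roots" for \<beta>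
  proof -
    have vb: "act v \<beta> \<in> roots" using act_root[OF v(1) positive_root[OF b]] .
    have "neg_root (act v \<beta>) \<in> positive_roots" using len_max_iff[OF v(1)] v(2) b negative_iff[OF vb] by blast
    then have "act (inv\<^bsub>\<G>\<^esub> w) (neg_root (act v \<beta>)) \<notin> positive_roots" by (rule iw)
    then have "neg_root (act (inv\<^bsub>\<G>\<^esub> w) (act v \<beta>)) \<notin> positive_roots" using B by (simp add: act_neg Bij_inv)
    then show ?thesis using B negative_iff[OF act_root[OF weyl_inv[OF w(1)] vb]] by (simp add: act_mult Bij_inv)
  qed
  then have "inversions ?u = {}" by (auto simp: inversions_def)
  then have "?u = \<one>\<^bsub>\<G>\<^esub>" using len_zero[OF u] len_inversions[OF u] by simp
  then have "w \<otimes>\<^bsub>\<G>\<^esub> ?u = w" using B by (simp add: Bij_r_one)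
  then show ?thesis using B by (simp add: Bij_assoc[symmetric] Bij_inv Bij_r_inv Bij_l_one)
qed

lemma longest: "longest \<in> weyl_group" "len longest = card positive_roots"
  and longest_unique: "w \<in> weyl_group \<Longrightarrow> len w = card positive_roots \<Longrightarrow> w = longest"
proof -
  obtain as where as: "set as \<subseteq> simples" "\<forall>\<beta>\<in>positive_roots. act (word as) \<beta> \<notin> positive_roots"
    using longest_word_exists by blast
  let ?w = "word as"
  have w: "?w \<in> weyl_group" "len ?w = card positive_roots"
    using word_weyl[OF as(1)] len_max_iff as(2) by auto
  have eq: "longest = ?w"
    unfolding longest_def
  proof (rule the_equality)
    show "?w \<in> weyl_group \<and> (\<forall>v\<in>weyl_group. len v \<le> len ?w)" using w len_le by simp
    fix u assume u: "u \<in> weyl_group \<and> (\<forall>v\<in>weyl_group. len v \<le> len u)"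
    then have "len u = card positive_roots" using w len_le[of u] by (metis le_antisym)
    then show "u = ?w" using u w len_max_unique by blast
  qed
  then show "longest \<in> weyl_group" "len longest = card positive_roots" using w by simp_all
  show "w \<in> weyl_group \<Longrightarrow> len w = card positive_roots \<Longrightarrow> w = longest" using eq w len_max_unique by metis
qed

lemma not_longest: "w \<in> weyl_group \<Longrightarrow> w \<noteq> longest \<Longrightarrow> \<exists>\<alpha>\<in>simples. len (w \<otimes>\<^bsub>\<G>\<^esub> reflection \<alpha>) = Suc (len w)"
  using len_up all_negative longest_unique len_max_iff by blast

text \<open>The map \<beta> -> -w_0 \<beta> permutes the positive roots and carries the inversions
  of w^-1 w_0 onto the complement of those of w^-1.\<close>

lemma len_inv_longest:
  assumes w: "w \<in> weyl_group"
  shows "len (inv\<^bsub>\<G>\<^esub> w \<otimes>\<^bsub>\<G>\<^esub> longest) + len w = card positive_roots"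
proof -
  let ?i = "inv\<^bsub>\<G>\<^esub> w" and ?w0 = longest
  note B = weyl_Bij[OF w] weyl_Bij[OF longest(1)]
  have i: "?i \<in> weyl_group" using w by (rule weyl_inv)
  have neg: "neg_root (act ?w0 \<beta>) \<in> positive_roots" if "\<beta> \<in> positive_roots" for \<beta>
    using len_max_iff[OF longest(1)] longest(2) that negative_iff act_root[OF longest(1) positive_root[OF that]] by blast
  have inj: "inj_on (\<lambda>\<beta>. neg_root (act ?w0 \<beta>)) positive_roots"
  proof (rule inj_on_inverseI[where g = "\<lambda>\<gamma>. act (inv\<^bsub>\<G>\<^esub> ?w0) (neg_root \<gamma>)"])
    fix \<beta> assume "\<beta> \<in> positive_roots"
    then show "act (inv\<^bsub>\<G>\<^esub> ?w0) (neg_root (neg_root (act ?w0 \<beta>))) = \<beta>"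
      using B by (simp only: neg_neg act_ext act_inv_act dual_ext roots_dual positive_root)
  qed
  have surj: "(\<lambda>\<beta>. neg_root (act ?w0 \<beta>)) ` positive_roots = positive_roots"
    using neg finite_positive inj by (intro card_subset_eq) (auto simp: card_image)
  have iff: "\<beta> \<in> inversions (?i \<otimes>\<^bsub>\<G>\<^esub> ?w0) \<longleftrightarrow> neg_root (act ?w0 \<beta>) \<notin> inversions ?i" if b: "\<beta> \<in> positive_roots" for \<beta>
  proof -
    have r: "act ?i (act ?w0 \<beta>) \<in> roots" using i longest(1) positive_root[OF b] by (intro act_root)
    have "act ?i (neg_root (act ?w0 \<beta>)) = neg_root (act ?i (act ?w0 \<beta>))" using B by (simp add: act_neg Bij_inv)
    then show ?thesis using b neg[OF b] negative_iff[OF r] B by (simp add: inversions_def act_mult Bij_inv)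
  qed
  have "(\<lambda>\<beta>. neg_root (act ?w0 \<beta>)) ` inversions (?i \<otimes>\<^bsub>\<G>\<^esub> ?w0) = positive_roots - inversions ?i"
  proof (intro equalityI subsetI)
    fix \<gamma> assume "\<gamma> \<in> (\<lambda>\<beta>. neg_root (act ?w0 \<beta>)) ` inversions (?i \<otimes>\<^bsub>\<G>\<^esub> ?w0)"
    then show "\<gamma> \<in> positive_roots - inversions ?i" using iff neg by (auto simp: inversions_def)
  next
    fix \<gamma> assume g: "\<gamma> \<in> positive_roots - inversions ?i"
    then obtain \<beta> where "\<beta> \<in> positive_roots" "\<gamma> = neg_root (act ?w0 \<beta>)" using surj by blast
    then show "\<gamma> \<in> (\<lambda>\<beta>. neg_root (act ?w0 \<beta>)) ` inversions (?i \<otimes>\<^bsub>\<G>\<^esub> ?w0)" using g iff by blast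
  qed
  moreover have "inj_on (\<lambda>\<beta>. neg_root (act ?w0 \<beta>)) (inversions (?i \<otimes>\<^bsub>\<G>\<^esub> ?w0))"
    using inj by (rule inj_on_subset) (auto simp: inversions_def)
  ultimately have "card (inversions (?i \<otimes>\<^bsub>\<G>\<^esub> ?w0)) = card (positive_roots - inversions ?i)"
    by (metis card_image)
  also have "\<dots> = card positive_roots - card (inversions ?i)"
    using finite_inversions by (intro card_Diff_subset) (auto simp: inversions_def)
  finally show ?thesis
    using len_inversions[OF weyl_mult[OF i longest(1)]] len_inversions[OF i] len_inv[OF w] inversions_le[of ?i] by simp
qed

section \<open>Minimal representatives of the cosets of W_J in terms of signs of roots\<close>

section \<open>Minimal coset representatives\<close>

lemma parabolic_word:
  assumes J: "J \<subseteq> simples" and v: "v \<in> parabolic J"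
  shows "\<exists>as. set as \<subseteq> J \<and> word as = v"
  using v unfolding parabolic_def
proof (induct rule: generate.induct)
  case one
  show ?case by (rule exI[of _ "[]"]) (simp add: word_Nil)
next
  case (incl h)
  then obtain \<alpha> where "\<alpha> \<in> J" "h = reflection \<alpha>" by blast
  then show ?case using J simple_reflection_Bij by (intro exI[of _ "[\<alpha>]"]) (auto simp: word_Cons word_Nil Bij_r_one)
next
  case (inv h)
  then obtain \<alpha> where "\<alpha> \<in> J" "h = reflection \<alpha>" by blast
  then show ?case using J simple_reflection_Bij simple_root
    by (intro exI[of _ "[\<alpha>]"]) (auto simp: word_Cons word_Nil Bij_r_one inv_reflection subset_iff)
next
  case (eng u v)
  then obtain as bs where "set as \<subseteq> J" "word as = u" "set bs \<subseteq> J" "word bs = v" by blast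
  then show ?case using J by (intro exI[of _ "as @ bs"]) (auto simp: word_append)
qed

lemma parabolic_span:
  assumes J: "J \<subseteq> simples" and as: "set as \<subseteq> J" and \<alpha>: "\<alpha> \<in> J"
  shows "\<exists>c. \<forall>x\<in>H. act (word as) \<alpha> x = (\<Sum>\<delta>\<in>J. c \<delta> * \<delta> x)"
  using as
proof (induction as)
  have fJ: "finite J" using J finite_simples finite_subset by blast
  case Nil
  show ?case
    using \<alpha> fJ J by (intro exI[of _ "\<lambda>\<delta>. if \<delta> = \<alpha> then 1 else 0"])
      (auto simp: word_Nil act_one dual_ext roots_dual simple_root subset_iff if_distrib[of "\<lambda>c. c * _"] sum.delta cong: if_cong)
next
  have fJ: "finite J" using J finite_simples finite_subset by blast
  case (Cons \<beta> as)
  have b: "\<beta> \<in> J" "\<beta> \<in> simples" and as: "set as \<subseteq> J" "set as \<subseteq> simples" using Cons.prems J by auto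
  obtain c where c: "\<And>x. x \<in> H \<Longrightarrow> act (word as) \<alpha> x = (\<Sum>\<delta>\<in>J. c \<delta> * \<delta> x)" using Cons.IH as by blast
  have r: "act (word as) \<alpha> \<in> roots" using \<alpha> J simple_root as by (intro act_root word_weyl) auto
  let ?k = "act (word as) \<alpha> (coroot \<beta>)"
  have "act (word (\<beta> # as)) \<alpha> x = (\<Sum>\<delta>\<in>J. (c \<delta> - (if \<delta> = \<beta> then ?k else 0)) * \<delta> x)" if x: "x \<in> H" for x
  proof -
    have "act (word (\<beta> # as)) \<alpha> x = act (word as) \<alpha> x - ?k * \<beta> x"
      using b as r x by (simp add: word_Cons act_mult simple_reflection_Bij word_Bij act_reflection_dual simple_root roots_dual)
    also have "\<dots> = (\<Sum>\<delta>\<in>J. c \<delta> * \<delta> x) - (\<Sum>\<delta>\<in>J. if \<delta> = \<beta> then ?k * \<delta> x else 0)"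
      using c[OF x] b fJ by (simp add: sum.delta)
    also have "\<dots> = (\<Sum>\<delta>\<in>J. (c \<delta> - (if \<delta> = \<beta> then ?k else 0)) * \<delta> x)"
      unfolding sum_subtractf[symmetric] by (rule sum.cong) (auto simp: algebra_simps)
    finally show ?thesis .
  qed
  then show ?case by (intro exI[of _ "\<lambda>\<delta>. c \<delta> - (if \<delta> = \<beta> then ?k else 0)"]) blast
qed

text \<open>A positive root in the span of J has its nonnegative coefficients supported on J. As w
  is positive on J, the image is a nonnegative combination of simple roots.\<close>

lemma positive_on_parabolic:
  assumes J: "J \<subseteq> simples" and w: "w \<in> weyl_group" "\<And>\<alpha>. \<alpha> \<in> J \<Longrightarrow> act w \<alpha> \<in> positive_roots"
    and as: "set as \<subseteq> J" and \<alpha>: "\<alpha> \<in> J" and p: "act (word as) \<alpha> \<in> positive_roots"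
  shows "act w (act (word as) \<alpha>) \<in> positive_roots"
proof (rule ccontr)
  have fJ: "finite J" using J finite_simples finite_subset by blast
  let ?\<beta> = "act (word as) \<alpha>"
  have r: "act w ?\<beta> \<in> roots" by (rule act_root[OF w(1) positive_root[OF p]])
  assume "act w ?\<beta> \<notin> positive_roots"
  then have n: "neg_root (act w ?\<beta>) \<in> positive_roots" using negative_iff[OF r] by blast
  obtain a :: "('g \<Rightarrow> complex) \<Rightarrow> nat" where a: "\<And>x. x \<in> H \<Longrightarrow> ?\<beta> x = (\<Sum>\<delta>\<in>simples. of_nat (a \<delta>) * \<delta> x)"
    using positive_coefficients[OF p] by metis
  obtain c where c: "\<And>x. x \<in> H \<Longrightarrow> ?\<beta> x = (\<Sum>\<delta>\<in>J. c \<delta> * \<delta> x)" using parabolic_span[OF J as \<alpha>] by blast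
  have "of_nat (a \<delta>) = (if \<delta> \<in> J then c \<delta> else 0)" if "\<delta> \<in> simples" for \<delta>
  proof (rule simple_coefficients_unique[OF _ that])
    fix x assume x: "x \<in> H"
    show "(\<Sum>\<delta>\<in>simples. of_nat (a \<delta>) * \<delta> x) = (\<Sum>\<delta>\<in>simples. (if \<delta> \<in> J then c \<delta> else 0) * \<delta> x)"
      using a[OF x] c[OF x] J finite_simples
      by (simp add: if_distrib[of "\<lambda>c. c * _"] sum.If_cases Int_absorb1 cong: if_cong)
  qed
  then have a0: "a \<delta> = 0" if "\<delta> \<in> simples - J" for \<delta> using that by (metis DiffE of_nat_eq_0_iff)
  have aJ: "?\<beta> x = (\<Sum>\<delta>\<in>J. of_nat (a \<delta>) * \<delta> x)" if "x \<in> H" for x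
    unfolding a[OF that] using finite_simples J a0 by (intro sum.mono_neutral_right) auto
  have "\<forall>\<delta>\<in>J. \<exists>m::('g \<Rightarrow> complex) \<Rightarrow> nat. \<forall>x\<in>H. act w \<delta> x = (\<Sum>\<epsilon>\<in>simples. of_nat (m \<epsilon>) * \<epsilon> x)"
    using w(2) positive_coefficients_ex by blast
  from bchoice[OF this] obtain m :: "('g \<Rightarrow> complex) \<Rightarrow> ('g \<Rightarrow> complex) \<Rightarrow> nat"
    where m: "\<And>\<delta> x. \<delta> \<in> J \<Longrightarrow> x \<in> H \<Longrightarrow> act w \<delta> x = (\<Sum>\<epsilon>\<in>simples. of_nat (m \<delta> \<epsilon>) * \<epsilon> x)" by blast
  have "act w ?\<beta> = (\<lambda>x\<in>H. \<Sum>\<epsilon>\<in>simples. of_nat (\<Sum>\<delta>\<in>J. a \<delta> * m \<delta> \<epsilon>) * \<epsilon> x)"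
  proof (rule extensionalityI[OF act_ext])
    fix x assume x: "x \<in> H"
    then have ix: "(inv\<^bsub>\<G>\<^esub> w) x \<in> H" using weyl_Bij[OF w(1)] by (simp add: Bij_app Bij_inv)
    have "act w ?\<beta> x = (\<Sum>\<delta>\<in>J. of_nat (a \<delta>) * act w \<delta> x)" using aJ[OF ix] x by (simp add: act_app[of x w])
    also have "\<dots> = (\<Sum>\<delta>\<in>J. \<Sum>\<epsilon>\<in>simples. of_nat (a \<delta>) * (of_nat (m \<delta> \<epsilon>) * \<epsilon> x))"
      by (rule sum.cong) (auto simp: m x sum_distrib_left)
    also have "\<dots> = (\<Sum>\<epsilon>\<in>simples. \<Sum>\<delta>\<in>J. of_nat (a \<delta>) * (of_nat (m \<delta> \<epsilon>) * \<epsilon> x))"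
      by (rule sum.swap)
    finally show "act w ?\<beta> x = (\<lambda>x\<in>H. \<Sum>\<epsilon>\<in>simples. of_nat (\<Sum>\<delta>\<in>J. a \<delta> * m \<delta> \<epsilon>) * \<epsilon> x) x"
      using x by (simp add: sum_distrib_right mult.assoc)
  qed simp
  then have "act w ?\<beta> \<in> positive_roots" using r
    unfolding positive_roots_def mem_Collect_eq by (intro conjI exI[of _ "\<lambda>\<epsilon>. \<Sum>\<delta>\<in>J. a \<delta> * m \<delta> \<epsilon>"])
  then show False using positive_not_negative n by blast
qed

text \<open>The last letter of the word either lengthens the product, by
  \<open>positive_on_parabolic\<close>, or can be cancelled by \<open>exchange\<close>, which leaves
  a shorter word in J for the same element.\<close>

lemma len_parabolic:
  assumes J: "J \<subseteq> simples" and w: "w \<in> weyl_group" "\<And>\<alpha>. \<alpha> \<in> J \<Longrightarrow> act w \<alpha> \<in> positive_roots"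
    and v: "set as \<subseteq> J"
  shows "len w \<le> len (w \<otimes>\<^bsub>\<G>\<^esub> word as)"
  using v
proof (induction "length as" arbitrary: as rule: less_induct)
  case less
  show ?case
  proof (cases as rule: rev_cases)
    case Nil
    then show ?thesis using w by (simp add: word_Nil Bij_r_one weyl_Bij)
  next
    case (snoc bs \<alpha>)
    have bs: "set bs \<subseteq> J" "set bs \<subseteq> simples" and \<alpha>: "\<alpha> \<in> J" "\<alpha> \<in> simples" using less.prems snoc J by auto
    note B = weyl_Bij[OF w(1)] word_Bij[OF bs(2)] simple_reflection_Bij[OF \<alpha>(2)]
    show ?thesis
    proof (cases "act (word bs) \<alpha> \<in> positive_roots")
      case True
      have "act (w \<otimes>\<^bsub>\<G>\<^esub> word bs) \<alpha> \<in> positive_roots"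
        using positive_on_parabolic[OF J w bs(1) \<alpha>(1) True] B by (simp add: act_mult)
      then have "len ((w \<otimes>\<^bsub>\<G>\<^esub> word bs) \<otimes>\<^bsub>\<G>\<^esub> reflection \<alpha>) = Suc (len (w \<otimes>\<^bsub>\<G>\<^esub> word bs))"
        using w(1) bs \<alpha> by (intro len_up weyl_mult word_weyl)
      moreover have "len w \<le> len (w \<otimes>\<^bsub>\<G>\<^esub> word bs)" using less.hyps[of bs] bs snoc by simp
      ultimately show ?thesis using B by (simp add: snoc word_snoc bs \<alpha> Bij_assoc)
    next
      case False
      then obtain cs where cs: "Suc (length cs) = length bs" "set cs \<subseteq> set bs" "word cs = word as"
        using exchange[OF bs(2) \<alpha>(2)] by (auto simp: snoc word_snoc bs \<alpha>)
      then show ?thesis using less.hyps[of cs] bs snoc by auto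
    qed
  qed
qed

lemma parabolic_reflection: "\<alpha> \<in> J \<Longrightarrow> reflection \<alpha> \<in> parabolic J"
  unfolding parabolic_def by (intro generate.incl) blast

text \<open>Minimality over the whole coset reduces to a sign condition on J, the form in which
  Demazure operators can detect it.\<close>

lemma min_coset_reps_iff:
  assumes J: "J \<subseteq> simples"
  shows "w \<in> min_coset_reps J \<longleftrightarrow> w \<in> weyl_group \<and> (\<forall>\<alpha>\<in>J. act w \<alpha> \<in> positive_roots)"
proof
  assume w: "w \<in> min_coset_reps J"
  have "act w \<alpha> \<in> positive_roots" if a: "\<alpha> \<in> J" for \<alpha>
  proof (rule ccontr)
    assume "act w \<alpha> \<notin> positive_roots"
    then have "len w = Suc (len (w \<otimes>\<^bsub>\<G>\<^esub> reflection \<alpha>))"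
      using w a J by (intro len_down) (auto simp: min_coset_reps_def)
    moreover have "len w \<le> len (w \<otimes>\<^bsub>\<G>\<^esub> reflection \<alpha>)"
      using w parabolic_reflection[OF a] by (simp add: min_coset_reps_def)
    ultimately show False by simp
  qed
  then show "w \<in> weyl_group \<and> (\<forall>\<alpha>\<in>J. act w \<alpha> \<in> positive_roots)" using w by (simp add: min_coset_reps_def)
next
  assume w: "w \<in> weyl_group \<and> (\<forall>\<alpha>\<in>J. act w \<alpha> \<in> positive_roots)"
  have "len w \<le> len (w \<otimes>\<^bsub>\<G>\<^esub> v)" if "v \<in> parabolic J" for v
    using parabolic_word[OF J that] len_parabolic[OF J] w by blast
  then show "w \<in> min_coset_reps J" using w by (simp add: min_coset_reps_def)
qed

end


text \<open>With \<open>restrict_apply\<close> the simplifier turns eta-expanded restricted functions into conditionals.\<close>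

declare restrict_apply [simp del] restrict_apply' [simp]

context semisimple_with_cartan
begin

section \<open>Polynomial functions on H: degree, filtration by degree, restriction to lines\<close>

section \<open>Polynomial functions\<close>

lemma sym_power_zero: "(\<lambda>x\<in>H. 0) \<in> sym_power k"
proof (cases k)
  case (Suc j)
  have "(\<lambda>x\<in>H. 0) = (\<lambda>x\<in>H. \<Sum>i<(0::nat). undefined i x * undefined i x)" by (rule restrict_ext) simp
  then show ?thesis unfolding Suc sym_power.simps by blast
qed auto

lemma sym_power_const: "(\<lambda>x\<in>H. a) \<in> sym_power 0"
  by auto

lemma sum_lessThan_split: "(\<Sum>i<m + n. h i) = (\<Sum>i<m. h i) + (\<Sum>i<n. h (m + i))" for h :: "nat \<Rightarrow> complex"
  by (induction n) (auto simp: add.assoc)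

lemma sym_power_add:
  assumes "f \<in> sym_power k" "g \<in> sym_power k"
  shows "(\<lambda>x\<in>H. f x + g x) \<in> sym_power k"
proof (cases k)
  case 0
  then obtain a b where "f = (\<lambda>x\<in>H. a)" "g = (\<lambda>x\<in>H. b)" using assms by auto
  then have "(\<lambda>x\<in>H. f x + g x) = (\<lambda>x\<in>H. a + b)" by (auto intro!: restrict_ext)
  then show ?thesis using 0 by auto
next
  case (Suc j)
  obtain m \<phi> F where f: "f = (\<lambda>x\<in>H. \<Sum>i<(m::nat). \<phi> i x * F i x)" "\<forall>i<m. \<phi> i \<in> dual \<and> F i \<in> sym_power j"
    using assms(1) unfolding Suc sym_power.simps by blast
  obtain n \<psi> G where g: "g = (\<lambda>x\<in>H. \<Sum>i<(n::nat). \<psi> i x * G i x)" "\<forall>i<n. \<psi> i \<in> dual \<and> G i \<in> sym_power j"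
    using assms(2) unfolding Suc sym_power.simps by blast
  define \<theta> where "\<theta> i = (if i < m then \<phi> i else \<psi> (i - m))" for i
  define K where "K i = (if i < m then F i else G (i - m))" for i
  have "(\<lambda>x\<in>H. f x + g x) = (\<lambda>x\<in>H. \<Sum>i<m + n. \<theta> i x * K i x)"
    by (rule restrict_ext) (simp add: f(1) g(1) sum_lessThan_split \<theta>_def K_def)
  moreover have "\<forall>i<m + n. \<theta> i \<in> dual \<and> K i \<in> sym_power j"
    using f(2) g(2) by (auto simp: \<theta>_def K_def)
  ultimately show ?thesis unfolding Suc sym_power.simps mem_Collect_eq
    by (intro exI[of _ "m + n"] exI[of _ \<theta>] exI[of _ K] conjI)
qed

lemma sym_power_mult_dual:
  assumes "\<phi> \<in> dual" "f \<in> sym_power k"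
  shows "(\<lambda>x\<in>H. \<phi> x * f x) \<in> sym_power (Suc k)"
proof -
  have "(\<lambda>x\<in>H. \<phi> x * f x) = (\<lambda>x\<in>H. \<Sum>i<(1::nat). (\<lambda>_. \<phi>) i x * (\<lambda>_. f) i x)" by (rule restrict_ext) simp
  then show ?thesis unfolding sym_power.simps mem_Collect_eq using assms
    by (intro exI[of _ "1::nat"] exI[of _ "\<lambda>_. \<phi>"] exI[of _ "\<lambda>_. f"] conjI) auto
qed

text \<open>The sum of n products in the recursion is split into binary sums, so that each algebraic
  operation becomes one case.\<close>

lemma sym_power_induct [consumes 1, case_names zero const mult add]:
  assumes "f \<in> sym_power k"
    and zero: "\<And>k. P k (\<lambda>x\<in>H. 0)" and const: "\<And>a. P 0 (\<lambda>x\<in>H. a)"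
    and mult: "\<And>k \<phi> f. \<phi> \<in> dual \<Longrightarrow> f \<in> sym_power k \<Longrightarrow> P k f \<Longrightarrow> P (Suc k) (\<lambda>x\<in>H. \<phi> x * f x)"
    and add: "\<And>k f g. f \<in> sym_power k \<Longrightarrow> g \<in> sym_power k \<Longrightarrow> P k f \<Longrightarrow> P k g \<Longrightarrow> P k (\<lambda>x\<in>H. f x + g x)"
  shows "P k f"
  using assms(1)
proof (induction k arbitrary: f)
  case 0
  then show ?case using const by auto
next
  case (Suc k)
  obtain n \<phi> F where f: "f = (\<lambda>x\<in>H. \<Sum>i<(n::nat). \<phi> i x * F i x)" and F: "\<forall>i<n. \<phi> i \<in> dual \<and> F i \<in> sym_power k"
    using Suc.prems unfolding sym_power.simps by blast
  have "P (Suc k) (\<lambda>x\<in>H. \<Sum>i<m. \<phi> i x * F i x) \<and> (\<lambda>x\<in>H. \<Sum>i<m. \<phi> i x * F i x) \<in> sym_power (Suc k)" if "m \<le> n" for m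
    using that
  proof (induction m)
    case 0
    have "(\<lambda>x\<in>H. \<Sum>i<0. \<phi> i x * F i x) = (\<lambda>x\<in>H. 0)" by (rule restrict_ext) simp
    then show ?case using zero[of "Suc k"] sym_power_zero[of "Suc k"] by (simp del: sym_power.simps)
  next
    case (Suc m)
    let ?A = "\<lambda>x\<in>H. \<Sum>i<m. \<phi> i x * F i x" and ?B = "\<lambda>x\<in>H. \<phi> m x * F m x"
    have m: "\<phi> m \<in> dual" "F m \<in> sym_power k" using F Suc.prems by auto
    have B: "P (Suc k) ?B" "?B \<in> sym_power (Suc k)" using mult[OF m] Suc.prems m \<open>\<And>f. f \<in> sym_power k \<Longrightarrow> P k f\<close>
      by (auto intro: sym_power_mult_dual simp del: sym_power.simps)
    have A: "P (Suc k) ?A" "?A \<in> sym_power (Suc k)" using Suc.IH Suc.prems by (auto simp del: sym_power.simps)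
    have "(\<lambda>x\<in>H. \<Sum>i<Suc m. \<phi> i x * F i x) = (\<lambda>x\<in>H. ?A x + ?B x)" by (rule restrict_ext) simp
    then show ?case using add[OF A(2) B(2) A(1) B(1)] sym_power_add[OF A(2) B(2)] by (simp del: sym_power.simps)
  qed
  then show ?case using f by blast
qed

declare sym_power.simps [simp del]

lemma sym_power_ext: "f \<in> sym_power k \<Longrightarrow> f \<in> extensional H"
  by (induct rule: sym_power_induct) auto

lemma sym_power_scale: "f \<in> sym_power k \<Longrightarrow> (\<lambda>x\<in>H. a * f x) \<in> sym_power k"
proof (induct rule: sym_power_induct)
  case (zero k)
  have "(\<lambda>x\<in>H. a * (\<lambda>x\<in>H. 0) x) = (\<lambda>x\<in>H. 0)" by (rule restrict_ext) simp
  then show ?case by (simp add: sym_power_zero)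
next
  case (const b)
  have "(\<lambda>x\<in>H. a * (\<lambda>x\<in>H. b) x) = (\<lambda>x\<in>H. a * b)" by (rule restrict_ext) simp
  then show ?case by (simp add: sym_power_const)
next
  case (mult k \<phi> f)
  have "(\<lambda>x\<in>H. a * (\<lambda>x\<in>H. \<phi> x * f x) x) = (\<lambda>x\<in>H. \<phi> x * (\<lambda>x\<in>H. a * f x) x)" by (rule restrict_ext) simp
  then show ?case using sym_power_mult_dual[OF mult(1,3)] by simp
next
  case (add k f g)
  have "(\<lambda>x\<in>H. a * (\<lambda>x\<in>H. f x + g x) x) = (\<lambda>x\<in>H. (\<lambda>x\<in>H. a * f x) x + (\<lambda>x\<in>H. a * g x) x)"
    by (rule restrict_ext) (simp add: algebra_simps)
  then show ?case using sym_power_add[OF add(3,4)] by simp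
qed

lemma sym_power_mult:
  assumes "f \<in> sym_power j" "g \<in> sym_power k"
  shows "(\<lambda>x\<in>H. f x * g x) \<in> sym_power (j + k)"
  using assms(1)
proof (induct rule: sym_power_induct)
  case (zero j)
  have "(\<lambda>x\<in>H. (\<lambda>x\<in>H. 0) x * g x) = (\<lambda>x\<in>H. 0)" by (rule restrict_ext) simp
  then show ?case by (simp add: sym_power_zero)
next
  case (const a)
  have "(\<lambda>x\<in>H. (\<lambda>x\<in>H. a) x * g x) = (\<lambda>x\<in>H. a * g x)" by (rule restrict_ext) simp
  then show ?case using sym_power_scale[OF assms(2)] by simp
next
  case (mult j \<phi> f)
  have "(\<lambda>x\<in>H. (\<lambda>x\<in>H. \<phi> x * f x) x * g x) = (\<lambda>x\<in>H. \<phi> x * (\<lambda>x\<in>H. f x * g x) x)" by (rule restrict_ext) simp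
  then show ?case using sym_power_mult_dual[OF mult(1,3)] by simp
next
  case (add j f h)
  have "(\<lambda>x\<in>H. (\<lambda>x\<in>H. f x + h x) x * g x) = (\<lambda>x\<in>H. (\<lambda>x\<in>H. f x * g x) x + (\<lambda>x\<in>H. h x * g x) x)"
    by (rule restrict_ext) (simp add: algebra_simps)
  then show ?case using sym_power_add[OF add(3,4)] by simp
qed

lemma sym_power_dual: "\<phi> \<in> dual \<Longrightarrow> \<phi> \<in> sym_power 1"
proof -
  assume \<phi>: "\<phi> \<in> dual"
  have "\<phi> = (\<lambda>x\<in>H. \<phi> x * (\<lambda>x\<in>H. 1) x)" by (rule extensionalityI[of _ H]) (use dual_ext \<phi> in auto)
  then show ?thesis using sym_power_mult_dual[OF \<phi> sym_power_const[of 1]] by simp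
qed

lemma sym_power_sum:
  assumes "\<And>i. i \<in> A \<Longrightarrow> f i \<in> sym_power k"
  shows "(\<lambda>x\<in>H. \<Sum>i\<in>A. f i x) \<in> sym_power k"
proof (cases "finite A")
  case True
  then show ?thesis using assms
  proof (induction A rule: finite_induct)
    case (insert i A)
    have "(\<lambda>x\<in>H. \<Sum>i\<in>insert i A. f i x) = (\<lambda>x\<in>H. f i x + (\<lambda>x\<in>H. \<Sum>i\<in>A. f i x) x)"
      by (rule restrict_ext) (use insert.hyps in simp)
    then show ?case using sym_power_add[OF insert.prems[of i] insert.IH] insert.prems by simp
  qed (simp add: sym_power_zero)
qed (simp add: sym_power_zero)

lemma sym_power_prod:
  assumes "finite A" "\<And>\<phi>. \<phi> \<in> A \<Longrightarrow> \<phi> \<in> dual"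
  shows "(\<lambda>x\<in>H. \<Prod>\<phi>\<in>A. \<phi> x) \<in> sym_power (card A)"
  using assms
proof (induction A rule: finite_induct)
  case (insert \<phi> A)
  have "(\<lambda>x\<in>H. \<Prod>\<phi>\<in>insert \<phi> A. \<phi> x) = (\<lambda>x\<in>H. \<phi> x * (\<lambda>x\<in>H. \<Prod>\<phi>\<in>A. \<phi> x) x)"
    by (rule restrict_ext) (use insert.hyps in simp)
  then show ?case using sym_power_mult_dual[OF insert.prems[of \<phi>] insert.IH] insert by simp
qed (simp add: sym_power_const)

lemma sym_power_act:
  assumes "w \<in> weyl_group" "f \<in> sym_power k"
  shows "act w f \<in> sym_power k"
  using assms(2)
proof (induct rule: sym_power_induct)
  note iH = Bij_app[OF weyl_Bij[OF weyl_inv[OF assms(1)]]]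
  {
    case (zero k)
    have "act w (\<lambda>x\<in>H. 0) = (\<lambda>x\<in>H. 0)" unfolding act_def by (rule restrict_ext) (simp add: iH)
    then show ?case by (simp add: sym_power_zero)
  next
    case (const a)
    have "act w (\<lambda>x\<in>H. a) = (\<lambda>x\<in>H. a)" unfolding act_def by (rule restrict_ext) (simp add: iH)
    then show ?case by (simp add: sym_power_const)
  next
    case (mult k \<phi> f)
    have "act w (\<lambda>x\<in>H. \<phi> x * f x) = (\<lambda>x\<in>H. act w \<phi> x * act w f x)"
      by (rule extensionalityI[OF act_ext]) (auto simp: act_app iH)
    then show ?case using sym_power_mult_dual[OF act_dual[OF assms(1) mult(1)] mult(3)] by simp
  next
    case (add k f g)
    have "act w (\<lambda>x\<in>H. f x + g x) = (\<lambda>x\<in>H. act w f x + act w g x)"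
      by (rule extensionalityI[OF act_ext]) (auto simp: act_app iH)
    then show ?case using sym_power_add[OF add(3,4)] by simp
  }
qed

lemma sym_power_homogeneous: "f \<in> sym_power k \<Longrightarrow> x \<in> H \<Longrightarrow> f (c *s x) = c ^ k * f x"
  by (induct rule: sym_power_induct) (auto simp: H_scale dual_scale algebra_simps)

lemma sym_power_at_zero: "f \<in> sym_power k \<Longrightarrow> k > 0 \<Longrightarrow> f 0 = 0"
  using sym_power_homogeneous[of f k 0 0] H_zero by (simp add: power_0_left)

text \<open>Degree at most n. On a W-orbit invariants become constants, so there only this
  filtration survives from the grading.\<close>

definition sym_le :: "nat \<Rightarrow> ('g \<Rightarrow> complex) set" where
  "sym_le n = {\<lambda>x\<in>H. \<Sum>i\<le>n. F i x | F. \<forall>i. F i \<in> sym_power i}"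

lemma sym_le_power: "f \<in> sym_power k \<Longrightarrow> k \<le> n \<Longrightarrow> f \<in> sym_le n"
proof -
  assume f: "f \<in> sym_power k" "k \<le> n"
  let ?F = "\<lambda>i. if i = k then f else (\<lambda>x\<in>H. 0)"
  have "f = (\<lambda>x\<in>H. \<Sum>i\<le>n. ?F i x)"
  proof (rule extensionalityI[OF sym_power_ext[OF f(1)]])
    fix x assume x: "x \<in> H"
    have "(\<Sum>i\<le>n. ?F i x) = (\<Sum>i\<le>n. if i = k then f x else 0)" using x by (intro sum.cong) auto
    then show "f x = (\<lambda>x\<in>H. \<Sum>i\<le>n. ?F i x) x" using x f(2) by (simp add: sum.delta)
  qed simp
  moreover have "\<forall>i. ?F i \<in> sym_power i" using f(1) sym_power_zero by auto
  ultimately show ?thesis unfolding sym_le_def mem_Collect_eq by (intro exI[of _ ?F] conjI)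
qed

lemma sym_le_add:
  assumes "f \<in> sym_le n" "g \<in> sym_le n" shows "(\<lambda>x\<in>H. f x + g x) \<in> sym_le n"
proof -
  obtain F G where F: "f = (\<lambda>x\<in>H. \<Sum>i\<le>n. F i x)" "\<forall>i. F i \<in> sym_power i"
    and G: "g = (\<lambda>x\<in>H. \<Sum>i\<le>n. G i x)" "\<forall>i. G i \<in> sym_power i" using assms unfolding sym_le_def by blast
  have "(\<lambda>x\<in>H. f x + g x) = (\<lambda>x\<in>H. \<Sum>i\<le>n. (\<lambda>x\<in>H. F i x + G i x) x)"
    by (rule restrict_ext) (simp add: F G sum.distrib)
  moreover have "\<forall>i. (\<lambda>x\<in>H. F i x + G i x) \<in> sym_power i" using F G sym_power_add by blast
  ultimately show ?thesis unfolding sym_le_def mem_Collect_eq by (intro exI[of _ "\<lambda>i. \<lambda>x\<in>H. F i x + G i x"]) simp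
qed

lemma sym_le_scale:
  assumes "f \<in> sym_le n" shows "(\<lambda>x\<in>H. a * f x) \<in> sym_le n"
proof -
  obtain F where F: "f = (\<lambda>x\<in>H. \<Sum>i\<le>n. F i x)" "\<forall>i. F i \<in> sym_power i" using assms unfolding sym_le_def by blast
  have "(\<lambda>x\<in>H. a * f x) = (\<lambda>x\<in>H. \<Sum>i\<le>n. (\<lambda>x\<in>H. a * F i x) x)"
    by (rule restrict_ext) (simp add: F sum_distrib_left)
  moreover have "\<forall>i. (\<lambda>x\<in>H. a * F i x) \<in> sym_power i" using F sym_power_scale by blast
  ultimately show ?thesis unfolding sym_le_def mem_Collect_eq by (intro exI[of _ "\<lambda>i. \<lambda>x\<in>H. a * F i x"]) simp
qed

lemma sym_le_zero: "(\<lambda>x\<in>H. 0) \<in> sym_le n"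
  by (rule sym_le_power[OF sym_power_zero[of 0]]) simp

lemma sym_le_sum:
  assumes "\<And>i. i \<in> A \<Longrightarrow> f i \<in> sym_le k"
  shows "(\<lambda>x\<in>H. \<Sum>i\<in>A. f i x) \<in> sym_le k"
proof (cases "finite A")
  case True
  then show ?thesis using assms
  proof (induction A rule: finite_induct)
    case (insert i A)
    have "(\<lambda>x\<in>H. \<Sum>i\<in>insert i A. f i x) = (\<lambda>x\<in>H. f i x + (\<lambda>x\<in>H. \<Sum>i\<in>A. f i x) x)"
      by (rule restrict_ext) (use insert.hyps in simp)
    then show ?case using sym_le_add[OF insert.prems[of i] insert.IH] insert.prems by simp
  qed (simp add: sym_le_zero)
qed (simp add: sym_le_zero)

lemma sym_le_mono: "m \<le> n \<Longrightarrow> sym_le m \<subseteq> sym_le n"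
proof
  fix f assume mn: "m \<le> n" and "f \<in> sym_le m"
  then obtain F where F: "f = (\<lambda>x\<in>H. \<Sum>i\<le>m. F i x)" "\<forall>i. F i \<in> sym_power i" unfolding sym_le_def by blast
  show "f \<in> sym_le n"
    unfolding F(1) by (rule sym_le_sum) (use F(2) mn in \<open>auto intro: sym_le_power\<close>)
qed

lemma sym_le_induct [consumes 1, case_names power add]:
  assumes "f \<in> sym_le n" and power: "\<And>k f. f \<in> sym_power k \<Longrightarrow> k \<le> n \<Longrightarrow> P f"
    and add: "\<And>f g. f \<in> sym_le n \<Longrightarrow> g \<in> sym_le n \<Longrightarrow> P f \<Longrightarrow> P g \<Longrightarrow> P (\<lambda>x\<in>H. f x + g x)"
  shows "P f"
proof -
  obtain F where F: "f = (\<lambda>x\<in>H. \<Sum>i\<le>n. F i x)" "\<forall>i. F i \<in> sym_power i" using assms(1) unfolding sym_le_def by blast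
  have "P (\<lambda>x\<in>H. \<Sum>i\<in>A. F i x) \<and> (\<lambda>x\<in>H. \<Sum>i\<in>A. F i x) \<in> sym_le n" if "finite A" "A \<subseteq> {..n}" for A
    using that
  proof (induction A rule: finite_induct)
    case empty
    show ?case using power[OF sym_power_zero[of 0]] sym_le_zero by simp
  next
    case (insert i A)
    have "(\<lambda>x\<in>H. \<Sum>i\<in>insert i A. F i x) = (\<lambda>x\<in>H. F i x + (\<lambda>x\<in>H. \<Sum>i\<in>A. F i x) x)"
      by (rule restrict_ext) (use insert.hyps in simp)
    moreover have "F i \<in> sym_le n" "P (F i)" using F(2) insert.prems power by (auto intro: sym_le_power)
    ultimately show ?case using insert.IH insert.prems add sym_le_add by simp
  qed
  from this[of "{..n}"] show ?thesis using F(1) by simp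
qed

lemma sym_carrier_le: "f \<in> sym_carrier \<longleftrightarrow> (\<exists>n. f \<in> sym_le n)"
proof
  assume "f \<in> sym_carrier"
  then show "\<exists>n. f \<in> sym_le n"
  proof induct
    case (homogeneous f k)
    then show ?case using sym_le_power by blast
  next
    case (add f g)
    then obtain m n where "f \<in> sym_le m" "g \<in> sym_le n" by blast
    then have "f \<in> sym_le (max m n)" "g \<in> sym_le (max m n)" using sym_le_mono by (meson max.cobounded1 max.cobounded2 subsetD)+
    then show ?case using sym_le_add by blast
  qed
next
  assume "\<exists>n. f \<in> sym_le n"
  then obtain n where "f \<in> sym_le n" by blast
  then show "f \<in> sym_carrier" by (induct rule: sym_le_induct) (auto intro: sym_carrier.intros)
qed

lemma sym_le_carrier: "f \<in> sym_le n \<Longrightarrow> f \<in> sym_carrier"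
  using sym_carrier_le by blast

lemma sym_carrier_ext: "f \<in> sym_carrier \<Longrightarrow> f \<in> extensional H"
  by (induct rule: sym_carrier.induct) (auto simp: sym_power_ext)

lemma sym_carrier_mult:
  assumes "f \<in> sym_carrier" "g \<in> sym_carrier"
  shows "(\<lambda>x\<in>H. f x * g x) \<in> sym_carrier"
  using assms(1)
proof induct
  case (homogeneous f k)
  show ?case
    using assms(2)
  proof induct
    case (homogeneous g j)
    then show ?case using sym_power_mult[OF \<open>f \<in> sym_power k\<close>] sym_carrier.homogeneous by blast
  next
    case (add g h)
    have "(\<lambda>x\<in>H. f x * (\<lambda>x\<in>H. g x + h x) x) = (\<lambda>x\<in>H. (\<lambda>x\<in>H. f x * g x) x + (\<lambda>x\<in>H. f x * h x) x)"
      by (rule restrict_ext) (simp add: algebra_simps)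
    then show ?case using sym_carrier.add[OF add(2,4)] by simp
  qed
next
  case (add f h)
  have "(\<lambda>x\<in>H. (\<lambda>x\<in>H. f x + h x) x * g x) = (\<lambda>x\<in>H. (\<lambda>x\<in>H. f x * g x) x + (\<lambda>x\<in>H. h x * g x) x)"
    by (rule restrict_ext) (simp add: algebra_simps)
  then show ?case using sym_carrier.add[OF add(2,4)] by simp
qed

lemma sym_carrier_const: "(\<lambda>x\<in>H. a) \<in> sym_carrier"
  using sym_carrier.homogeneous[OF sym_power_const] .

lemma sym_carrier_scale: "f \<in> sym_carrier \<Longrightarrow> (\<lambda>x\<in>H. a * f x) \<in> sym_carrier"
  using sym_le_scale sym_carrier_le by meson

lemma sym_carrier_diff: "f \<in> sym_carrier \<Longrightarrow> g \<in> sym_carrier \<Longrightarrow> (\<lambda>x\<in>H. f x - g x) \<in> sym_carrier"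
proof -
  assume "f \<in> sym_carrier" "g \<in> sym_carrier"
  from sym_carrier.add[OF this(1) sym_carrier_scale[OF this(2), of "-1"]]
  show ?thesis by (simp cong: restrict_cong)
qed

lemma sym_carrier_act: "w \<in> weyl_group \<Longrightarrow> f \<in> sym_carrier \<Longrightarrow> act w f \<in> sym_carrier"
proof -
  assume w: "w \<in> weyl_group"
  assume "f \<in> sym_carrier"
  then show ?thesis
  proof induct
    case (homogeneous f k)
    then show ?case using sym_power_act[OF w] sym_carrier.homogeneous by blast
  next
    case (add f g)
    have "act w (\<lambda>x\<in>H. f x + g x) = (\<lambda>x\<in>H. act w f x + act w g x)"
      using Bij_app[OF weyl_Bij[OF weyl_inv[OF w]]] by (intro extensionalityI[OF act_ext]) (auto simp: act_app)
    then show ?case using sym_carrier.add[OF add(2,4)] by simp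
  qed
qed

text \<open>Restriction to lines reduces cancellation among polynomial functions to the finiteness
  of roots in one variable.\<close>

lemma polynomial_on_line:
  assumes "f \<in> sym_carrier" "x \<in> H" "z \<in> H"
  shows "\<exists>p. \<forall>c. f (x + c *s z) = poly p c"
  using assms(1)
proof induct
  case (homogeneous f k)
  then show ?case
  proof (induct rule: sym_power_induct)
    case (zero k)
    show ?case by (rule exI[of _ 0]) (simp add: H_add H_scale assms)
  next
    case (const a)
    show ?case by (rule exI[of _ "[:a:]"]) (simp add: H_add H_scale assms)
  next
    case (mult k \<phi> f)
    then obtain p where "\<forall>c. f (x + c *s z) = poly p c" by blast
    then show ?case using mult(1) assms
      by (intro exI[of _ "[:\<phi> x, \<phi> z:] * p"]) (simp add: H_add H_scale dual_add dual_scale algebra_simps)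
  next
    case (add k f g)
    then obtain p q where "\<forall>c. f (x + c *s z) = poly p c" "\<forall>c. g (x + c *s z) = poly q c" by blast
    then show ?case using assms by (intro exI[of _ "p + q"]) (simp add: H_add H_scale)
  qed
next
  case (add f g)
  then obtain p q where "\<forall>c. f (x + c *s z) = poly p c" "\<forall>c. g (x + c *s z) = poly q c" by blast
  then show ?case using assms by (intro exI[of _ "p + q"]) (simp add: H_add H_scale)
qed

text \<open>On the line through x in direction z, \<alpha> vanishes at one point only, so f vanishes
  elsewhere on the line and hence on all of it.\<close>

lemma linear_factor_cancel:
  assumes f: "f \<in> sym_carrier" and \<alpha>: "\<alpha> \<in> dual" "z \<in> H" "\<alpha> z \<noteq> 0"
    and 0: "\<And>x. x \<in> H \<Longrightarrow> \<alpha> x * f x = 0" and x: "x \<in> H"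
  shows "f x = 0"
proof -
  obtain p where p: "\<And>c. f (x + c *s z) = poly p c" using polynomial_on_line[OF f x \<alpha>(2)] by blast
  have "poly p c = 0" if "c \<noteq> - \<alpha> x / \<alpha> z" for c
  proof -
    have "\<alpha> (x + c *s z) = \<alpha> x + c * \<alpha> z" using \<alpha> x by (simp add: dual_add dual_scale H_scale)
    also have "\<dots> \<noteq> 0" using that \<alpha>(3) by (auto simp: field_simps add_eq_0_iff)
    finally show ?thesis using 0[of "x + c *s z"] p[of c] x \<alpha>(2) by (simp add: H_add H_scale)
  qed
  then have "UNIV - {- \<alpha> x / \<alpha> z} \<subseteq> {c. poly p c = 0}" by blast
  moreover have "infinite (UNIV - {- \<alpha> x / \<alpha> z})" by (simp add: infinite_UNIV_char_0)
  ultimately have "p = 0" using poly_roots_finite finite_subset by blast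
  then show ?thesis using p[of 0] by simp
qed

text \<open>A point that is good for \<open>F\<close> is moved in a direction on which the new form
  does not vanish; each form spoils at most one parameter.\<close>

lemma generic_point:
  assumes "finite F" "\<And>\<phi>. \<phi> \<in> F \<Longrightarrow> \<phi> \<in> dual" "\<And>\<phi>. \<phi> \<in> F \<Longrightarrow> \<exists>z\<in>H. \<phi> z \<noteq> 0"
  shows "\<exists>x\<in>H. \<forall>\<phi>\<in>F. \<phi> x \<noteq> 0"
  using assms
proof (induction F rule: finite_induct)
  case empty
  show ?case using H_zero by blast
next
  case (insert \<psi> F)
  obtain x where x: "x \<in> H" "\<And>\<phi>. \<phi> \<in> F \<Longrightarrow> \<phi> x \<noteq> 0" using insert.IH insert.prems by (metis insertCI)
  obtain z where z: "z \<in> H" "\<psi> z \<noteq> 0" using insert.prems(2)[of \<psi>] by blast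
  \<comment> \<open>If \<phi> z = 0, the quotient is 0 by convention. This excludes a harmless
    parameter, and such a form keeps its nonzero value along the line.\<close>
  let ?bad = "insert (- \<psi> x / \<psi> z) ((\<lambda>\<phi>. - \<phi> x / \<phi> z) ` F)"
  have "finite ?bad" using insert.hyps by simp
  then obtain c where c: "c \<notin> ?bad" using ex_new_if_finite[OF infinite_UNIV_char_0] by metis
  have "\<phi> (x + c *s z) \<noteq> 0" if p: "\<phi> \<in> insert \<psi> F" for \<phi>
  proof
    assume "\<phi> (x + c *s z) = 0"
    then have e: "\<phi> x + c * \<phi> z = 0" using insert.prems(1)[OF p] x z by (simp add: dual_add dual_scale H_scale)
    show False
    proof (cases "\<phi> z = 0")
      case True
      then have "\<phi> x = 0" using e by simp
      then show False using p x(2) z(2) True by blast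
    next
      case False
      then have "c = - \<phi> x / \<phi> z" using e by (simp add: field_simps eq_neg_iff_add_eq_0 add.commute)
      then show False using c p by blast
    qed
  qed
  then show ?case using x z by (intro bexI[of _ "x + c *s z"]) (auto simp: H_add H_scale)
qed

section \<open>The symmetric algebra as a ring\<close>

lemma sym_simps:
  "carrier sym_algebra = sym_carrier" "f \<otimes>\<^bsub>sym_algebra\<^esub> g = (\<lambda>x\<in>H. f x * g x)"
  "\<one>\<^bsub>sym_algebra\<^esub> = (\<lambda>x\<in>H. 1)" "\<zero>\<^bsub>sym_algebra\<^esub> = (\<lambda>x\<in>H. 0)"
  "f \<oplus>\<^bsub>sym_algebra\<^esub> g = (\<lambda>x\<in>H. f x + g x)" "a \<odot>\<^bsub>sym_algebra\<^esub> f = (\<lambda>x\<in>H. a * f x)"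
  by (simp_all add: sym_algebra_def)

lemma sym_cring: "cring sym_algebra"
proof (rule cringI)
  show "abelian_group sym_algebra"
  proof (rule abelian_groupI)
    fix f assume "f \<in> carrier sym_algebra"
    then have f: "f \<in> sym_carrier" by (simp add: sym_simps)
    show "\<exists>g\<in>carrier sym_algebra. g \<oplus>\<^bsub>sym_algebra\<^esub> f = \<zero>\<^bsub>sym_algebra\<^esub>"
      using sym_carrier_scale[OF f, of "-1"]
      by (intro bexI[of _ "\<lambda>x\<in>H. -1 * f x"]) (auto simp: sym_simps intro!: restrict_ext)
    show "\<zero>\<^bsub>sym_algebra\<^esub> \<oplus>\<^bsub>sym_algebra\<^esub> f = f"
      by (rule extensionalityI[of _ H]) (auto simp: sym_simps sym_carrier_ext f)
  qed (auto simp: sym_simps sym_carrier.add sym_carrier_const algebra_simps intro!: restrict_ext)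
  show "comm_monoid sym_algebra"
  proof (rule comm_monoidI)
    fix f assume "f \<in> carrier sym_algebra"
    then show "\<one>\<^bsub>sym_algebra\<^esub> \<otimes>\<^bsub>sym_algebra\<^esub> f = f"
      by (intro extensionalityI[of _ H]) (auto simp: sym_simps sym_carrier_ext)
  qed (auto simp: sym_simps sym_carrier_mult sym_carrier_const algebra_simps intro!: restrict_ext)
qed (auto simp: sym_simps algebra_simps intro!: restrict_ext)

text \<open>The negative is written as a product with a constant function, so that closure under
  multiplication yields closure under negation.\<close>

lemma sym_uminus:
  assumes "g \<in> sym_carrier"
  shows "\<ominus>\<^bsub>sym_algebra\<^esub> g = (\<lambda>x\<in>H. g x * (\<lambda>x\<in>H. - 1) x)"
proof -
  interpret S: cring sym_algebra by (rule sym_cring)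
  show ?thesis
  proof (rule S.minus_equality)
    show "(\<lambda>x\<in>H. g x * (\<lambda>x\<in>H. - 1) x) \<oplus>\<^bsub>sym_algebra\<^esub> g = \<zero>\<^bsub>sym_algebra\<^esub>"
      unfolding sym_simps by (rule restrict_ext) simp
  qed (use assms sym_carrier_mult[OF assms sym_carrier_const] in \<open>simp_all add: sym_simps\<close>)
qed

lemma sym_minus: "g \<in> sym_carrier \<Longrightarrow> f \<ominus>\<^bsub>sym_algebra\<^esub> g = (\<lambda>x\<in>H. f x - g x)"
  unfolding a_minus_def sym_uminus sym_simps by (rule restrict_ext) simp

section \<open>Divided differences of polynomials and their effect on the degree\<close>

section \<open>Demazure operators\<close>

text \<open>Constants have divided difference 0, and products follow the twisted Leibniz rule
  \<Delta>(\<phi> f) = \<phi> \<Delta>f + \<phi>(c) sf, with s the reflection and c the coroot. The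
  case distinction is there because no degree lies below 0.\<close>

lemma demazure_exists:
  assumes \<alpha>: "\<alpha> \<in> roots" and f: "f \<in> sym_power k"
  shows "\<exists>g. (case k of 0 \<Rightarrow> g = (\<lambda>x\<in>H. 0) | Suc j \<Rightarrow> g \<in> sym_power j) \<and>
    (\<forall>x\<in>H. \<alpha> x * g x = f x - f (reflection \<alpha> x))"
  using f
proof (induct rule: sym_power_induct)
  case (zero k)
  show ?case
    by (rule exI[of _ "\<lambda>x\<in>H. 0"]) (auto split: nat.split simp: sym_power_zero reflection_involution \<alpha>)
next
  case (const a)
  show ?case by (rule exI[of _ "\<lambda>x\<in>H. 0"]) (auto simp: reflection_involution \<alpha>)
next
  case (mult k \<phi> f)
  then obtain g where g: "case k of 0 \<Rightarrow> g = (\<lambda>x\<in>H. 0) | Suc j \<Rightarrow> g \<in> sym_power j"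
    "\<forall>x\<in>H. \<alpha> x * g x = f x - f (reflection \<alpha> x)" by blast
  let ?c = "\<phi> (coroot \<alpha>)"
  let ?g = "\<lambda>x\<in>H. (\<lambda>x\<in>H. \<phi> x * g x) x + (\<lambda>x\<in>H. ?c * act (reflection \<alpha>) f x) x"
  have "(\<lambda>x\<in>H. \<phi> x * g x) \<in> sym_power k"
  proof (cases k)
    case 0
    then have "(\<lambda>x\<in>H. \<phi> x * g x) = (\<lambda>x\<in>H. 0)" using g(1) by (auto intro: restrict_ext)
    then show ?thesis by (simp add: sym_power_zero)
  next
    case (Suc j)
    then show ?thesis using g(1) mult(1) by (auto intro: sym_power_mult_dual)
  qed
  moreover have "(\<lambda>x\<in>H. ?c * act (reflection \<alpha>) f x) \<in> sym_power k"
    by (intro sym_power_scale sym_power_act weyl_reflection \<alpha> mult)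
  ultimately have "?g \<in> sym_power k" by (rule sym_power_add)
  moreover have "\<alpha> x * ?g x = (\<lambda>x\<in>H. \<phi> x * f x) x - (\<lambda>x\<in>H. \<phi> x * f x) (reflection \<alpha> x)" if x: "x \<in> H" for x
  proof -
    have sx: "reflection \<alpha> x \<in> H" using \<alpha> x by (simp add: reflection_involution)
    have 1: "\<phi> (reflection \<alpha> x) = \<phi> x - \<alpha> x * ?c"
      using x \<alpha> mult(1) by (simp add: reflection_app dual_diff dual_scale H_scale coroot_H)
    have "\<alpha> x * ?g x = \<phi> x * (\<alpha> x * g x) + \<alpha> x * ?c * f (reflection \<alpha> x)"
      using x \<alpha> by (simp add: act_reflection_app algebra_simps)
    also have "\<dots> = \<phi> x * (f x - f (reflection \<alpha> x)) + \<alpha> x * ?c * f (reflection \<alpha> x)"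
      using g(2) x by simp
    also have "\<dots> = \<phi> x * f x - \<phi> (reflection \<alpha> x) * f (reflection \<alpha> x)"
      unfolding 1 by (simp add: algebra_simps)
    finally show ?thesis using x sx by simp
  qed
  ultimately show ?case by (intro exI[of _ ?g]) simp
next
  case (add k f h)
  then obtain g g' where g: "case k of 0 \<Rightarrow> g = (\<lambda>x\<in>H. 0) | Suc j \<Rightarrow> g \<in> sym_power j"
    "\<forall>x\<in>H. \<alpha> x * g x = f x - f (reflection \<alpha> x)"
    and g': "case k of 0 \<Rightarrow> g' = (\<lambda>x\<in>H. 0) | Suc j \<Rightarrow> g' \<in> sym_power j"
    "\<forall>x\<in>H. \<alpha> x * g' x = h x - h (reflection \<alpha> x)" by blast
  let ?g = "\<lambda>x\<in>H. g x + g' x"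
  have "case k of 0 \<Rightarrow> ?g = (\<lambda>x\<in>H. 0) | Suc j \<Rightarrow> ?g \<in> sym_power j"
    using g(1) g'(1) by (auto split: nat.splits intro: sym_power_add restrict_ext)
  moreover have "\<forall>x\<in>H. \<alpha> x * ?g x = (\<lambda>x\<in>H. f x + h x) x - (\<lambda>x\<in>H. f x + h x) (reflection \<alpha> x)"
    using g(2) g'(2) by (simp add: reflection_involution \<alpha> distrib_left add_diff_add)
  ultimately show ?case by blast
qed

text \<open>\<alpha> can be cancelled by \<open>linear_factor_cancel\<close>, so any polynomial
  solution of the defining equation is the one described in \<open>demazure\<close>.\<close>

lemma demazure_eqI:
  assumes \<alpha>: "\<alpha> \<in> roots" and f: "f \<in> sym_carrier" and g: "g \<in> sym_carrier"
    and eq: "\<And>x. x \<in> H \<Longrightarrow> \<alpha> x * g x = f x - f (reflection \<alpha> x)"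
  shows "demazure \<alpha> f = g"
  unfolding demazure_def
proof (rule the_equality)
  have af: "act (reflection \<alpha>) f \<in> sym_carrier" by (intro sym_carrier_act weyl_reflection \<alpha> f)
  show "g \<in> carrier sym_algebra \<and> \<alpha> \<otimes>\<^bsub>sym_algebra\<^esub> g = f \<ominus>\<^bsub>sym_algebra\<^esub> act (reflection \<alpha>) f"
    using g eq by (auto simp: sym_minus[OF af] sym_simps act_reflection_app \<alpha> intro!: restrict_ext)
  fix h assume h: "h \<in> carrier sym_algebra \<and> \<alpha> \<otimes>\<^bsub>sym_algebra\<^esub> h = f \<ominus>\<^bsub>sym_algebra\<^esub> act (reflection \<alpha>) f"
  then have hc: "h \<in> sym_carrier" and "(\<lambda>x\<in>H. \<alpha> x * h x) = (\<lambda>x\<in>H. f x - act (reflection \<alpha>) f x)"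
    by (auto simp: sym_minus[OF af] sym_simps)
  then have heq: "\<alpha> x * h x = f x - f (reflection \<alpha> x)" if "x \<in> H" for x
    using that \<alpha> by (auto dest: fun_cong[of _ _ x] simp: act_reflection_app)
  obtain z where z: "z \<in> H" "\<alpha> z \<noteq> 0" using root_nonzero[OF \<alpha>] by blast
  have "(\<lambda>x\<in>H. h x - g x) x = 0" if "x \<in> H" for x
    by (rule linear_factor_cancel[OF sym_carrier_diff[OF hc g] roots_dual[OF \<alpha>] z _ that])
      (simp add: right_diff_distrib heq eq)
  then show "h = g" using hc g sym_carrier_ext by (intro extensionalityI[of _ H]) auto
qed

lemma demazure_sym_power_Suc: "\<alpha> \<in> roots \<Longrightarrow> f \<in> sym_power (Suc k) \<Longrightarrow> demazure \<alpha> f \<in> sym_power k"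
proof -
  assume a: "\<alpha> \<in> roots" "f \<in> sym_power (Suc k)"
  obtain g where g: "g \<in> sym_power k" "\<forall>x\<in>H. \<alpha> x * g x = f x - f (reflection \<alpha> x)"
    using demazure_exists[OF a] by auto
  then have "demazure \<alpha> f = g" using a sym_carrier.homogeneous by (intro demazure_eqI) auto
  then show ?thesis using g by simp
qed

lemma demazure_sym_power_0: "\<alpha> \<in> roots \<Longrightarrow> f \<in> sym_power 0 \<Longrightarrow> demazure \<alpha> f = (\<lambda>x\<in>H. 0)"
proof -
  assume a: "\<alpha> \<in> roots" "f \<in> sym_power 0"
  obtain g where g: "g = (\<lambda>x\<in>H. 0)" "\<forall>x\<in>H. \<alpha> x * g x = f x - f (reflection \<alpha> x)"
    using demazure_exists[OF a] by auto
  then show ?thesis using a sym_carrier.homogeneous sym_carrier_const by (intro demazure_eqI) auto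
qed

lemma demazure_ex:
  assumes \<alpha>: "\<alpha> \<in> roots" and f: "f \<in> sym_carrier"
  shows "\<exists>g\<in>sym_carrier. \<forall>x\<in>H. \<alpha> x * g x = f x - f (reflection \<alpha> x)"
  using f
proof induct
  case (homogeneous f k)
  obtain g where g: "case k of 0 \<Rightarrow> g = (\<lambda>x\<in>H. 0) | Suc j \<Rightarrow> g \<in> sym_power j"
    "\<forall>x\<in>H. \<alpha> x * g x = f x - f (reflection \<alpha> x)"
    using demazure_exists[OF \<alpha> homogeneous] by blast
  have "g \<in> sym_carrier"
    using g(1) sym_carrier.homogeneous sym_carrier_const[of 0] by (cases k) auto
  then show ?case using g(2) by blast
next
  case (add f h)
  then obtain g g' where g: "g \<in> sym_carrier" "\<forall>x\<in>H. \<alpha> x * g x = f x - f (reflection \<alpha> x)"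
    and g': "g' \<in> sym_carrier" "\<forall>x\<in>H. \<alpha> x * g' x = h x - h (reflection \<alpha> x)" by blast
  then show ?case using sym_carrier.add[OF g(1) g'(1)]
    by (intro bexI[of _ "\<lambda>x\<in>H. g x + g' x"]) (auto simp: reflection_involution \<alpha> distrib_left add_diff_add)
qed

lemma demazure:
  assumes "\<alpha> \<in> roots" "f \<in> sym_carrier"
  shows "demazure \<alpha> f \<in> sym_carrier"
    and "x \<in> H \<Longrightarrow> \<alpha> x * demazure \<alpha> f x = f x - f (reflection \<alpha> x)"
  using demazure_ex[OF assms] demazure_eqI[OF assms] by auto

lemma demazure_add: "\<alpha> \<in> roots \<Longrightarrow> f \<in> sym_carrier \<Longrightarrow> g \<in> sym_carrier
    \<Longrightarrow> demazure \<alpha> (\<lambda>x\<in>H. f x + g x) = (\<lambda>x\<in>H. demazure \<alpha> f x + demazure \<alpha> g x)"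
  by (rule demazure_eqI) (auto simp: sym_carrier.add demazure distrib_left reflection_involution)

lemma demazure_scale: "\<alpha> \<in> roots \<Longrightarrow> f \<in> sym_carrier
    \<Longrightarrow> demazure \<alpha> (\<lambda>x\<in>H. a * f x) = (\<lambda>x\<in>H. a * demazure \<alpha> f x)"
  by (rule demazure_eqI)
    (auto simp: sym_carrier_scale demazure mult.left_commute right_diff_distrib reflection_involution)

lemma demazure_invariant_mult:
  assumes "\<alpha> \<in> roots" "f \<in> sym_carrier" "g \<in> sym_carrier" "act (reflection \<alpha>) g = g"
  shows "demazure \<alpha> (\<lambda>x\<in>H. g x * f x) = (\<lambda>x\<in>H. g x * demazure \<alpha> f x)"
proof (rule demazure_eqI)
  fix x assume x: "x \<in> H"
  have "g (reflection \<alpha> x) = g x" using assms(1,4) x act_reflection_app by metis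
  then have "\<alpha> x * (g x * demazure \<alpha> f x) = g x * f x - g (reflection \<alpha> x) * f (reflection \<alpha> x)"
    using demazure(2)[OF assms(1,2) x] by (simp add: mult.left_commute[of "\<alpha> x"] right_diff_distrib)
  then show "\<alpha> x * (\<lambda>x\<in>H. g x * demazure \<alpha> f x) x
      = (\<lambda>x\<in>H. g x * f x) x - (\<lambda>x\<in>H. g x * f x) (reflection \<alpha> x)"
    using x assms(1) by (simp add: reflection_involution)
qed (use assms in \<open>auto simp: sym_carrier_mult demazure\<close>)

lemma demazure_zero: "\<alpha> \<in> roots \<Longrightarrow> demazure \<alpha> (\<lambda>x\<in>H. 0) = (\<lambda>x\<in>H. 0)"
  by (simp add: demazure_sym_power_0 sym_power_zero)

lemma demazure_sym_le:
  assumes \<alpha>: "\<alpha> \<in> roots" and f: "f \<in> sym_le n"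
  shows "demazure \<alpha> f \<in> sym_le (n - 1)"
  using f
proof (induct rule: sym_le_induct)
  case (power k f)
  show ?case
  proof (cases k)
    case 0
    then show ?thesis using demazure_sym_power_0[OF \<alpha>] power sym_le_zero by simp
  next
    case (Suc j)
    then have "demazure \<alpha> f \<in> sym_power j" using demazure_sym_power_Suc[OF \<alpha>] power by simp
    then show ?thesis by (rule sym_le_power) (use power Suc in simp)
  qed
next
  case (add f g)
  then show ?case using demazure_add[OF \<alpha> sym_le_carrier sym_le_carrier] sym_le_add by simp
qed

lemma demazure_sym_le_0: "\<alpha> \<in> roots \<Longrightarrow> f \<in> sym_le 0 \<Longrightarrow> demazure \<alpha> f = (\<lambda>x\<in>H. 0)"
proof -
  assume a: "\<alpha> \<in> roots" "f \<in> sym_le 0"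
  then obtain F where F: "f = (\<lambda>x\<in>H. F 0 x)" "F 0 \<in> sym_power 0" unfolding sym_le_def by auto
  then have "f = F 0" using sym_power_ext by (auto intro!: extensionalityI[of _ H])
  then show ?thesis using demazure_sym_power_0 a F by simp
qed

text \<open>Defined for arbitrary words, with the first letter acting last as in
  \<open>word\<close>.\<close>

definition dem :: "('g \<Rightarrow> complex) list \<Rightarrow> ('g \<Rightarrow> complex) \<Rightarrow> 'g \<Rightarrow> complex" where
  "dem as f = foldr demazure as f"

lemma dem_simps: "dem [] f = f" "dem (\<alpha> # as) f = demazure \<alpha> (dem as f)" "dem (as @ bs) f = dem as (dem bs f)"
  by (simp_all add: dem_def)

lemma dem_carrier: "set as \<subseteq> roots \<Longrightarrow> f \<in> sym_carrier \<Longrightarrow> dem as f \<in> sym_carrier"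
  by (induction as) (auto simp: dem_simps demazure)

lemma dem_add: "set as \<subseteq> roots \<Longrightarrow> f \<in> sym_carrier \<Longrightarrow> g \<in> sym_carrier
    \<Longrightarrow> dem as (\<lambda>x\<in>H. f x + g x) = (\<lambda>x\<in>H. dem as f x + dem as g x)"
proof (induction as)
  case Nil
  then show ?case by (simp add: dem_simps)
qed (simp add: dem_simps dem_carrier demazure_add)

lemma dem_scale: "set as \<subseteq> roots \<Longrightarrow> f \<in> sym_carrier \<Longrightarrow> dem as (\<lambda>x\<in>H. a * f x) = (\<lambda>x\<in>H. a * dem as f x)"
proof (induction as)
  case Nil
  then show ?case by (simp add: dem_simps)
qed (simp add: dem_simps dem_carrier demazure_scale)

lemma dem_zero: "set as \<subseteq> roots \<Longrightarrow> dem as (\<lambda>x\<in>H. 0) = (\<lambda>x\<in>H. 0)"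
  by (induction as) (auto simp: dem_simps demazure_zero)

lemma dem_sym_power: "set as \<subseteq> roots \<Longrightarrow> f \<in> sym_power (length as + k) \<Longrightarrow> dem as f \<in> sym_power k"
  by (induction as arbitrary: k) (auto simp: dem_simps intro: demazure_sym_power_Suc)

lemma dem_sym_le: "set as \<subseteq> roots \<Longrightarrow> f \<in> sym_le n \<Longrightarrow> dem as f \<in> sym_le (n - length as)"
proof (induction as)
  case (Cons \<alpha> as)
  then show ?case using demazure_sym_le[of \<alpha> "dem as f" "n - length as"] by (simp add: dem_simps)
qed (simp add: dem_simps)

lemma dem_sym_le_zero:
  assumes "set as \<subseteq> roots" "f \<in> sym_le n" "n < length as"
  shows "dem as f = (\<lambda>x\<in>H. 0)"
proof -
  \<comment> \<open>Exactly n letters stand to the right of position \<open>?m\<close>. They lower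
    the degree to 0, and the letter at \<open>?m\<close> kills the resulting constant.\<close>
  let ?m = "length as - Suc n"
  have as: "as = take ?m as @ [as ! ?m] @ drop (Suc ?m) as"
    using assms(3) by (metis Cons_eq_appendI Cons_nth_drop_Suc append_take_drop_id diff_less self_append_conv2
        zero_less_Suc less_nat_zero_code linorder_neqE_nat)
  have r: "set (take ?m as) \<subseteq> roots" "as ! ?m \<in> roots" "set (drop (Suc ?m) as) \<subseteq> roots"
    using assms(1,3) set_take_subset[of ?m as] set_drop_subset[of "Suc ?m" as] by (auto simp: nth_mem subset_iff)
  have "dem (drop (Suc ?m) as) f \<in> sym_le (n - length (drop (Suc ?m) as))"
    by (rule dem_sym_le[OF r(3) assms(2)])
  then have "demazure (as ! ?m) (dem (drop (Suc ?m) as) f) = (\<lambda>x\<in>H. 0)"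
    using assms(3) by (intro demazure_sym_le_0[OF r(2)]) simp
  then have "dem as f = dem (take ?m as) (\<lambda>x\<in>H. 0)"
    by (subst as) (simp add: dem_simps)
  then show ?thesis using dem_zero[OF r(1)] by simp
qed

lemma dem_invariant_mult:
  assumes "set as \<subseteq> roots" "f \<in> sym_carrier" "g \<in> sym_carrier" "\<And>w. w \<in> weyl_group \<Longrightarrow> act w g = g"
  shows "dem as (\<lambda>x\<in>H. g x * f x) = (\<lambda>x\<in>H. g x * dem as f x)"
  using assms(1)
proof (induction as)
  case (Cons \<alpha> as)
  then show ?case using assms by (simp add: dem_simps dem_carrier demazure_invariant_mult weyl_reflection)
qed (simp add: dem_simps)

end


context semisimple_with_simple_roots
begin

section \<open>Demazure words as linear functionals on the values at a regular orbit\<close>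

section \<open>Evaluation on a generic orbit\<close>

text \<open>The hyperplanes to be avoided are the kernels of the roots and, for each nontrivial w,
  the kernel of w\<beta> - \<beta> for some root \<beta> moved by w.\<close>

lemma generic_orbit_exists:
  "\<exists>x\<in>H. (\<forall>\<beta>\<in>roots. \<beta> x \<noteq> 0) \<and> (\<forall>w\<in>weyl_group. w \<noteq> \<one>\<^bsub>\<G>\<^esub> \<longrightarrow> w x \<noteq> x)"
proof -
  have "\<forall>w\<in>weyl_group - {\<one>\<^bsub>\<G>\<^esub>}. \<exists>\<beta>. \<beta> \<in> roots \<and> act w \<beta> \<noteq> \<beta>" using act_trivial by blast
  from bchoice[OF this] obtain b where b: "\<And>w. w \<in> weyl_group \<Longrightarrow> w \<noteq> \<one>\<^bsub>\<G>\<^esub> \<Longrightarrow> b w \<in> roots \<and> act w (b w) \<noteq> b w"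
    by blast
  define \<phi> where "\<phi> w = (\<lambda>x\<in>H. 1 * act w (b w) x + (-1) * b w x)" for w
  let ?F = "roots \<union> \<phi> ` (weyl_group - {\<one>\<^bsub>\<G>\<^esub>})"
  have "\<exists>x\<in>H. \<forall>\<psi>\<in>?F. \<psi> x \<noteq> 0"
  proof (rule generic_point)
    show "finite ?F" using finite_roots finite_weyl by simp
    fix \<psi> assume p: "\<psi> \<in> ?F"
    have "\<phi> w \<in> dual" if "w \<in> weyl_group" "w \<noteq> \<one>\<^bsub>\<G>\<^esub>" for w
      unfolding \<phi>_def using b[OF that] act_dual[OF that(1)] roots_dual by (intro dual_comb) auto
    then show "\<psi> \<in> dual" using p roots_dual by blast
    show "\<exists>z\<in>H. \<psi> z \<noteq> 0"
    proof (cases "\<psi> \<in> roots")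
      case False
      then obtain w where w: "w \<in> weyl_group" "w \<noteq> \<one>\<^bsub>\<G>\<^esub>" "\<psi> = \<phi> w" using p by blast
      then obtain z where "z \<in> H" "act w (b w) z \<noteq> b w z"
        using b dual_neq[of "act w (b w)" "b w"] act_dual roots_dual by blast
      then show ?thesis using w(3) by (intro bexI[of _ z]) (auto simp: \<phi>_def)
    qed (rule root_nonzero)
  qed
  then obtain x where x: "x \<in> H" "\<And>\<psi>. \<psi> \<in> ?F \<Longrightarrow> \<psi> x \<noteq> 0" by blast
  have "w x \<noteq> x" if w: "w \<in> weyl_group" "w \<noteq> \<one>\<^bsub>\<G>\<^esub>" for w
  proof
    assume "w x = x"
    then have "(inv\<^bsub>\<G>\<^esub> w) x = x" using inv_app[OF weyl_Bij[OF w(1)] x(1)] by simp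
    then have "\<phi> w x = 0" using x(1) by (simp add: \<phi>_def act_app)
    then show False using x(2)[of "\<phi> w"] w by blast
  qed
  then show ?thesis using x by blast
qed

definition base_point :: 'g where
  "base_point = (SOME x. x \<in> H \<and> (\<forall>\<beta>\<in>roots. \<beta> x \<noteq> 0) \<and> (\<forall>w\<in>weyl_group. w \<noteq> \<one>\<^bsub>\<G>\<^esub> \<longrightarrow> w x \<noteq> x))"

lemma base_point: "base_point \<in> H" "\<beta> \<in> roots \<Longrightarrow> \<beta> base_point \<noteq> 0"
  "w \<in> weyl_group \<Longrightarrow> w base_point = base_point \<Longrightarrow> w = \<one>\<^bsub>\<G>\<^esub>"
proof -
  have "base_point \<in> H \<and> (\<forall>\<beta>\<in>roots. \<beta> base_point \<noteq> 0) \<and> (\<forall>w\<in>weyl_group. w \<noteq> \<one>\<^bsub>\<G>\<^esub> \<longrightarrow> w base_point \<noteq> base_point)"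
    unfolding base_point_def by (rule someI_ex) (use generic_orbit_exists in blast)
  then show "base_point \<in> H" "\<beta> \<in> roots \<Longrightarrow> \<beta> base_point \<noteq> 0"
    "w \<in> weyl_group \<Longrightarrow> w base_point = base_point \<Longrightarrow> w = \<one>\<^bsub>\<G>\<^esub>" by blast+
qed

text \<open>The inverse makes right multiplication of v by a simple reflection correspond to
  applying this reflection to the point, see \<open>pt_reflection\<close>.\<close>

definition pt :: "('g \<Rightarrow> 'g) \<Rightarrow> 'g" where
  "pt v = (inv\<^bsub>\<G>\<^esub> v) base_point"

lemma pt_H: "v \<in> weyl_group \<Longrightarrow> pt v \<in> H"
  using Bij_app[OF Bij_inv[OF weyl_Bij] base_point(1)] by (simp add: pt_def)

lemma pt_one: "pt \<one>\<^bsub>\<G>\<^esub> = base_point"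
  using monoid.inv_one[OF group.is_monoid[OF group_GH]] by (simp add: pt_def one_app base_point)

lemma pt_reflection: "v \<in> weyl_group \<Longrightarrow> \<alpha> \<in> simples \<Longrightarrow> pt (v \<otimes>\<^bsub>\<G>\<^esub> reflection \<alpha>) = reflection \<alpha> (pt v)"
  by (simp add: pt_def Bij_inv_mult weyl_Bij simple_reflection_Bij inv_reflection simple_root mult_app Bij_inv base_point)

lemma pt_root: "v \<in> weyl_group \<Longrightarrow> \<beta> \<in> roots \<Longrightarrow> \<beta> (pt v) \<noteq> 0"
  using base_point(2)[OF act_root[of v \<beta>]] base_point(1) by (simp add: pt_def act_app)

lemma pt_inj:
  assumes u: "u \<in> weyl_group" and v: "v \<in> weyl_group" and eq: "pt u = pt v"
  shows "u = v"
proof -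
  note B = weyl_Bij[OF u] weyl_Bij[OF v]
  have "(v \<otimes>\<^bsub>\<G>\<^esub> inv\<^bsub>\<G>\<^esub> u) base_point = v (pt u)" using B by (simp add: mult_app Bij_inv base_point pt_def)
  also have "\<dots> = v (pt v)" unfolding eq ..
  also have "\<dots> = base_point" unfolding pt_def by (rule app_inv[OF B(2) base_point(1)])
  finally have "v \<otimes>\<^bsub>\<G>\<^esub> inv\<^bsub>\<G>\<^esub> u = \<one>\<^bsub>\<G>\<^esub>" using u v by (intro base_point(3) weyl_mult weyl_inv)
  then have "(v \<otimes>\<^bsub>\<G>\<^esub> inv\<^bsub>\<G>\<^esub> u) \<otimes>\<^bsub>\<G>\<^esub> u = u" using B by (simp add: Bij_l_one)
  then show ?thesis using B by (simp add: Bij_assoc Bij_inv Bij_l_inv Bij_r_one)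
qed

lemma weyl_right_reindex:
  assumes "\<alpha> \<in> simples"
  shows "(\<Sum>v\<in>weyl_group. h (v \<otimes>\<^bsub>\<G>\<^esub> reflection \<alpha>)) = (\<Sum>v\<in>weyl_group. h v)"
proof (rule sum.reindex_bij_betw)
  show "bij_betw (\<lambda>v. v \<otimes>\<^bsub>\<G>\<^esub> reflection \<alpha>) weyl_group weyl_group"
    by (rule bij_betw_byWitness[where f' = "\<lambda>v. v \<otimes>\<^bsub>\<G>\<^esub> reflection \<alpha>"])
      (use assms in \<open>auto simp: right_cancel weyl_Bij intro: weyl_mult simple_reflection_weyl\<close>)
qed

lemma demazure_pt:
  assumes "\<alpha> \<in> simples" "f \<in> sym_carrier" "v \<in> weyl_group"
  shows "demazure \<alpha> f (pt v) = (f (pt v) - f (pt (v \<otimes>\<^bsub>\<G>\<^esub> reflection \<alpha>))) / \<alpha> (pt v)"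
  using demazure(2)[OF simple_root[OF assms(1)] assms(2) pt_H[OF assms(3)]] pt_root[OF assms(3) simple_root[OF assms(1)]] assms
  by (simp add: pt_reflection field_simps)

lemma set_simples_roots: "set as \<subseteq> simples \<Longrightarrow> set as \<subseteq> roots"
  using simples_roots by blast

text \<open>Appending a letter on the right replaces the value at \<open>pt v\<close> by values at
  \<open>pt v\<close> and \<open>pt (v s)\<close>, and lengths change by one; this gives the
  triangular support. The leading coefficient of a reduced word is, up to sign, a product of
  inverses of root values.\<close>

lemma dem_expansion:
  assumes "set as \<subseteq> simples"
  shows "\<exists>c. (\<forall>f\<in>sym_carrier. dem as f base_point = (\<Sum>v\<in>weyl_group. c v * f (pt v))) \<and>
    (\<forall>v\<in>weyl_group. c v \<noteq> 0 \<longrightarrow> len v < length as \<or> v = word as) \<and>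
    (len (word as) = length as \<longrightarrow> c (word as) \<noteq> 0)"
  using assms
proof (induction as rule: rev_induct)
  case Nil
  have "(\<Sum>v\<in>weyl_group. (if v = \<one>\<^bsub>\<G>\<^esub> then 1 else 0) * f (pt v)) = f base_point" for f :: "'g \<Rightarrow> complex"
    using finite_weyl weyl_one by (simp add: if_distrib[of "\<lambda>c. c * _"] sum.delta pt_one cong: if_cong)
  then show ?case
    by (intro exI[of _ "\<lambda>v. if v = \<one>\<^bsub>\<G>\<^esub> then 1 else 0"]) (auto simp: dem_simps word_Nil)
next
  case (snoc \<alpha> as)
  have as: "set as \<subseteq> simples" and \<alpha>: "\<alpha> \<in> simples" using snoc.prems by auto
  obtain c where c: "\<And>f. f \<in> sym_carrier \<Longrightarrow> dem as f base_point = (\<Sum>v\<in>weyl_group. c v * f (pt v))"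
    "\<And>v. v \<in> weyl_group \<Longrightarrow> c v \<noteq> 0 \<Longrightarrow> len v < length as \<or> v = word as"
    "len (word as) = length as \<Longrightarrow> c (word as) \<noteq> 0" using snoc.IH[OF as] by blast
  let ?s = "reflection \<alpha>"
  \<comment> \<open>The coefficient of the value at \<open>pt u\<close>: one contribution comes from
    v = u, the other from v = u s after reindexing the sum.\<close>
  define d where "d u = c u / \<alpha> (pt u) - c (u \<otimes>\<^bsub>\<G>\<^esub> ?s) / \<alpha> (pt (u \<otimes>\<^bsub>\<G>\<^esub> ?s))" for u
  have ws: "u \<otimes>\<^bsub>\<G>\<^esub> ?s \<in> weyl_group" if "u \<in> weyl_group" for u
    using that \<alpha> by (intro weyl_mult simple_reflection_weyl)
  have rc: "(u \<otimes>\<^bsub>\<G>\<^esub> ?s) \<otimes>\<^bsub>\<G>\<^esub> ?s = u" if "u \<in> weyl_group" for u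
    using that \<alpha> by (simp add: right_cancel weyl_Bij)
  have 1: "dem (as @ [\<alpha>]) f base_point = (\<Sum>v\<in>weyl_group. d v * f (pt v))" if f: "f \<in> sym_carrier" for f
  proof -
    have "dem (as @ [\<alpha>]) f base_point = (\<Sum>v\<in>weyl_group. c v * demazure \<alpha> f (pt v))"
      using c(1)[OF demazure(1)[OF simple_root[OF \<alpha>] f]] by (simp add: dem_simps)
    also have "\<dots> = (\<Sum>v\<in>weyl_group. c v / \<alpha> (pt v) * f (pt v) - c v / \<alpha> (pt v) * f (pt (v \<otimes>\<^bsub>\<G>\<^esub> ?s)))"
      by (rule sum.cong) (use \<alpha> f in \<open>auto simp: demazure_pt diff_divide_distrib right_diff_distrib\<close>)
    also have "\<dots> = (\<Sum>v\<in>weyl_group. c v / \<alpha> (pt v) * f (pt v))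
        - (\<Sum>v\<in>weyl_group. c v / \<alpha> (pt v) * f (pt (v \<otimes>\<^bsub>\<G>\<^esub> ?s)))" by (rule sum_subtractf)
    also have "(\<Sum>v\<in>weyl_group. c v / \<alpha> (pt v) * f (pt (v \<otimes>\<^bsub>\<G>\<^esub> ?s)))
        = (\<Sum>v\<in>weyl_group. c (v \<otimes>\<^bsub>\<G>\<^esub> ?s) / \<alpha> (pt (v \<otimes>\<^bsub>\<G>\<^esub> ?s)) * f (pt ((v \<otimes>\<^bsub>\<G>\<^esub> ?s) \<otimes>\<^bsub>\<G>\<^esub> ?s)))"
      by (rule weyl_right_reindex[OF \<alpha>, symmetric])
    also have "\<dots> = (\<Sum>v\<in>weyl_group. c (v \<otimes>\<^bsub>\<G>\<^esub> ?s) / \<alpha> (pt (v \<otimes>\<^bsub>\<G>\<^esub> ?s)) * f (pt v))"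
      by (rule sum.cong) (auto simp: rc)
    finally show ?thesis by (simp add: d_def sum_subtractf left_diff_distrib)
  qed
  have 2: "len u < length (as @ [\<alpha>]) \<or> u = word (as @ [\<alpha>])" if u: "u \<in> weyl_group" "d u \<noteq> 0" for u
  proof -
    have "c u \<noteq> 0 \<or> c (u \<otimes>\<^bsub>\<G>\<^esub> ?s) \<noteq> 0" using u(2) by (auto simp: d_def)
    then show ?thesis
    proof
      assume "c u \<noteq> 0"
      then show ?thesis using c(2)[OF u(1)] len_word_le[OF as] by auto
    next
      assume "c (u \<otimes>\<^bsub>\<G>\<^esub> ?s) \<noteq> 0"
      then consider "len (u \<otimes>\<^bsub>\<G>\<^esub> ?s) < length as" | "u \<otimes>\<^bsub>\<G>\<^esub> ?s = word as" using c(2)[OF ws[OF u(1)]] by blast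
      then show ?thesis
      proof cases
        case 1
        then show ?thesis using len_up_or_down[OF u(1) \<alpha>] by auto
      next
        case 2
        then show ?thesis using rc[OF u(1)] as \<alpha> by (simp add: word_snoc)
      qed
    qed
  qed
  have 3: "d (word (as @ [\<alpha>])) \<noteq> 0" if l: "len (word (as @ [\<alpha>])) = length (as @ [\<alpha>])"
  proof -
    let ?u = "word (as @ [\<alpha>])"
    have wa: "word as \<in> weyl_group" using as by (rule word_weyl)
    have u: "?u = word as \<otimes>\<^bsub>\<G>\<^esub> ?s" "?u \<in> weyl_group" using as \<alpha> ws[OF wa] by (simp_all add: word_snoc)
    have us: "?u \<otimes>\<^bsub>\<G>\<^esub> ?s = word as" using rc[OF wa] u by simp
    have "len (word as) = length as"
      using len_up_or_down[OF wa \<alpha>] l u(1) len_word_le[OF as] by auto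
    then have "c (word as) \<noteq> 0" "?u \<noteq> word as" using c(3) l by auto
    \<comment> \<open>The new element is longer than every element in the old support, so only one
      of the two contributions to \<open>d\<close> is present and no cancellation can occur.\<close>
    moreover have "c ?u = 0" using c(2)[OF u(2)] l \<open>?u \<noteq> word as\<close> by auto
    ultimately show ?thesis using pt_root[OF wa simple_root[OF \<alpha>]] by (simp add: d_def us)
  qed
  show ?case using 1 2 3 by blast
qed

section \<open>The bilinear form on the orbit and the adjoint of a Demazure word\<close>

section \<open>A pairing for which the Demazure operators are self-adjoint\<close>

definition Dp :: "'g \<Rightarrow> complex" where
  "Dp = (\<lambda>x\<in>H. \<Prod>\<beta>\<in>positive_roots. \<beta> x)"

lemma Dp_power: "Dp \<in> sym_power (card positive_roots)"
  unfolding Dp_def using finite_positive positive_root roots_dual by (intro sym_power_prod) auto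

lemma Dp_carrier: "Dp \<in> sym_carrier"
  by (rule sym_carrier.homogeneous[OF Dp_power])

lemma Dp_pt: "v \<in> weyl_group \<Longrightarrow> Dp (pt v) \<noteq> 0"
  using finite_positive pt_root positive_root by (simp add: Dp_def pt_H prod_zero_iff)

text \<open>The reflection negates \<alpha> and permutes the other positive roots.\<close>

lemma Dp_reflection:
  assumes \<alpha>: "\<alpha> \<in> simples" and x: "x \<in> H"
  shows "Dp (reflection \<alpha> x) = - Dp x"
proof -
  let ?s = "reflection \<alpha>" and ?P = "positive_roots - {\<alpha>}"
  note r = simple_root[OF \<alpha>]
  have sx: "?s x \<in> H" using r x by (simp add: reflection_involution)
  have ss: "act ?s (act ?s \<beta>) = \<beta>" if "\<beta> \<in> roots" for \<beta>
    using act_inv_act[OF reflection_Bij[OF r], of \<beta>] that by (simp add: inv_reflection r dual_ext roots_dual)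
  have stable: "act ?s \<beta> \<in> ?P" if b: "\<beta> \<in> ?P" for \<beta>
  proof -
    have "act ?s \<beta> \<noteq> \<alpha>"
    proof
      assume "act ?s \<beta> = \<alpha>"
      then have "\<beta> = neg_root \<alpha>" using ss[of \<beta>] b positive_root act_reflection_self[OF r] by force
      then show False using b positive_not_negative[OF simple_positive[OF \<alpha>]] by blast
    qed
    then show ?thesis using simple_permutes[OF \<alpha>] b by blast
  qed
  have split: "Dp y = \<alpha> y * (\<Prod>\<beta>\<in>?P. \<beta> y)" if "y \<in> H" for y
    using that simple_positive[OF \<alpha>] finite_positive by (simp add: Dp_def prod.remove[of positive_roots \<alpha>])
  have "(\<Prod>\<beta>\<in>?P. \<beta> (?s x)) = (\<Prod>\<beta>\<in>?P. act ?s \<beta> x)"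
    using x r by (simp add: act_reflection_app)
  also have "\<dots> = (\<Prod>\<beta>\<in>?P. \<beta> x)"
    by (rule prod.reindex_bij_witness[of _ "act ?s" "act ?s"]) (use stable ss positive_root in auto)
  finally have "(\<Prod>\<beta>\<in>?P. \<beta> (?s x)) = (\<Prod>\<beta>\<in>?P. \<beta> x)" .
  moreover have "\<alpha> (?s x) = - \<alpha> x" using act_reflection_app[OF r x, of \<alpha>] act_reflection_self[OF r] x by simp
  ultimately show ?thesis using split[OF x] split[OF sx] by simp
qed

text \<open>The classical formula for the value of \<Delta>_w0 (f g) at the base point. The usual
  sign of v is absorbed in \<open>Dp (pt v)\<close>, since D is anti-invariant.\<close>

definition pairing :: "('g \<Rightarrow> complex) \<Rightarrow> ('g \<Rightarrow> complex) \<Rightarrow> complex" where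
  "pairing f g = (\<Sum>v\<in>weyl_group. f (pt v) * g (pt v) / Dp (pt v))"

lemma pairing_demazure:
  assumes \<alpha>: "\<alpha> \<in> simples" and f: "f \<in> sym_carrier" and g: "g \<in> sym_carrier"
  shows "pairing (demazure \<alpha> f) g = pairing f (demazure \<alpha> g)"
proof -
  let ?t = "\<lambda>v. v \<otimes>\<^bsub>\<G>\<^esub> reflection \<alpha>"
  \<comment> \<open>The difference of the two summands. Under v -> v s its numerator changes sign,
    whereas \<alpha> and D both do, so their product does not; the sum over W is therefore
    0.\<close>
  define h where "h v = (f (pt v) * g (pt (?t v)) - f (pt (?t v)) * g (pt v)) / (\<alpha> (pt v) * Dp (pt v))" for v
  have "pairing (demazure \<alpha> f) g - pairing f (demazure \<alpha> g) = (\<Sum>v\<in>weyl_group. h v)"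
    unfolding pairing_def sum_subtractf[symmetric] h_def
    by (rule sum.cong) (use \<alpha> f g in \<open>auto simp: demazure_pt diff_divide_distrib algebra_simps\<close>)
  moreover have "h (?t v) = - h v" if v: "v \<in> weyl_group" for v
  proof -
    have "\<alpha> (pt (?t v)) = - \<alpha> (pt v)"
      using act_reflection_app[OF simple_root[OF \<alpha>] pt_H[OF v], of \<alpha>] act_reflection_self[OF simple_root[OF \<alpha>]] pt_H[OF v]
      by (simp add: pt_reflection v \<alpha>)
    moreover have "Dp (pt (?t v)) = - Dp (pt v)" using Dp_reflection[OF \<alpha> pt_H[OF v]] by (simp add: pt_reflection v \<alpha>)
    ultimately have "h (?t v) = (f (pt (?t v)) * g (pt v) - f (pt v) * g (pt (?t v))) / (\<alpha> (pt v) * Dp (pt v))"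
      unfolding h_def right_cancel[OF weyl_Bij[OF v] \<alpha>] by simp
    then show ?thesis unfolding h_def by (simp only: minus_divide_left minus_diff_eq)
  qed
  then have "(\<Sum>v\<in>weyl_group. h (?t v)) = - (\<Sum>v\<in>weyl_group. h v)" by (simp add: sum_negf[symmetric])
  then have "(\<Sum>v\<in>weyl_group. h v) = 0" using weyl_right_reindex[OF \<alpha>, of h] by simp
  ultimately show ?thesis by simp
qed

lemma pairing_dem:
  assumes "set as \<subseteq> simples" "f \<in> sym_carrier" "g \<in> sym_carrier"
  shows "pairing (dem as f) g = pairing f (dem (rev as) g)"
  using assms
proof (induction as arbitrary: g)
  case (Cons \<alpha> as)
  have "dem as f \<in> sym_carrier" "demazure \<alpha> g \<in> sym_carrier"
    using Cons.prems simple_root set_simples_roots by (auto intro: dem_carrier demazure)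
  then show ?case using Cons by (simp add: dem_simps pairing_demazure)
qed (simp add: dem_simps)

lemma pairing_zero: "pairing f (\<lambda>x\<in>H. 0) = 0"
  by (simp add: pairing_def pt_H)

text \<open>D cancels the denominators. Thus the constant left by a long word can be recovered from
  the pairing, where self-adjointness applies.\<close>

lemma pairing_const_Dp: "pairing (\<lambda>x\<in>H. a) Dp = a * of_nat (card weyl_group)"
proof -
  have "pairing (\<lambda>x\<in>H. a) Dp = (\<Sum>v\<in>weyl_group. a)"
    unfolding pairing_def by (rule sum.cong) (auto simp: pt_H Dp_pt)
  then show ?thesis by simp
qed

lemma card_weyl: "card weyl_group \<noteq> 0"
  using finite_weyl weyl_one by auto

section \<open>The invariant ideal degree by degree, and interpolation on the orbit with degree
  bounds\<close>

section \<open>The ideal of invariants\<close>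

text \<open>The part of the ideal in degree k, built from homogeneous products so that the degree is
  carried along, as the reduction of degree in \<open>hom_ideal_lower\<close> requires.\<close>

inductive hom_ideal :: "nat \<Rightarrow> ('g \<Rightarrow> complex) \<Rightarrow> bool" where
  zero: "hom_ideal k (\<lambda>x\<in>H. 0)"
| add: "hom_ideal k f \<Longrightarrow> hom_ideal k g \<Longrightarrow> hom_ideal k (\<lambda>x\<in>H. f x + g x)"
| mult: "g \<in> sym_power j \<Longrightarrow> j > 0 \<Longrightarrow> (\<And>w. w \<in> weyl_group \<Longrightarrow> act w g = g) \<Longrightarrow> h \<in> sym_power i
    \<Longrightarrow> hom_ideal (j + i) (\<lambda>x\<in>H. g x * h x)"

lemma hom_ideal_mult: "hom_ideal k f \<Longrightarrow> p \<in> sym_power i \<Longrightarrow> hom_ideal (k + i) (\<lambda>x\<in>H. f x * p x)"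
proof (induct rule: hom_ideal.induct)
  case (zero k)
  have "(\<lambda>x\<in>H. (\<lambda>x\<in>H. 0) x * p x) = (\<lambda>x\<in>H. 0)" by (rule restrict_ext) simp
  then show ?case using hom_ideal.zero by simp
next
  case (add k f g)
  have "(\<lambda>x\<in>H. (\<lambda>x\<in>H. f x + g x) x * p x) = (\<lambda>x\<in>H. (\<lambda>x\<in>H. f x * p x) x + (\<lambda>x\<in>H. g x * p x) x)"
    by (rule restrict_ext) (simp add: algebra_simps)
  then show ?case using hom_ideal.add add by simp
next
  case (mult g j h l)
  have "(\<lambda>x\<in>H. (\<lambda>x\<in>H. g x * h x) x * p x) = (\<lambda>x\<in>H. g x * (\<lambda>x\<in>H. h x * p x) x)"
    by (rule restrict_ext) simp
  then show ?case using hom_ideal.mult[OF mult(1,2,3) sym_power_mult[OF mult(4,5)]] by (simp add: add.assoc)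
qed

lemma hom_ideal_scale: "hom_ideal k f \<Longrightarrow> hom_ideal k (\<lambda>x\<in>H. a * f x)"
proof -
  assume "hom_ideal k f"
  from hom_ideal_mult[OF this sym_power_const[of a]]
  have "hom_ideal k (\<lambda>x\<in>H. f x * (\<lambda>x\<in>H. a) x)" by simp
  moreover have "(\<lambda>x\<in>H. f x * (\<lambda>x\<in>H. a) x) = (\<lambda>x\<in>H. a * f x)" by (rule restrict_ext) simp
  ultimately show ?thesis by simp
qed

lemma hom_ideal_sum:
  assumes "finite A" "\<And>i. i \<in> A \<Longrightarrow> hom_ideal k (f i)"
  shows "hom_ideal k (\<lambda>x\<in>H. \<Sum>i\<in>A. f i x)"
  using assms
proof (induction A rule: finite_induct)
  case (insert i A)
  have "(\<lambda>x\<in>H. \<Sum>i\<in>insert i A. f i x) = (\<lambda>x\<in>H. f i x + (\<lambda>x\<in>H. \<Sum>i\<in>A. f i x) x)"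
    by (rule restrict_ext) (use insert.hyps in simp)
  then show ?case using hom_ideal.add[OF insert.prems[of i] insert.IH] insert.prems by simp
qed (simp add: hom_ideal.zero)

lemma hom_ideal_act: "w \<in> weyl_group \<Longrightarrow> hom_ideal k f \<Longrightarrow> hom_ideal k (act w f)"
proof -
  assume w: "w \<in> weyl_group"
  note iH = Bij_app[OF weyl_Bij[OF weyl_inv[OF w]]]
  assume "hom_ideal k f"
  then show ?thesis
  proof (induct rule: hom_ideal.induct)
    case (zero k)
    have "act w (\<lambda>x\<in>H. 0) = (\<lambda>x\<in>H. 0)" unfolding act_def by (rule restrict_ext) (simp add: iH)
    then show ?case using hom_ideal.zero by simp
  next
    case (add k f g)
    have "act w (\<lambda>x\<in>H. f x + g x) = (\<lambda>x\<in>H. act w f x + act w g x)"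
      by (rule extensionalityI[OF act_ext]) (auto simp: act_app iH)
    then show ?case using hom_ideal.add add by simp
  next
    case (mult g j h i)
    have "act w (\<lambda>x\<in>H. g x * h x) = (\<lambda>x\<in>H. act w g x * act w h x)"
      by (rule extensionalityI[OF act_ext]) (auto simp: act_app iH)
    then show ?case using hom_ideal.mult[OF mult(1-3) sym_power_act[OF w mult(4)]] mult(3)[OF w] by simp
  qed
qed

lemma weyl_left_reindex:
  assumes "u \<in> weyl_group"
  shows "(\<Sum>v\<in>weyl_group. h (u \<otimes>\<^bsub>\<G>\<^esub> v)) = (\<Sum>v\<in>weyl_group. h v)"
proof (rule sum.reindex_bij_betw)
  show "bij_betw (\<lambda>v. u \<otimes>\<^bsub>\<G>\<^esub> v) weyl_group weyl_group"
    by (rule bij_betw_byWitness[where f' = "\<lambda>v. inv\<^bsub>\<G>\<^esub> u \<otimes>\<^bsub>\<G>\<^esub> v"])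
      (use assms in \<open>auto simp: Bij_assoc[symmetric] Bij_inv weyl_Bij Bij_l_inv Bij_r_inv Bij_l_one
        intro: weyl_mult weyl_inv\<close>)
qed

text \<open>If all \<open>\<Delta>\<^sub>s f\<close> lie in the ideal, then \<open>f\<close> is congruent to all its \<open>W\<close>-translates, hence to
  their average, which is an invariant.\<close>

lemma hom_ideal_if_killed:
  assumes "f \<in> sym_power k" "\<And>as. set as \<subseteq> simples \<Longrightarrow> length as = k \<Longrightarrow> dem as f 0 = 0"
  shows "hom_ideal k f"
  using assms
proof (induction k arbitrary: f)
  case 0
  then obtain a where f: "f = (\<lambda>x\<in>H. a)" by (auto simp: sym_power.simps)
  then have "a = 0" using 0(2)[of "[]"] H_zero by (simp add: dem_simps)
  then show ?case using f hom_ideal.zero by simp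
next
  case (Suc k)
  note fc = sym_carrier.homogeneous[OF Suc.prems(1)]
  have s: "hom_ideal (Suc k) (\<lambda>x\<in>H. f x - act (reflection \<alpha>) f x)" if \<alpha>: "\<alpha> \<in> simples" for \<alpha>
  proof -
    have "hom_ideal k (demazure \<alpha> f)"
    proof (rule Suc.IH[OF demazure_sym_power_Suc[OF simple_root[OF \<alpha>] Suc.prems(1)]])
      fix as assume "set as \<subseteq> simples" "length as = k"
      then show "dem as (demazure \<alpha> f) 0 = 0" using Suc.prems(2)[of "as @ [\<alpha>]"] \<alpha> by (simp add: dem_simps)
    qed
    from hom_ideal_mult[OF this sym_power_dual[OF roots_dual[OF simple_root[OF \<alpha>]]]]
    have "hom_ideal (Suc k) (\<lambda>x\<in>H. demazure \<alpha> f x * \<alpha> x)" by simp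
    moreover have "(\<lambda>x\<in>H. demazure \<alpha> f x * \<alpha> x) = (\<lambda>x\<in>H. f x - act (reflection \<alpha>) f x)"
      by (rule restrict_ext)
        (use demazure(2)[OF simple_root[OF \<alpha>] fc] \<alpha> in \<open>simp add: mult.commute act_reflection_app simple_root\<close>)
    ultimately show ?thesis by simp
  qed
  \<comment> \<open>Telescoping: f - s(uf) = (f - sf) + s(f - uf), and the homogeneous parts of the
    ideal are stable under s.\<close>
  have word: "hom_ideal (Suc k) (\<lambda>x\<in>H. f x - act (word as) f x)" if "set as \<subseteq> simples" for as
    using that
  proof (induction as)
    case Nil
    have "(\<lambda>x\<in>H. f x - act (word []) f x) = (\<lambda>x\<in>H. 0)"
      by (rule restrict_ext) (simp add: word_Nil act_one sym_carrier_ext fc)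
    then show ?case using hom_ideal.zero by simp
  next
    case (Cons \<alpha> as)
    then have \<alpha>: "\<alpha> \<in> simples" and as: "set as \<subseteq> simples" by auto
    note iH = Bij_app[OF weyl_Bij[OF weyl_inv[OF simple_reflection_weyl[OF \<alpha>]]]]
    have "(\<lambda>x\<in>H. f x - act (word (\<alpha> # as)) f x) = (\<lambda>x\<in>H. (\<lambda>x\<in>H. f x - act (reflection \<alpha>) f x) x
        + act (reflection \<alpha>) (\<lambda>x\<in>H. f x - act (word as) f x) x)"
      by (rule restrict_ext) (simp add: word_Cons act_mult simple_reflection_Bij \<alpha> word_Bij as act_app[of _ "reflection \<alpha>"] iH)
    then show ?case
      using hom_ideal.add[OF s[OF \<alpha>] hom_ideal_act[OF simple_reflection_weyl[OF \<alpha>] Cons.IH[OF as]]] by simp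
  qed
  let ?n = "of_nat (card weyl_group) :: complex"
  \<comment> \<open>The average has positive degree and is therefore itself in the ideal; f exceeds
    it by the mean of the differences f - wf.\<close>
  define avg where "avg = (\<lambda>x\<in>H. 1 / ?n * (\<lambda>x\<in>H. \<Sum>w\<in>weyl_group. act w f x) x)"
  have avg: "avg \<in> sym_power (Suc k)"
    unfolding avg_def by (intro sym_power_scale sym_power_sum sym_power_act Suc.prems)
  have inv: "act u avg = avg" if u: "u \<in> weyl_group" for u
  proof (rule extensionalityI[OF act_ext])
    fix x assume x: "x \<in> H"
    have ix: "(inv\<^bsub>\<G>\<^esub> u) x \<in> H" using Bij_app[OF weyl_Bij[OF weyl_inv[OF u]] x] .
    have "(\<Sum>w\<in>weyl_group. act w f ((inv\<^bsub>\<G>\<^esub> u) x)) = (\<Sum>w\<in>weyl_group. act (u \<otimes>\<^bsub>\<G>\<^esub> w) f x)"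
      by (rule sum.cong) (use u x in \<open>auto simp: act_mult weyl_Bij act_app[of _ u]\<close>)
    then show "act u avg x = avg x" using x ix weyl_left_reindex[OF u, of "\<lambda>w. act w f x"]
      by (simp add: act_app[of _ u] avg_def)
  qed (simp add: avg_def)
  have "hom_ideal (Suc k) (\<lambda>x\<in>H. avg x * (\<lambda>x\<in>H. 1) x)"
    using hom_ideal.mult[OF avg _ inv sym_power_const[of 1]] by simp
  then have 1: "hom_ideal (Suc k) avg"
    using sym_power_ext[OF avg] by (simp add: extensional_restrict cong: restrict_cong)
  have 2: "hom_ideal (Suc k) (\<lambda>x\<in>H. 1 / ?n * (\<lambda>x\<in>H. \<Sum>w\<in>weyl_group. (\<lambda>x\<in>H. f x - act w f x) x) x)"
    using weyl_word word by (intro hom_ideal_scale hom_ideal_sum finite_weyl) metis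
  have "f = (\<lambda>x\<in>H. (\<lambda>x\<in>H. 1 / ?n * (\<lambda>x\<in>H. \<Sum>w\<in>weyl_group. (\<lambda>x\<in>H. f x - act w f x) x) x) x + avg x)"
    by (rule extensionalityI[OF sym_power_ext[OF Suc.prems(1)]])
      (auto simp: avg_def sum_subtractf card_weyl field_simps)
  then show ?case using hom_ideal.add[OF 2 1] by simp
qed

lemma sym_power_0D: "f \<in> sym_power 0 \<Longrightarrow> f = (\<lambda>x\<in>H. f 0)"
  using H_zero by (auto simp: sym_power.simps)

text \<open>A word of length k turns f into a constant a, and pairing with D gives a|W|. Moving the
  word onto D gives 0, since k exceeds the degree of D. So f is killed by all words of length
  k.\<close>

lemma hom_ideal_high_degree:
  assumes f: "f \<in> sym_power k" and k: "k > card positive_roots"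
  shows "hom_ideal k f"
proof (rule hom_ideal_if_killed[OF f])
  fix as assume as: "set as \<subseteq> simples" "length as = k"
  note r = set_simples_roots[OF as(1)]
  let ?a = "dem as f 0"
  have "dem as f \<in> sym_power 0" using dem_sym_power[OF r, of f 0] f as(2) by simp
  then have c: "dem as f = (\<lambda>x\<in>H. ?a)" by (rule sym_power_0D)
  have "?a * of_nat (card weyl_group) = pairing (dem as f) Dp" using c pairing_const_Dp by metis
  also have "\<dots> = pairing f (dem (rev as) Dp)"
    by (rule pairing_dem[OF as(1) sym_carrier.homogeneous[OF f] Dp_carrier])
  also have "dem (rev as) Dp = (\<lambda>x\<in>H. 0)"
    by (rule dem_sym_le_zero[OF _ sym_le_power[OF Dp_power order_refl]]) (use r as(2) k in auto)
  finally show "?a = 0" using pairing_zero card_weyl by simp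
qed

lemma pt_invariant: "v \<in> weyl_group \<Longrightarrow> (\<And>w. w \<in> weyl_group \<Longrightarrow> act w g = g) \<Longrightarrow> g (pt v) = g base_point"
  by (metis act_app base_point(1) pt_def)

text \<open>On the orbit the invariant factor of a product is a constant, so the product agrees
  there with a function of smaller degree.\<close>

lemma hom_ideal_lower:
  assumes "hom_ideal k f" "k > 0"
  shows "\<exists>g\<in>sym_le (k - 1). \<forall>v\<in>weyl_group. g (pt v) = f (pt v)"
  using assms
proof (induct rule: hom_ideal.induct)
  case (zero k)
  show ?case by (rule bexI[OF _ sym_le_zero]) simp
next
  case (add k f g)
  then obtain f' g' where "f' \<in> sym_le (k - 1)" "\<forall>v\<in>weyl_group. f' (pt v) = f (pt v)"
    "g' \<in> sym_le (k - 1)" "\<forall>v\<in>weyl_group. g' (pt v) = g (pt v)" by blast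
  then show ?case by (intro bexI[of _ "\<lambda>x\<in>H. f' x + g' x"]) (auto simp: pt_H intro: sym_le_add)
next
  case (mult g j h i)
  have "(\<lambda>x\<in>H. g base_point * h x) \<in> sym_le (j + i - 1)"
    using mult(2) by (intro sym_le_scale sym_le_power[OF mult(4)]) simp
  then show ?case using pt_invariant[OF _ mult(3)] by (intro bexI[of _ "\<lambda>x\<in>H. g base_point * h x"]) (auto simp: pt_H)
qed

lemma sym_le_SucD: "f \<in> sym_le (Suc n) \<Longrightarrow> \<exists>g\<in>sym_le n. \<exists>h\<in>sym_power (Suc n). f = (\<lambda>x\<in>H. g x + h x)"
proof -
  assume "f \<in> sym_le (Suc n)"
  then obtain F where F: "f = (\<lambda>x\<in>H. \<Sum>i\<le>Suc n. F i x)" "\<forall>i. F i \<in> sym_power i" unfolding sym_le_def by blast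
  have "(\<lambda>x\<in>H. \<Sum>i\<le>n. F i x) \<in> sym_le n" unfolding sym_le_def using F(2) by blast
  moreover have "f = (\<lambda>x\<in>H. (\<lambda>x\<in>H. \<Sum>i\<le>n. F i x) x + F (Suc n) x)" unfolding F(1) by (rule restrict_ext) simp
  ultimately show ?thesis using F(2) by blast
qed

text \<open>A top component of degree above that of D lies in the ideal and can be traded for lower
  terms without changing the values on the orbit.\<close>

lemma orbit_reduce:
  assumes "f \<in> sym_carrier"
  shows "\<exists>g\<in>sym_le (card positive_roots). \<forall>v\<in>weyl_group. g (pt v) = f (pt v)"
proof -
  have "\<exists>g\<in>sym_le (card positive_roots). \<forall>v\<in>weyl_group. g (pt v) = f (pt v)" if "f \<in> sym_le n" for n f
    using that
  proof (induction n arbitrary: f)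
    case 0
    then show ?case using sym_le_mono[of 0 "card positive_roots"] by blast
  next
    case (Suc n)
    show ?case
    proof (cases "Suc n \<le> card positive_roots")
      case True
      then show ?thesis using Suc.prems sym_le_mono by blast
    next
      case False
      obtain g h where gh: "g \<in> sym_le n" "h \<in> sym_power (Suc n)" "f = (\<lambda>x\<in>H. g x + h x)"
        using sym_le_SucD[OF Suc.prems] by blast
      obtain h' where h': "h' \<in> sym_le n" "\<forall>v\<in>weyl_group. h' (pt v) = h (pt v)"
        using hom_ideal_lower[OF hom_ideal_high_degree[OF gh(2)]] False by auto
      obtain k where "k \<in> sym_le (card positive_roots)" "\<forall>v\<in>weyl_group. k (pt v) = (\<lambda>x\<in>H. g x + h' x) (pt v)"
        using Suc.IH[OF sym_le_add[OF gh(1) h'(1)]] by blast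
      then show ?thesis using h'(2) gh(3) by (intro bexI[of _ k]) (auto simp: pt_H)
    qed
  qed
  then show ?thesis using assms sym_carrier_le by blast
qed

text \<open>The function is a product of factors \<beta> - \<beta>(pt u), one for each u in
  \<open>A\<close>, where \<beta> is a root that distinguishes \<open>pt u\<close> from
  \<open>pt w\<close>.\<close>

lemma separating_function:
  assumes "finite A" "A \<subseteq> weyl_group" "w \<in> weyl_group" "w \<notin> A"
  shows "\<exists>f\<in>sym_carrier. f (pt w) \<noteq> 0 \<and> (\<forall>v\<in>A. f (pt v) = 0)"
  using assms
proof (induction A rule: finite_induct)
  case empty
  show ?case using empty by (intro bexI[of _ "\<lambda>x\<in>H. 1"]) (auto simp: sym_carrier_const pt_H)
next
  case (insert u A)
  obtain f where f: "f \<in> sym_carrier" "f (pt w) \<noteq> 0" "\<And>v. v \<in> A \<Longrightarrow> f (pt v) = 0"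
    using insert.IH insert.prems by auto
  have u: "u \<in> weyl_group" "u \<noteq> w" using insert.prems by auto
  have "pt w - pt u \<noteq> 0" using pt_inj[of w u] u insert.prems(2) by auto
  then obtain \<beta> where b: "\<beta> \<in> roots" "\<beta> (pt w - pt u) \<noteq> 0"
    using roots_separate[of "pt w - pt u"] H_diff pt_H u insert.prems(2) by blast
  then have ne: "\<beta> (pt w) \<noteq> \<beta> (pt u)" using pt_H u insert.prems(2) by (simp add: dual_diff roots_dual)
  let ?l = "\<lambda>x\<in>H. \<beta> x - (\<lambda>x\<in>H. \<beta> (pt u)) x"
  have "?l \<in> sym_carrier"
    by (rule sym_carrier_diff[OF sym_carrier.homogeneous[OF sym_power_dual[OF roots_dual[OF b(1)]]] sym_carrier_const])
  then have "(\<lambda>x\<in>H. ?l x * f x) \<in> sym_carrier" using f(1) by (rule sym_carrier_mult)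
  then show ?case using f ne pt_H u insert.prems
    by (intro bexI[of _ "\<lambda>x\<in>H. ?l x * f x"]) (auto simp: subset_iff)
qed

text \<open>The functions below play the role of double Schubert polynomials at the generic point: the one for
  the longest element exists by \<open>orbit_reduce\<close>, and Demazure operators produce the others from it.\<close>

lemma schubert_function:
  assumes "w \<in> weyl_group"
  shows "\<exists>f\<in>sym_le (len w). f (pt w) \<noteq> 0 \<and> (\<forall>v\<in>weyl_group. len v \<le> len w \<longrightarrow> v \<noteq> w \<longrightarrow> f (pt v) = 0)"
  using assms
proof (induction "card positive_roots - len w" arbitrary: w rule: less_induct)
  case less
  note w = less.prems
  show ?case
  proof (cases "w = longest")
    case True
    obtain f where f: "f \<in> sym_carrier" "f (pt w) \<noteq> 0" "\<forall>v\<in>weyl_group - {w}. f (pt v) = 0"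
      using separating_function[of "weyl_group - {w}" w] finite_weyl w by blast
    obtain g where "g \<in> sym_le (card positive_roots)" "\<forall>v\<in>weyl_group. g (pt v) = f (pt v)"
      using orbit_reduce[OF f(1)] by blast
    then show ?thesis using f w True longest(2) by (intro bexI[of _ g]) auto
  next
    case False
    then obtain \<alpha> where \<alpha>: "\<alpha> \<in> simples" "len (w \<otimes>\<^bsub>\<G>\<^esub> reflection \<alpha>) = Suc (len w)"
      using not_longest[OF w] by blast
    let ?t = "\<lambda>v. v \<otimes>\<^bsub>\<G>\<^esub> reflection \<alpha>"
    have tw: "?t v \<in> weyl_group" if "v \<in> weyl_group" for v
      using that \<alpha> by (intro weyl_mult simple_reflection_weyl)
    have "card positive_roots - len (?t w) < card positive_roots - len w"
      using \<alpha>(2) len_le[OF tw[OF w]] by simp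
    from less.hyps[OF this tw[OF w]] obtain Q where Q: "Q \<in> sym_le (Suc (len w))" "Q (pt (?t w)) \<noteq> 0"
      "\<And>v. v \<in> weyl_group \<Longrightarrow> len v \<le> Suc (len w) \<Longrightarrow> v \<noteq> ?t w \<Longrightarrow> Q (pt v) = 0"
      unfolding \<alpha>(2) by blast
    have Qc: "Q \<in> sym_carrier" by (rule sym_le_carrier[OF Q(1)])
    have "demazure \<alpha> Q \<in> sym_le (len w)" using demazure_sym_le[OF simple_root[OF \<alpha>(1)] Q(1)] by simp
    moreover have "demazure \<alpha> Q (pt w) \<noteq> 0"
    proof -
      have "?t w \<noteq> w" using \<alpha>(2) by auto
      then have "Q (pt w) = 0" using Q(3)[OF w] by auto
      then show ?thesis using Q(2) pt_root[OF w simple_root[OF \<alpha>(1)]] by (simp add: demazure_pt[OF \<alpha>(1) Qc w])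
    qed
    \<comment> \<open>Both v and v s have length at most \<open>len w\<close> + 1 and differ from w
      s, so Q vanishes at both points of the divided difference.\<close>
    moreover have "demazure \<alpha> Q (pt v) = 0" if v: "v \<in> weyl_group" "len v \<le> len w" "v \<noteq> w" for v
    proof -
      have "v \<noteq> ?t w" using v(2) \<alpha>(2) by auto
      then have 1: "Q (pt v) = 0" using Q(3)[OF v(1)] v(2) by simp
      have "?t v \<noteq> ?t w" using v(3) right_cancel[OF weyl_Bij[OF v(1)] \<alpha>(1)] right_cancel[OF weyl_Bij[OF w] \<alpha>(1)] by metis
      moreover have "len (?t v) \<le> Suc (len w)" using len_up_or_down[OF v(1) \<alpha>(1)] v(2) by auto
      ultimately have "Q (pt (?t v)) = 0" using Q(3)[OF tw[OF v(1)]] by blast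
      then show ?thesis using 1 by (simp add: demazure_pt[OF \<alpha>(1) Qc v(1)])
    qed
    ultimately show ?thesis by blast
  qed
qed

text \<open>Newton interpolation along the length: the values at elements of length j + 1 are
  corrected by multiples of their functions from \<open>schubert_function\<close>, which vanish at
  all other elements of length at most j + 1.\<close>

lemma interpolation:
  assumes f: "f \<in> sym_carrier"
  shows "\<exists>g\<in>sym_le j. \<forall>v\<in>weyl_group. len v \<le> j \<longrightarrow> g (pt v) = f (pt v)"
proof (induction j)
  case 0
  have "(\<lambda>x\<in>H. f base_point) \<in> sym_le 0" by (rule sym_le_power[OF sym_power_const]) simp
  then show ?case by (rule bexI[rotated]) (use len_zero base_point pt_one in auto)
next
  case (Suc j)
  then obtain g where g: "g \<in> sym_le j" "\<And>v. v \<in> weyl_group \<Longrightarrow> len v \<le> j \<Longrightarrow> g (pt v) = f (pt v)" by blast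
  have "\<forall>w\<in>weyl_group. \<exists>p. p \<in> sym_le (len w) \<and> p (pt w) \<noteq> 0 \<and> (\<forall>v\<in>weyl_group. len v \<le> len w \<longrightarrow> v \<noteq> w \<longrightarrow> p (pt v) = 0)"
    using schubert_function by blast
  from bchoice[OF this] obtain p where p: "\<And>w. w \<in> weyl_group \<Longrightarrow> p w \<in> sym_le (len w)"
    "\<And>w. w \<in> weyl_group \<Longrightarrow> p w (pt w) \<noteq> 0"
    "\<And>w v. w \<in> weyl_group \<Longrightarrow> v \<in> weyl_group \<Longrightarrow> len v \<le> len w \<Longrightarrow> v \<noteq> w \<Longrightarrow> p w (pt v) = 0" by blast
  let ?L = "{w \<in> weyl_group. len w = Suc j}"
  let ?q = "\<lambda>w. \<lambda>x\<in>H. (f (pt w) - g (pt w)) / p w (pt w) * p w x"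
  let ?h = "\<lambda>x\<in>H. g x + (\<lambda>x\<in>H. \<Sum>w\<in>?L. ?q w x) x"
  have "?q w \<in> sym_le (Suc j)" if "w \<in> ?L" for w using p(1)[of w] that by (intro sym_le_scale) auto
  then have "?h \<in> sym_le (Suc j)" using g(1) sym_le_mono[of j "Suc j"] by (intro sym_le_add sym_le_sum) auto
  moreover have "?h (pt v) = f (pt v)" if v: "v \<in> weyl_group" "len v \<le> Suc j" for v
  proof (cases "len v = Suc j")
    case True
    have "(\<Sum>w\<in>?L. ?q w (pt v)) = (\<Sum>w\<in>?L. if w = v then f (pt v) - g (pt v) else 0)"
      by (rule sum.cong) (use True v p in \<open>auto simp: pt_H\<close>)
    also have "\<dots> = f (pt v) - g (pt v)" using finite_weyl v(1) True by (simp add: sum.delta)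
    finally show ?thesis using v by (simp add: pt_H)
  next
    case False
    have "p w (pt v) = 0" if "w \<in> ?L" for w using p(3)[of w v] that v False by auto
    then have "(\<Sum>w\<in>?L. ?q w (pt v)) = 0" using v(1) by (intro sum.neutral) (simp add: pt_H)
    then show ?thesis using g(2)[OF v(1)] False v by (simp add: pt_H)
  qed
  ultimately show ?case by blast
qed

lemma dem_diff: "set as \<subseteq> roots \<Longrightarrow> f \<in> sym_carrier \<Longrightarrow> g \<in> sym_carrier
    \<Longrightarrow> dem as (\<lambda>x\<in>H. f x - g x) = (\<lambda>x\<in>H. dem as f x - dem as g x)"
proof -
  assume a: "set as \<subseteq> roots" "f \<in> sym_carrier" "g \<in> sym_carrier"
  have "(\<lambda>x\<in>H. f x - g x) = (\<lambda>x\<in>H. f x + (\<lambda>x\<in>H. -1 * g x) x)" by (rule restrict_ext) simp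
  then show ?thesis
    using dem_add[OF a(1,2) sym_carrier_scale[OF a(3)], of "-1"] dem_scale[OF a(1,3), of "-1"]
    by (auto intro!: restrict_ext)
qed

text \<open>An interpolant of degree below k is subtracted; every word of length k kills it.\<close>

lemma orbit_normalize:
  assumes f: "f \<in> sym_carrier"
  shows "\<exists>h\<in>sym_carrier. (\<forall>v\<in>weyl_group. len v < k \<longrightarrow> h (pt v) = 0) \<and>
    (\<forall>as. set as \<subseteq> simples \<longrightarrow> length as = k \<longrightarrow> dem as h = dem as f)"
proof (cases k)
  case 0
  then show ?thesis using f by blast
next
  case (Suc j)
  obtain g where g: "g \<in> sym_le j" "\<forall>v\<in>weyl_group. len v \<le> j \<longrightarrow> g (pt v) = f (pt v)"
    using interpolation[OF f] by blast
  let ?h = "\<lambda>x\<in>H. f x - g x"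
  have gc: "g \<in> sym_carrier" by (rule sym_le_carrier[OF g(1)])
  have "dem as ?h = dem as f" if as: "set as \<subseteq> simples" "length as = k" for as
  proof -
    note r = set_simples_roots[OF as(1)]
    have "dem as g = (\<lambda>x\<in>H. 0)" by (rule dem_sym_le_zero[OF r g(1)]) (use as Suc in simp)
    then show ?thesis using dem_diff[OF r f gc] sym_carrier_ext[OF dem_carrier[OF r f]]
      by (simp add: extensional_restrict cong: restrict_cong)
  qed
  then show ?thesis using sym_carrier_diff[OF f gc] g(2) Suc by (intro bexI[of _ ?h]) (auto simp: pt_H)
qed

lemma dem_at_zero_cases:
  assumes "set as \<subseteq> simples" "f \<in> sym_power k" "k \<noteq> length as"
  shows "dem as f 0 = 0"
proof (cases "k < length as")
  case True
  then show ?thesis using dem_sym_le_zero[OF set_simples_roots[OF assms(1)] sym_le_power[OF assms(2) order_refl]] H_zero by simp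
next
  case False
  then have "dem as f \<in> sym_power (k - length as)" using assms by (intro dem_sym_power set_simples_roots) auto
  then show ?thesis using sym_power_at_zero False assms(3) by auto
qed

text \<open>A word as long as the degree leaves a constant, so its value at 0 can be read off at the
  base point. This is the bridge between the ideal and the regular orbit.\<close>

lemma dem_at_zero:
  assumes "set as \<subseteq> simples" "f \<in> sym_power (length as)"
  shows "dem as f = (\<lambda>x\<in>H. dem as f 0)" "dem as f 0 = dem as f base_point"
proof -
  have "dem as f \<in> sym_power 0" using assms dem_sym_power[OF set_simples_roots[OF assms(1)], of f 0] by simp
  then show 1: "dem as f = (\<lambda>x\<in>H. dem as f 0)" by (rule sym_power_0D)
  show "dem as f 0 = dem as f base_point" by (subst (2) 1) (simp add: base_point)
qed

text \<open>After \<open>orbit_normalize\<close> the function vanishes at all elements shorter than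
  the word, and \<open>word as\<close> is one of them; so every term of \<open>dem_expansion\<close>
  is zero.\<close>

lemma dem_nonreduced:
  assumes as: "set as \<subseteq> simples" "len (word as) < length as" and f: "f \<in> sym_carrier"
  shows "dem as f 0 = 0"
  using f
proof induct
  case (homogeneous f k)
  note fc = sym_carrier.homogeneous[OF homogeneous]
  show ?case
  proof (cases "k = length as")
    case True
    obtain h where h: "h \<in> sym_carrier" "\<forall>v\<in>weyl_group. len v < k \<longrightarrow> h (pt v) = 0" "dem as h = dem as f"
      using orbit_normalize[OF fc, of k] as(1) True by blast
    obtain c where c: "dem as h base_point = (\<Sum>v\<in>weyl_group. c v * h (pt v))"
      "\<And>v. v \<in> weyl_group \<Longrightarrow> c v \<noteq> 0 \<Longrightarrow> len v < length as \<or> v = word as"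
      using dem_expansion[OF as(1)] h(1) by blast
    have "c v * h (pt v) = 0" if "v \<in> weyl_group" for v
      using c(2)[OF that] h(2) that as(2) True by (cases "c v = 0") auto
    then have "dem as f base_point = 0" using c(1) h(3) sum.neutral[of weyl_group "\<lambda>v. c v * h (pt v)"] by simp
    then show ?thesis using dem_at_zero(2)[OF as(1)] homogeneous True by simp
  qed (use dem_at_zero_cases[OF as(1) homogeneous] in blast)
next
  case (add f g)
  then show ?case using dem_add[OF set_simples_roots[OF as(1)]] H_zero by simp
qed

text \<open>On functions that vanish at all shorter elements only the leading term of
  \<open>dem_expansion\<close> survives; c is its coefficient and is the same for all h.\<close>

lemma dem_top_coefficient:
  assumes as: "set as \<subseteq> simples" "len (word as) = length as"
  shows "\<exists>c. c \<noteq> 0 \<and> (\<forall>h\<in>sym_carrier. (\<forall>v\<in>weyl_group. len v < length as \<longrightarrow> h (pt v) = 0)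
    \<longrightarrow> dem as h base_point = c * h (pt (word as)))"
proof -
  obtain c where c: "\<And>h. h \<in> sym_carrier \<Longrightarrow> dem as h base_point = (\<Sum>v\<in>weyl_group. c v * h (pt v))"
    "\<And>v. v \<in> weyl_group \<Longrightarrow> c v \<noteq> 0 \<Longrightarrow> len v < length as \<or> v = word as" "c (word as) \<noteq> 0"
    using dem_expansion[OF as(1)] as(2) by blast
  have "dem as h base_point = c (word as) * h (pt (word as))"
    if h: "h \<in> sym_carrier" "\<forall>v\<in>weyl_group. len v < length as \<longrightarrow> h (pt v) = 0" for h
  proof -
    have "(\<Sum>v\<in>weyl_group. c v * h (pt v)) = (\<Sum>v\<in>{word as}. c v * h (pt v))"
      by (rule sum.mono_neutral_right) (use finite_weyl word_weyl[OF as(1)] c(2) h(2) in auto)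
    then show ?thesis using c(1)[OF h(1)] by simp
  qed
  then show ?thesis using c(3) by blast
qed

text \<open>On normalized functions both words give nonzero multiples of the value at the same orbit
  point; l is the quotient of the two factors.\<close>

lemma dem_reduced_proportional:
  assumes as: "set as \<subseteq> simples" "len (word as) = length as"
    and bs: "set bs \<subseteq> simples" "length bs = length as" "word bs = word as"
  shows "\<exists>l. l \<noteq> 0 \<and> (\<forall>f\<in>sym_carrier. dem as f 0 = l * dem bs f 0)"
proof -
  obtain a where a: "a \<noteq> 0" "\<And>h. h \<in> sym_carrier \<Longrightarrow> (\<forall>v\<in>weyl_group. len v < length as \<longrightarrow> h (pt v) = 0)
    \<Longrightarrow> dem as h base_point = a * h (pt (word as))" using dem_top_coefficient[OF as] by blast
  obtain b where b: "b \<noteq> 0" "\<And>h. h \<in> sym_carrier \<Longrightarrow> (\<forall>v\<in>weyl_group. len v < length bs \<longrightarrow> h (pt v) = 0)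
    \<Longrightarrow> dem bs h base_point = b * h (pt (word bs))" using dem_top_coefficient[OF bs(1)] bs as by auto
  have "dem as f 0 = a / b * dem bs f 0" if "f \<in> sym_carrier" for f
    using that
  proof induct
    case (homogeneous f k)
    show ?case
    proof (cases "k = length as")
      case True
      obtain h where h: "h \<in> sym_carrier" "\<forall>v\<in>weyl_group. len v < k \<longrightarrow> h (pt v) = 0" "dem as h = dem as f" "dem bs h = dem bs f"
        using orbit_normalize[OF sym_carrier.homogeneous[OF homogeneous], of k] as(1) bs True by blast
      have "dem as f 0 = a * h (pt (word as))" "dem bs f 0 = b * h (pt (word as))"
        using a(2)[OF h(1)] b(2)[OF h(1)] h(2-4) True bs dem_at_zero(2)[OF as(1)] dem_at_zero(2)[OF bs(1)] homogeneous by auto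
      then show ?thesis using b(1) by simp
    next
      case False
      then show ?thesis using dem_at_zero_cases[OF as(1) homogeneous] dem_at_zero_cases[OF bs(1) homogeneous] bs(2) by simp
    qed
  next
    case (add f g)
    then show ?case using dem_add[OF set_simples_roots[OF as(1)]] dem_add[OF set_simples_roots[OF bs(1)]] H_zero
      by (simp add: algebra_simps)
  qed
  then show ?thesis using a(1) b(1) by (intro exI[of _ "a / b"]) simp
qed

text \<open>The reversed word also represents the longest element and turns the function of
  \<open>schubert_function\<close> for that element into a nonzero constant, whose pairing with D is
  nonzero. If the word killed D, self-adjointness would make this pairing vanish.\<close>

lemma dem_longest_Dp:
  assumes as: "set as \<subseteq> simples" "word as = longest" "length as = card positive_roots"
  shows "dem as Dp 0 \<noteq> 0"
proof
  assume z: "dem as Dp 0 = 0"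
  let ?bs = "rev as"
  have "inv\<^bsub>\<G>\<^esub> longest = longest" using longest len_inv[OF longest(1)] weyl_inv[OF longest(1)] by (intro longest_unique) auto
  then have bs: "set ?bs \<subseteq> simples" "word ?bs = longest" "length ?bs = card positive_roots"
    using as by (auto simp: word_rev)
  obtain c where c: "c \<noteq> 0" "\<And>h. h \<in> sym_carrier \<Longrightarrow> (\<forall>v\<in>weyl_group. len v < length ?bs \<longrightarrow> h (pt v) = 0)
    \<Longrightarrow> dem ?bs h base_point = c * h (pt (word ?bs))" using dem_top_coefficient[OF bs(1)] bs longest(2) by auto
  obtain f where f: "f \<in> sym_le (len longest)" "f (pt longest) \<noteq> 0"
    "\<forall>v\<in>weyl_group. len v \<le> len longest \<longrightarrow> v \<noteq> longest \<longrightarrow> f (pt v) = 0" using schubert_function[OF longest(1)] by blast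
  have fc: "f \<in> sym_carrier" by (rule sym_le_carrier[OF f(1)])
  have "\<forall>v\<in>weyl_group. len v < length ?bs \<longrightarrow> f (pt v) = 0" using f(3) bs(3) longest(2) by auto
  from c(2)[OF fc this] have "dem ?bs f base_point = c * f (pt longest)" unfolding bs(2) .
  then have nz: "dem ?bs f base_point \<noteq> 0" using c(1) f(2) by simp
  have "dem ?bs f \<in> sym_le 0" using dem_sym_le[OF set_simples_roots[OF bs(1)] f(1)] longest(2) bs(3) by simp
  then obtain F where "dem ?bs f = (\<lambda>x\<in>H. F (0::nat) x)" "F 0 \<in> sym_power 0" unfolding sym_le_def by auto
  then obtain a where a: "dem ?bs f = (\<lambda>x\<in>H. a)" using sym_power_0D by (metis restrict_ext restrict_apply')
  have "dem as Dp = (\<lambda>x\<in>H. dem as Dp 0)" by (rule dem_at_zero(1)[OF as(1)]) (simp add: Dp_power as(3))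
  then have "dem as Dp = (\<lambda>x\<in>H. 0)" unfolding z .
  then have "pairing (dem ?bs f) Dp = 0"
    using pairing_dem[OF bs(1) fc Dp_carrier] pairing_zero by simp
  then have "a = 0" using a pairing_const_Dp card_weyl by simp
  then show False using a nz base_point(1) by simp
qed

end


context semisimple_with_simple_roots
begin

section \<open>The coinvariant ideal detected by the values of Demazure words at 0\<close>

section \<open>The coinvariant algebra\<close>

abbreviation "invariant_generators \<equiv> {f. (\<exists>k>0. f \<in> sym_power k) \<and> (\<forall>w\<in>weyl_group. act w f = f)}"

lemma invariant_generators_carrier: "invariant_generators \<subseteq> carrier sym_algebra"
  by (auto simp: sym_simps intro: sym_carrier.homogeneous)

lemma ideal_coinvariant: "ideal coinvariant_ideal sym_algebra"
  unfolding coinvariant_ideal_def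
  using sym_cring invariant_generators_carrier by (intro ring.genideal_ideal cring.axioms(1))

lemma ideal_zero: "(\<lambda>x\<in>H. 0) \<in> coinvariant_ideal"
  and ideal_add: "f \<in> coinvariant_ideal \<Longrightarrow> g \<in> coinvariant_ideal \<Longrightarrow> (\<lambda>x\<in>H. f x + g x) \<in> coinvariant_ideal"
  and ideal_mult: "f \<in> coinvariant_ideal \<Longrightarrow> g \<in> sym_carrier \<Longrightarrow> (\<lambda>x\<in>H. f x * g x) \<in> coinvariant_ideal"
  and ideal_carrier: "f \<in> coinvariant_ideal \<Longrightarrow> f \<in> sym_carrier"
proof -
  interpret I: ideal coinvariant_ideal sym_algebra by (rule ideal_coinvariant)
  show "(\<lambda>x\<in>H. 0) \<in> coinvariant_ideal" using additive_subgroup.zero_closed[OF I.additive_subgroup_axioms] by (simp add: sym_simps)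
  show "f \<in> coinvariant_ideal \<Longrightarrow> g \<in> coinvariant_ideal \<Longrightarrow> (\<lambda>x\<in>H. f x + g x) \<in> coinvariant_ideal"
    using additive_subgroup.a_closed[OF I.additive_subgroup_axioms] by (simp add: sym_simps)
  show "f \<in> coinvariant_ideal \<Longrightarrow> g \<in> sym_carrier \<Longrightarrow> (\<lambda>x\<in>H. f x * g x) \<in> coinvariant_ideal"
    using I.I_r_closed by (simp add: sym_simps)
  show "f \<in> coinvariant_ideal \<Longrightarrow> f \<in> sym_carrier" using I.Icarr by (simp add: sym_simps)
qed

lemma hom_ideal_ideal: "hom_ideal k f \<Longrightarrow> f \<in> coinvariant_ideal"
proof (induct rule: hom_ideal.induct)
  case (mult g j h i)
  then have "g \<in> invariant_generators" by blast
  then have "g \<in> coinvariant_ideal" unfolding coinvariant_ideal_def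
    using ring.genideal_self[OF cring.axioms(1)[OF sym_cring] invariant_generators_carrier] by blast
  then show ?case using ideal_mult sym_carrier.homogeneous[OF mult(4)] by blast
qed (auto intro: ideal_zero ideal_add)

text \<open>The generated ideal as explicit sums of products, which allows induction over its
  elements. In contrast to \<open>hom_ideal\<close>, the cofactor h is an arbitrary
  polynomial.\<close>

inductive_set invariant_span :: "('g \<Rightarrow> complex) set" where
  zero: "(\<lambda>x\<in>H. 0) \<in> invariant_span"
| add: "f \<in> invariant_span \<Longrightarrow> g \<in> invariant_span \<Longrightarrow> (\<lambda>x\<in>H. f x + g x) \<in> invariant_span"
| mult: "g \<in> sym_power k \<Longrightarrow> k > 0 \<Longrightarrow> (\<And>w. w \<in> weyl_group \<Longrightarrow> act w g = g) \<Longrightarrow> h \<in> sym_carrier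
    \<Longrightarrow> (\<lambda>x\<in>H. g x * h x) \<in> invariant_span"

lemma invariant_span_carrier: "f \<in> invariant_span \<Longrightarrow> f \<in> sym_carrier"
  by (induct rule: invariant_span.induct)
    (auto intro: sym_carrier.add sym_carrier_const sym_carrier_mult sym_carrier.homogeneous)

lemma invariant_span_mult: "f \<in> invariant_span \<Longrightarrow> p \<in> sym_carrier \<Longrightarrow> (\<lambda>x\<in>H. f x * p x) \<in> invariant_span"
proof (induct rule: invariant_span.induct)
  case zero
  have "(\<lambda>x\<in>H. (\<lambda>x\<in>H. 0) x * p x) = (\<lambda>x\<in>H. 0)" by (rule restrict_ext) simp
  then show ?case using invariant_span.zero by simp
next
  case (add f g)
  have "(\<lambda>x\<in>H. (\<lambda>x\<in>H. f x + g x) x * p x) = (\<lambda>x\<in>H. (\<lambda>x\<in>H. f x * p x) x + (\<lambda>x\<in>H. g x * p x) x)"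
    by (rule restrict_ext) (simp add: algebra_simps)
  then show ?case using invariant_span.add add by simp
next
  case (mult g k h)
  have "(\<lambda>x\<in>H. (\<lambda>x\<in>H. g x * h x) x * p x) = (\<lambda>x\<in>H. g x * (\<lambda>x\<in>H. h x * p x) x)"
    by (rule restrict_ext) simp
  then show ?case using invariant_span.mult[OF mult(1,2,3) sym_carrier_mult[OF mult(4,5)]] by simp
qed

lemma invariant_span_ideal: "ideal invariant_span sym_algebra"
proof (rule idealI[OF cring.axioms(1)[OF sym_cring]])
  have inv: "inv\<^bsub>add_monoid sym_algebra\<^esub> f = (\<lambda>x\<in>H. f x * (\<lambda>x\<in>H. - 1) x)" if "f \<in> invariant_span" for f
    using sym_uminus[OF invariant_span_carrier[OF that]] by (simp add: a_inv_def)
  show "subgroup invariant_span (add_monoid sym_algebra)"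
  proof (rule subgroup.intro)
    show "invariant_span \<subseteq> carrier (add_monoid sym_algebra)"
      using invariant_span_carrier by (auto simp: sym_simps)
    show "inv\<^bsub>add_monoid sym_algebra\<^esub> f \<in> invariant_span" if "f \<in> invariant_span" for f
      unfolding inv[OF that] by (rule invariant_span_mult[OF that sym_carrier_const])
  qed (auto simp: sym_simps intro: invariant_span.intros)
  fix f p assume f: "f \<in> invariant_span" and "p \<in> carrier sym_algebra"
  then have p: "p \<in> sym_carrier" by (simp add: sym_simps)
  show 1: "f \<otimes>\<^bsub>sym_algebra\<^esub> p \<in> invariant_span" using invariant_span_mult[OF f p] by (simp add: sym_simps)
  have "p \<otimes>\<^bsub>sym_algebra\<^esub> f = f \<otimes>\<^bsub>sym_algebra\<^esub> p" unfolding sym_simps by (rule restrict_ext) simp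
  then show "p \<otimes>\<^bsub>sym_algebra\<^esub> f \<in> invariant_span" using 1 by simp
qed

lemma coinvariant_ideal_span: "coinvariant_ideal \<subseteq> invariant_span"
  unfolding coinvariant_ideal_def
proof (rule ring.genideal_minimal[OF cring.axioms(1)[OF sym_cring] invariant_span_ideal])
  show "invariant_generators \<subseteq> invariant_span"
  proof
    fix g assume "g \<in> invariant_generators"
    then obtain k where g: "g \<in> sym_power k" "k > 0" "\<And>w. w \<in> weyl_group \<Longrightarrow> act w g = g" by blast
    have "(\<lambda>x\<in>H. g x * (\<lambda>x\<in>H. 1) x) = g"
      by (rule extensionalityI[of _ H]) (auto simp: sym_power_ext[OF g(1)])
    then show "g \<in> invariant_span" using invariant_span.mult[OF g sym_carrier_const[of 1]] by simp
  qed
qed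

text \<open>Demazure operators are linear over W-invariants, and a homogeneous invariant of positive
  degree vanishes at 0.\<close>

lemma dem_ideal:
  assumes "f \<in> coinvariant_ideal" "set as \<subseteq> simples"
  shows "dem as f 0 = 0"
proof -
  note r = set_simples_roots[OF assms(2)]
  have "f \<in> invariant_span" using assms(1) coinvariant_ideal_span by blast
  then show ?thesis
  proof induct
    case zero
    then show ?case using dem_zero[OF r] H_zero by simp
  next
    case (add f g)
    then show ?case using dem_add[OF r invariant_span_carrier invariant_span_carrier] H_zero by simp
  next
    case (mult g k h)
    then show ?case
      using dem_invariant_mult[OF r mult(4) sym_carrier.homogeneous[OF mult(1)] mult(3)] sym_power_at_zero[OF mult(1,2)] H_zero
      by simp
  qed
qed

text \<open>At 0 a word of length k sees only the component of degree k, so each homogeneous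
  component satisfies the hypothesis of \<open>hom_ideal_if_killed\<close>.\<close>

lemma ideal_iff_dem:
  assumes f: "f \<in> sym_carrier"
  shows "f \<in> coinvariant_ideal \<longleftrightarrow> (\<forall>as. set as \<subseteq> simples \<longrightarrow> dem as f 0 = 0)"
proof
  assume *: "\<forall>as. set as \<subseteq> simples \<longrightarrow> dem as f 0 = 0"
  obtain n F where F: "f = (\<lambda>x\<in>H. \<Sum>i\<le>n. F i x)" "\<And>i. F i \<in> sym_power i"
    using f unfolding sym_carrier_le sym_le_def by blast
  have sum: "dem as (\<lambda>x\<in>H. \<Sum>i\<in>A. F i x) 0 = (\<Sum>i\<in>A. dem as (F i) 0) \<and> (\<lambda>x\<in>H. \<Sum>i\<in>A. F i x) \<in> sym_carrier"
    if as: "set as \<subseteq> simples" and A: "finite A" for as A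
    using A
  proof (induction A rule: finite_induct)
    case empty
    show ?case using dem_zero[OF set_simples_roots[OF as]] H_zero sym_carrier_const by simp
  next
    case (insert i A)
    have e: "(\<lambda>x\<in>H. \<Sum>i\<in>insert i A. F i x) = (\<lambda>x\<in>H. F i x + (\<lambda>x\<in>H. \<Sum>i\<in>A. F i x) x)"
      by (rule restrict_ext) (use insert.hyps in simp)
    have c: "F i \<in> sym_carrier" "(\<lambda>x\<in>H. \<Sum>i\<in>A. F i x) \<in> sym_carrier"
      using sym_carrier.homogeneous[OF F(2)] insert.IH by auto
    show ?case unfolding e using dem_add[OF set_simples_roots[OF as] c] insert sym_carrier.add[OF c] H_zero by simp
  qed
  have "F k \<in> coinvariant_ideal" if k: "k \<le> n" for k
  proof (rule hom_ideal_ideal[OF hom_ideal_if_killed[OF F(2)]])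
    fix as assume as: "set as \<subseteq> simples" "length as = k"
    have "0 = (\<Sum>i\<le>n. dem as (F i) 0)" using * sum[OF as(1), of "{..n}"] as(1) F(1) by simp
    also have "\<dots> = (\<Sum>i\<le>n. if i = k then dem as (F k) 0 else 0)"
      by (rule sum.cong) (use dem_at_zero_cases[OF as(1) F(2)] as(2) in auto)
    finally show "dem as (F k) 0 = 0" using k by (simp add: sum.delta)
  qed
  note FI = this
  have "(\<lambda>x\<in>H. \<Sum>i\<in>A. F i x) \<in> coinvariant_ideal" if "finite A" "A \<subseteq> {..n}" for A
    using that
  proof (induction A rule: finite_induct)
    case (insert i A)
    have "(\<lambda>x\<in>H. \<Sum>i\<in>insert i A. F i x) = (\<lambda>x\<in>H. F i x + (\<lambda>x\<in>H. \<Sum>i\<in>A. F i x) x)"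
      by (rule restrict_ext) (use insert.hyps in simp)
    then show ?case using ideal_add[OF FI[of i] insert.IH] insert.prems by simp
  qed (simp add: ideal_zero)
  from this[of "{..n}"] show "f \<in> coinvariant_ideal" using F(1) by simp
qed (use dem_ideal in blast)

section \<open>Coordinates indexed by W, their duality with the X_w, and invariance under
  W_J\<close>

section \<open>Coordinates\<close>

text \<open>The same choice as in \<open>demazure_elt\<close>, so that the X_w and the coordinates
  use identical words.\<close>

definition rword :: "('g \<Rightarrow> 'g) \<Rightarrow> ('g \<Rightarrow> complex) list" where
  "rword w = (SOME \<alpha>s. reduced_expression \<alpha>s w)"

lemma rword:
  assumes "w \<in> weyl_group"
  shows "set (rword w) \<subseteq> simples" "word (rword w) = w" "length (rword w) = len w"
  using someI_ex[OF reduced_exists[OF assms]] by (auto simp: rword_def reduced_expression_def)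

lemma demazure_elt_rword: "demazure_elt w = dem (rword w)"
proof -
  have "foldr (\<lambda>\<alpha> \<theta>. demazure \<alpha> \<circ> \<theta>) as id = dem as" for as
    by (induction as) (auto simp: dem_def)
  then show ?thesis by (simp add: demazure_elt_def rword_def)
qed

text \<open>The component of degree \<open>len w\<close> determines this value, being sent to the
  constant \<Delta>_w of it; the other degrees contribute 0.\<close>

definition coeff :: "('g \<Rightarrow> 'g) \<Rightarrow> ('g \<Rightarrow> complex) \<Rightarrow> complex" where
  "coeff w f = dem (rword w) f 0"

lemma coeff_add: "w \<in> weyl_group \<Longrightarrow> f \<in> sym_carrier \<Longrightarrow> g \<in> sym_carrier
    \<Longrightarrow> coeff w (\<lambda>x\<in>H. f x + g x) = coeff w f + coeff w g"
  and coeff_scale: "w \<in> weyl_group \<Longrightarrow> f \<in> sym_carrier \<Longrightarrow> coeff w (\<lambda>x\<in>H. a * f x) = a * coeff w f"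
  and coeff_diff: "w \<in> weyl_group \<Longrightarrow> f \<in> sym_carrier \<Longrightarrow> g \<in> sym_carrier
    \<Longrightarrow> coeff w (\<lambda>x\<in>H. f x - g x) = coeff w f - coeff w g"
  and coeff_zero: "w \<in> weyl_group \<Longrightarrow> coeff w (\<lambda>x\<in>H. 0) = 0"
  using set_simples_roots[OF rword(1)] H_zero by (simp_all add: coeff_def dem_add dem_scale dem_diff dem_zero)

lemma sym_carrier_sum:
  assumes "\<And>i. i \<in> A \<Longrightarrow> f i \<in> sym_carrier"
  shows "(\<lambda>x\<in>H. \<Sum>i\<in>A. f i x) \<in> sym_carrier"
proof (cases "finite A")
  case True
  then show ?thesis using assms
  proof (induction A rule: finite_induct)
    case (insert i A)
    have "(\<lambda>x\<in>H. \<Sum>i\<in>insert i A. f i x) = (\<lambda>x\<in>H. f i x + (\<lambda>x\<in>H. \<Sum>i\<in>A. f i x) x)"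
      by (rule restrict_ext) (use insert.hyps in simp)
    then show ?case using sym_carrier.add[OF insert.prems[of i] insert.IH] insert.prems by simp
  qed (simp add: sym_carrier_const)
qed (simp add: sym_carrier_const)

lemma coeff_sum:
  assumes "w \<in> weyl_group" "finite A" "\<And>i. i \<in> A \<Longrightarrow> f i \<in> sym_carrier"
  shows "coeff w (\<lambda>x\<in>H. \<Sum>i\<in>A. f i x) = (\<Sum>i\<in>A. coeff w (f i))"
  using assms(2,3)
proof (induction A rule: finite_induct)
  case (insert i A)
  have "(\<lambda>x\<in>H. \<Sum>i\<in>insert i A. f i x) = (\<lambda>x\<in>H. f i x + (\<lambda>x\<in>H. \<Sum>i\<in>A. f i x) x)"
    by (rule restrict_ext) (use insert.hyps in simp)
  then show ?case using insert coeff_add[OF assms(1) insert.prems[of i] sym_carrier_sum[of A f]] by simp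
qed (simp add: coeff_zero assms)

lemma coeff_degree: "w \<in> weyl_group \<Longrightarrow> f \<in> sym_power k \<Longrightarrow> k \<noteq> len w \<Longrightarrow> coeff w f = 0"
  unfolding coeff_def by (rule dem_at_zero_cases) (auto simp: rword)

lemma coeff_one: "coeff \<one>\<^bsub>\<G>\<^esub> f = f 0"
proof -
  have "rword \<one>\<^bsub>\<G>\<^esub> = []" using rword(3)[OF weyl_one] len_one by simp
  then show ?thesis by (simp add: coeff_def dem_simps)
qed

text \<open>Every word yields zero or a nonzero multiple of one coordinate, so the |W| coordinates
  detect as much as all words together.\<close>

lemma dem_coeff:
  assumes as: "set as \<subseteq> simples"
  shows "len (word as) = length as \<Longrightarrow> \<exists>l. l \<noteq> 0 \<and> (\<forall>f\<in>sym_carrier. dem as f 0 = l * coeff (word as) f)"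
    and "len (word as) \<noteq> length as \<Longrightarrow> f \<in> sym_carrier \<Longrightarrow> dem as f 0 = 0"
proof -
  note w = word_weyl[OF as]
  show "len (word as) = length as \<Longrightarrow> \<exists>l. l \<noteq> 0 \<and> (\<forall>f\<in>sym_carrier. dem as f 0 = l * coeff (word as) f)"
    unfolding coeff_def using rword[OF w] as by (intro dem_reduced_proportional) auto
  show "len (word as) \<noteq> length as \<Longrightarrow> f \<in> sym_carrier \<Longrightarrow> dem as f 0 = 0"
    using len_word_le[OF as] by (intro dem_nonreduced[OF as]) auto
qed

lemma ideal_iff_coeff:
  assumes f: "f \<in> sym_carrier"
  shows "f \<in> coinvariant_ideal \<longleftrightarrow> (\<forall>w\<in>weyl_group. coeff w f = 0)"
proof
  assume *: "\<forall>w\<in>weyl_group. coeff w f = 0"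
  show "f \<in> coinvariant_ideal"
    unfolding ideal_iff_dem[OF f]
  proof (intro allI impI)
    fix as assume as: "set as \<subseteq> simples"
    show "dem as f 0 = 0"
      using dem_coeff[OF as] * word_weyl[OF as] f by (cases "len (word as) = length as") auto
  qed
qed (use ideal_iff_dem[OF f] rword in \<open>auto simp: coeff_def\<close>)

definition X_rep :: "('g \<Rightarrow> 'g) \<Rightarrow> 'g \<Rightarrow> complex" where
  "X_rep w = dem (rword (inv\<^bsub>\<G>\<^esub> w \<otimes>\<^bsub>\<G>\<^esub> longest)) top_class"

lemma top_class_Dp: "top_class = (\<lambda>x\<in>H. 1 / of_nat (card weyl_group) * Dp x)"
  unfolding top_class_def Dp_def by (rule restrict_ext) simp

lemma top_class_power: "top_class \<in> sym_power (card positive_roots)"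
  unfolding top_class_Dp by (rule sym_power_scale[OF Dp_power])

lemma complement_weyl: "w \<in> weyl_group \<Longrightarrow> inv\<^bsub>\<G>\<^esub> w \<otimes>\<^bsub>\<G>\<^esub> longest \<in> weyl_group"
  by (intro weyl_mult weyl_inv longest)

lemma X_rep_power: "w \<in> weyl_group \<Longrightarrow> X_rep w \<in> sym_power (len w)"
  unfolding X_rep_def using rword[OF complement_weyl] len_inv_longest[of w] top_class_power
  by (intro dem_sym_power set_simples_roots) auto

lemma X_rep_carrier: "w \<in> weyl_group \<Longrightarrow> X_rep w \<in> sym_carrier"
  by (rule sym_carrier.homogeneous[OF X_rep_power])

text \<open>The coefficient is a word for u w^-1 w_0 applied to a multiple of D. If the lengths of u
  and w agree, the word has as many letters as D has degree, and a nonzero value requires the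
  product w_0, that is u = w. If they differ, the degrees do not match.\<close>

lemma coeff_X_rep:
  assumes u: "u \<in> weyl_group" and w: "w \<in> weyl_group"
  shows "u \<noteq> w \<Longrightarrow> coeff u (X_rep w) = 0" "coeff w (X_rep w) \<noteq> 0"
proof -
  note B = weyl_Bij[OF u] weyl_Bij[OF w] weyl_Bij[OF longest(1)]
  let ?as = "\<lambda>u. rword u @ rword (inv\<^bsub>\<G>\<^esub> w \<otimes>\<^bsub>\<G>\<^esub> longest)"
  have c: "coeff v (X_rep w) = dem (?as v) top_class 0" for v
    by (simp add: coeff_def X_rep_def dem_simps)
  have as: "set (?as v) \<subseteq> simples" "word (?as v) = v \<otimes>\<^bsub>\<G>\<^esub> (inv\<^bsub>\<G>\<^esub> w \<otimes>\<^bsub>\<G>\<^esub> longest)"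
    "length (?as v) + len w = len v + card positive_roots" if v: "v \<in> weyl_group" for v
    using rword[OF v] rword[OF complement_weyl[OF w]] len_inv_longest[OF w] by (auto simp: word_append)
  have tc: "top_class \<in> sym_carrier" by (rule sym_carrier.homogeneous[OF top_class_power])
  show "coeff u (X_rep w) = 0" if "u \<noteq> w"
  proof (cases "len u = len w")
    case True
    have "word (?as u) \<noteq> longest"
    proof
      assume "word (?as u) = longest"
      then have "(u \<otimes>\<^bsub>\<G>\<^esub> inv\<^bsub>\<G>\<^esub> w) \<otimes>\<^bsub>\<G>\<^esub> longest = \<one>\<^bsub>\<G>\<^esub> \<otimes>\<^bsub>\<G>\<^esub> longest"
        using as(2)[OF u] B by (simp add: Bij_assoc Bij_inv Bij_l_one)
      then have "u \<otimes>\<^bsub>\<G>\<^esub> inv\<^bsub>\<G>\<^esub> w = \<one>\<^bsub>\<G>\<^esub>"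
        using group.right_cancel[OF group_GH] B by (simp add: carrier_GH Bij_closed Bij_inv Bij_one)
      then have "(u \<otimes>\<^bsub>\<G>\<^esub> inv\<^bsub>\<G>\<^esub> w) \<otimes>\<^bsub>\<G>\<^esub> w = w" using B by (simp add: Bij_l_one)
      then show False using that B by (simp add: Bij_assoc Bij_inv Bij_l_inv Bij_r_one)
    qed
    then have "len (word (?as u)) \<noteq> card positive_roots" using longest_unique word_weyl[OF as(1)[OF u]] by blast
    then show ?thesis using dem_coeff(2)[OF as(1)[OF u] _ tc] as(3)[OF u] True by (simp add: c)
  next
    case False
    then show ?thesis unfolding c using as[OF u] by (intro dem_at_zero_cases[OF _ top_class_power]) auto
  qed
  have wl: "word (?as w) = longest"
    using as(2)[OF w] B by (simp add: Bij_assoc[symmetric] Bij_inv Bij_r_inv Bij_l_one)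
  have "dem (?as w) top_class 0 = 1 / of_nat (card weyl_group) * dem (?as w) Dp 0"
    unfolding top_class_Dp dem_scale[OF set_simples_roots[OF as(1)[OF w]] Dp_carrier] using H_zero by simp
  then show "coeff w (X_rep w) \<noteq> 0"
    using dem_longest_Dp[OF as(1)[OF w] wl] as(3)[OF w] card_weyl by (simp add: c)
qed

text \<open>The operator changes sign on sf. As 2 is invertible, \<Delta>f can thus be recovered
  from f - sf.\<close>

lemma demazure_neg_act:
  assumes \<alpha>: "\<alpha> \<in> roots" and f: "f \<in> sym_carrier"
  shows "demazure \<alpha> (\<lambda>x\<in>H. f x - act (reflection \<alpha>) f x) = (\<lambda>x\<in>H. 2 * demazure \<alpha> f x)"
proof (rule demazure_eqI[OF \<alpha>])
  show "(\<lambda>x\<in>H. f x - act (reflection \<alpha>) f x) \<in> sym_carrier"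
    by (intro sym_carrier_diff sym_carrier_act weyl_reflection \<alpha> f)
  show "(\<lambda>x\<in>H. 2 * demazure \<alpha> f x) \<in> sym_carrier" by (intro sym_carrier_scale demazure \<alpha> f)
  fix x assume x: "x \<in> H"
  have "\<alpha> x * (2 * demazure \<alpha> f x) = 2 * (f x - f (reflection \<alpha> x))"
    unfolding demazure(2)[OF \<alpha> f x, symmetric] by (rule mult.left_commute)
  then show "\<alpha> x * (\<lambda>x\<in>H. 2 * demazure \<alpha> f x) x = (\<lambda>x\<in>H. f x - act (reflection \<alpha>) f x) x
      - (\<lambda>x\<in>H. f x - act (reflection \<alpha>) f x) (reflection \<alpha> x)"
    using x \<alpha> by (simp add: act_reflection_app reflection_involution algebra_simps)
qed

lemma demazure_ideal: "\<alpha> \<in> simples \<Longrightarrow> f \<in> coinvariant_ideal \<Longrightarrow> demazure \<alpha> f \<in> coinvariant_ideal"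
proof -
  assume \<alpha>: "\<alpha> \<in> simples" and f: "f \<in> coinvariant_ideal"
  note fc = ideal_carrier[OF f]
  have "dem as (demazure \<alpha> f) 0 = 0" if "set as \<subseteq> simples" for as
    using dem_ideal[OF f, of "as @ [\<alpha>]"] that \<alpha> by (simp add: dem_simps)
  then show ?thesis using ideal_iff_dem[OF demazure(1)[OF simple_root[OF \<alpha>] fc]] by blast
qed

lemma reflection_difference:
  "\<alpha> \<in> roots \<Longrightarrow> f \<in> sym_carrier \<Longrightarrow> (\<lambda>x\<in>H. f x - act (reflection \<alpha>) f x) = (\<lambda>x\<in>H. demazure \<alpha> f x * \<alpha> x)"
  by (rule restrict_ext) (simp add: demazure(2)[symmetric] act_reflection_app mult.commute)

text \<open>The Demazure operator preserves the ideal and sends f - sf to 2\<Delta>f; multiplication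
  of \<Delta>f by \<alpha> leads back.\<close>

lemma congruent_reflection_iff:
  assumes \<alpha>: "\<alpha> \<in> simples" and f: "f \<in> sym_carrier"
  shows "(\<lambda>x\<in>H. f x - act (reflection \<alpha>) f x) \<in> coinvariant_ideal \<longleftrightarrow> demazure \<alpha> f \<in> coinvariant_ideal"
proof
  note r = simple_root[OF \<alpha>]
  assume "(\<lambda>x\<in>H. f x - act (reflection \<alpha>) f x) \<in> coinvariant_ideal"
  then have "(\<lambda>x\<in>H. 2 * demazure \<alpha> f x) \<in> coinvariant_ideal"
    using demazure_ideal[OF \<alpha>] demazure_neg_act[OF r f] by metis
  from ideal_mult[OF this sym_carrier_const[of "1 / 2"]]
  have "(\<lambda>x\<in>H. (\<lambda>x\<in>H. 2 * demazure \<alpha> f x) x * (\<lambda>x\<in>H. 1 / 2) x) \<in> coinvariant_ideal" .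
  also have "(\<lambda>x\<in>H. (\<lambda>x\<in>H. 2 * demazure \<alpha> f x) x * (\<lambda>x\<in>H. 1 / 2) x) = demazure \<alpha> f"
    by (rule extensionalityI[of _ H]) (auto simp: sym_carrier_ext demazure(1)[OF r f])
  finally show "demazure \<alpha> f \<in> coinvariant_ideal" .
next
  assume "demazure \<alpha> f \<in> coinvariant_ideal"
  then show "(\<lambda>x\<in>H. f x - act (reflection \<alpha>) f x) \<in> coinvariant_ideal"
    unfolding reflection_difference[OF simple_root[OF \<alpha>] f]
    using sym_carrier.homogeneous[OF sym_power_dual[OF roots_dual[OF simple_root[OF \<alpha>]]]] by (rule ideal_mult)
qed

text \<open>Congruence modulo the ideal, expressed by coordinates so that it is visibly an
  equivalence relation; \<open>congr_iff\<close> gives the form with the ideal.\<close>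

definition congr :: "('g \<Rightarrow> complex) \<Rightarrow> ('g \<Rightarrow> complex) \<Rightarrow> bool" where
  "congr f g \<longleftrightarrow> (\<forall>w\<in>weyl_group. coeff w f = coeff w g)"

lemma congr_iff: "f \<in> sym_carrier \<Longrightarrow> g \<in> sym_carrier \<Longrightarrow> congr f g \<longleftrightarrow> (\<lambda>x\<in>H. f x - g x) \<in> coinvariant_ideal"
  by (auto simp: ideal_iff_coeff sym_carrier_diff congr_def coeff_diff)

text \<open>Reflections preserve the ideal: for h in it, h - sh = \<alpha> \<Delta>h lies in it
  too.\<close>

lemma congr_reflection:
  assumes \<alpha>: "\<alpha> \<in> simples" and f: "f \<in> sym_carrier" and g: "g \<in> sym_carrier" and fg: "congr f g"
  shows "congr (act (reflection \<alpha>) f) (act (reflection \<alpha>) g)"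
proof -
  note r = simple_root[OF \<alpha>]
  let ?h = "\<lambda>x\<in>H. f x - g x"
  have h: "?h \<in> coinvariant_ideal" using fg f g by (simp add: congr_iff)
  have hc: "?h \<in> sym_carrier" using f g by (rule sym_carrier_diff)
  have sc: "act (reflection \<alpha>) f \<in> sym_carrier" "act (reflection \<alpha>) g \<in> sym_carrier"
    using f g by (auto intro: sym_carrier_act weyl_reflection r)
  have "(\<lambda>x\<in>H. ?h x - act (reflection \<alpha>) ?h x) \<in> coinvariant_ideal"
    using congruent_reflection_iff[OF \<alpha> hc] demazure_ideal[OF \<alpha> h] by blast
  then have 1: "coeff w ?h = coeff w (act (reflection \<alpha>) ?h)" if "w \<in> weyl_group" for w
    using that congr_iff[OF hc sym_carrier_act[OF weyl_reflection[OF r] hc]] by (simp add: congr_def)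
  have "act (reflection \<alpha>) ?h = (\<lambda>x\<in>H. act (reflection \<alpha>) f x - act (reflection \<alpha>) g x)"
    by (rule extensionalityI[OF act_ext]) (auto simp: act_reflection_app r reflection_involution)
  then show ?thesis
    using 1 h ideal_iff_coeff[OF hc] coeff_diff[OF _ sc] by (auto simp: congr_def)
qed

lemma congr_act:
  assumes "w \<in> weyl_group" "f \<in> sym_carrier" "g \<in> sym_carrier" "congr f g"
  shows "congr (act w f) (act w g)"
proof -
  have "congr (act (word as) f) (act (word as) g)" if "set as \<subseteq> simples" for as
    using that
  proof (induction as)
    case Nil
    then show ?case using assms by (simp add: word_Nil act_one sym_carrier_ext)
  next
    case (Cons \<alpha> as)
    then show ?case using assms(2,3)
      by (simp add: word_Cons act_mult simple_reflection_Bij word_Bij congr_reflection sym_carrier_act word_weyl)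
  qed
  then show ?thesis using weyl_word[OF assms(1)] by blast
qed

text \<open>Invariance of the class under s_\<alpha> means that \<Delta>_\<alpha> f lies in the
  ideal. The coordinate of \<Delta>_\<alpha> f at u comes from the word for u followed by \<alpha>:
  it is a nonzero multiple of the coordinate of f at u s_\<alpha> if the length grows, and 0
  otherwise. The elements u s_\<alpha> that arise in this way from \<alpha> in J are those outside
  the minimal representatives.\<close>

lemma parabolic_invariant_iff:
  assumes J: "J \<subseteq> simples" and f: "f \<in> sym_carrier"
  shows "(\<forall>v\<in>parabolic J. congr (act v f) f) \<longleftrightarrow> (\<forall>w\<in>weyl_group - min_coset_reps J. coeff w f = 0)"
proof
  assume inv: "\<forall>v\<in>parabolic J. congr (act v f) f"
  show "\<forall>w\<in>weyl_group - min_coset_reps J. coeff w f = 0"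
  proof
    fix w assume w: "w \<in> weyl_group - min_coset_reps J"
    then obtain \<alpha> where \<alpha>: "\<alpha> \<in> J" "\<alpha> \<in> simples" "act w \<alpha> \<notin> positive_roots"
      using min_coset_reps_iff[OF J] J by blast
    note r = simple_root[OF \<alpha>(2)]
    let ?u = "w \<otimes>\<^bsub>\<G>\<^esub> reflection \<alpha>"
    have u: "?u \<in> weyl_group" using w \<alpha> by (intro weyl_mult simple_reflection_weyl) auto
    have "congr f (act (reflection \<alpha>) f)" using inv parabolic_reflection[OF \<alpha>(1)] by (simp add: congr_def)
    then have d: "demazure \<alpha> f \<in> coinvariant_ideal"
      using congr_iff[OF f sym_carrier_act[OF weyl_reflection[OF r] f]] congruent_reflection_iff[OF \<alpha>(2) f] by blast
    let ?as = "rword ?u @ [\<alpha>]"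
    have as: "set ?as \<subseteq> simples" using rword[OF u] \<alpha> by simp
    have wd: "word ?as = w"
      using rword[OF u] \<alpha> w by (simp add: word_snoc right_cancel weyl_Bij)
    have "len w = length ?as" using len_down[of w \<alpha>] w \<alpha> rword(3)[OF u] by simp
    then obtain l where "l \<noteq> 0" "dem ?as f 0 = l * coeff w f" using dem_coeff(1)[OF as] wd f by auto
    moreover have "dem ?as f 0 = 0" using dem_ideal[OF d rword(1)[OF u]] by (simp add: dem_simps)
    ultimately show "coeff w f = 0" by simp
  qed
next
  assume z: "\<forall>w\<in>weyl_group - min_coset_reps J. coeff w f = 0"
  have s: "congr (act (reflection \<alpha>) f) f" if \<alpha>: "\<alpha> \<in> J" for \<alpha>
  proof -
    have a: "\<alpha> \<in> simples" using \<alpha> J by blast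
    note r = simple_root[OF a]
    have "coeff u (demazure \<alpha> f) = 0" if u: "u \<in> weyl_group" for u
    proof -
      let ?as = "rword u @ [\<alpha>]"
      have as: "set ?as \<subseteq> simples" "word ?as = u \<otimes>\<^bsub>\<G>\<^esub> reflection \<alpha>" using rword[OF u] a by (auto simp: word_snoc)
      have "coeff u (demazure \<alpha> f) = dem ?as f 0" by (simp add: coeff_def dem_simps)
      also have "\<dots> = 0"
      proof (cases "len (word ?as) = length ?as")
        case True
        then have "act u \<alpha> \<in> positive_roots" using len_down[OF u a] as(2) rword(3)[OF u] by fastforce
        then have "act (word ?as) \<alpha> \<notin> positive_roots"
          using act_right_simple[OF u a] as(2) positive_not_negative by simp
        then have "word ?as \<in> weyl_group - min_coset_reps J"
          using word_weyl[OF as(1)] min_coset_reps_iff[OF J] \<alpha> by blast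
        then show ?thesis using z dem_coeff(1)[OF as(1) True] f by auto
      qed (use dem_coeff(2)[OF as(1) _ f] in blast)
      finally show ?thesis .
    qed
    then have "demazure \<alpha> f \<in> coinvariant_ideal" using ideal_iff_coeff[OF demazure(1)[OF r f]] by blast
    then have "congr f (act (reflection \<alpha>) f)"
      using congruent_reflection_iff[OF a f] congr_iff[OF f sym_carrier_act[OF weyl_reflection[OF r] f]] by blast
    then show ?thesis by (simp add: congr_def)
  qed
  have "congr (act (word as) f) f" if "set as \<subseteq> J" for as
    using that
  proof (induction as)
    case Nil
    then show ?case using f by (simp add: word_Nil act_one sym_carrier_ext congr_def)
  next
    case (Cons \<alpha> as)
    then have a: "\<alpha> \<in> J" "\<alpha> \<in> simples" "set as \<subseteq> simples" "set as \<subseteq> J" using J by auto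
    have "congr (act (reflection \<alpha>) (act (word as) f)) (act (reflection \<alpha>) f)"
      using Cons.IH a f by (intro congr_reflection) (auto intro: sym_carrier_act word_weyl)
    then show ?case using s[OF a(1)] a by (simp add: word_Cons act_mult simple_reflection_Bij word_Bij congr_def)
  qed
  then show "\<forall>v\<in>parabolic J. congr (act v f) f" using parabolic_word[OF J] by blast
qed

end


context semisimple_with_simple_roots
begin

section \<open>From polynomials to cosets\<close>

section \<open>Classes of polynomial functions\<close>

lemma class_eq_iff: "f \<in> sym_carrier \<Longrightarrow> g \<in> sym_carrier \<Longrightarrow> coinv_class f = coinv_class g \<longleftrightarrow> congr f g"
  using ring.quotient_eq_iff_same_a_r_cos[OF cring.axioms(1)[OF sym_cring] ideal_coinvariant, of f g]
  by (simp add: sym_simps sym_minus coinv_class_def congr_iff)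

lemma class_mem:
  assumes f: "f \<in> sym_carrier" and g: "g \<in> coinv_class f"
  shows "g \<in> sym_carrier" "congr g f"
proof -
  obtain h where h: "h \<in> coinvariant_ideal" "g = (\<lambda>x\<in>H. h x + f x)"
    using g by (auto simp: coinv_class_def a_r_coset_def' sym_simps)
  show gc: "g \<in> sym_carrier" using h f ideal_carrier by (auto intro: sym_carrier.add)
  have "(\<lambda>x\<in>H. g x - f x) = h"
    by (rule extensionalityI[of _ H]) (auto simp: h(2) sym_carrier_ext ideal_carrier h(1))
  then show "congr g f" using h(1) congr_iff[OF gc f] by simp
qed

lemma class_self: "f \<in> sym_carrier \<Longrightarrow> f \<in> coinv_class f"
proof -
  assume f: "f \<in> sym_carrier"
  have "f = (\<lambda>x\<in>H. (\<lambda>x\<in>H. 0) x + f x)" by (rule extensionalityI[OF sym_carrier_ext[OF f]]) auto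
  then show ?thesis using ideal_zero by (auto simp: coinv_class_def a_r_coset_def' sym_simps)
qed

text \<open>The union in \<open>induced\<close> runs over one coset, and compatibility of \<theta>
  makes all its members the same class.\<close>

lemma induced_class:
  assumes f: "f \<in> sym_carrier" and \<theta>: "\<And>g. g \<in> sym_carrier \<Longrightarrow> \<theta> g \<in> sym_carrier"
    and c: "\<And>g. g \<in> sym_carrier \<Longrightarrow> congr g f \<Longrightarrow> congr (\<theta> g) (\<theta> f)"
  shows "induced \<theta> (coinv_class f) = coinv_class (\<theta> f)"
proof -
  have "coinv_class (\<theta> g) = coinv_class (\<theta> f)" if "g \<in> coinv_class f" for g
    using class_mem[OF f that] \<theta> c f by (simp add: class_eq_iff)
  then show ?thesis using class_self[OF f] unfolding induced_def by blast
qed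

lemma coinvariant_algebra_simps:
  "carrier coinvariant_algebra = coinv_class ` sym_carrier"
  "f \<in> sym_carrier \<Longrightarrow> g \<in> sym_carrier
    \<Longrightarrow> coinv_class f \<otimes>\<^bsub>coinvariant_algebra\<^esub> coinv_class g = coinv_class (\<lambda>x\<in>H. f x * g x)"
  "f \<in> sym_carrier \<Longrightarrow> g \<in> sym_carrier
    \<Longrightarrow> coinv_class f \<oplus>\<^bsub>coinvariant_algebra\<^esub> coinv_class g = coinv_class (\<lambda>x\<in>H. f x + g x)"
  "f \<in> sym_carrier \<Longrightarrow> a \<odot>\<^bsub>coinvariant_algebra\<^esub> coinv_class f = coinv_class (\<lambda>x\<in>H. a * f x)"
  "\<one>\<^bsub>coinvariant_algebra\<^esub> = coinv_class (\<lambda>x\<in>H. 1)"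
  "\<zero>\<^bsub>coinvariant_algebra\<^esub> = coinv_class (\<lambda>x\<in>H. 0)"
proof -
  interpret I: ideal coinvariant_ideal sym_algebra by (rule ideal_coinvariant)
  note d = coinvariant_algebra_def ring.defs module.defs FactRing_def
  show "carrier coinvariant_algebra = coinv_class ` sym_carrier"
    by (auto simp: d A_RCOSETS_def' coinv_class_def sym_simps)
  show "coinv_class f \<otimes>\<^bsub>coinvariant_algebra\<^esub> coinv_class g = coinv_class (\<lambda>x\<in>H. f x * g x)"
    if "f \<in> sym_carrier" "g \<in> sym_carrier"
    using that I.rcoset_mult_add[of f g] by (simp add: d coinv_class_def sym_simps)
  show "coinv_class f \<oplus>\<^bsub>coinvariant_algebra\<^esub> coinv_class g = coinv_class (\<lambda>x\<in>H. f x + g x)"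
    if "f \<in> sym_carrier" "g \<in> sym_carrier"
    using that I.a_rcos_sum[of f g] by (simp add: d coinv_class_def sym_simps)
  show "a \<odot>\<^bsub>coinvariant_algebra\<^esub> coinv_class f = coinv_class (\<lambda>x\<in>H. a * f x)" if f: "f \<in> sym_carrier"
  proof -
    have "induced (\<lambda>f. \<lambda>x\<in>H. a * f x) (coinv_class f) = coinv_class (\<lambda>x\<in>H. a * f x)"
      by (rule induced_class[OF f sym_carrier_scale]) (use f in \<open>auto simp: congr_def coeff_scale\<close>)
    then show ?thesis by (simp add: d sym_simps)
  qed
  show "\<one>\<^bsub>coinvariant_algebra\<^esub> = coinv_class (\<lambda>x\<in>H. 1)" by (simp add: d coinv_class_def sym_simps)
  have "coinvariant_ideal +>\<^bsub>sym_algebra\<^esub> (\<lambda>x\<in>H. 0) = coinvariant_ideal"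
    using ring.a_rcos_zero[OF cring.axioms(1)[OF sym_cring] ideal_coinvariant ideal_zero] .
  then show "\<zero>\<^bsub>coinvariant_algebra\<^esub> = coinv_class (\<lambda>x\<in>H. 0)" by (simp add: d coinv_class_def)
qed

lemma congr_mult:
  assumes c: "f \<in> sym_carrier" "f' \<in> sym_carrier" "g \<in> sym_carrier" "g' \<in> sym_carrier"
    and fg: "congr f f'" "congr g g'"
  shows "congr (\<lambda>x\<in>H. f x * g x) (\<lambda>x\<in>H. f' x * g' x)"
proof -
  have "coinv_class f = coinv_class f'" "coinv_class g = coinv_class g'" using assms by (simp_all add: class_eq_iff)
  then have "coinv_class (\<lambda>x\<in>H. f x * g x) = coinv_class (\<lambda>x\<in>H. f' x * g' x)"
    using coinvariant_algebra_simps(2)[OF c(1,3)] coinvariant_algebra_simps(2)[OF c(2,4)] by simp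
  then show ?thesis using c by (simp add: class_eq_iff sym_carrier_mult)
qed

text \<open>Demazure words preserve the ideal, so the induced map sends the class of
  \<open>top_class\<close> to the class of \<open>X_rep w\<close>.\<close>

lemma X_elt_class: "w \<in> weyl_group \<Longrightarrow> X_elt w = coinv_class (X_rep w)"
proof -
  assume w: "w \<in> weyl_group"
  note r = rword(1)[OF complement_weyl[OF w]]
  have tc: "top_class \<in> sym_carrier" by (rule sym_carrier.homogeneous[OF top_class_power])
  show ?thesis
    unfolding X_elt_def X_rep_def demazure_elt_rword
  proof (rule induced_class[OF tc dem_carrier[OF set_simples_roots[OF r]]])
    fix g assume g: "g \<in> sym_carrier" "congr g top_class"
    let ?as = "rword (inv\<^bsub>\<G>\<^esub> w \<otimes>\<^bsub>\<G>\<^esub> longest)"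
    note rr = set_simples_roots[OF r]
    have i: "(\<lambda>x\<in>H. g x - top_class x) \<in> coinvariant_ideal" using g tc by (simp add: congr_iff)
    have dc: "dem ?as (\<lambda>x\<in>H. g x - top_class x) \<in> sym_carrier" using rr ideal_carrier[OF i] by (rule dem_carrier)
    have "dem bs (dem ?as (\<lambda>x\<in>H. g x - top_class x)) 0 = 0" if "set bs \<subseteq> simples" for bs
      using dem_ideal[OF i, of "bs @ ?as"] that r by (simp add: dem_simps)
    then have "dem ?as (\<lambda>x\<in>H. g x - top_class x) \<in> coinvariant_ideal" using ideal_iff_dem[OF dc] by blast
    then show "congr (dem ?as g) (dem ?as top_class)"
      using dem_diff[OF rr g(1) tc] congr_iff dem_carrier[OF rr] g(1) tc by simp
  qed
qed

text \<open>Terms of f of positive degree push the product beyond degree \<open>len w\<close>, where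
  the coordinate of w vanishes; the constant term acts as a scalar. This is the source of the cell
  coefficients.\<close>

lemma coeff_mult_low:
  assumes f: "f \<in> sym_carrier" and D: "D \<in> sym_power k" and w: "w \<in> weyl_group" "len w \<le> k"
  shows "coeff w (\<lambda>x\<in>H. f x * D x) = f 0 * coeff w D"
  using f
proof induct
  case (homogeneous f j)
  note Dc = sym_carrier.homogeneous[OF D]
  show ?case
  proof (cases "j = 0")
    case True
    then have f: "f = (\<lambda>x\<in>H. f 0)" using sym_power_0D homogeneous by blast
    have "(\<lambda>x\<in>H. f x * D x) = (\<lambda>x\<in>H. f 0 * D x)"
      by (rule restrict_ext) (subst f, simp)
    then show ?thesis using coeff_scale[OF w(1) Dc] by simp
  next
    case False
    then have "f 0 = 0" using sym_power_at_zero homogeneous by simp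
    then show ?thesis using coeff_degree[OF w(1) sym_power_mult[OF homogeneous D]] w(2) False by simp
  qed
next
  case (add f g)
  note Dc = sym_carrier.homogeneous[OF D]
  have "(\<lambda>x\<in>H. (\<lambda>x\<in>H. f x + g x) x * D x) = (\<lambda>x\<in>H. (\<lambda>x\<in>H. f x * D x) x + (\<lambda>x\<in>H. g x * D x) x)"
    by (rule restrict_ext) (simp add: algebra_simps)
  then show ?case
    using add coeff_add[OF w(1) sym_carrier_mult[OF add(1) Dc] sym_carrier_mult[OF add(3) Dc]] H_zero
    by (simp add: distrib_right)
qed

text \<open>A class is a bare set, so a representative is chosen; by \<open>coord_class\<close> the
  choice does not matter.\<close>

definition coord :: "('g \<Rightarrow> 'g) \<Rightarrow> ('g \<Rightarrow> complex) set \<Rightarrow> complex" where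
  "coord w Y = coeff w (SOME f. f \<in> sym_carrier \<and> Y = coinv_class f)"

lemma coord_class: "f \<in> sym_carrier \<Longrightarrow> w \<in> weyl_group \<Longrightarrow> coord w (coinv_class f) = coeff w f"
proof -
  assume f: "f \<in> sym_carrier" and w: "w \<in> weyl_group"
  let ?g = "SOME g. g \<in> sym_carrier \<and> coinv_class f = coinv_class g"
  have "?g \<in> sym_carrier \<and> coinv_class f = coinv_class ?g" by (rule someI[of _ f]) (use f in simp)
  then have "congr f ?g" using class_eq_iff f by blast
  then show ?thesis using w by (simp add: coord_def congr_def)
qed

lemma parabolic_weyl: "J \<subseteq> simples \<Longrightarrow> v \<in> parabolic J \<Longrightarrow> v \<in> weyl_group"
  using parabolic_word[of J v] word_weyl by fastforce

section \<open>The algebra of W_J-invariant classes and its grading in coordinates\<close>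

section \<open>The invariant subalgebra\<close>

context
  fixes J :: "('g \<Rightarrow> complex) set"
  assumes J: "J \<subseteq> simples"
begin

abbreviation "CJ \<equiv> parabolic_coinvariants J"
abbreviation "MJ \<equiv> min_coset_reps J"

text \<open>The polynomials with W_J-invariant class. In this form closure under sums is immediate;
  closure under products uses the invariance form \<open>PJ_iff\<close>.\<close>

definition "PJ = {f \<in> sym_carrier. \<forall>w\<in>weyl_group - MJ. coeff w f = 0}"

lemma PJ_carrier: "f \<in> PJ \<Longrightarrow> f \<in> sym_carrier" by (simp add: PJ_def)

lemma MJ_weyl: "w \<in> MJ \<Longrightarrow> w \<in> weyl_group" by (simp add: min_coset_reps_def)

lemma finite_MJ: "finite MJ" using finite_weyl by (simp add: min_coset_reps_def)

lemma one_MJ: "\<one>\<^bsub>\<G>\<^esub> \<in> MJ"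
  by (simp add: min_coset_reps_def weyl_one len_one)

lemma PJ_iff: "f \<in> PJ \<longleftrightarrow> f \<in> sym_carrier \<and> (\<forall>v\<in>parabolic J. congr (act v f) f)"
  using parabolic_invariant_iff[OF J] by (auto simp: PJ_def)

lemma PJ_add: "f \<in> PJ \<Longrightarrow> g \<in> PJ \<Longrightarrow> (\<lambda>x\<in>H. f x + g x) \<in> PJ"
  by (auto simp: PJ_def coeff_add intro: sym_carrier.add)

lemma PJ_scale: "f \<in> PJ \<Longrightarrow> (\<lambda>x\<in>H. a * f x) \<in> PJ"
  by (auto simp: PJ_def coeff_scale intro: sym_carrier_scale)

lemma PJ_mult:
  assumes "f \<in> PJ" "g \<in> PJ" shows "(\<lambda>x\<in>H. f x * g x) \<in> PJ"
  unfolding PJ_iff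
proof (intro conjI ballI)
  note c = assms[THEN PJ_carrier]
  show "(\<lambda>x\<in>H. f x * g x) \<in> sym_carrier" using c by (rule sym_carrier_mult)
  fix v assume v: "v \<in> parabolic J"
  note vW = parabolic_weyl[OF J v]
  have "act v (\<lambda>x\<in>H. f x * g x) = (\<lambda>x\<in>H. act v f x * act v g x)"
    using Bij_app[OF weyl_Bij[OF weyl_inv[OF vW]]] by (intro extensionalityI[OF act_ext]) (auto simp: act_app)
  then show "congr (act v (\<lambda>x\<in>H. f x * g x)) (\<lambda>x\<in>H. f x * g x)"
    using assms v c sym_carrier_act[OF vW] by (simp add: congr_mult PJ_iff)
qed

lemma PJ_const: "(\<lambda>x\<in>H. a) \<in> PJ"
proof -
  have "coeff w (\<lambda>x\<in>H. a) = 0" if "w \<in> weyl_group - MJ" for w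
    using that one_MJ len_zero coeff_degree[OF _ sym_power_const, of w a] by fastforce
  then show ?thesis using sym_carrier_const by (simp add: PJ_def)
qed

lemma CJ_carrier: "carrier CJ = coinv_class ` PJ"
proof -
  have "induced (act v) (coinv_class f) = coinv_class f \<longleftrightarrow> congr (act v f) f"
    if f: "f \<in> sym_carrier" and v: "v \<in> parabolic J" for f v
  proof -
    note vW = parabolic_weyl[OF J v]
    have "induced (act v) (coinv_class f) = coinv_class (act v f)"
      by (rule induced_class[OF f]) (auto intro: sym_carrier_act vW congr_act f)
    then show ?thesis using class_eq_iff[OF sym_carrier_act[OF vW f] f] by simp
  qed
  then have "{f \<in> sym_carrier. \<forall>v\<in>parabolic J. induced (act v) (coinv_class f) = coinv_class f} = PJ"
    unfolding set_eq_iff mem_Collect_eq PJ_iff by blast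
  moreover have "carrier CJ = coinv_class ` {f \<in> sym_carrier. \<forall>v\<in>parabolic J. induced (act v) (coinv_class f) = coinv_class f}"
    by (simp add: parabolic_coinvariants_def coinvariant_algebra_simps(1)) blast
  ultimately show ?thesis by simp
qed

lemma CJ_rep: "Y \<in> carrier CJ \<Longrightarrow> \<exists>f\<in>PJ. Y = coinv_class f"
  by (auto simp: CJ_carrier)

lemma CJ_simps:
  "f \<in> sym_carrier \<Longrightarrow> g \<in> sym_carrier \<Longrightarrow> coinv_class f \<otimes>\<^bsub>CJ\<^esub> coinv_class g = coinv_class (\<lambda>x\<in>H. f x * g x)"
  "f \<in> sym_carrier \<Longrightarrow> g \<in> sym_carrier \<Longrightarrow> coinv_class f \<oplus>\<^bsub>CJ\<^esub> coinv_class g = coinv_class (\<lambda>x\<in>H. f x + g x)"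
  "f \<in> sym_carrier \<Longrightarrow> a \<odot>\<^bsub>CJ\<^esub> coinv_class f = coinv_class (\<lambda>x\<in>H. a * f x)"
  "\<one>\<^bsub>CJ\<^esub> = coinv_class (\<lambda>x\<in>H. 1)" "\<zero>\<^bsub>CJ\<^esub> = coinv_class (\<lambda>x\<in>H. 0)"
  using coinvariant_algebra_simps by (simp_all add: parabolic_coinvariants_def)

lemmas PJ_intros = PJ_carrier PJ_add PJ_scale PJ_mult PJ_const

lemma class_CJ: "f \<in> PJ \<Longrightarrow> coinv_class f \<in> carrier CJ"
  by (simp add: CJ_carrier)

lemma class_cong: "(\<And>x. x \<in> H \<Longrightarrow> f x = g x) \<Longrightarrow> coinv_class (restrict f H) = coinv_class (restrict g H)"
  by (rule arg_cong[of _ _ coinv_class]) (rule restrict_ext)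

lemma CJ_cring: "cring CJ"
proof (rule cringI)
  show "abelian_group CJ"
  proof (rule abelian_groupI)
    fix U assume "U \<in> carrier CJ"
    then obtain f where f: "f \<in> PJ" "U = coinv_class f" using CJ_rep by blast
    have "coinv_class (\<lambda>x\<in>H. - 1 * f x) \<oplus>\<^bsub>CJ\<^esub> U = coinv_class (\<lambda>x\<in>H. (\<lambda>x\<in>H. - 1 * f x) x + f x)"
      unfolding f(2) by (rule CJ_simps(2)[OF PJ_carrier[OF PJ_scale[OF f(1)]] PJ_carrier[OF f(1)]])
    also have "\<dots> = \<zero>\<^bsub>CJ\<^esub>" unfolding CJ_simps(5) by (rule class_cong) simp
    finally have "coinv_class (\<lambda>x\<in>H. - 1 * f x) \<oplus>\<^bsub>CJ\<^esub> U = \<zero>\<^bsub>CJ\<^esub>" .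
    then show "\<exists>Y\<in>carrier CJ. Y \<oplus>\<^bsub>CJ\<^esub> U = \<zero>\<^bsub>CJ\<^esub>" using class_CJ[OF PJ_scale[OF f(1)]] by blast
    have "(\<lambda>x\<in>H. (\<lambda>x\<in>H. 0) x + f x) = f"
      by (rule extensionalityI[of _ H]) (auto simp: sym_carrier_ext PJ_carrier f)
    then show "\<zero>\<^bsub>CJ\<^esub> \<oplus>\<^bsub>CJ\<^esub> U = U" by (simp add: f CJ_simps PJ_intros sym_carrier_const)
  next
    fix U Y assume "U \<in> carrier CJ" "Y \<in> carrier CJ"
    then obtain f g where f: "f \<in> PJ" "U = coinv_class f" "g \<in> PJ" "Y = coinv_class g" using CJ_rep by blast
    show "U \<oplus>\<^bsub>CJ\<^esub> Y \<in> carrier CJ" by (simp add: f CJ_simps PJ_intros class_CJ)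
    show "U \<oplus>\<^bsub>CJ\<^esub> Y = Y \<oplus>\<^bsub>CJ\<^esub> U" by (auto simp: f CJ_simps PJ_intros intro!: class_cong)
    fix Z assume "Z \<in> carrier CJ"
    then obtain h where h: "h \<in> PJ" "Z = coinv_class h" using CJ_rep by blast
    show "U \<oplus>\<^bsub>CJ\<^esub> Y \<oplus>\<^bsub>CJ\<^esub> Z = U \<oplus>\<^bsub>CJ\<^esub> (Y \<oplus>\<^bsub>CJ\<^esub> Z)"
      by (auto simp: f h CJ_simps PJ_intros add.assoc intro!: class_cong)
  next
    show "\<zero>\<^bsub>CJ\<^esub> \<in> carrier CJ" by (simp add: CJ_simps class_CJ PJ_const)
  qed
  show "comm_monoid CJ"
  proof (rule comm_monoidI)
    fix U assume "U \<in> carrier CJ"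
    then obtain f where f: "f \<in> PJ" "U = coinv_class f" using CJ_rep by blast
    have "(\<lambda>x\<in>H. (\<lambda>x\<in>H. 1) x * f x) = f"
      by (rule extensionalityI[of _ H]) (auto simp: sym_carrier_ext PJ_carrier f)
    then show "\<one>\<^bsub>CJ\<^esub> \<otimes>\<^bsub>CJ\<^esub> U = U" by (simp add: f CJ_simps PJ_intros sym_carrier_const)
  next
    fix U Y assume "U \<in> carrier CJ" "Y \<in> carrier CJ"
    then obtain f g where f: "f \<in> PJ" "U = coinv_class f" "g \<in> PJ" "Y = coinv_class g" using CJ_rep by blast
    show "U \<otimes>\<^bsub>CJ\<^esub> Y \<in> carrier CJ" by (simp add: f CJ_simps PJ_intros class_CJ)
    show "U \<otimes>\<^bsub>CJ\<^esub> Y = Y \<otimes>\<^bsub>CJ\<^esub> U" by (auto simp: f CJ_simps PJ_intros intro!: class_cong)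
    fix Z assume "Z \<in> carrier CJ"
    then obtain h where h: "h \<in> PJ" "Z = coinv_class h" using CJ_rep by blast
    show "U \<otimes>\<^bsub>CJ\<^esub> Y \<otimes>\<^bsub>CJ\<^esub> Z = U \<otimes>\<^bsub>CJ\<^esub> (Y \<otimes>\<^bsub>CJ\<^esub> Z)"
      by (auto simp: f h CJ_simps PJ_intros mult.assoc intro!: class_cong)
  next
    show "\<one>\<^bsub>CJ\<^esub> \<in> carrier CJ" by (simp add: CJ_simps class_CJ PJ_const)
  qed
  fix U Y Z assume U: "U \<in> carrier CJ" and Y: "Y \<in> carrier CJ" and Z: "Z \<in> carrier CJ"
  obtain f g h where f: "f \<in> PJ" "U = coinv_class f" "g \<in> PJ" "Y = coinv_class g"
    "h \<in> PJ" "Z = coinv_class h" using CJ_rep[OF U] CJ_rep[OF Y] CJ_rep[OF Z] by blast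
  show "(U \<oplus>\<^bsub>CJ\<^esub> Y) \<otimes>\<^bsub>CJ\<^esub> Z = U \<otimes>\<^bsub>CJ\<^esub> Z \<oplus>\<^bsub>CJ\<^esub> Y \<otimes>\<^bsub>CJ\<^esub> Z"
    by (auto simp: f CJ_simps PJ_intros distrib_right intro!: class_cong)
qed

lemma complex_field_simps:
  "carrier complex_field = UNIV" "a \<otimes>\<^bsub>complex_field\<^esub> b = a * b" "a \<oplus>\<^bsub>complex_field\<^esub> b = a + b"
  "\<one>\<^bsub>complex_field\<^esub> = 1" "\<zero>\<^bsub>complex_field\<^esub> = 0"
  by (simp_all add: ring_of_type_algebra_def)

lemma CJ_module: "Module.module complex_field CJ"
proof (rule moduleI)
  show "cring complex_field" by (rule cring_from_type_algebra)
  show "abelian_group CJ" using CJ_cring by (intro ring.is_abelian_group cring.axioms(1))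
next
  fix a b U assume "U \<in> carrier CJ"
  then obtain f where f: "f \<in> PJ" "U = coinv_class f" using CJ_rep by blast
  show "a \<odot>\<^bsub>CJ\<^esub> U \<in> carrier CJ" by (simp add: f CJ_simps PJ_intros class_CJ)
  show "(a \<oplus>\<^bsub>complex_field\<^esub> b) \<odot>\<^bsub>CJ\<^esub> U = a \<odot>\<^bsub>CJ\<^esub> U \<oplus>\<^bsub>CJ\<^esub> b \<odot>\<^bsub>CJ\<^esub> U"
    by (auto simp: f CJ_simps PJ_intros complex_field_simps distrib_right intro!: class_cong)
  show "(a \<otimes>\<^bsub>complex_field\<^esub> b) \<odot>\<^bsub>CJ\<^esub> U = a \<odot>\<^bsub>CJ\<^esub> (b \<odot>\<^bsub>CJ\<^esub> U)"
    by (auto simp: f CJ_simps PJ_intros complex_field_simps mult.assoc intro!: class_cong)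
  have "(\<lambda>x\<in>H. 1 * f x) = f"
    by (rule extensionalityI[of _ H]) (auto simp: sym_carrier_ext PJ_carrier f)
  then show "\<one>\<^bsub>complex_field\<^esub> \<odot>\<^bsub>CJ\<^esub> U = U"
    using CJ_simps(3)[OF PJ_carrier[OF f(1)], of 1] by (simp add: f(2) complex_field_simps del: mult_1)
  fix Y assume "Y \<in> carrier CJ"
  then obtain g where g: "g \<in> PJ" "Y = coinv_class g" using CJ_rep by blast
  show "a \<odot>\<^bsub>CJ\<^esub> (U \<oplus>\<^bsub>CJ\<^esub> Y) = a \<odot>\<^bsub>CJ\<^esub> U \<oplus>\<^bsub>CJ\<^esub> a \<odot>\<^bsub>CJ\<^esub> Y"
    by (auto simp: f g CJ_simps PJ_intros distrib_left intro!: class_cong)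
qed

lemma CJ_assoc_algebra: "assoc_algebra complex_field CJ"
proof (intro assoc_algebra.intro assoc_algebra_axioms.intro)
  show "Module.module complex_field CJ" by (rule CJ_module)
  show "Ring.ring CJ" using CJ_cring by (rule cring.axioms(1))
  fix k U Y assume "U \<in> carrier CJ" "Y \<in> carrier CJ"
  then obtain f g where f: "f \<in> PJ" "U = coinv_class f" "g \<in> PJ" "Y = coinv_class g" using CJ_rep by blast
  show "k \<odot>\<^bsub>CJ\<^esub> U \<otimes>\<^bsub>CJ\<^esub> Y = k \<odot>\<^bsub>CJ\<^esub> (U \<otimes>\<^bsub>CJ\<^esub> Y)"
    by (auto simp: f CJ_simps PJ_intros intro!: class_cong)
  show "U \<otimes>\<^bsub>CJ\<^esub> (k \<odot>\<^bsub>CJ\<^esub> Y) = k \<odot>\<^bsub>CJ\<^esub> (U \<otimes>\<^bsub>CJ\<^esub> Y)"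
    by (auto simp: f CJ_simps PJ_intros intro!: class_cong)
qed

lemma coord_add: "U \<in> carrier CJ \<Longrightarrow> Y \<in> carrier CJ \<Longrightarrow> w \<in> weyl_group \<Longrightarrow> coord w (U \<oplus>\<^bsub>CJ\<^esub> Y) = coord w U + coord w Y"
  and coord_smult: "U \<in> carrier CJ \<Longrightarrow> w \<in> weyl_group \<Longrightarrow> coord w (a \<odot>\<^bsub>CJ\<^esub> U) = a * coord w U"
  and coord_zero: "w \<in> weyl_group \<Longrightarrow> coord w \<zero>\<^bsub>CJ\<^esub> = 0"
  by (auto simp: CJ_carrier CJ_simps PJ_intros coord_class coeff_add coeff_scale coeff_zero sym_carrier_const
      sym_carrier.add sym_carrier_scale)

lemma coord_uminus: "U \<in> carrier CJ \<Longrightarrow> w \<in> weyl_group \<Longrightarrow> coord w (\<ominus>\<^bsub>CJ\<^esub> U) = - coord w U"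
proof -
  interpret R: cring CJ by (rule CJ_cring)
  assume U: "U \<in> carrier CJ" and w: "w \<in> weyl_group"
  have "coord w (\<ominus>\<^bsub>CJ\<^esub> U) + coord w U = coord w (\<ominus>\<^bsub>CJ\<^esub> U \<oplus>\<^bsub>CJ\<^esub> U)" using U w by (simp add: coord_add)
  also have "\<dots> = 0" using U w by (simp add: R.l_neg coord_zero)
  finally show ?thesis by (simp add: eq_neg_iff_add_eq_0)
qed

lemma coord_minus: "U \<in> carrier CJ \<Longrightarrow> Y \<in> carrier CJ \<Longrightarrow> w \<in> weyl_group \<Longrightarrow> coord w (U \<ominus>\<^bsub>CJ\<^esub> Y) = coord w U - coord w Y"
proof -
  interpret R: cring CJ by (rule CJ_cring)
  assume "U \<in> carrier CJ" "Y \<in> carrier CJ" "w \<in> weyl_group"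
  then show ?thesis by (simp add: a_minus_def coord_add coord_uminus)
qed

lemma coord_finsum:
  assumes "finite A" "\<And>i. i \<in> A \<Longrightarrow> F i \<in> carrier CJ" "w \<in> weyl_group"
  shows "coord w (\<Oplus>\<^bsub>CJ\<^esub>i\<in>A. F i) = (\<Sum>i\<in>A. coord w (F i))"
proof -
  interpret R: cring CJ by (rule CJ_cring)
  show ?thesis
    using assms(1,2)
  proof (induction A rule: finite_induct)
    case (insert i A)
    then show ?case using assms(3) by (simp add: R.finsum_insert coord_add Pi_def)
  qed (simp add: coord_zero assms)
qed

lemma coord_outside: "U \<in> carrier CJ \<Longrightarrow> w \<in> weyl_group - MJ \<Longrightarrow> coord w U = 0"
  by (auto simp: CJ_carrier coord_class PJ_carrier) (simp add: PJ_def)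

lemma coord_eqI:
  assumes "U \<in> carrier CJ" "Y \<in> carrier CJ" "\<And>w. w \<in> MJ \<Longrightarrow> coord w U = coord w Y"
  shows "U = Y"
proof -
  obtain f g where f: "f \<in> PJ" "U = coinv_class f" "g \<in> PJ" "Y = coinv_class g" using CJ_rep assms by blast
  have "coord w U = coord w Y" if "w \<in> weyl_group" for w
    using assms coord_outside[of _ w] that by (cases "w \<in> MJ") auto
  then have "congr f g" using f by (simp add: congr_def coord_class PJ_carrier)
  then show ?thesis using f by (simp add: class_eq_iff PJ_carrier)
qed

lemma X_rep_PJ: "w \<in> MJ \<Longrightarrow> X_rep w \<in> PJ"
  using coeff_X_rep(1) MJ_weyl X_rep_carrier by (auto simp: PJ_def)

lemma X_elt_CJ: "w \<in> MJ \<Longrightarrow> X_elt w \<in> carrier CJ"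
  by (simp add: X_elt_class MJ_weyl class_CJ X_rep_PJ)

lemma coord_X: "u \<in> weyl_group \<Longrightarrow> w \<in> MJ \<Longrightarrow> u \<noteq> w \<Longrightarrow> coord u (X_elt w) = 0"
  and coord_X_self: "w \<in> MJ \<Longrightarrow> coord w (X_elt w) \<noteq> 0"
  using coeff_X_rep(1) coeff_X_rep(2)[OF weyl_one, of w]
  by (auto simp: X_elt_class MJ_weyl coord_class X_rep_carrier)

lemma coord_combination:
  assumes Q: "Q \<subseteq> MJ" and w: "w \<in> weyl_group"
  shows "coord w (\<Oplus>\<^bsub>CJ\<^esub>q\<in>Q. a q \<odot>\<^bsub>CJ\<^esub> X_elt q) = (if w \<in> Q then a w * coord w (X_elt w) else 0)"
    "(\<Oplus>\<^bsub>CJ\<^esub>q\<in>Q. a q \<odot>\<^bsub>CJ\<^esub> X_elt q) \<in> carrier CJ"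
proof -
  interpret M: Module.module complex_field CJ by (rule CJ_module)
  have fQ: "finite Q" using Q finite_MJ finite_subset by blast
  have c: "a q \<odot>\<^bsub>CJ\<^esub> X_elt q \<in> carrier CJ" if "q \<in> Q" for q
    using that Q by (intro M.smult_closed X_elt_CJ) (auto simp: complex_field_simps)
  have "coord w (\<Oplus>\<^bsub>CJ\<^esub>q\<in>Q. a q \<odot>\<^bsub>CJ\<^esub> X_elt q) = (\<Sum>q\<in>Q. coord w (a q \<odot>\<^bsub>CJ\<^esub> X_elt q))"
    using fQ c w by (rule coord_finsum)
  also have "\<dots> = (\<Sum>q\<in>Q. if q = w then a w * coord w (X_elt w) else 0)"
    by (rule sum.cong) (use w Q in \<open>auto simp: coord_smult X_elt_CJ coord_X subset_iff\<close>)
  finally show "coord w (\<Oplus>\<^bsub>CJ\<^esub>q\<in>Q. a q \<odot>\<^bsub>CJ\<^esub> X_elt q) = (if w \<in> Q then a w * coord w (X_elt w) else 0)"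
    using fQ by (simp add: sum.delta)
  show "(\<Oplus>\<^bsub>CJ\<^esub>q\<in>Q. a q \<odot>\<^bsub>CJ\<^esub> X_elt q) \<in> carrier CJ" using c by (intro M.finsum_closed) auto
qed

text \<open>The X_w are dual to the coordinates up to nonzero scalars; dividing by these scalars
  realizes any prescribed values.\<close>

lemma coord_surj: "\<exists>Y\<in>carrier CJ. \<forall>w\<in>MJ. coord w Y = c w"
  using coord_combination[of MJ _ "\<lambda>w. c w / coord w (X_elt w)"] coord_X_self MJ_weyl
  by (intro bexI[of _ "\<Oplus>\<^bsub>CJ\<^esub>q\<in>MJ. (c q / coord q (X_elt q)) \<odot>\<^bsub>CJ\<^esub> X_elt q"]) (auto intro: weyl_one)

abbreviation "gJ \<equiv> parabolic_grading J"

lemma gJ_carrier: "Y \<in> gJ d \<Longrightarrow> Y \<in> carrier CJ"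
  by (simp add: parabolic_grading_def)

text \<open>X_w has degree 2 \<open>len w\<close>, so the degree can be read off from the support of
  the coordinates. The submodule and decomposition properties of the grading then become statements
  about supports.\<close>

lemma gJ_iff: "Y \<in> gJ d \<longleftrightarrow> Y \<in> carrier CJ \<and> (\<forall>w\<in>MJ. 2 * int (len w) \<noteq> d \<longrightarrow> coord w Y = 0)"
proof
  assume Y: "Y \<in> gJ d"
  have "coord w Y = 0" if w: "w \<in> MJ" "2 * int (len w) \<noteq> d" for w
  proof (cases "d \<ge> 0 \<and> even d")
    case True
    then obtain f where f: "f \<in> sym_power (nat (d div 2))" "Y = coinv_class f"
      using Y by (auto simp: parabolic_grading_def coinvariant_grading_def)
    have "nat (d div 2) \<noteq> len w" using w(2) True by auto
    then show ?thesis
      using coeff_degree[OF MJ_weyl[OF w(1)] f(1)] f coord_class[OF sym_carrier.homogeneous[OF f(1)] MJ_weyl[OF w(1)]] by simp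
  next
    case False
    then have "Y = \<zero>\<^bsub>CJ\<^esub>" using Y
      by (auto simp: parabolic_grading_def coinvariant_grading_def parabolic_coinvariants_def)
    then show ?thesis using coord_zero MJ_weyl w by simp
  qed
  then show "Y \<in> carrier CJ \<and> (\<forall>w\<in>MJ. 2 * int (len w) \<noteq> d \<longrightarrow> coord w Y = 0)" using Y gJ_carrier by blast
next
  assume Y: "Y \<in> carrier CJ \<and> (\<forall>w\<in>MJ. 2 * int (len w) \<noteq> d \<longrightarrow> coord w Y = 0)"
  show "Y \<in> gJ d"
  proof (cases "d \<ge> 0 \<and> even d")
    case True
    let ?Q = "{w \<in> MJ. 2 * int (len w) = d}"
    let ?F = "\<lambda>w. \<lambda>x\<in>H. coord w Y / coord w (X_elt w) * X_rep w x"
    \<comment> \<open>Membership in the grading asks for a homogeneous polynomial representative;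
      this combination has the required degree and the coordinates of Y.\<close>
    let ?f = "\<lambda>x\<in>H. \<Sum>w\<in>?Q. ?F w x"
    have F: "?F w \<in> sym_power (nat (d div 2))" if "w \<in> ?Q" for w
    proof -
      have n: "nat (d div 2) = len w" using that by auto
      show ?thesis unfolding n by (rule sym_power_scale[OF X_rep_power[OF MJ_weyl]]) (use that in simp)
    qed
    then have f: "?f \<in> sym_power (nat (d div 2))" by (rule sym_power_sum)
    have "coeff u ?f = coord u Y" if u: "u \<in> weyl_group" for u
    proof -
      have "coeff u ?f = (\<Sum>w\<in>?Q. coeff u (?F w))"
        by (rule coeff_sum[OF u]) (use finite_MJ sym_carrier.homogeneous[OF F] in auto)
      also have "\<dots> = (\<Sum>w\<in>?Q. if w = u then coord u Y else 0)"
      proof (rule sum.cong[OF refl])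
        fix w assume w: "w \<in> ?Q"
        have "coeff u (?F w) = coord w Y / coord w (X_elt w) * coeff u (X_rep w)"
          by (rule coeff_scale[OF u X_rep_carrier]) (use w MJ_weyl in blast)
        also have "coeff u (X_rep w) = coord u (X_elt w)"
          using w u MJ_weyl by (simp add: X_rep_carrier X_elt_class coord_class)
        finally have "coeff u (?F w) = coord w Y / coord w (X_elt w) * coord u (X_elt w)" .
        then show "coeff u (?F w) = (if w = u then coord u Y else 0)"
          using w u coord_X[OF u, of w] coord_X_self[of w] by auto
      qed
      also have "\<dots> = (if u \<in> ?Q then coord u Y else 0)" using finite_MJ by (simp add: sum.delta)
      also have "\<dots> = coord u Y" using Y coord_outside[of Y u] u by auto
      finally show ?thesis .
    qed
    moreover obtain g where g: "g \<in> PJ" "Y = coinv_class g" using CJ_rep Y by blast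
    ultimately have "congr ?f g" by (simp add: congr_def coord_class PJ_carrier)
    then have "Y = coinv_class ?f" using g class_eq_iff[OF sym_carrier.homogeneous[OF f] PJ_carrier[OF g(1)]] by simp
    then show ?thesis using True f Y by (auto simp: parabolic_grading_def coinvariant_grading_def)
  next
    case False
    interpret R: cring CJ by (rule CJ_cring)
    have "2 * int (len w) \<noteq> d" for w using False by auto
    then have "Y = \<zero>\<^bsub>CJ\<^esub>" using Y by (intro coord_eqI) (auto simp: coord_zero MJ_weyl)
    moreover have "\<zero>\<^bsub>CJ\<^esub> = \<zero>\<^bsub>coinvariant_algebra\<^esub>" by (simp add: parabolic_coinvariants_def)
    ultimately show ?thesis using False Y by (auto simp: parabolic_grading_def coinvariant_grading_def)
  qed
qed

lemma gJ_mult: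
  assumes a: "a \<in> gJ d" and b: "b \<in> gJ e"
  shows "a \<otimes>\<^bsub>CJ\<^esub> b \<in> gJ (d + e)"
proof -
  interpret R: cring CJ by (rule CJ_cring)
  have ab: "a \<in> carrier CJ" "b \<in> carrier CJ" using a b gJ_carrier by auto
  have zero: "\<zero>\<^bsub>CJ\<^esub> \<in> gJ m" for m by (simp add: gJ_iff coord_zero MJ_weyl)
  have z: "Y = \<zero>\<^bsub>CJ\<^esub>" if "Y \<in> gJ m" "\<not> (m \<ge> 0 \<and> even m)" for Y m
    using that by (auto simp: parabolic_grading_def coinvariant_grading_def parabolic_coinvariants_def)
  show ?thesis
  proof (cases "(d \<ge> 0 \<and> even d) \<and> (e \<ge> 0 \<and> even e)")
    case True
    obtain f where f: "f \<in> sym_power (nat (d div 2))" "a = coinv_class f"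
      using a True by (auto simp: parabolic_grading_def coinvariant_grading_def)
    obtain g where g: "g \<in> sym_power (nat (e div 2))" "b = coinv_class g"
      using b True by (auto simp: parabolic_grading_def coinvariant_grading_def)
    have n: "nat (d div 2) + nat (e div 2) = nat ((d + e) div 2)"
      using True by (auto elim!: evenE)
    have "a \<otimes>\<^bsub>CJ\<^esub> b = coinv_class (\<lambda>x\<in>H. f x * g x)"
      using f g by (simp add: CJ_simps sym_carrier.homogeneous)
    then have "a \<otimes>\<^bsub>CJ\<^esub> b \<in> coinvariant_grading (d + e)"
      using sym_power_mult[OF f(1) g(1)] True unfolding coinvariant_grading_def n by auto
    then show ?thesis using ab by (simp add: parabolic_grading_def)
  next
    case False
    then have "a = \<zero>\<^bsub>CJ\<^esub> \<or> b = \<zero>\<^bsub>CJ\<^esub>" using z a b by blast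
    then show ?thesis using ab zero by auto
  qed
qed

text \<open>The component of degree d keeps the coordinates of a at the elements with 2
  \<open>len w\<close> = d and has 0 elsewhere; comparison of coordinates gives uniqueness.\<close>

lemma gJ_decomposition:
  assumes a: "a \<in> carrier CJ"
  shows "\<exists>!f. (\<forall>d. f d \<in> gJ d) \<and> finite {d. f d \<noteq> \<zero>\<^bsub>CJ\<^esub>} \<and> a = (\<Oplus>\<^bsub>CJ\<^esub>d\<in>{d. f d \<noteq> \<zero>\<^bsub>CJ\<^esub>}. f d)"
proof -
  interpret R: cring CJ by (rule CJ_cring)
  have sum: "coord w (\<Oplus>\<^bsub>CJ\<^esub>d\<in>{d. f d \<noteq> \<zero>\<^bsub>CJ\<^esub>}. f d) = coord w (f (2 * int (len w)))"
    if f: "\<And>d. f d \<in> gJ d" "finite {d. f d \<noteq> \<zero>\<^bsub>CJ\<^esub>}" and w: "w \<in> MJ" for f w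
  proof -
    have "coord w (\<Oplus>\<^bsub>CJ\<^esub>d\<in>{d. f d \<noteq> \<zero>\<^bsub>CJ\<^esub>}. f d) = (\<Sum>d\<in>{d. f d \<noteq> \<zero>\<^bsub>CJ\<^esub>}. coord w (f d))"
      using f gJ_carrier w MJ_weyl by (intro coord_finsum) auto
    also have "\<dots> = (\<Sum>d\<in>{d. f d \<noteq> \<zero>\<^bsub>CJ\<^esub>}. if d = 2 * int (len w) then coord w (f (2 * int (len w))) else 0)"
      by (rule sum.cong[OF refl]) (use f(1) w in \<open>auto simp: gJ_iff\<close>)
    also have "\<dots> = coord w (f (2 * int (len w)))" using f(2) w MJ_weyl by (auto simp: sum.delta coord_zero)
    finally show ?thesis .
  qed
  have "\<forall>d. \<exists>Y. Y \<in> carrier CJ \<and> (\<forall>w\<in>MJ. coord w Y = (if 2 * int (len w) = d then coord w a else 0))"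
    using coord_surj[of "\<lambda>w. if 2 * int (len w) = _ then coord w a else 0"] by blast
  from choice[OF this] obtain f where f: "\<And>d. f d \<in> carrier CJ"
    "\<And>d w. w \<in> MJ \<Longrightarrow> coord w (f d) = (if 2 * int (len w) = d then coord w a else 0)" by blast
  have g: "f d \<in> gJ d" for d using f by (simp add: gJ_iff)
  have "{d. f d \<noteq> \<zero>\<^bsub>CJ\<^esub>} \<subseteq> (\<lambda>w. 2 * int (len w)) ` MJ"
  proof
    fix d assume d: "d \<in> {d. f d \<noteq> \<zero>\<^bsub>CJ\<^esub>}"
    show "d \<in> (\<lambda>w. 2 * int (len w)) ` MJ"
    proof (rule ccontr)
      assume "d \<notin> (\<lambda>w. 2 * int (len w)) ` MJ"
      then have "f d = \<zero>\<^bsub>CJ\<^esub>" using f by (intro coord_eqI) (auto simp: coord_zero MJ_weyl)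
      then show False using d by simp
    qed
  qed
  then have fin: "finite {d. f d \<noteq> \<zero>\<^bsub>CJ\<^esub>}" using finite_MJ finite_subset by blast
  show ?thesis
  proof (rule ex1I[of _ f])
    have "a = (\<Oplus>\<^bsub>CJ\<^esub>d\<in>{d. f d \<noteq> \<zero>\<^bsub>CJ\<^esub>}. f d)"
      using a f(1) by (intro coord_eqI R.finsum_closed) (auto simp: sum[OF g fin] f(2))
    then show "(\<forall>d. f d \<in> gJ d) \<and> finite {d. f d \<noteq> \<zero>\<^bsub>CJ\<^esub>} \<and> a = (\<Oplus>\<^bsub>CJ\<^esub>d\<in>{d. f d \<noteq> \<zero>\<^bsub>CJ\<^esub>}. f d)"
      using g fin by blast
  next
    fix h assume h: "(\<forall>d. h d \<in> gJ d) \<and> finite {d. h d \<noteq> \<zero>\<^bsub>CJ\<^esub>} \<and> a = (\<Oplus>\<^bsub>CJ\<^esub>d\<in>{d. h d \<noteq> \<zero>\<^bsub>CJ\<^esub>}. h d)"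
    have "coord w (h d) = coord w (f d)" if w: "w \<in> MJ" for w d
    proof (cases "d = 2 * int (len w)")
      case True
      have "coord w a = coord w (h (2 * int (len w)))" using sum[of h w] h w by metis
      then show ?thesis using True f(2)[OF w] by simp
    next
      case False
      then show ?thesis using h f(2)[OF w] w by (auto simp: gJ_iff)
    qed
    moreover have "h d \<in> carrier CJ" for d using h gJ_carrier by blast
    ultimately show "h = f" using f(1) by (intro ext coord_eqI)
  qed
qed

lemma CJ_graded_algebra: "graded_algebra complex_field CJ gJ"
proof (intro graded_algebra.intro graded_algebra_axioms.intro CJ_assoc_algebra)
  interpret M: Module.module complex_field CJ by (rule CJ_module)
  interpret R: cring CJ by (rule CJ_cring)
  show "submodule (gJ d) complex_field CJ" for d
    by (rule M.submoduleI)
      (auto simp: gJ_iff coord_zero coord_uminus coord_add coord_smult MJ_weyl complex_field_simps)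
  have "(\<lambda>x\<in>H. 1) \<in> sym_power (nat (0 div 2))" using sym_power_const by simp
  then show "\<one>\<^bsub>CJ\<^esub> \<in> gJ 0"
    unfolding parabolic_grading_def coinvariant_grading_def by (simp add: CJ_simps(4) class_CJ PJ_const)
  show "\<exists>!f. (\<forall>d. f d \<in> gJ d) \<and> finite {d. f d \<noteq> \<zero>\<^bsub>CJ\<^esub>} \<and> a = (\<Oplus>\<^bsub>CJ\<^esub>d\<in>{d. f d \<noteq> \<zero>\<^bsub>CJ\<^esub>}. f d)"
    if "a \<in> carrier CJ" for a using that by (rule gJ_decomposition)
  show "a \<otimes>\<^bsub>CJ\<^esub> b \<in> gJ (d + e)" if "a \<in> gJ d" "b \<in> gJ e" for a b d e
    using that by (rule gJ_mult)
qed

section \<open>The cell datum on the minimal coset representatives\<close>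

section \<open>The cellular structure\<close>

lemma finsum_submodule:
  assumes N: "submodule N complex_field CJ" and A: "finite A" "\<And>i. i \<in> A \<Longrightarrow> F i \<in> N"
  shows "(\<Oplus>\<^bsub>CJ\<^esub>i\<in>A. F i) \<in> N"
proof -
  interpret M: Module.module complex_field CJ by (rule CJ_module)
  note sub = M.submoduleE[OF N]
  have "\<zero>\<^bsub>CJ\<^esub> \<in> N" using subgroup.one_closed[OF submodule.axioms(1)[OF N]] by simp
  with A show ?thesis
  proof (induction A rule: finite_induct)
    case (insert i A)
    then show ?case using sub by (subst M.finsum_insert) auto
  qed simp
qed

text \<open>Y is the combination of the X_q with coefficients
  \<open>coord q Y / coord q (X_elt q)\<close>, and the vanishing coordinates remove every q of
  length at most k.\<close>

lemma high_coord_span: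
  assumes Y: "Y \<in> carrier CJ" "\<And>w. w \<in> MJ \<Longrightarrow> len w \<le> k \<Longrightarrow> coord w Y = 0"
  shows "Y \<in> module_span complex_field CJ (X_elt ` {q \<in> MJ. len q > k})"
  unfolding module_span_def
proof (rule InterI)
  fix N assume "N \<in> {N. submodule N complex_field CJ \<and> X_elt ` {q \<in> MJ. k < len q} \<subseteq> N}"
  then have N: "submodule N complex_field CJ" "\<And>q. q \<in> MJ \<Longrightarrow> k < len q \<Longrightarrow> X_elt q \<in> N" by auto
  let ?Q = "{q \<in> MJ. k < len q}"
  let ?S = "\<Oplus>\<^bsub>CJ\<^esub>q\<in>?Q. (coord q Y / coord q (X_elt q)) \<odot>\<^bsub>CJ\<^esub> X_elt q"
  have Q: "?Q \<subseteq> MJ" by blast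
  have "Y = ?S"
  proof (rule coord_eqI[OF Y(1) coord_combination(2)[OF Q weyl_one]])
    fix w assume w: "w \<in> MJ"
    show "coord w Y = coord w ?S"
      unfolding coord_combination(1)[OF Q MJ_weyl[OF w]] using w Y(2)[OF w] coord_X_self[OF w] by auto
  qed
  moreover have "?S \<in> N"
    by (rule finsum_submodule[OF N(1)])
      (use finite_MJ N(2) submodule.smult_closed[OF N(1)] in \<open>auto simp: complex_field_simps\<close>)
  ultimately show "Y \<in> N" by simp
qed

lemma finsum_single:
  assumes "abelian_monoid G" "F i \<in> carrier G"
  shows "finsum G F {i} = F i"
proof -
  interpret abelian_monoid G by (rule assms)
  show ?thesis using assms(2) by (simp add: finsum_insert[of "{}"])
qed

text \<open>The index set contains one triple (p, p, p) for each p, so the basis property is the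
  duality between the X_p and the coordinates.\<close>

lemma X_basis: "is_finite_basis complex_field CJ (SIGMA p:MJ. {p} \<times> {p}) (\<lambda>(p, s, t). X_elt p)"
  unfolding is_finite_basis_def
proof (intro conjI ballI)
  interpret M: Module.module complex_field CJ by (rule CJ_module)
  let ?I = "SIGMA p:MJ. {p} \<times> {p}" and ?b = "\<lambda>(p, s, t). X_elt p"
  show fI: "finite ?I" using finite_MJ by auto
  show "?b \<in> ?I \<rightarrow> carrier CJ" by (auto simp: X_elt_CJ)
  have s: "coord w (\<Oplus>\<^bsub>CJ\<^esub>i\<in>?I. f i \<odot>\<^bsub>CJ\<^esub> ?b i) = f (w, w, w) * coord w (X_elt w)" if w: "w \<in> MJ" for f w
  proof -
    have "coord w (\<Oplus>\<^bsub>CJ\<^esub>i\<in>?I. f i \<odot>\<^bsub>CJ\<^esub> ?b i) = (\<Sum>i\<in>?I. coord w (f i \<odot>\<^bsub>CJ\<^esub> ?b i))"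
      by (rule coord_finsum[OF fI]) (auto simp: X_elt_CJ complex_field_simps MJ_weyl w)
    also have "\<dots> = (\<Sum>i\<in>?I. if i = (w, w, w) then f (w, w, w) * coord w (X_elt w) else 0)"
    proof (rule sum.cong[OF refl])
      fix i assume "i \<in> ?I"
      then obtain a where a: "a \<in> MJ" "i = (a, a, a)" by auto
      then show "coord w (f i \<odot>\<^bsub>CJ\<^esub> ?b i) = (if i = (w, w, w) then f (w, w, w) * coord w (X_elt w) else 0)"
        using coord_X[OF MJ_weyl[OF w] a(1)] by (cases "a = w") (auto simp: coord_smult X_elt_CJ MJ_weyl w)
    qed
    finally show ?thesis using fI w by (simp add: sum.delta)
  qed
  fix v assume v: "v \<in> carrier CJ"
  have cl: "(\<Oplus>\<^bsub>CJ\<^esub>i\<in>?I. f i \<odot>\<^bsub>CJ\<^esub> ?b i) \<in> carrier CJ" for f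
    by (intro M.finsum_closed) (auto simp: X_elt_CJ complex_field_simps)
  let ?f = "\<lambda>i\<in>?I. coord (fst i) v / coord (fst i) (X_elt (fst i))"
  show "\<exists>!f. f \<in> ?I \<rightarrow>\<^sub>E carrier complex_field \<and> v = (\<Oplus>\<^bsub>CJ\<^esub>i\<in>?I. f i \<odot>\<^bsub>CJ\<^esub> ?b i)"
  proof (rule ex1I[of _ ?f])
    show "?f \<in> ?I \<rightarrow>\<^sub>E carrier complex_field \<and> v = (\<Oplus>\<^bsub>CJ\<^esub>i\<in>?I. ?f i \<odot>\<^bsub>CJ\<^esub> ?b i)"
    proof
      show "?f \<in> ?I \<rightarrow>\<^sub>E carrier complex_field" by (auto simp: complex_field_simps)
      show "v = (\<Oplus>\<^bsub>CJ\<^esub>i\<in>?I. ?f i \<odot>\<^bsub>CJ\<^esub> ?b i)"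
      proof (rule coord_eqI[OF v cl])
        fix w assume w: "w \<in> MJ"
        show "coord w v = coord w (\<Oplus>\<^bsub>CJ\<^esub>i\<in>?I. ?f i \<odot>\<^bsub>CJ\<^esub> ?b i)"
          unfolding s[OF w] using coord_X_self[OF w] w by simp
      qed
    qed
  next
    fix f assume f: "f \<in> ?I \<rightarrow>\<^sub>E carrier complex_field \<and> v = (\<Oplus>\<^bsub>CJ\<^esub>i\<in>?I. f i \<odot>\<^bsub>CJ\<^esub> ?b i)"
    show "f = ?f"
    proof (rule extensionalityI[of _ ?I])
      fix i assume "i \<in> ?I"
      then obtain w where w: "w \<in> MJ" "i = (w, w, w)" by auto
      have "coord w v = f i * coord w (X_elt w)" using f s[OF w(1), of f] w(2) by simp
      then show "f i = ?f i" using coord_X_self[OF w(1)] w by simp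
    qed (use f in \<open>auto simp: PiE_def\<close>)
  qed
qed

text \<open>Longer elements are larger in the poset. Each T(p) has one element, whose degree
  \<open>len p\<close> is half the degree of X_p. By \<open>coeff_mult_low\<close>, a acts on X_p
  modulo longer elements as its constant term, which is the coordinate at the identity. The identity
  map is an anti-automorphism because the algebra is commutative.\<close>

lemma CJ_cellular:
  "graded_cellular_algebra complex_field CJ gJ MJ (\<lambda>q p. len q > len p) (\<lambda>p. {p}) (\<lambda>p s t. X_elt p)
    (\<lambda>p s. int (len p)) (\<lambda>p a s u. coord \<one>\<^bsub>\<G>\<^esub> a)"
proof (intro graded_cellular_algebra.intro graded_cellular_algebra_axioms.intro CJ_graded_algebra)
  interpret M: Module.module complex_field CJ by (rule CJ_module)
  interpret R: cring CJ by (rule CJ_cring)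
  show "is_finite_basis complex_field CJ (SIGMA p:MJ. {p} \<times> {p}) (\<lambda>(p, s, t). X_elt p)" by (rule X_basis)
  show "X_elt p \<in> gJ (int (len p) + int (len p))" if p: "p \<in> MJ" for p
    using p X_elt_CJ coord_X MJ_weyl by (auto simp: gJ_iff)
  show "a \<otimes>\<^bsub>CJ\<^esub> X_elt p \<ominus>\<^bsub>CJ\<^esub> (\<Oplus>\<^bsub>CJ\<^esub>u\<in>{p}. coord \<one>\<^bsub>\<G>\<^esub> a \<odot>\<^bsub>CJ\<^esub> X_elt p)
      \<in> module_span complex_field CJ {X_elt q |q u v. q \<in> MJ \<and> len p < len q \<and> u \<in> {q} \<and> v \<in> {q}}"
    if p: "p \<in> MJ" and a: "a \<in> carrier CJ" for p a
  proof -
    obtain f where f: "f \<in> PJ" "a = coinv_class f" using CJ_rep a by blast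
    note Xp = X_elt_CJ[OF p]
    have sm: "coord \<one>\<^bsub>\<G>\<^esub> a \<odot>\<^bsub>CJ\<^esub> X_elt p \<in> carrier CJ" using Xp by (simp add: complex_field_simps)
    have e: "(\<Oplus>\<^bsub>CJ\<^esub>u\<in>{p}. coord \<one>\<^bsub>\<G>\<^esub> a \<odot>\<^bsub>CJ\<^esub> X_elt p) = coord \<one>\<^bsub>\<G>\<^esub> a \<odot>\<^bsub>CJ\<^esub> X_elt p"
      using sm by (rule finsum_single[OF abelian_group.axioms(1)[OF R.is_abelian_group]])
    have c1: "coord \<one>\<^bsub>\<G>\<^esub> a = f 0" using f by (simp add: coord_class PJ_carrier weyl_one coeff_one)
    have low: "coord w (a \<otimes>\<^bsub>CJ\<^esub> X_elt p \<ominus>\<^bsub>CJ\<^esub> (coord \<one>\<^bsub>\<G>\<^esub> a \<odot>\<^bsub>CJ\<^esub> X_elt p)) = 0"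
      if w: "w \<in> MJ" "len w \<le> len p" for w
    proof -
      have "coord w (a \<otimes>\<^bsub>CJ\<^esub> X_elt p) = f 0 * coeff w (X_rep p)"
        using coeff_mult_low[OF PJ_carrier[OF f(1)] X_rep_power[OF MJ_weyl[OF p]] MJ_weyl[OF w(1)] w(2)]
          f(1) MJ_weyl p w(1)
        by (simp add: f(2) X_elt_class CJ_simps PJ_carrier X_rep_carrier coord_class sym_carrier_mult)
      then show ?thesis
        using a Xp sm w(1) MJ_weyl p
        by (simp add: coord_minus coord_smult c1) (simp add: X_elt_class coord_class X_rep_carrier)
    qed
    have "{X_elt q |q u v. q \<in> MJ \<and> len p < len q \<and> u \<in> {q} \<and> v \<in> {q}} = X_elt ` {q \<in> MJ. len q > len p}" by auto
    then show ?thesis unfolding e using high_coord_span[OF _ low] a Xp sm by simp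
  qed
  show "\<exists>\<phi>. anti_automorphism complex_field CJ \<phi> \<and> (\<forall>p\<in>MJ. \<forall>s\<in>{p}. \<forall>t\<in>{p}. \<phi> (X_elt p) = X_elt p)"
    by (rule exI[of _ "\<lambda>x. x"])
      (auto simp: anti_automorphism_def linear_map_on_def R.m_comm bij_betw_def)
qed (auto simp: finite_MJ complex_field_simps)

text \<open>The multiple of the unit by k has coordinate k at the identity, so restriction of
  scalars gives the ordinary scalar action on functions on a one-point set.\<close>

lemma cell_module_dimension:
  "has_dimension complex_field (restrict_scalars CJ (cell_module complex_field (\<lambda>p. {p}) (\<lambda>p a s u. coord \<one>\<^bsub>\<G>\<^esub> a) p)) 1"
proof -
  let ?V = "restrict_scalars CJ (cell_module complex_field (\<lambda>p. {p}) (\<lambda>p a s u. coord \<one>\<^bsub>\<G>\<^esub> a) p)"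
  have K: "abelian_monoid complex_field"
    using cring_from_type_algebra[where 'a = complex] by (intro abelian_group.axioms(1) ring.is_abelian_group cring.axioms(1))
  have carr: "carrier ?V = {p} \<rightarrow>\<^sub>E UNIV" and zero: "\<zero>\<^bsub>?V\<^esub> = (\<lambda>s\<in>{p}. 0)"
    and add: "\<And>v w. v \<oplus>\<^bsub>?V\<^esub> w = (\<lambda>s\<in>{p}. v s + w s)"
    by (simp_all add: restrict_scalars_def cell_module_def complex_field_simps)
  have one: "coord \<one>\<^bsub>\<G>\<^esub> (k \<odot>\<^bsub>CJ\<^esub> \<one>\<^bsub>CJ\<^esub>) = k" for k
  proof -
    have "k \<odot>\<^bsub>CJ\<^esub> \<one>\<^bsub>CJ\<^esub> = coinv_class (\<lambda>x\<in>H. k * (\<lambda>x\<in>H. 1) x)" by (simp add: CJ_simps sym_carrier_const)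
    then show ?thesis using H_zero by (simp add: coord_class weyl_one coeff_one sym_carrier_scale sym_carrier_const)
  qed
  have smult: "k \<odot>\<^bsub>?V\<^esub> v = (\<lambda>u\<in>{p}. k * v p)" for k v
  proof -
    have "(\<Oplus>\<^bsub>complex_field\<^esub>s\<in>{p}. k \<otimes>\<^bsub>complex_field\<^esub> v s) = k * v p"
      by (subst finsum_single[OF K]) (simp_all add: complex_field_simps)
    then show ?thesis by (simp add: restrict_scalars_def cell_module_def one)
  qed
  have V: "abelian_monoid ?V"
  proof (rule abelian_monoidI)
    fix x y z assume "x \<in> carrier ?V" "y \<in> carrier ?V" "z \<in> carrier ?V"
    show "x \<oplus>\<^bsub>?V\<^esub> y \<oplus>\<^bsub>?V\<^esub> z = x \<oplus>\<^bsub>?V\<^esub> (y \<oplus>\<^bsub>?V\<^esub> z)" unfolding add by (rule restrict_ext) simp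
  next
    fix x assume x: "x \<in> carrier ?V"
    show "\<zero>\<^bsub>?V\<^esub> \<oplus>\<^bsub>?V\<^esub> x = x"
      unfolding add zero by (rule extensionalityI[of _ "{p}"]) (use x in \<open>auto simp: carr PiE_def\<close>)
  next
    fix x y
    show "x \<oplus>\<^bsub>?V\<^esub> y = y \<oplus>\<^bsub>?V\<^esub> x" unfolding add by (rule restrict_ext) simp
  qed (auto simp: carr zero add)
  let ?b = "\<lambda>_::nat. \<lambda>s\<in>{p}. 1 :: complex"
  have sum: "(\<Oplus>\<^bsub>?V\<^esub>i\<in>{..<1::nat}. f i \<odot>\<^bsub>?V\<^esub> ?b i) = (\<lambda>u\<in>{p}. f 0)" for f
  proof -
    have "{..<1::nat} = {0}" by auto
    moreover have "(\<Oplus>\<^bsub>?V\<^esub>i\<in>{0::nat}. f i \<odot>\<^bsub>?V\<^esub> ?b i) = f 0 \<odot>\<^bsub>?V\<^esub> ?b 0"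
      by (rule finsum_single[OF V]) (simp add: smult carr)
    ultimately show ?thesis by (simp add: smult)
  qed
  have "is_finite_basis complex_field ?V {..<1} ?b"
    unfolding is_finite_basis_def
  proof (intro conjI ballI)
    show "?b \<in> {..<1} \<rightarrow> carrier ?V" by (simp add: carr)
    fix v assume v: "v \<in> carrier ?V"
    show "\<exists>!f. f \<in> {..<1} \<rightarrow>\<^sub>E carrier complex_field \<and> v = (\<Oplus>\<^bsub>?V\<^esub>i\<in>{..<1}. f i \<odot>\<^bsub>?V\<^esub> ?b i)"
      unfolding sum
    proof (rule ex1I[of _ "\<lambda>i\<in>{..<1}. v p"])
      have "v = (\<lambda>u\<in>{p}. (\<lambda>i\<in>{..<1::nat}. v p) 0)"
        by (rule extensionalityI[of _ "{p}"]) (use v in \<open>auto simp: carr PiE_def\<close>)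
      then show "(\<lambda>i\<in>{..<1}. v p) \<in> {..<1} \<rightarrow>\<^sub>E carrier complex_field \<and> v = (\<lambda>u\<in>{p}. (\<lambda>i\<in>{..<1::nat}. v p) 0)"
        by (auto simp: complex_field_simps)
      fix f assume f: "f \<in> {..<1::nat} \<rightarrow>\<^sub>E carrier complex_field \<and> v = (\<lambda>u\<in>{p}. f 0)"
      then have "v p = f 0" by (metis restrict_apply' singletonI)
      then show "f = (\<lambda>i\<in>{..<1}. v p)"
        by (intro extensionalityI[of _ "{..<1}"]) (use f in \<open>auto simp: PiE_def\<close>)
    qed
  qed simp
  then show ?thesis unfolding has_dimension_def by blast
qed

end

end

theorem corollary3p7:
  fixes scale :: "complex \<Rightarrow> 'g::ab_group_add \<Rightarrow> 'g"
    and bracket :: "'g \<Rightarrow> 'g \<Rightarrow> 'g"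
    and H :: "'g set"
    and simples J :: "('g \<Rightarrow> complex) set"
  assumes "semisimple_with_simple_roots scale bracket H simples"
    and "J \<subseteq> simples"
  shows "\<exists>(P :: ('g \<Rightarrow> 'g) set) gt (T :: ('g \<Rightarrow> 'g) \<Rightarrow> ('g \<Rightarrow> 'g) set) c deg r.
    graded_cellular_algebra complex_field
      (semisimple_with_cartan.parabolic_coinvariants scale bracket H J)
      (semisimple_with_cartan.parabolic_grading scale bracket H J) P gt T c deg r \<and>
    {c p s t | p s t. p \<in> P \<and> s \<in> T p \<and> t \<in> T p} =
      semisimple_with_simple_roots.X_elt scale bracket H simples `
        semisimple_with_simple_roots.min_coset_reps scale bracket H simples J \<and>
    (\<forall>p\<in>P. has_dimension complex_field
      (restrict_scalars (semisimple_with_cartan.parabolic_coinvariants scale bracket H J)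
        (cell_module complex_field T r p)) 1)"
proof -
  interpret semisimple_with_simple_roots scale bracket H simples by (rule assms(1))
  show ?thesis
    \<comment> \<open>The witnesses are fixed by unification with \<open>CJ_cellular\<close>; there
      remain the set of basis elements and the dimension of the cell modules.\<close>
    by (intro exI conjI ballI, rule CJ_cellular[OF assms(2)])
      (auto simp del: One_nat_def intro: cell_module_dimension[OF assms(2)])
qed

end
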